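(* Let $A\subset M$ be a unital inclusion of von Neumann algebras and assume that there exists a faithful normal semifinite operator valued weight $E_A\colon M\to A$. Then for every positive element $x\in M$ with $E_A(x)<\infty$, the $\sigma$-weak closure of the convex hull $$\mathcal K(x,A):=\overline{\mathrm{conv}}^{\,\sigma\text{-weak}}\{uxu^*\mid u\in\mathcal U(A)\}\subset M$$ intersects the relative commutant $A'\cap M$, i.e. $A'\cap \mathcal K(x,A)\neq\emptyset$.
   Context: $\mathcal U(A)$ is the unitary group of $A$. For a von Neumann algebra $A$, the extended positive cone $\widehat A^+$ is the set of lower semicontinuous, additive, positively homogeneous maps $m\colon A_*^+\to[0,\infty]$; $A^+\subset\widehat A^+$ via evaluation. An operator valued weight from $M$ to $A$ is a map $T\colon M^+\to\widehat A^+$ that is additive, positively homogeneous, and satisfies $T(a^*xa)=a^*T(x)a$ for $x\in M^+$, $a\in A$. It is faithful if $T(x)=0$ implies $x=0$ for $x\in M^+$; normal if $T(x_i)\nearrow T(x)$ whenever $x_i\nearrow x$ in $M^+$; semifinite if the linear span $\mathfrak m_T$ of $\{x\in M^+\mid T(x)\in A^+\}$ is $\sigma$-weakly dense in $M$. For $x\in M^+$, "$E_A(x)<\infty$" means $E_A(x)\in A^+$. *)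

theory Defs
  imports "HOL-Analysis.Analysis"
begin

section \<open>Complex Hilbert spaces and bounded operators\<close>

text \<open>
  A complex Hilbert space is a real Hilbert space with a compatible complex scalar multiplication
  and a sesquilinear form, conjugate linear in the first argument, whose real part is the real
  inner product. In particular the norm and the topology are the usual ones.
\<close>

class chilbert_space = real_inner + complete_space +
  fixes scaleC :: "complex \<Rightarrow> 'a \<Rightarrow> 'a"  (infixr \<open>*\<^sub>C\<close> 75)
    and cinner :: "'a \<Rightarrow> 'a \<Rightarrow> complex"
  assumes scaleC_add_right: "c *\<^sub>C (x + y) = c *\<^sub>C x + c *\<^sub>C y"
    and scaleC_add_left: "(c + d) *\<^sub>C x = c *\<^sub>C x + d *\<^sub>C x"
    and scaleC_scaleC: "c *\<^sub>C d *\<^sub>C x = (c * d) *\<^sub>C x"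
    and scaleC_of_real: "complex_of_real r *\<^sub>C x = r *\<^sub>R x"
    and cinner_commute: "cinner x y = cnj (cinner y x)"
    and cinner_add_right: "cinner x (y + z) = cinner x y + cinner x z"
    and cinner_scaleC_right: "cinner x (c *\<^sub>C y) = c * cinner x y"
    and Re_cinner: "Re (cinner x y) = inner x y"

lemma cinner_self: "cinner x x = complex_of_real ((norm x)\<^sup>2)"
  for x :: "'h::chilbert_space"
proof (rule complex_eqI)
  show "Re (cinner x x) = Re (complex_of_real ((norm x)\<^sup>2))"
    by (simp add: Re_cinner power2_norm_eq_inner)
  have "Im (cinner x x) = - Im (cinner x x)"
    by (subst cinner_commute) simp
  then show "Im (cinner x x) = Im (complex_of_real ((norm x)\<^sup>2))" by simp
qed

lemma norm_scaleC: "norm (c *\<^sub>C x) = cmod c * norm x"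
  for x :: "'h::chilbert_space"
proof -
  have "cinner (c *\<^sub>C x) (c *\<^sub>C x) = c * cnj (c * cinner x x)"
    by (metis cinner_commute cinner_scaleC_right)
  also have "\<dots> = complex_of_real ((cmod c * norm x)\<^sup>2)"
    by (simp add: cinner_self power_mult_distrib complex_norm_square mult_ac del: of_real_power)
  finally have "(norm (c *\<^sub>C x))\<^sup>2 = (cmod c * norm x)\<^sup>2"
    by (simp add: cinner_self del: of_real_power)
  then show ?thesis by simp
qed

lemma bounded_linear_scaleC: "bounded_linear (\<lambda>x::'h::chilbert_space. c *\<^sub>C x)"
proof (rule bounded_linear_intro[where K = "cmod c"])
  fix r :: real and x :: 'h
  show "c *\<^sub>C r *\<^sub>R x = r *\<^sub>R c *\<^sub>C x"
    by (simp add: scaleC_of_real[symmetric] scaleC_scaleC mult.commute)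
qed (simp_all add: scaleC_add_right norm_scaleC mult.commute)

text \<open>
  The type \<open>'h \<Rightarrow>\<^sub>L 'h\<close> consists of the bounded real-linear operators; \<open>B(H)\<close> is the subset of
  complex-linear ones.
\<close>

definition bounded_ops :: "('h::chilbert_space \<Rightarrow>\<^sub>L 'h) set" where
  "bounded_ops = {T :: 'h \<Rightarrow>\<^sub>L 'h. \<forall>c x. T (c *\<^sub>C x) = c *\<^sub>C T x}"

lift_definition scale_op :: "complex \<Rightarrow> ('h::chilbert_space \<Rightarrow>\<^sub>L 'h) \<Rightarrow> ('h \<Rightarrow>\<^sub>L 'h)"
  is "\<lambda>c T x. c *\<^sub>C T x"
  by (rule bounded_linear_compose[OF bounded_linear_scaleC])

lemma vector_space_scale_op: "vector_space (scale_op :: complex \<Rightarrow> ('h::chilbert_space \<Rightarrow>\<^sub>L 'h) \<Rightarrow> _)"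
proof
  have one: "1 *\<^sub>C x = x" for x :: 'h
    using scaleC_of_real[of 1 x] by simp
  show "scale_op 1 T = T" for T :: "'h \<Rightarrow>\<^sub>L 'h"
    by transfer (simp add: one)
qed (transfer, simp add: scaleC_add_right scaleC_add_left scaleC_scaleC)+

definition op_adj :: "('h::chilbert_space \<Rightarrow>\<^sub>L 'h) \<Rightarrow> ('h \<Rightarrow>\<^sub>L 'h)" where
  "op_adj T = (THE S :: 'h \<Rightarrow>\<^sub>L 'h. \<forall>x y. cinner (S x) y = cinner x (T y))"

definition commutant :: "('h::chilbert_space \<Rightarrow>\<^sub>L 'h) set \<Rightarrow> ('h \<Rightarrow>\<^sub>L 'h) set" where
  "commutant X = {T \<in> bounded_ops. \<forall>S\<in>X. T o\<^sub>L S = S o\<^sub>L T}"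

section \<open>Von Neumann algebras\<close>

text \<open>
  Closure under the algebraic operations and the presence of the identity operator follow from
  being a commutant.
\<close>

definition von_neumann_algebra :: "('h::chilbert_space \<Rightarrow>\<^sub>L 'h) set \<Rightarrow> bool" where
  "von_neumann_algebra M \<longleftrightarrow>
     M \<subseteq> bounded_ops \<and> (\<forall>T\<in>M. op_adj T \<in> M) \<and> commutant (commutant M) = M"

definition unitaries :: "('h::chilbert_space \<Rightarrow>\<^sub>L 'h) set \<Rightarrow> ('h \<Rightarrow>\<^sub>L 'h) set" where
  "unitaries A = {u \<in> A. op_adj u o\<^sub>L u = id_blinfun \<and> u o\<^sub>L op_adj u = id_blinfun}"

definition pos_op :: "('h::chilbert_space \<Rightarrow>\<^sub>L 'h) \<Rightarrow> bool" where
  "pos_op T \<longleftrightarrow> T \<in> bounded_ops \<and> (\<forall>x. cinner x (T x) \<in> \<real>\<^sub>\<ge>\<^sub>0)"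

definition pos_cone :: "('h::chilbert_space \<Rightarrow>\<^sub>L 'h) set \<Rightarrow> ('h \<Rightarrow>\<^sub>L 'h) set" where
  "pos_cone A = {T \<in> A. pos_op T}"

definition sigma_weak :: "('h::chilbert_space \<Rightarrow>\<^sub>L 'h) topology" where
  "sigma_weak = topology_generated_by
     {{T :: 'h \<Rightarrow>\<^sub>L 'h. T \<in> bounded_ops \<and> (\<Sum>n. cinner (\<xi> n) (T (\<eta> n))) \<in> U} | \<xi> \<eta> U.
        summable (\<lambda>n::nat. (norm (\<xi> n))\<^sup>2) \<and> summable (\<lambda>n::nat. (norm (\<eta> n))\<^sup>2) \<and> open U}"

section \<open>The predual and the extended positive cone\<close>

text \<open>
  \<open>predual_pos A\<close> is \<open>A\<^sub>*\<^sup>+\<close>, the set of positive normal linear functionals on \<open>A\<close>. Functionals on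
  \<open>A\<close> are represented by functions on the whole operator type that vanish outside \<open>A\<close>, so that
  equality of functionals is equality of functions and sums are pointwise.
\<close>

definition predual_pos :: "('h::chilbert_space \<Rightarrow>\<^sub>L 'h) set \<Rightarrow> (('h \<Rightarrow>\<^sub>L 'h) \<Rightarrow> complex) set" where
  "predual_pos A = {\<phi>.
     (\<forall>T. T \<notin> A \<longrightarrow> \<phi> T = 0) \<and>
     (\<forall>S\<in>A. \<forall>T\<in>A. \<phi> (S + T) = \<phi> S + \<phi> T) \<and>
     (\<forall>c. \<forall>T\<in>A. \<phi> (scale_op c T) = c * \<phi> T) \<and>
     (\<forall>T\<in>pos_cone A. \<phi> T \<in> \<real>\<^sub>\<ge>\<^sub>0) \<and>
     continuous_map (subtopology sigma_weak A) euclidean \<phi>}"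

definition predual_norm :: "('h::chilbert_space \<Rightarrow>\<^sub>L 'h) set \<Rightarrow> (('h \<Rightarrow>\<^sub>L 'h) \<Rightarrow> complex) \<Rightarrow> real" where
  "predual_norm A \<phi> = (SUP T\<in>{T \<in> A. norm T \<le> 1}. cmod (\<phi> T))"

text \<open>
  Elements of the extended positive cone are likewise extended by \<open>0\<close> outside \<open>A\<^sub>*\<^sup>+\<close>. Lower
  semicontinuity refers to the norm of the predual. Homogeneity includes the scalar \<open>0\<close>, with
  \<open>0 * \<infinity> = 0\<close>.
\<close>

definition ext_pos_cone ::
    "('h::chilbert_space \<Rightarrow>\<^sub>L 'h) set \<Rightarrow> ((('h \<Rightarrow>\<^sub>L 'h) \<Rightarrow> complex) \<Rightarrow> ennreal) set" where
  "ext_pos_cone A = {m.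
     (\<forall>\<phi>. \<phi> \<notin> predual_pos A \<longrightarrow> m \<phi> = 0) \<and>
     (\<forall>\<phi>\<in>predual_pos A. \<forall>\<psi>\<in>predual_pos A. m (\<lambda>T. \<phi> T + \<psi> T) = m \<phi> + m \<psi>) \<and>
     (\<forall>r\<ge>0. \<forall>\<phi>\<in>predual_pos A. m (\<lambda>T. complex_of_real r * \<phi> T) = ennreal r * m \<phi>) \<and>
     (\<forall>\<phi>\<in>predual_pos A. \<forall>c<m \<phi>. \<exists>\<epsilon>>0. \<forall>\<psi>\<in>predual_pos A.
        predual_norm A (\<lambda>T. \<psi> T - \<phi> T) < \<epsilon> \<longrightarrow> c < m \<psi>)}"

definition ext_eval ::
    "('h::chilbert_space \<Rightarrow>\<^sub>L 'h) set \<Rightarrow> ('h \<Rightarrow>\<^sub>L 'h) \<Rightarrow> (('h \<Rightarrow>\<^sub>L 'h) \<Rightarrow> complex) \<Rightarrow> ennreal" where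
  "ext_eval A y = (\<lambda>\<phi>. if \<phi> \<in> predual_pos A then ennreal (Re (\<phi> y)) else 0)"

text \<open>
  \<open>ext_conj A a m\<close> is \<open>a\<^sup>* m a\<close>, that is \<open>\<phi> \<mapsto> m (a \<phi> a\<^sup>*)\<close> with \<open>(a \<phi> a\<^sup>*) y = \<phi> (a\<^sup>* y a)\<close>; on
  evaluations at \<open>y\<close> this is evaluation at \<open>a\<^sup>* y a\<close>.
\<close>

definition ext_conj ::
    "('h::chilbert_space \<Rightarrow>\<^sub>L 'h) set \<Rightarrow> ('h \<Rightarrow>\<^sub>L 'h) \<Rightarrow> ((('h \<Rightarrow>\<^sub>L 'h) \<Rightarrow> complex) \<Rightarrow> ennreal)
      \<Rightarrow> (('h \<Rightarrow>\<^sub>L 'h) \<Rightarrow> complex) \<Rightarrow> ennreal" where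
  "ext_conj A a m = (\<lambda>\<phi>. if \<phi> \<in> predual_pos A
     then m (\<lambda>y. if y \<in> A then \<phi> (op_adj a o\<^sub>L y o\<^sub>L a) else 0) else 0)"

section \<open>Operator valued weights\<close>

text \<open>Only the values of \<open>E\<close> on the positive cone of \<open>M\<close> matter.\<close>

type_synonym 'h opval_map = "('h \<Rightarrow>\<^sub>L 'h) \<Rightarrow> (('h \<Rightarrow>\<^sub>L 'h) \<Rightarrow> complex) \<Rightarrow> ennreal"

definition operator_valued_weight ::
    "('h::chilbert_space \<Rightarrow>\<^sub>L 'h) set \<Rightarrow> ('h \<Rightarrow>\<^sub>L 'h) set \<Rightarrow> 'h opval_map \<Rightarrow> bool" where
  "operator_valued_weight M A E \<longleftrightarrow>
     (\<forall>x\<in>pos_cone M. E x \<in> ext_pos_cone A) \<and>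
     (\<forall>x\<in>pos_cone M. \<forall>y\<in>pos_cone M. E (x + y) = (\<lambda>\<phi>. E x \<phi> + E y \<phi>)) \<and>
     (\<forall>r\<ge>0. \<forall>x\<in>pos_cone M. E (r *\<^sub>R x) = (\<lambda>\<phi>. ennreal r * E x \<phi>)) \<and>
     (\<forall>x\<in>pos_cone M. \<forall>a\<in>A. E (op_adj a o\<^sub>L x o\<^sub>L a) = ext_conj A a (E x))"

definition faithful_weight :: "('h::chilbert_space \<Rightarrow>\<^sub>L 'h) set \<Rightarrow> 'h opval_map \<Rightarrow> bool" where
  "faithful_weight M E \<longleftrightarrow> (\<forall>x\<in>pos_cone M. E x = (\<lambda>\<phi>. 0) \<longrightarrow> x = 0)"

text \<open>
  Increasing nets are represented by upward directed sets, and \<open>x\<^sub>i \<nearrow> x\<close> in \<open>M\<^sup>+\<close> by \<open>x\<close> being the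
  least upper bound for the operator order. Suprema in the extended positive cone are pointwise.
\<close>

definition op_le :: "('h::chilbert_space \<Rightarrow>\<^sub>L 'h) \<Rightarrow> ('h \<Rightarrow>\<^sub>L 'h) \<Rightarrow> bool" where
  "op_le S T \<longleftrightarrow> pos_op (T - S)"

definition increases_to ::
    "('h::chilbert_space \<Rightarrow>\<^sub>L 'h) set \<Rightarrow> ('h \<Rightarrow>\<^sub>L 'h) set \<Rightarrow> ('h \<Rightarrow>\<^sub>L 'h) \<Rightarrow> bool" where
  "increases_to M D x \<longleftrightarrow>
     D \<noteq> {} \<and> D \<subseteq> pos_cone M \<and> x \<in> pos_cone M \<and>
     (\<forall>y\<in>D. \<forall>z\<in>D. \<exists>w\<in>D. op_le y w \<and> op_le z w) \<and>
     (\<forall>y\<in>D. op_le y x) \<and>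
     (\<forall>z\<in>pos_cone M. (\<forall>y\<in>D. op_le y z) \<longrightarrow> op_le x z)"

definition normal_weight :: "('h::chilbert_space \<Rightarrow>\<^sub>L 'h) set \<Rightarrow> 'h opval_map \<Rightarrow> bool" where
  "normal_weight M E \<longleftrightarrow> (\<forall>D x. increases_to M D x \<longrightarrow> E x = (\<lambda>\<phi>. SUP y\<in>D. E y \<phi>))"

definition finite_value ::
    "('h::chilbert_space \<Rightarrow>\<^sub>L 'h) set \<Rightarrow> ((('h \<Rightarrow>\<^sub>L 'h) \<Rightarrow> complex) \<Rightarrow> ennreal) \<Rightarrow> bool" where
  "finite_value A m \<longleftrightarrow> (\<exists>y\<in>pos_cone A. m = ext_eval A y)"

definition semifinite_weight ::
    "('h::chilbert_space \<Rightarrow>\<^sub>L 'h) set \<Rightarrow> ('h \<Rightarrow>\<^sub>L 'h) set \<Rightarrow> 'h opval_map \<Rightarrow> bool" where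
  "semifinite_weight M A E \<longleftrightarrow>
     subtopology sigma_weak M closure_of
       module.span scale_op {x \<in> pos_cone M. finite_value A (E x)} = M"

definition conj_hull ::
    "('h::chilbert_space \<Rightarrow>\<^sub>L 'h) set \<Rightarrow> ('h \<Rightarrow>\<^sub>L 'h) \<Rightarrow> ('h \<Rightarrow>\<^sub>L 'h) set \<Rightarrow> ('h \<Rightarrow>\<^sub>L 'h) set" where
  "conj_hull M x A =
     subtopology sigma_weak M closure_of (convex hull ((\<lambda>u. u o\<^sub>L x o\<^sub>L op_adj u) ` unitaries A))"

end

theory Submission
  imports Defs
begin

text \<open>
  Write \<open>\<langle>\<xi>, b\<^sub>w \<xi>\<rangle> = E(w\<^sup>2)(\<omega>\<^sub>\<xi>)\<close> for self-adjoint \<open>w\<close>. On the weakly compact set \<open>K(x,A)\<close> the operators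
  \<open>b\<^sub>w \<in> A\<close> are bounded, and normality makes \<open>w \<mapsto> \<langle>\<xi>, b\<^sub>w \<xi>\<rangle>\<close> weakly lower semicontinuous. On a minimal
  closed convex subset invariant under a group \<open>G\<close> of unitaries, a minimax argument and the parallelogram
  law show that every \<open>b = b\<^sub>y\<^sub>-\<^sub>z\<close> has \<open>u\<^sup>* b u\<close>, \<open>u \<in> G\<close>, arbitrarily small on finitely many vectors.

  For \<open>G = U(A)\<close> this puts \<open>b\<close> into the ideal \<open>J\<close> of those elements for which \<open>a b a\<^sup>* \<rightarrow> 0\<close> weakly whenever
  \<open>a \<rightarrow> 0\<close> strongly and boundedly: otherwise an almost orthogonal family of multiples of a spectral
  projection of \<open>b\<close> can be assembled to a contraction on which no average of the \<open>u\<^sup>* b u\<close> is small.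
  Conversely, if \<open>G\<close> consists of unitaries supported where some \<open>h \<in> J\<close> is at least \<open>\<tau> > 0\<close>, then \<open>b\<close>
  vanishes there and the points of the minimal set are fixed by \<open>G\<close>. By compactness, \<open>K(x,A)\<close> contains a
  minimal \<open>U(A)\<close>-invariant set of points commuting with \<open>J A J\<close>. Its operators \<open>b \<in> J\<close> commute with \<open>J A J\<close>
  as well, so \<open>b\<^sup>2\<close> is central in \<open>A\<close>; being small somewhere on every orbit it is \<open>0\<close>. By faithfulness the set
  is a single point, which is then fixed by \<open>U(A)\<close>.
\<close>

section \<open>Hilbert space\<close>

text \<open>For a scalar weight such as a trace, the element of \<open>K(x,A)\<close> of least
  2-norm is unique, hence fixed by \<open>U(A)\<close>. Here the norm is replaced by a family of
  quadratic forms. The supremum over \<open>u\<close> of \<open><u \<xi>, E(y^2) u \<xi>>\<close> is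
  invariant and lower semicontinuous but not strictly convex, so minimality does not make
  \<open>y\<close> unique. All that survives of uniform convexity is that
  \<open>b = E((y - z)^2)\<close> becomes small somewhere along its orbit, and this does not force
  \<open>b = 0\<close>: in \<open>B(H)\<close> with \<open>H\<close> infinite dimensional a compact
  \<open>b\<close> can be moved weakly to \<open>0\<close> by unitaries. The ideal \<open>J\<close>
  captures this obstruction; it is all of \<open>A\<close> when \<open>A\<close> is finite and the
  compact operators when \<open>A = B(H)\<close>. It is overcome on corners of \<open>A\<close>,
  where moving \<open>b\<close> away is impossible. Squares occur for two reasons:
  \<open>x^2 <= norm x * x\<close> keeps them in the domain of \<open>E\<close>, and the
  parallelogram law gives the exact defect of convexity. Since \<open>E\<close> is finite only on a
  part of \<open>M\<close>, no continuity is available; lower semicontinuity on bounded sets has to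
  be extracted from normality, which is only about increasing nets.\<close>

class hilbert_space = real_inner + complete_space

instance hilbert_space \<subseteq> banach ..

lemma parallelogram:
  fixes a b :: "'a::real_inner"
  shows "(norm (a + b))\<^sup>2 + (norm (a - b))\<^sup>2 = 2 * (norm a)\<^sup>2 + 2 * (norm b)\<^sup>2"
  by (simp add: power2_norm_eq_inner algebra_simps inner_commute)

lemma closest_point:
  fixes S :: "'a::hilbert_space set"
  assumes "closed S" "convex S" "S \<noteq> {}"
  shows "\<exists>p\<in>S. \<forall>y\<in>S. norm (x - p) \<le> norm (x - y)"
proof -
  define d where "d = (INF y\<in>S. (norm (x - y))\<^sup>2)"
  have bdd: "bdd_below ((\<lambda>y. (norm (x - y))\<^sup>2) ` S)" by (rule bdd_belowI[of _ 0]) auto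
  have d_le: "d \<le> (norm (x - y))\<^sup>2" if "y \<in> S" for y
    unfolding d_def by (rule cINF_lower[OF bdd that])
  have "\<exists>y\<in>S. (norm (x - y))\<^sup>2 < d + inverse (real (Suc n))" for n
  proof -
    have "(INF y\<in>S. (norm (x - y))\<^sup>2) < d + inverse (real (Suc n))" by (simp add: d_def)
    then show ?thesis using cINF_less_iff[OF assms(3) bdd] by blast
  qed
  then obtain s where s: "\<And>n. s n \<in> S" "\<And>n. (norm (x - s n))\<^sup>2 < d + inverse (real (Suc n))"
    by metis
  have est: "(norm (s m - s n))\<^sup>2 \<le> 2 * inverse (real (Suc m)) + 2 * inverse (real (Suc n))" for m n
  proof -
    have "(1/2) *\<^sub>R s m + (1/2) *\<^sub>R s n \<in> S"
      using assms(2) s(1) by (simp add: convex_def)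
    then have "d \<le> (norm (x - ((1/2) *\<^sub>R s m + (1/2) *\<^sub>R s n)))\<^sup>2" by (rule d_le)
    also have "x - ((1/2) *\<^sub>R s m + (1/2) *\<^sub>R s n) = (1/2) *\<^sub>R ((x - s m) + (x - s n))"
    proof -
      have "x = (1/2) *\<^sub>R x + (1/2) *\<^sub>R x" by (simp flip: scaleR_left.add)
      then show ?thesis by (simp add: algebra_simps)
    qed
    finally have "4 * d \<le> (norm ((x - s m) + (x - s n)))\<^sup>2" by (simp add: power_divide)
    moreover have "(norm ((x - s m) + (x - s n)))\<^sup>2 + (norm ((x - s m) - (x - s n)))\<^sup>2
       = 2 * (norm (x - s m))\<^sup>2 + 2 * (norm (x - s n))\<^sup>2" by (rule parallelogram)
    moreover have "norm ((x - s m) - (x - s n)) = norm (s m - s n)" by (simp add: norm_minus_commute)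
    ultimately show ?thesis using s(2)[of m] s(2)[of n] by simp
  qed
  have "Cauchy s"
  proof (rule CauchyI)
    fix e :: real assume "0 < e"
    then obtain N where N: "inverse (real (Suc N)) < e\<^sup>2 / 4"
      using reals_Archimedean[of "e\<^sup>2 / 4"] by auto
    have "norm (s m - s n) < e" if "m \<ge> N" "n \<ge> N" for m n
    proof -
      have "inverse (real (Suc m)) \<le> inverse (real (Suc N))" "inverse (real (Suc n)) \<le> inverse (real (Suc N))"
        using that by (auto intro: le_imp_inverse_le)
      then have "(norm (s m - s n))\<^sup>2 < e\<^sup>2" using est[of m n] N by linarith
      then show ?thesis using \<open>0 < e\<close> by (simp add: power_less_imp_less_base)
    qed
    then show "\<exists>M. \<forall>m\<ge>M. \<forall>n\<ge>M. norm (s m - s n) < e" by blast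
  qed
  then obtain p where p: "s \<longlonglongrightarrow> p" using Cauchy_convergent convergent_def by blast
  have "p \<in> S" using assms(1) p s(1) closed_sequentially by blast
  have "(\<lambda>n. (norm (x - s n))\<^sup>2) \<longlonglongrightarrow> (norm (x - p))\<^sup>2" by (intro tendsto_intros p)
  moreover have "(\<lambda>n. d + inverse (real (Suc n))) \<longlonglongrightarrow> d + 0"
    by (intro tendsto_intros LIMSEQ_inverse_real_of_nat)
  ultimately have "(norm (x - p))\<^sup>2 \<le> d"
    using s(2) by (intro LIMSEQ_le[of "\<lambda>n. (norm (x - s n))\<^sup>2" _ "\<lambda>n. d + inverse (real (Suc n))"]) (auto intro: less_imp_le)
  then have "norm (x - p) \<le> norm (x - y)" if "y \<in> S" for y
    using d_le[OF that] by (meson order_trans power2_le_imp_le norm_ge_zero)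
  with \<open>p \<in> S\<close> show ?thesis by blast
qed

lemma ex_orthogonal_projection:
  fixes S :: "'a::hilbert_space set"
  assumes "closed S" "subspace S"
  shows "\<exists>p\<in>S. \<forall>y\<in>S. inner (x - p) y = 0"
proof -
  obtain p where p: "p \<in> S" "\<And>y. y \<in> S \<Longrightarrow> norm (x - p) \<le> norm (x - y)"
    using closest_point[OF assms(1) subspace_imp_convex[OF assms(2)]] subspace_0[OF assms(2)] by blast
  have "inner (x - p) y = 0" if y: "y \<in> S" for y
  proof (cases "y = 0")
    case False
    \<comment> \<open>The step along \<open>y\<close> that minimizes the distance to
      \<open>x\<close>. Optimality of \<open>p\<close> then leaves no component of
      \<open>x - p\<close> along \<open>y\<close>.\<close>
    define t where "t = inner (x - p) y / inner y y"
    have "p + t *\<^sub>R y \<in> S" using assms(2) p(1) y by (simp add: subspace_add subspace_scale)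
    then have "norm (x - p) \<le> norm (x - p - t *\<^sub>R y)" using p(2) by (simp add: diff_diff_eq)
    then have "(norm (x - p))\<^sup>2 \<le> (norm (x - p - t *\<^sub>R y))\<^sup>2" by simp
    also have "\<dots> = (norm (x - p))\<^sup>2 - 2 * t * inner (x - p) y + t\<^sup>2 * inner y y"
      by (simp only: power2_norm_eq_inner inner_diff_left[of "x - p"] inner_diff_right[of _ "x - p"])
        (simp add: inner_commute power2_eq_square)
    also have "t\<^sup>2 * inner y y = t * inner (x - p) y"
      using False by (simp add: t_def power2_eq_square)
    finally have "t * inner (x - p) y \<le> 0" by simp
    then have "(inner (x - p) y)\<^sup>2 / inner y y \<le> 0" by (simp add: t_def power2_eq_square)
    moreover have "inner y y > 0" using False by simp
    ultimately have "(inner (x - p) y)\<^sup>2 \<le> 0" by (simp add: divide_le_0_iff)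
    then show ?thesis by simp
  qed simp
  with p(1) show ?thesis by blast
qed

lemma riesz_representation:
  fixes f :: "'a::hilbert_space \<Rightarrow> real"
  assumes f: "bounded_linear f"
  shows "\<exists>v. \<forall>x. f x = inner v x"
proof (cases "\<forall>x. f x = 0")
  case True
  then show ?thesis by (intro exI[of _ 0]) simp
next
  case False
  then obtain x0 where x0: "f x0 \<noteq> 0" by blast
  interpret f: bounded_linear f by fact
  let ?S = "{x. f x = 0}"
  have "closed ?S" by (intro closed_Collect_eq continuous_intros f.continuous_on)
  moreover have "subspace ?S" by (auto simp: subspace_def f.add f.scaleR f.zero)
  ultimately obtain p where p: "p \<in> ?S" "\<And>y. y \<in> ?S \<Longrightarrow> inner (x0 - p) y = 0"
    using ex_orthogonal_projection by blast
  define w where "w = x0 - p"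
  have fw: "f w \<noteq> 0" using x0 p(1) by (simp add: w_def f.diff)
  then have w: "inner w w \<noteq> 0" using f.zero by auto
  have "f x = inner ((f w / inner w w) *\<^sub>R w) x" for x
  proof -
    have "f (x - (f x / f w) *\<^sub>R w) = 0" using fw by (simp add: f.diff f.scaleR)
    then have "inner w (x - (f x / f w) *\<^sub>R w) = 0" using p(2) by (simp add: w_def)
    then show ?thesis using fw w by (simp add: inner_diff_right field_simps)
  qed
  then show ?thesis by blast
qed

section \<open>The algebra of bounded operators\<close>

text \<open>
  A separate type constructor is needed to have the bounded operators as an instance of the ring
  classes. The operators are only real-linear: on a complex Hilbert space the complex-linear ones
  are those that commute with multiplication by the imaginary unit.
\<close>

typedef (overloaded) 'a endo = "UNIV :: ('a::hilbert_space \<Rightarrow>\<^sub>L 'a) set"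
  morphisms blin endo ..

setup_lifting type_definition_endo

lift_definition app :: "'a::hilbert_space endo \<Rightarrow> 'a \<Rightarrow> 'a" (infixr \<open>\<cdot>\<close> 75)
  is blinfun_apply .

lemma endo_eqI: "(\<And>x. S \<cdot> x = T \<cdot> x) \<Longrightarrow> S = T"
  by transfer (rule blinfun_eqI)

instantiation endo :: (hilbert_space) real_normed_vector
begin
lift_definition zero_endo :: "'a endo" is 0 .
lift_definition plus_endo :: "'a endo \<Rightarrow> 'a endo \<Rightarrow> 'a endo" is "(+)" .
lift_definition minus_endo :: "'a endo \<Rightarrow> 'a endo \<Rightarrow> 'a endo" is "(-)" .
lift_definition uminus_endo :: "'a endo \<Rightarrow> 'a endo" is uminus .
lift_definition scaleR_endo :: "real \<Rightarrow> 'a endo \<Rightarrow> 'a endo" is scaleR .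
lift_definition norm_endo :: "'a endo \<Rightarrow> real" is norm .
lift_definition dist_endo :: "'a endo \<Rightarrow> 'a endo \<Rightarrow> real" is dist .
lift_definition sgn_endo :: "'a endo \<Rightarrow> 'a endo" is sgn .
definition uniformity_endo :: "('a endo \<times> 'a endo) filter" where
  "uniformity_endo = (INF e\<in>{0<..}. principal {(x, y). dist x y < e})"
definition open_endo :: "'a endo set \<Rightarrow> bool" where
  "open_endo S \<longleftrightarrow> (\<forall>x\<in>S. \<forall>\<^sub>F (x', y) in uniformity. x' = x \<longrightarrow> y \<in> S)"
instance
proof
  fix U :: "'a endo set" and S T :: "'a endo"
  show "open U \<longleftrightarrow> (\<forall>x\<in>U. \<forall>\<^sub>F (x', y) in uniformity. x' = x \<longrightarrow> y \<in> U)" by (rule open_endo_def)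
  show "uniformity = (INF e\<in>{0<..}. principal {(x::'a endo, y). dist x y < e})" by (rule uniformity_endo_def)
  show "norm (S + T) \<le> norm S + norm T" by transfer (rule norm_triangle_ineq)
  show "dist S T = norm (S - T)" by transfer (rule dist_norm)
  show "sgn S = inverse (norm S) *\<^sub>R S" by transfer (rule sgn_div_norm)
  show "norm S = 0 \<longleftrightarrow> S = 0" by transfer simp
  show "norm (r *\<^sub>R S) = \<bar>r\<bar> * norm S" for r by transfer simp
qed (transfer, simp add: scaleR_add_left scaleR_add_right)+
end

text \<open>On the zero space \<open>0 = 1\<close> and \<open>norm 1 = 0\<close>, so the sort stops
  at \<open>real_normed_algebra\<close>, with the unit laws supplied by \<open>monoid_mult\<close>;
  \<open>real_normed_algebra_1\<close> would exclude that space.\<close>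

instantiation endo :: (hilbert_space) "{real_normed_algebra,monoid_mult}"
begin
lift_definition times_endo :: "'a endo \<Rightarrow> 'a endo \<Rightarrow> 'a endo" is blinfun_compose .
lift_definition one_endo :: "'a endo" is id_blinfun .
instance
proof
  fix S T U :: "'a endo" and r :: real
  show "norm (S * T) \<le> norm S * norm T" by transfer (rule norm_blinfun_compose)
  show "S * T * U = S * (T * U)" by transfer (rule blinfun_eqI, simp)
  show "1 * S = S" "S * 1 = S" by (transfer, rule blinfun_eqI, simp)+
  show "(S + T) * U = S * U + T * U" "S * (T + U) = S * T + S * U"
    "r *\<^sub>R S * T = r *\<^sub>R (S * T)" "S * r *\<^sub>R T = r *\<^sub>R (S * T)"
    by (transfer, rule blinfun_eqI, simp add: blinfun.bilinear_simps)+
qed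
end

instance endo :: (hilbert_space) banach
proof
  fix X :: "nat \<Rightarrow> 'a endo" assume X: "Cauchy X"
  have "Cauchy (\<lambda>n. blin (X n))"
    using X unfolding Cauchy_def dist_endo.rep_eq .
  then have "convergent (\<lambda>n. blin (X n))" by (rule Cauchy_convergent)
  then obtain L where L: "(\<lambda>n. blin (X n)) \<longlonglongrightarrow> L" unfolding convergent_def ..
  have "blin (endo L) = L" by (rule endo_inverse) simp
  then have "X \<longlonglongrightarrow> endo L"
    using L unfolding LIMSEQ_def dist_endo.rep_eq by (simp only:)
  then show "convergent X" by (rule convergentI)
qed

lemma app_simps [simp]:
  "(0::'a::hilbert_space endo) \<cdot> x = 0"
  "(1::'a endo) \<cdot> x = x"
  "(S + T) \<cdot> x = S \<cdot> x + T \<cdot> x"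
  "(S - T) \<cdot> x = S \<cdot> x - T \<cdot> x"
  "(- S) \<cdot> x = - (S \<cdot> x)"
  "(S * T) \<cdot> x = S \<cdot> T \<cdot> x"
  "(r *\<^sub>R S) \<cdot> x = r *\<^sub>R (S \<cdot> x)"
  by (transfer; simp add: blinfun.bilinear_simps; fail)+

lemma bounded_bilinear_app: "bounded_bilinear (app :: 'a::hilbert_space endo \<Rightarrow> _)"
proof
  fix S T :: "'a endo" and x y :: 'a and r :: real
  show "(S + T) \<cdot> x = S \<cdot> x + T \<cdot> x" "(r *\<^sub>R T) \<cdot> x = r *\<^sub>R (T \<cdot> x)" by simp_all
  show "T \<cdot> (x + y) = T \<cdot> x + T \<cdot> y" by transfer (rule blinfun.add_right)
  show "T \<cdot> r *\<^sub>R x = r *\<^sub>R (T \<cdot> x)" by transfer (rule blinfun.scaleR_right)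
  have "norm (T \<cdot> x) \<le> norm T * norm x * 1" for T :: "'a endo" and x
    unfolding mult_1_right by transfer (rule norm_blinfun)
  then show "\<exists>K. \<forall>(T :: 'a endo) x. norm (T \<cdot> x) \<le> norm T * norm x * K" by blast
qed

interpretation app: bounded_bilinear app by (rule bounded_bilinear_app)

lemmas app_right_simps [simp] = app.add_right app.diff_right app.minus_right app.scaleR_right app.zero_right

lemma norm_app: "norm (T \<cdot> x) \<le> norm T * norm x"
  by transfer (rule norm_blinfun)

lemma norm_endo_le: "0 \<le> c \<Longrightarrow> (\<And>x. norm (T \<cdot> x) \<le> c * norm x) \<Longrightarrow> norm T \<le> c"
  by transfer (rule norm_blinfun_bound)

lemma ex_endo: "bounded_linear f \<Longrightarrow> \<exists>T. \<forall>x. T \<cdot> x = f x"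
  by (rule exI[of _ "endo (Blinfun f)"]) (simp add: app.rep_eq endo_inverse bounded_linear_Blinfun_apply)

lemma endo_sum_app: "(\<Sum>i\<in>I. f i) \<cdot> x = (\<Sum>i\<in>I. f i \<cdot> x)"
  by (rule app.sum_left)

lemma endo_eq_innerI: "(\<And>x y. inner x (S \<cdot> y) = inner x (T \<cdot> y)) \<Longrightarrow> S = T"
proof (rule endo_eqI)
  fix y assume "\<And>x y. inner x (S \<cdot> y) = inner x (T \<cdot> y)"
  then have "inner (S \<cdot> y - T \<cdot> y) (S \<cdot> y - T \<cdot> y) = 0" by (simp add: inner_diff_right)
  then show "S \<cdot> y = T \<cdot> y" by simp
qed

definition adj :: "'a::hilbert_space endo \<Rightarrow> 'a endo" where
  "adj T = (SOME S. \<forall>x y. inner (S \<cdot> x) y = inner x (T \<cdot> y))"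

text \<open>Riesz representation in the second variable gives \<open>f\<close>, and testing the
  bound of \<open>B\<close> at \<open>f x\<close> bounds \<open>f\<close>. Adjoints, monotone
  limits, weak limit points and the operators attached to the weight are all obtained from this
  correspondence.\<close>

lemma ex_form_operator:
  fixes B :: "'a::hilbert_space \<Rightarrow> 'a \<Rightarrow> real"
  assumes "bounded_bilinear B"
  shows "\<exists>T. \<forall>x y. inner (T \<cdot> x) y = B x y"
proof -
  interpret B: bounded_bilinear B by fact
  have "\<exists>v. \<forall>y. B x y = inner v y" for x by (rule riesz_representation) (rule B.bounded_linear_right)
  then obtain f where f: "\<And>x y. B x y = inner (f x) y" by metis
  obtain K where "K > 0" and K: "\<And>x y. norm (B x y) \<le> norm x * norm y * K" using B.pos_bounded by blast
  have "bounded_linear f"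
  proof (rule bounded_linear_intro)
    show "f (x + y) = f x + f y" for x y
      by (rule inner_eq_zero_iff[THEN iffD1, of "f (x + y) - (f x + f y)", unfolded right_minus_eq])
         (simp add: inner_diff_left inner_add_left flip: f, simp add: B.add_left)
    show "f (r *\<^sub>R x) = r *\<^sub>R f x" for r x
      by (rule inner_eq_zero_iff[THEN iffD1, of "f (r *\<^sub>R x) - r *\<^sub>R f x", unfolded right_minus_eq])
         (simp add: inner_diff_left flip: f, simp add: B.scaleR_left)
    show "norm (f x) \<le> norm x * K" for x
    proof (cases "f x = 0")
      case True
      then show ?thesis using \<open>K > 0\<close> by simp
    next
      case False
      have "norm (f x) * norm (f x) = B x (f x)" by (simp add: f flip: power2_eq_square power2_norm_eq_inner)
      also have "\<dots> \<le> norm x * norm (f x) * K" using K[of x "f x"] by simp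
      finally show ?thesis using False by (simp add: mult.assoc mult.commute mult.left_commute)
    qed
  qed
  then show ?thesis using ex_endo[of f] f by metis
qed

lemma inner_adj_left: "inner (adj T \<cdot> x) y = inner x (T \<cdot> y)"
proof -
  have "bounded_bilinear (\<lambda>x y. inner x (T \<cdot> y))"
    by (rule bounded_bilinear.comp[OF bounded_bilinear_inner bounded_linear_ident app.bounded_linear_right])
  then have "\<exists>S. \<forall>x y. inner (S \<cdot> x) y = inner x (T \<cdot> y)" by (rule ex_form_operator)
  from someI_ex[OF this] show ?thesis by (simp add: adj_def)
qed

lemma inner_adj_right: "inner x (adj T \<cdot> y) = inner (T \<cdot> x) y"
  by (metis inner_adj_left inner_commute)

lemma adj_eqI: "(\<And>x y. inner x (S \<cdot> y) = inner (T \<cdot> x) y) \<Longrightarrow> adj T = S"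
  by (rule endo_eq_innerI) (simp add: inner_adj_right)

lemma adj_adj [simp]: "adj (adj T) = T"
  by (rule adj_eqI) (simp add: inner_adj_left)

lemma adj_simps [simp]:
  "adj (S * T) = adj T * adj S" "adj (S + T) = adj S + adj T" "adj (S - T) = adj S - adj T"
  "adj (- T) = - adj T" "adj (r *\<^sub>R T) = r *\<^sub>R adj T" "adj 0 = 0" "adj 1 = 1"
  by (rule adj_eqI; simp add: inner_adj_left inner_adj_right inner_simps)+

lemma norm_adj [simp]: "norm (adj T) = norm T"
proof -
  have "norm (adj T) \<le> norm T" for T :: "'a endo"
  proof (rule norm_endo_le)
    fix x
    have "norm (adj T \<cdot> x) * norm (adj T \<cdot> x) = inner x (T \<cdot> adj T \<cdot> x)"
      by (metis inner_adj_left power2_eq_square power2_norm_eq_inner)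
    also have "\<dots> \<le> norm x * (norm T * norm (adj T \<cdot> x))"
      by (meson norm_app norm_cauchy_schwarz order_trans mult_left_mono norm_ge_zero)
    finally show "norm (adj T \<cdot> x) \<le> norm T * norm x"
      by (cases "adj T \<cdot> x = 0") (auto simp: mult_ac)
  qed simp
  from this[of T] this[of "adj T"] show ?thesis by simp
qed

lemma bounded_linear_adj: "bounded_linear adj"
  by (rule bounded_linear_intro[where K=1]) simp_all

section \<open>Positive operators\<close>

abbreviation qf :: "'a::hilbert_space endo \<Rightarrow> 'a \<Rightarrow> real" where
  "qf T x \<equiv> inner x (T \<cdot> x)"

text \<open>Over the reals a nonnegative quadratic form does not force self-adjointness, so the
  latter is a separate clause.\<close>

definition pos :: "'a::hilbert_space endo \<Rightarrow> bool" where
  "pos T \<longleftrightarrow> adj T = T \<and> (\<forall>x. 0 \<le> qf T x)"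

lemma pos_adj: "pos T \<Longrightarrow> adj T = T" and pos_qf: "pos T \<Longrightarrow> 0 \<le> qf T x"
  by (auto simp: pos_def)

lemma adj_inner: "adj T = T \<Longrightarrow> inner (T \<cdot> x) y = inner x (T \<cdot> y)"
  using inner_adj_left[of T x y] by simp

lemma pos_diffI: "adj S = S \<Longrightarrow> adj T = T \<Longrightarrow> (\<And>x. qf S x \<le> qf T x) \<Longrightarrow> pos (T - S)"
  by (simp add: pos_def inner_diff_right)

lemma pos_diffD: "pos (T - S) \<Longrightarrow> qf S x \<le> qf T x"
  using pos_qf[of "T - S" x] by (simp add: inner_diff_right)

lemma qf_simps:
  "qf 0 x = 0" "qf 1 x = (norm x)\<^sup>2" "qf (S + T) x = qf S x + qf T x" "qf (S - T) x = qf S x - qf T x"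
  "qf (r *\<^sub>R S) x = r * qf S x" "qf (- S) x = - qf S x"
  by (simp_all add: inner_add_right inner_diff_right power2_norm_eq_inner)

lemma qf_sum: "qf (\<Sum>i\<in>I. f i) x = (\<Sum>i\<in>I. qf (f i) x)"
  by (simp add: endo_sum_app inner_sum_right)

lemma qf_adj_mult: "qf (adj S * S) x = (norm (S \<cdot> x))\<^sup>2"
  by (simp add: inner_adj_right power2_norm_eq_inner)

lemma qf_square: "adj S = S \<Longrightarrow> qf (S * S) x = (norm (S \<cdot> x))\<^sup>2"
  using qf_adj_mult[of x S] by simp

lemma qf_conj: "qf (adj S * T * S) x = qf T (S \<cdot> x)"
  by (simp add: inner_adj_right)

lemma qf_le_norm: "qf T x \<le> norm T * (norm x)\<^sup>2"
proof -
  have "qf T x \<le> norm x * norm (T \<cdot> x)" by (rule norm_cauchy_schwarz)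
  also have "\<dots> \<le> norm x * (norm T * norm x)" by (intro mult_left_mono norm_app) simp
  finally show ?thesis by (simp add: power2_eq_square mult_ac)
qed

lemma pos_zero: "pos 0" and pos_one: "pos 1"
  by (simp_all add: pos_def)

lemma pos_add: "pos S \<Longrightarrow> pos T \<Longrightarrow> pos (S + T)"
  by (simp add: pos_def inner_add_right)

lemma pos_scale: "0 \<le> r \<Longrightarrow> pos S \<Longrightarrow> pos (r *\<^sub>R S)"
  by (simp add: pos_def)

lemma pos_sum: "(\<And>i. i \<in> I \<Longrightarrow> pos (f i)) \<Longrightarrow> pos (\<Sum>i\<in>I. f i)"
  by (induction I rule: infinite_finite_induct) (auto intro: pos_add pos_zero)

lemma pos_adj_mult: "pos (adj S * S)"
  unfolding pos_def by (simp only: qf_adj_mult) simp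

lemma pos_mult_adj: "pos (S * adj S)"
  using pos_adj_mult[of "adj S"] by simp

lemma pos_square: "adj S = S \<Longrightarrow> pos (S * S)"
  using pos_adj_mult[of S] by simp

lemma pos_conj: "pos T \<Longrightarrow> pos (adj S * T * S)"
  unfolding pos_def by (simp only: qf_conj) (simp add: mult.assoc)

lemma pos_conj_sa: "pos T \<Longrightarrow> adj S = S \<Longrightarrow> pos (S * T * S)"
  using pos_conj[of T S] by simp

lemma pos_conj': "pos T \<Longrightarrow> pos (S * T * adj S)"
  using pos_conj[of T "adj S"] by simp

lemma adj_mult_eq_0: "adj S * S = 0 \<Longrightarrow> S = 0"
proof (rule endo_eqI)
  fix x assume "adj S * S = 0"
  then have "(norm (S \<cdot> x))\<^sup>2 = 0" using qf_adj_mult[of x S] by simp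
  then show "S \<cdot> x = 0 \<cdot> x" by simp
qed

lemma form_eqI:
  assumes "adj S = S" "adj T = T" "\<And>x. qf S x = qf T x"
  shows "S = T"
proof (rule endo_eq_innerI)
  fix x y
  have *: "qf R (x + y) = qf R x + qf R y + 2 * inner x (R \<cdot> y)" if "adj R = R" for R :: "'a endo"
    using adj_inner[OF that, of x y] by (simp add: inner_add_left inner_add_right inner_commute)
  show "inner x (S \<cdot> y) = inner x (T \<cdot> y)"
    using *[OF assms(1)] *[OF assms(2)] assms(3)[of x] assms(3)[of y] assms(3)[of "x + y"] by simp
qed

lemma pos_cauchy_schwarz:
  assumes T: "pos T"
  shows "(inner x (T \<cdot> y))\<^sup>2 \<le> qf T x * qf T y"
proof -
  define a b c where "a = qf T x" and "b = inner x (T \<cdot> y)" and "c = qf T y"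
  have yx: "inner y (T \<cdot> x) = b"
    using adj_inner[OF pos_adj[OF T], of y x] by (simp add: b_def inner_commute)
  have ge: "0 \<le> s\<^sup>2 * a + 2 * s * t * b + t\<^sup>2 * c" for s t
  proof -
    have "0 \<le> qf T (s *\<^sub>R x + t *\<^sub>R y)" by (rule pos_qf[OF T])
    also have "\<dots> = s\<^sup>2 * a + 2 * s * t * b + t\<^sup>2 * c"
      using yx by (simp add: inner_add_left inner_add_right a_def b_def c_def power2_eq_square algebra_simps)
    finally show ?thesis .
  qed
  have "0 \<le> c" by (simp add: c_def pos_qf[OF T])
  have "b\<^sup>2 \<le> a * c"
  proof (cases "c = 0")
    case True
    have "b = 0"
    proof (rule ccontr)
      assume "b \<noteq> 0"
      have "0 \<le> a + 2 * (- (a + 1) / b) * b" using ge[of 1 "- (a + 1) / b"] True by simp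
      also have "\<dots> = - a - 2" using \<open>b \<noteq> 0\<close> by simp
      finally show False using pos_qf[OF T, of x] by (simp add: a_def)
    qed
    then show ?thesis using True by simp
  next
    case False
    have "0 \<le> c * (a * c - b\<^sup>2)" using ge[of c "- b"] by (simp add: power2_eq_square algebra_simps)
    then show ?thesis using False \<open>0 \<le> c\<close> by (simp add: zero_le_mult_iff)
  qed
  then show ?thesis by (simp add: a_def b_def c_def)
qed

text \<open>This is \<open>T^2 <= k T\<close> for \<open>0 <= T <= k\<close>: Cauchy-Schwarz for the
  form of \<open>T\<close> at the pair \<open>T x\<close>, \<open>x\<close>, after which one factor
  \<open>norm (T x)^2\<close> cancels.\<close>

lemma pos_norm_app_le:
  assumes T: "pos T" and k: "0 \<le> k" "\<And>x. qf T x \<le> k * (norm x)\<^sup>2"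
  shows "(norm (T \<cdot> x))\<^sup>2 \<le> k * qf T x"
proof -
  have "((norm (T \<cdot> x))\<^sup>2)\<^sup>2 = (inner (T \<cdot> x) (T \<cdot> x))\<^sup>2" by (simp add: power2_norm_eq_inner)
  also have "\<dots> \<le> qf T (T \<cdot> x) * qf T x" by (rule pos_cauchy_schwarz[OF T])
  also have "\<dots> \<le> (k * (norm (T \<cdot> x))\<^sup>2) * qf T x"
    by (intro mult_right_mono k pos_qf[OF T])
  finally have "(norm (T \<cdot> x))\<^sup>2 * (norm (T \<cdot> x))\<^sup>2 \<le> (norm (T \<cdot> x))\<^sup>2 * (k * qf T x)"
    by (simp add: power2_eq_square mult_ac)
  then show ?thesis
  proof (cases "T \<cdot> x = 0")
    case False
    then have "0 < (norm (T \<cdot> x))\<^sup>2" by simp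
    with \<open>(norm (T \<cdot> x))\<^sup>2 * _ \<le> _\<close> show ?thesis by (rule mult_left_le_imp_le)
  qed (use k(1) pos_qf[OF T, of x] in simp)
qed

lemma pos_norm_app_le': "pos T \<Longrightarrow> (norm (T \<cdot> x))\<^sup>2 \<le> norm T * qf T x"
  by (rule pos_norm_app_le) (auto intro: qf_le_norm)

lemma pos_norm_le:
  assumes T: "pos T" and k: "0 \<le> k" "\<And>x. qf T x \<le> k * (norm x)\<^sup>2"
  shows "norm T \<le> k"
proof (rule norm_endo_le[OF k(1)])
  fix x
  have "(norm (T \<cdot> x))\<^sup>2 \<le> k * (k * (norm x)\<^sup>2)"
    using pos_norm_app_le[OF assms(1) k(1) k(2), of x] mult_left_mono[OF k(2)[of x] k(1)] by (rule order_trans)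
  also have "\<dots> = (k * norm x)\<^sup>2" by (simp only: power_mult_distrib power2_eq_square[of k] mult.assoc)
  finally show "norm (T \<cdot> x) \<le> k * norm x"
    by (rule power2_le_imp_le) (use k(1) in simp)
qed

section \<open>Square roots, resolvents and positive parts\<close>

text \<open>
  Newton-free square root: the iterates \<open>Y\<^sub>n\<^sub>+\<^sub>1 = (x + Y\<^sub>n\<^sup>2) / 2\<close> are polynomials in \<open>x\<close> with nonnegative
  coefficients, so their increments are dominated by those of the scalar iteration at \<open>x = 1\<close>;
  the limit satisfies \<open>(1 - Y)\<^sup>2 = 1 - x\<close>.
\<close>

lemma ex_sqrt_one_minus:
  fixes x :: "'a::{real_normed_algebra,banach}"
  assumes x: "norm x \<le> 1"
  shows "\<exists>Y. 2 *\<^sub>R Y = x + Y * Y \<and> norm Y \<le> 1 \<and>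
    (\<forall>S. closed S \<longrightarrow> 0 \<in> S \<longrightarrow> (\<forall>y\<in>S. (1/2) *\<^sub>R (x + y * y) \<in> S) \<longrightarrow> Y \<in> S)"
proof -
  define Y where "Y = rec_nat 0 (\<lambda>_ y. (1/2) *\<^sub>R (x + y * y))"
  have Y: "Y 0 = 0" "\<And>n. Y (Suc n) = (1/2) *\<^sub>R (x + Y n * Y n)" by (simp_all add: Y_def)
  define s :: "nat \<Rightarrow> real" where "s = rec_nat 0 (\<lambda>_ y. (1 + y\<^sup>2) / 2)"
  have s: "s 0 = 0" "\<And>n. s (Suc n) = (1 + (s n)\<^sup>2) / 2" by (simp_all add: s_def)
  have s_bd: "0 \<le> s n \<and> s n \<le> 1" for n
    by (induction n) (auto simp: s power_le_one)
  have "incseq s"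
  proof (rule incseq_SucI)
    fix n
    have "0 \<le> (1 - s n)\<^sup>2" by simp
    then show "s n \<le> s (Suc n)" by (simp add: s power2_eq_square algebra_simps)
  qed
  then have "Cauchy s"
    using incseq_convergent[of s 1] s_bd LIMSEQ_imp_Cauchy by metis
  have YB: "norm (Y n) \<le> s n" for n
  proof (induction n)
    case (Suc n)
    have "norm (x + Y n * Y n) \<le> norm x + norm (Y n) * norm (Y n)"
      by (rule norm_triangle_mono[OF order_refl norm_mult_ineq])
    also have "\<dots> \<le> 1 + s n * s n"
      using x Suc s_bd[of n] by (intro add_mono mult_mono) auto
    finally show ?case by (simp add: Y s power2_eq_square)
  qed (simp add: Y s)
  have step: "norm (Y (Suc n) - Y n) \<le> s (Suc n) - s n" for n
  proof (induction n)
    case 0 then show ?case using x by (simp add: Y s)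
  next
    case (Suc n)
    have eq: "Y (Suc (Suc n)) - Y (Suc n)
        = (1/2) *\<^sub>R (Y (Suc n) * (Y (Suc n) - Y n) + (Y (Suc n) - Y n) * Y n)"
    proof -
      define a b where "a = Y (Suc n)" and "b = Y n"
      have "Y (Suc (Suc n)) = (1/2) *\<^sub>R (x + a * a)" "a = (1/2) *\<^sub>R (x + b * b)"
        by (simp_all add: a_def b_def Y(2))
      then have "Y (Suc (Suc n)) - a = (1/2) *\<^sub>R (a * a - b * b)"
        by (metis add_diff_cancel_left scaleR_diff_right)
      also have "a * a - b * b = a * (a - b) + (a - b) * b" by (simp add: algebra_simps)
      finally show ?thesis by (simp add: a_def b_def)
    qed
    have "norm (Y (Suc (Suc n)) - Y (Suc n)) \<le> (1/2) * (s (Suc n) * (s (Suc n) - s n) + (s (Suc n) - s n) * s n)"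
    proof -
      have "norm (Y (Suc n) * (Y (Suc n) - Y n)) \<le> s (Suc n) * (s (Suc n) - s n)"
        using YB[of "Suc n"] Suc s_bd[of "Suc n"]
        by (intro order_trans[OF norm_mult_ineq] mult_mono) auto
      moreover have "norm ((Y (Suc n) - Y n) * Y n) \<le> (s (Suc n) - s n) * s n"
        using YB[of n] Suc s_bd[of n] \<open>incseq s\<close>
        by (intro order_trans[OF norm_mult_ineq] mult_mono) (auto dest: incseq_SucD)
      ultimately have "norm (Y (Suc n) * (Y (Suc n) - Y n) + (Y (Suc n) - Y n) * Y n)
          \<le> s (Suc n) * (s (Suc n) - s n) + (s (Suc n) - s n) * s n"
        by (rule norm_triangle_mono)
      then show ?thesis unfolding eq by simp
    qed
    also have "\<dots> = s (Suc (Suc n)) - s (Suc n)"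
    proof -
      define a b where "a = s (Suc n)" and "b = s n"
      have "s (Suc (Suc n)) = (1 + a\<^sup>2) / 2" "a = (1 + b\<^sup>2) / 2"
        by (simp_all add: a_def b_def s(2))
      then have "s (Suc (Suc n)) - a = (1 + a\<^sup>2) / 2 - (1 + b\<^sup>2) / 2" by (simp only:)
      also have "\<dots> = (a\<^sup>2 - b\<^sup>2) / 2" by (simp add: diff_divide_distrib add_divide_distrib)
      also have "\<dots> = (1/2) * (a * (a - b) + (a - b) * b)" 
        by (simp add: power2_eq_square field_simps)
      finally show ?thesis by (simp add: a_def b_def)
    qed
    finally show ?case .
  qed
  have diff: "norm (Y (m + k) - Y m) \<le> s (m + k) - s m" for m k
  proof (induction k)
    case (Suc k)
    have "norm (Y (m + Suc k) - Y m) = norm ((Y (Suc (m + k)) - Y (m + k)) + (Y (m + k) - Y m))" by simp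
    also have "\<dots> \<le> (s (Suc (m + k)) - s (m + k)) + (s (m + k) - s m)"
      by (rule norm_triangle_mono[OF step Suc])
    finally show ?case by simp
  qed simp
  have "Cauchy Y"
  proof (rule CauchyI')
    fix e :: real assume "0 < e"
    then obtain M where M: "\<And>m n. m \<ge> M \<Longrightarrow> n \<ge> M \<Longrightarrow> norm (s m - s n) < e"
      using CauchyD[OF \<open>Cauchy s\<close>] by meson
    have "norm (Y m - Y n) < e" if "m \<ge> M" "m < n" for m n
    proof -
      have "norm (Y m - Y n) \<le> s n - s m"
        using diff[of m "n - m"] that by (simp add: norm_minus_commute)
      also have "\<dots> < e" using M[of n m] that by auto
      finally show ?thesis .
    qed
    then show "\<exists>M. \<forall>m\<ge>M. \<forall>n>m. dist (Y m) (Y n) < e" unfolding dist_norm by blast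
  qed
  then obtain L where L: "Y \<longlonglongrightarrow> L" using Cauchy_convergent convergent_def by blast
  have "(\<lambda>n. 2 *\<^sub>R Y (Suc n)) \<longlonglongrightarrow> 2 *\<^sub>R L" by (intro tendsto_intros LIMSEQ_Suc L)
  moreover have "(\<lambda>n. 2 *\<^sub>R Y (Suc n)) \<longlonglongrightarrow> x + L * L" unfolding Y by simp (intro tendsto_intros L)
  ultimately have "2 *\<^sub>R L = x + L * L" by (rule LIMSEQ_unique)
  moreover have "norm (Y n) \<le> 1" for n using YB[of n] s_bd[of n] by linarith
  then have "norm L \<le> 1" using L by (metis (no_types) Lim_bounded tendsto_norm)
  \<comment> \<open>Every closed condition preserved by the iteration passes to the limit.
    Self-adjointness, commutation and support of the root are later read off in this way, in place
    of a functional calculus.\<close>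
  moreover have "L \<in> S" if S: "closed S" "0 \<in> S" "\<forall>y\<in>S. (1/2) *\<^sub>R (x + y * y) \<in> S" for S
  proof -
    have "Y n \<in> S" for n by (induction n) (use S in \<open>auto simp: Y\<close>)
    then show ?thesis using closed_sequentially[OF S(1)] L by blast
  qed
  ultimately show ?thesis by blast
qed

text \<open>The commutant is taken among all real-linear operators. It agrees with the complex one
  as soon as \<open>X\<close> contains multiplication by the imaginary unit, see
  \<open>vimage_commutant\<close>.\<close>

definition comm :: "'a::hilbert_space endo set \<Rightarrow> 'a endo set" where
  "comm X = {T. \<forall>S\<in>X. T * S = S * T}"

lemma commD: "T \<in> comm X \<Longrightarrow> S \<in> X \<Longrightarrow> T * S = S * T"
  by (simp add: comm_def)

lemma commI: "(\<And>S. S \<in> X \<Longrightarrow> T * S = S * T) \<Longrightarrow> T \<in> comm X"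
  by (simp add: comm_def)

lemma comm_zero: "0 \<in> comm X" and comm_one: "1 \<in> comm X"
  by (auto intro!: commI)

lemma comm_add: "S \<in> comm X \<Longrightarrow> T \<in> comm X \<Longrightarrow> S + T \<in> comm X"
  and comm_diff: "S \<in> comm X \<Longrightarrow> T \<in> comm X \<Longrightarrow> S - T \<in> comm X"
  and comm_uminus: "S \<in> comm X \<Longrightarrow> - S \<in> comm X"
  and comm_scaleR: "S \<in> comm X \<Longrightarrow> r *\<^sub>R S \<in> comm X"
  by (auto simp: comm_def algebra_simps)

lemma comm_mult: "S \<in> comm X \<Longrightarrow> T \<in> comm X \<Longrightarrow> S * T \<in> comm X"
  by (intro commI) (metis commD mult.assoc)

lemma comm_closed: "closed (comm X)"
proof -
  have "comm X = (\<Inter>S\<in>X. {T. T * S = S * T})" by (auto simp: comm_def)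
  also have "closed \<dots>" by (intro closed_INT ballI closed_Collect_eq continuous_intros)
  finally show ?thesis .
qed

lemma comm_adj: "(\<And>S. S \<in> X \<Longrightarrow> adj S \<in> X) \<Longrightarrow> T \<in> comm X \<Longrightarrow> adj T \<in> comm X"
  by (intro commI) (metis adj_adj adj_simps(1) commD)

text \<open>Each clause is the invariant-set part of \<open>ex_sqrt_one_minus\<close> applied to a
  suitable closed set. The two support clauses are there for \<open>ex_unitary\<close>: a unitary
  built from \<open>Y\<close> differs from \<open>1\<close> only where \<open>x\<close>
  lives.\<close>

lemma ex_sqrt_one_minus_endo:
  fixes x :: "'a::hilbert_space endo"
  assumes x: "norm x \<le> 1" "adj x = x"
  shows "\<exists>Y. (1 - Y) * (1 - Y) = 1 - x \<and> adj Y = Y \<and> pos (1 - Y) \<and>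
    (\<forall>z. z * x = x * z \<longrightarrow> z * Y = Y * z) \<and> (\<forall>s. s * x = x \<longrightarrow> s * Y = Y) \<and> (\<forall>s. x * s = x \<longrightarrow> Y * s = Y)"
proof -
  obtain Y where Y: "2 *\<^sub>R Y = x + Y * Y" "norm Y \<le> 1"
    and S: "\<And>S. closed S \<Longrightarrow> 0 \<in> S \<Longrightarrow> \<forall>y\<in>S. (1/2) *\<^sub>R (x + y * y) \<in> S \<Longrightarrow> Y \<in> S"
    using ex_sqrt_one_minus[OF x(1)] by blast
  have "(1 - Y) * (1 - Y) = 1 - 2 *\<^sub>R Y + Y * Y" by (simp add: algebra_simps scaleR_2)
  then have sq: "(1 - Y) * (1 - Y) = 1 - x" using Y(1) by simp
  have Ysa: "adj Y = Y"
  proof -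
    have "closed {y. adj y = y}"
      by (intro closed_Collect_eq continuous_intros linear_continuous_on bounded_linear_adj)
    then have "Y \<in> {y. adj y = y}" by (rule S) (auto simp: x(2))
    then show ?thesis by simp
  qed
  have c: "z * Y = Y * z" if "z * x = x * z" for z
  proof -
    have "Y \<in> comm {z}"
    proof (rule S[OF comm_closed comm_zero], intro ballI comm_scaleR comm_add comm_mult)
      show "x \<in> comm {z}" using that by (simp add: comm_def)
    qed
    then show ?thesis by (simp add: comm_def)
  qed
  have l: "s * Y = Y" if "s * x = x" for s
  proof -
    have "closed {y. s * y = y}" by (intro closed_Collect_eq continuous_intros)
    then have "Y \<in> {y. s * y = y}"
      by (rule S) (use that in \<open>auto simp: distrib_left simp flip: mult.assoc\<close>)
    then show ?thesis by simp
  qed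
  have r: "Y * s = Y" if "x * s = x" for s
  proof -
    have "closed {y. y * s = y}" by (intro closed_Collect_eq continuous_intros)
    then have "Y \<in> {y. y * s = y}"
      by (rule S) (use that in \<open>auto simp: distrib_right mult.assoc\<close>)
    then show ?thesis by simp
  qed
  have "pos (1 - Y)"
  proof (rule pos_diffI)
    fix v
    have "qf Y v \<le> norm Y * (norm v)\<^sup>2" by (rule qf_le_norm)
    also have "\<dots> \<le> 1 * (norm v)\<^sup>2" using Y(2) by (intro mult_right_mono) auto
    finally show "qf Y v \<le> qf 1 v" by (simp add: dot_square_norm)
  qed (simp_all add: Ysa)
  then show ?thesis using sq Ysa c l r by blast
qed

lemma ex_sqrt:
  assumes T: "pos T"
  shows "\<exists>S. pos S \<and> S * S = T \<and> (\<forall>z. z * T = T * z \<longrightarrow> z * S = S * z)"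
proof -
  define c where "c = norm T + 1"
  have c: "c > 0" by (simp add: c_def add_nonneg_pos)
  define x where "x = 1 - (1/c) *\<^sub>R T"
  have qx: "qf x v = (norm v)\<^sup>2 - (1/c) * qf T v" for v by (simp add: x_def inner_diff_right dot_square_norm)
  have "pos x"
    unfolding pos_def
  proof (intro conjI allI)
    show "adj x = x" by (simp add: x_def pos_adj[OF T])
    fix v
    have "qf T v \<le> c * (norm v)\<^sup>2"
      using qf_le_norm[of v T] by (rule order_trans) (simp add: c_def mult_right_mono)
    then show "0 \<le> qf x v" unfolding qx using c by (simp add: field_simps)
  qed
  have "norm x \<le> 1"
    by (rule pos_norm_le[OF \<open>pos x\<close>]) (use pos_qf[OF T] c in \<open>simp_all add: qx\<close>)
  then obtain Y where Y: "(1 - Y) * (1 - Y) = 1 - x" "pos (1 - Y)"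
      "\<And>z. z * x = x * z \<Longrightarrow> z * Y = Y * z"
    using ex_sqrt_one_minus_endo pos_adj[OF \<open>pos x\<close>] by metis
  define S where "S = sqrt c *\<^sub>R (1 - Y)"
  have "S * S = c *\<^sub>R (1 - x)" using c Y(1) by (simp add: S_def)
  also have "\<dots> = T" using c by (simp add: x_def)
  finally have "S * S = T" .
  moreover have "pos S" unfolding S_def using c Y(2) by (intro pos_scale) auto
  moreover have "z * S = S * z" if "z * T = T * z" for z
  proof -
    have "z * x = x * z" using that by (simp add: x_def algebra_simps)
    from Y(3)[OF this] show ?thesis by (simp add: S_def algebra_simps)
  qed
  ultimately show ?thesis by blast
qed

lemma pos_mult_commute:
  assumes "pos S" "pos T" "S * T = T * S"
  shows "pos (S * T)"
proof -
  obtain R where R: "pos R" "R * R = S" "\<And>z. z * S = S * z \<Longrightarrow> z * R = R * z"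
    using ex_sqrt[OF assms(1)] by blast
  have "T * R = R * T" by (rule R(3)) (simp add: assms(3))
  then have "S * T = R * T * R" by (simp add: mult.assoc flip: R(2))
  then show ?thesis using pos_conj_sa[OF assms(2) pos_adj[OF R(1)]] by simp
qed

text \<open>\<open>1 + T = c (1 - N)\<close> with \<open>norm N <= 1 - 1/c < 1\<close>. The left and
  right inverses of \<open>1 - N\<close> are fixed points of the contractions
  \<open>Z \<mapsto> 1 + N Z\<close> and \<open>Z \<mapsto> 1 + Z N\<close>, and associativity
  identifies them.\<close>

lemma ex_inverse_one_plus:
  fixes T :: "'a::hilbert_space endo"
  assumes T: "pos T"
  shows "\<exists>G. G * (1 + T) = 1 \<and> (1 + T) * G = 1"
proof -
  define c where "c = norm T + 1"
  have c: "c \<ge> 1" by (simp add: c_def)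
  define N where "N = 1 - (1/c) *\<^sub>R (1 + T)"
  have qN: "qf N v = (norm v)\<^sup>2 - (1/c) * ((norm v)\<^sup>2 + qf T v)" for v by (simp add: N_def inner_diff_right inner_add_right dot_square_norm)
  have "pos N"
    unfolding pos_def
  proof (intro conjI allI)
    show "adj N = N" by (simp add: N_def pos_adj[OF T])
    fix v
    have "(norm v)\<^sup>2 + qf T v \<le> c * (norm v)\<^sup>2"
      using qf_le_norm[of v T] by (simp add: c_def algebra_simps)
    then show "0 \<le> qf N v" unfolding qN using c by (simp add: field_simps)
  qed
  have Nn: "norm N \<le> 1 - 1/c"
  proof (rule pos_norm_le[OF \<open>pos N\<close>])
    fix v
    have "0 \<le> (1/c) * qf T v" using c pos_qf[OF T, of v] by simp
    then show "qf N v \<le> (1 - 1/c) * (norm v)\<^sup>2" unfolding qN by (simp add: algebra_simps)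
  qed (use c in simp)
  have c1: "0 \<le> 1 - 1/c" "1 - 1/c < 1" using c by auto
  have "\<exists>!Z\<in>UNIV. 1 + N * Z = Z"
  proof (rule Banach_fix[OF complete_UNIV _ c1])
    show "\<And>x y. x \<in> UNIV \<Longrightarrow> y \<in> UNIV \<Longrightarrow> dist (1 + N * x) (1 + N * y) \<le> (1 - 1/c) * dist x y"
      unfolding dist_norm add_diff_cancel_left right_diff_distrib[symmetric]
      by (rule order_trans[OF norm_mult_ineq]) (intro mult_right_mono Nn norm_ge_zero)
  qed auto
  then obtain Z where Z: "1 + N * Z = Z" by blast
  have "\<exists>!Z\<in>UNIV. 1 + Z * N = Z"
  proof (rule Banach_fix[OF complete_UNIV _ c1])
    show "\<And>x y. x \<in> UNIV \<Longrightarrow> y \<in> UNIV \<Longrightarrow> dist (1 + x * N) (1 + y * N) \<le> (1 - 1/c) * dist x y"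
      unfolding dist_norm add_diff_cancel_left left_diff_distrib[symmetric]
      by (rule order_trans[OF norm_mult_ineq], subst mult.commute) (intro mult_right_mono Nn norm_ge_zero)
  qed auto
  then obtain Z' where Z': "1 + Z' * N = Z'" by blast
  have T_N: "1 + T = c *\<^sub>R (1 - N)" using c by (simp add: N_def)
  have Z1: "(1 - N) * Z = 1" using Z by (simp add: algebra_simps)
  have Z1': "Z' * (1 - N) = 1" using Z' by (simp add: algebra_simps)
  have "Z' * ((1 - N) * Z) = Z" using Z1' by (simp only: mult.assoc[symmetric]) simp
  then have "Z' = Z" using Z1 by simp
  then show ?thesis using Z1 Z1' c by (intro exI[of _ "(1/c) *\<^sub>R Z"]) (simp add: T_N)
qed

text \<open>The only function of a positive operator that is needed besides the square root. Its
  complement \<open>1 - resolvent T\<close> is \<open>T / (1 + T)\<close>, a bounded monotone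
  cut-off of \<open>T\<close>, and \<open>resolvent T\<close> itself is small where \<open>T\<close>
  is large, which replaces spectral projections.\<close>

definition resolvent :: "'a::hilbert_space endo \<Rightarrow> 'a endo" where
  "resolvent T = (SOME G. G * (1 + T) = 1 \<and> (1 + T) * G = 1)"

context
  fixes T :: "'a::hilbert_space endo"
  assumes T: "pos T"
begin

lemma resolvent_left: "resolvent T * (1 + T) = 1" and resolvent_right: "(1 + T) * resolvent T = 1"
  using someI_ex[OF ex_inverse_one_plus[OF T]] by (simp_all add: resolvent_def)

lemma resolvent_commute:
  assumes "z * T = T * z" shows "z * resolvent T = resolvent T * z"
proof -
  have "(1 + T) * z = z * (1 + T)" using assms by (simp add: algebra_simps)
  then have "resolvent T * (1 + T) * z * resolvent T = resolvent T * z * ((1 + T) * resolvent T)"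
    by (simp only: mult.assoc)
  then show ?thesis by (simp add: resolvent_left resolvent_right)
qed

lemma resolvent_adj: "adj (resolvent T) = resolvent T"
proof -
  have "adj (resolvent T) * (1 + T) = 1"
    using arg_cong[OF resolvent_right, of adj] by (simp add: pos_adj[OF T])
  then have "adj (resolvent T) * ((1 + T) * resolvent T) = resolvent T"
    by (simp only: mult.assoc[symmetric]) simp
  then show ?thesis by (simp add: resolvent_right)
qed

lemma resolvent_split: "x = resolvent T \<cdot> x + T \<cdot> resolvent T \<cdot> x"
  using arg_cong[OF resolvent_right, of "\<lambda>S. S \<cdot> x"] by simp

lemma one_minus_resolvent: "1 - resolvent T = T * resolvent T" "1 - resolvent T = resolvent T * T"
  using resolvent_right resolvent_left by (simp_all add: algebra_simps)

lemma qf_resolvent: "qf (resolvent T) x = (norm (resolvent T \<cdot> x))\<^sup>2 + qf T (resolvent T \<cdot> x)"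
  by (subst (1) resolvent_split) (simp add: inner_add_left power2_norm_eq_inner adj_inner[OF pos_adj[OF T]])

lemma qf_one_minus_resolvent:
  "qf (1 - resolvent T) x = qf T (resolvent T \<cdot> x) + (norm (T \<cdot> resolvent T \<cdot> x))\<^sup>2"
proof -
  have "qf (1 - resolvent T) x = inner x (T \<cdot> resolvent T \<cdot> x)" by (simp add: one_minus_resolvent(1))
  also have "\<dots> = inner (resolvent T \<cdot> x + T \<cdot> resolvent T \<cdot> x) (T \<cdot> resolvent T \<cdot> x)"
    using resolvent_split[of x] by simp
  finally show ?thesis by (simp add: inner_add_left power2_norm_eq_inner)
qed

lemma resolvent_pos: "pos (resolvent T)"
  unfolding pos_def using resolvent_adj qf_resolvent pos_qf[OF T] by simp

lemma one_minus_resolvent_pos: "pos (1 - resolvent T)"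
  unfolding pos_def using resolvent_adj qf_one_minus_resolvent pos_qf[OF T] by simp

lemma qf_resolvent_le: "qf (resolvent T) x \<le> (norm x)\<^sup>2"
  using pos_diffD[OF one_minus_resolvent_pos, of x] by (simp add: dot_square_norm)

lemma norm_resolvent: "norm (resolvent T) \<le> 1"
  by (rule pos_norm_le[OF resolvent_pos]) (use qf_resolvent_le in auto)

lemma norm_resolvent_app: "norm (resolvent T \<cdot> x) \<le> norm x"
  using norm_app[of "resolvent T" x] mult_right_mono[OF norm_resolvent norm_ge_zero[of x]] by linarith

lemma qf_T_resolvent_le: "qf T (resolvent T \<cdot> x) \<le> (norm x)\<^sup>2"
  using qf_resolvent[of x] qf_resolvent_le[of x] zero_le_power2[of "norm (resolvent T \<cdot> x)"] by linarith

lemma norm_one_minus_resolvent_app: "(norm ((1 - resolvent T) \<cdot> x))\<^sup>2 \<le> qf (1 - resolvent T) x"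
proof -
  have "qf (1 - resolvent T) x \<le> 1 * (norm x)\<^sup>2" for x
    using pos_qf[OF resolvent_pos, of x] by (simp only: qf_simps)
  from pos_norm_app_le[OF one_minus_resolvent_pos _ this, of x] show ?thesis by (simp only: mult_1)
qed

lemma qf_one_minus_resolvent_le: "qf (1 - resolvent T) x \<le> qf T x"
proof -
  define y where "y = resolvent T \<cdot> x"
  have x: "x = y + T \<cdot> y" unfolding y_def by (rule resolvent_split)
  have "qf T x = qf T y + 2 * (norm (T \<cdot> y))\<^sup>2 + qf T (T \<cdot> y)"
    unfolding x using adj_inner[OF pos_adj[OF T], of y "T \<cdot> y"] adj_inner[OF pos_adj[OF T], of "T \<cdot> y" "y"]
    by (simp add: inner_add_left inner_add_right power2_norm_eq_inner)
  then show ?thesis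
    using qf_one_minus_resolvent[of x] pos_qf[OF T, of "T \<cdot> y"] by (simp add: y_def)
qed

text \<open>The scalar inequality \<open>t <= (1 + c) t / (1 + t)\<close> on \<open>[0, c]\<close>.
  It holds without spectral theory because \<open>x = y + T y\<close> for
  \<open>y = resolvent T x\<close> expands both sides into forms in \<open>y\<close>; it serves to
  undo the cut-off for bounded \<open>T\<close>.\<close>

lemma qf_le_one_minus_resolvent:
  assumes c: "0 \<le> c" "\<And>x. qf T x \<le> c * (norm x)\<^sup>2"
  shows "qf T x \<le> (1 + c) * qf (1 - resolvent T) x"
proof -
  define y where "y = resolvent T \<cdot> x"
  have x: "x = y + T \<cdot> y" unfolding y_def by (rule resolvent_split)
  have "qf T x = qf T y + 2 * (norm (T \<cdot> y))\<^sup>2 + qf T (T \<cdot> y)"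
    unfolding x using adj_inner[OF pos_adj[OF T], of y "T \<cdot> y"] adj_inner[OF pos_adj[OF T], of "T \<cdot> y" "y"]
    by (simp add: inner_add_left inner_add_right power2_norm_eq_inner)
  also have "\<dots> \<le> qf T y + (norm (T \<cdot> y))\<^sup>2 + c * qf T y + c * (norm (T \<cdot> y))\<^sup>2"
    using c(2)[of "T \<cdot> y"] pos_norm_app_le[OF T c, of y] by linarith
  also have "\<dots> = (1 + c) * (qf T y + (norm (T \<cdot> y))\<^sup>2)" by (simp add: algebra_simps)
  finally show ?thesis unfolding qf_one_minus_resolvent y_def .
qed

end

text \<open>The whole argument is \<open>0 <= <g - h, (1 + S)(g - h)>\<close>, expanded with
  \<open>(1 + S) h = x = (1 + T) g\<close> and \<open>1 + S <= 1 + T\<close> at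
  \<open>g\<close>.\<close>

lemma resolvent_antimono:
  assumes S: "pos S" and T: "pos T" and le: "\<And>x. qf S x \<le> qf T x"
  shows "qf (resolvent T) x \<le> qf (resolvent S) x"
proof -
  define g h where "g = resolvent T \<cdot> x" and "h = resolvent S \<cdot> x"
  have xg: "x = g + T \<cdot> g" unfolding g_def by (rule resolvent_split[OF T])
  have xh: "x = h + S \<cdot> h" unfolding h_def by (rule resolvent_split[OF S])
  have "0 \<le> qf (1 + S) (g - h)" using pos_add[OF pos_one S] by (rule pos_qf)
  also have "\<dots> = qf (1 + S) g - 2 * inner g ((1 + S) \<cdot> h) + inner h ((1 + S) \<cdot> h)"
    using adj_inner[OF pos_adj[OF S], of h g]
    by (simp add: inner_diff_left inner_diff_right inner_add_left inner_add_right inner_commute)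
  also have "(1 + S) \<cdot> h = x" using xh by simp
  finally have "2 * inner g x - qf (1 + S) g \<le> inner h x" by simp
  moreover have "inner g x = qf (1 + T) g" using xg by simp
  moreover have "qf (1 + S) g \<le> qf (1 + T) g" using le[of g] by (simp only: qf_simps)
  ultimately have "inner g x \<le> inner h x" by linarith
  then show ?thesis by (simp add: g_def h_def inner_commute)
qed

text \<open>With \<open>G = (1 + Z^2/e^2)^-1\<close> one has \<open>1 - G = e^-2 Z^2 G\<close>, so
  \<open>(1 - G) Z (1 - G)\<close> is a positive multiple of a conjugate of \<open>Z^3\<close>. The
  remainder of \<open>Z\<close> is of order \<open>e\<close> because \<open>norm (Z G) <= e\<close>.
  Letting \<open>e\<close> tend to \<open>0\<close> gives positivity without a spectral
  theorem.\<close>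

lemma pos_of_cube:
  assumes Z: "adj Z = Z" and cube: "pos (Z * Z * Z)"
  shows "pos Z"
proof -
  have "0 \<le> qf Z x" for x
  proof -
    have "- 3 * e * (norm x)\<^sup>2 \<le> qf Z x" if e: "e > 0" for e
    proof -
      define T where "T = (1/e\<^sup>2) *\<^sub>R (Z * Z)"
      have T: "pos T" unfolding T_def by (intro pos_scale pos_square Z) simp
      define G where "G = resolvent T"
      have ZG: "Z * G = G * Z" unfolding G_def by (rule resolvent_commute[OF T]) (simp add: T_def mult.assoc)
      have ZGW: "Z * (G * W) = G * (Z * W)" for W by (simp only: mult.assoc[symmetric] ZG)
      have Gsa: "adj G = G" unfolding G_def by (rule resolvent_adj[OF T])
      have ZGn: "norm (Z \<cdot> G \<cdot> v) \<le> e * norm v" for v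
      proof -
        have "(1/e\<^sup>2) * (norm (Z \<cdot> G \<cdot> v))\<^sup>2 = qf T (G \<cdot> v)"
          by (simp add: T_def qf_square[OF Z, unfolded app_simps])
        also have "\<dots> \<le> (norm v)\<^sup>2" unfolding G_def by (rule qf_T_resolvent_le[OF T])
        finally have "(norm (Z \<cdot> G \<cdot> v))\<^sup>2 \<le> (e * norm v)\<^sup>2"
          using e by (simp add: field_simps power_mult_distrib)
        then show ?thesis by (rule power2_le_imp_le) (use e in simp)
      qed
      have 1: "1 - G = (1/e\<^sup>2) *\<^sub>R (Z * Z * G)"
        unfolding G_def one_minus_resolvent(1)[OF T] by (simp add: T_def)
      have "(1 - G) * Z * (1 - G) = (1/e^4) *\<^sub>R (adj (Z * G) * (Z * Z * Z) * (Z * G))"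
      proof -
        have "(1 - G) * Z * (1 - G) = (1/e\<^sup>2 * (1/e\<^sup>2)) *\<^sub>R (Z * (Z * (G * (Z * (Z * (Z * G))))))"
          unfolding 1 by (simp add: mult.assoc)
        also have "Z * (Z * (G * (Z * (Z * (Z * G))))) = G * (Z * (Z * (Z * (Z * (Z * G)))))"
          by (simp only: ZGW)
        finally show ?thesis by (simp add: Z Gsa mult.assoc power4_eq_xxxx power2_eq_square)
      qed
      then have "pos ((1 - G) * Z * (1 - G))" using e by (simp add: pos_scale pos_conj[OF cube] del: adj_simps)
      moreover have "Z = (1 - G) * Z * (1 - G) + (Z * G + Z * G - G * (Z * G))"
        using ZG by (simp add: algebra_simps)
      then have "qf Z x = qf ((1 - G) * Z * (1 - G)) x + (2 * inner x (Z \<cdot> G \<cdot> x) - inner (G \<cdot> x) (Z \<cdot> G \<cdot> x))"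
      proof -
        have "qf (Z * G + Z * G - G * (Z * G)) x = 2 * inner x (Z \<cdot> G \<cdot> x) - inner (G \<cdot> x) (Z \<cdot> G \<cdot> x)"
          by (simp add: inner_add_right inner_diff_right adj_inner[OF Gsa])
        then show ?thesis using \<open>Z = _\<close> by (metis qf_simps(3))
      qed
      moreover have "\<bar>inner x (Z \<cdot> G \<cdot> x)\<bar> \<le> norm x * (e * norm x)"
        by (rule order_trans[OF Cauchy_Schwarz_ineq2]) (intro mult_left_mono ZGn norm_ge_zero)
      moreover have "\<bar>inner (G \<cdot> x) (Z \<cdot> G \<cdot> x)\<bar> \<le> norm x * (e * norm x)"
        by (rule order_trans[OF Cauchy_Schwarz_ineq2])
          (intro mult_mono ZGn norm_ge_zero, simp_all add: G_def norm_resolvent_app[OF T])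
      ultimately have "qf Z x \<ge> - (3 * (norm x * (e * norm x)))"
        using pos_qf[of "(1 - G) * Z * (1 - G)" x] by linarith
      then show ?thesis by (simp add: power2_eq_square mult_ac)
    qed
    then have *: "- 3 * (norm x)\<^sup>2 * e \<le> qf Z x" if "e > 0" for e using that by (simp add: mult_ac)
    show ?thesis
    proof (rule tendsto_upperbound[where F = "at_right 0" and f = "\<lambda>e. - 3 * (norm x)\<^sup>2 * e"])
      show "((\<lambda>e. - 3 * (norm x)\<^sup>2 * e) \<longlongrightarrow> 0) (at_right 0)" by (rule tendsto_eq_intros refl | simp)+
      show "\<forall>\<^sub>F e in at_right 0. - 3 * (norm x)\<^sup>2 * e \<le> qf Z x"
        unfolding eventually_at_right_field by (intro exI[of _ 1]) (use * in auto)
    qed simp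
  qed
  with Z show ?thesis by (simp add: pos_def)
qed

lemma ex_pos_neg_parts:
  assumes s: "adj s = s"
  shows "\<exists>p n. pos p \<and> pos n \<and> s = p - n \<and> p * n = 0 \<and> n * p = 0 \<and>
    (\<forall>z. z * s = s * z \<longrightarrow> z * p = p * z \<and> z * n = n * z)"
proof -
  obtain a where a: "pos a" "a * a = s * s" "\<And>z. z * (s * s) = s * s * z \<Longrightarrow> z * a = a * z"
    using ex_sqrt[OF pos_square[OF s]] by blast
  have sa: "s * a = a * s" by (rule a(3)) (simp add: mult.assoc)
  define p n where "p = (1/2) *\<^sub>R (a + s)" and "n = (1/2) *\<^sub>R (a - s)"
  have pn: "p * n = 0" "n * p = 0" using sa a(2) by (simp_all add: p_def n_def algebra_simps)
  have a_pn: "a = p + n" "s = p - n"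
    by (simp_all add: p_def n_def algebra_simps flip: scaleR_left.add)
  have psa: "adj p = p" and nsa: "adj n = n" by (simp_all add: p_def n_def s pos_adj[OF a(1)])
  \<comment> \<open>As \<open>a = p + n\<close> and \<open>p n = 0\<close>, the visibly positive
    \<open>p a p\<close> is the cube of \<open>p\<close>; \<open>pos_of_cube\<close> then
    applies.\<close>
  have "p * a * p = p * p * p" "n * a * n = n * n * n"
    using pn by (simp_all add: a_pn(1) distrib_left distrib_right mult.assoc)
  then have "pos p" "pos n"
    using pos_conj_sa[OF a(1) psa] pos_conj_sa[OF a(1) nsa] pos_of_cube psa nsa by metis+
  moreover have "z * p = p * z \<and> z * n = n * z" if z: "z * s = s * z" for z
  proof -
    have "z * (s * s) = s * s * z" using z by (metis mult.assoc)
    then have "z * a = a * z" by (rule a(3))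
    then show ?thesis using z by (simp add: p_def n_def algebra_simps)
  qed
  ultimately show ?thesis using pn a_pn(2) by blast
qed

section \<open>Von Neumann algebras\<close>

definition vna :: "'a::hilbert_space endo set \<Rightarrow> bool" where
  "vna X \<longleftrightarrow> (\<forall>T\<in>X. adj T \<in> X) \<and> comm (comm X) = X"

context
  fixes X :: "'a::hilbert_space endo set"
  assumes X: "vna X"
begin

lemma vna_adj: "T \<in> X \<Longrightarrow> adj T \<in> X"
  using X by (simp add: vna_def)

lemma vna_bicomm: "comm (comm X) = X"
  using X by (simp add: vna_def)

lemma vna_memI: "(\<And>S. S \<in> comm X \<Longrightarrow> T * S = S * T) \<Longrightarrow> T \<in> X"
  using vna_bicomm commI[of "comm X" T] by auto

text \<open>Stands in for functional calculus inside \<open>X\<close>: roots, resolvents and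
  positive parts come with the clause that they commute with whatever commutes with
  \<open>T\<close>, and the bicommutant property does the rest.\<close>

lemma vna_gen: "T \<in> X \<Longrightarrow> (\<And>z. z * T = T * z \<Longrightarrow> z * S = S * z) \<Longrightarrow> S \<in> X"
  by (rule vna_memI) (metis commD)

lemma vna_ops:
  "0 \<in> X" "1 \<in> X" "S \<in> X \<Longrightarrow> T \<in> X \<Longrightarrow> S + T \<in> X" "S \<in> X \<Longrightarrow> T \<in> X \<Longrightarrow> S - T \<in> X"
  "S \<in> X \<Longrightarrow> - S \<in> X" "S \<in> X \<Longrightarrow> r *\<^sub>R S \<in> X" "S \<in> X \<Longrightarrow> T \<in> X \<Longrightarrow> S * T \<in> X"
  using comm_zero[of "comm X"] comm_one[of "comm X"] comm_add[of S "comm X" T] comm_diff[of S "comm X" T]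
    comm_uminus[of S "comm X"] comm_scaleR[of S "comm X" r] comm_mult[of S "comm X" T]
  unfolding vna_bicomm by auto

lemma vna_sum: "(\<And>i. i \<in> I \<Longrightarrow> f i \<in> X) \<Longrightarrow> (\<Sum>i\<in>I. f i) \<in> X"
  by (induction I rule: infinite_finite_induct) (auto intro: vna_ops)

lemma vna_resolvent: "T \<in> X \<Longrightarrow> pos T \<Longrightarrow> resolvent T \<in> X"
  by (rule vna_gen[of T]) (auto intro: resolvent_commute)

lemma vna_comm: "vna (comm X)"
  using vna_bicomm comm_adj vna_adj by (auto simp: vna_def)

end

definition unis :: "'a::hilbert_space endo set \<Rightarrow> 'a endo set" where
  "unis X = {u \<in> X. adj u * u = 1 \<and> u * adj u = 1}"

lemma unis_adj: "vna X \<Longrightarrow> u \<in> unis X \<Longrightarrow> adj u \<in> unis X"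
  and unis_mult: "vna X \<Longrightarrow> u \<in> unis X \<Longrightarrow> v \<in> unis X \<Longrightarrow> u * v \<in> unis X"
  and unis_one: "vna X \<Longrightarrow> 1 \<in> unis X"
proof -
  show "vna X \<Longrightarrow> u \<in> unis X \<Longrightarrow> adj u \<in> unis X" "vna X \<Longrightarrow> 1 \<in> unis X"
    by (auto simp: unis_def vna_adj vna_ops)
  assume a: "vna X" "u \<in> unis X" "v \<in> unis X"
  then have "adj v * (adj u * u) * v = 1" "u * (v * adj v) * adj u = 1"
    by (simp_all add: unis_def)
  then have "adj (u * v) * (u * v) = 1" "u * v * adj (u * v) = 1" by (simp_all add: mult.assoc)
  with a show "u * v \<in> unis X"
    unfolding unis_def using vna_ops(7) by blast
qed

lemma unisD: "u \<in> unis X \<Longrightarrow> u \<in> X" "u \<in> unis X \<Longrightarrow> adj u * u = 1" "u \<in> unis X \<Longrightarrow> u * adj u = 1"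
  by (auto simp: unis_def)

lemma unis_norm_app: "u \<in> unis X \<Longrightarrow> norm (u \<cdot> x) = norm x"
  using qf_adj_mult[of x u] by (simp add: unisD dot_square_norm)

lemma unis_adj_norm_app: "u \<in> unis X \<Longrightarrow> norm (adj u \<cdot> x) = norm x"
  using qf_adj_mult[of x "adj u"] by (simp add: unisD dot_square_norm)

lemma unis_norm: "u \<in> unis X \<Longrightarrow> norm u \<le> 1"
  by (rule norm_endo_le) (auto simp: unis_norm_app)

lemma unis_cancel:
  assumes "u \<in> unis X" shows "adj u \<cdot> u \<cdot> x = x" "u \<cdot> adj u \<cdot> x = x"
  using arg_cong[OF unisD(2)[OF assms], of "\<lambda>T. T \<cdot> x"] arg_cong[OF unisD(3)[OF assms], of "\<lambda>T. T \<cdot> x"]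
  by simp_all

text \<open>The complex structure is kept as one more operator: a central, skew-adjoint
  \<open>I\<close> with square \<open>-1\<close>. \<open>I_comm\<close> expresses that the elements
  of \<open>X\<close> are complex-linear.\<close>

locale complex_unit =
  fixes X :: "'a::hilbert_space endo set" and I :: "'a endo"
  assumes vna: "vna X" and I_mem: "I \<in> X" and I_adj: "adj I = - I" and I_sq: "I * I = - 1"
    and I_comm: "T \<in> X \<Longrightarrow> T * I = I * T"
begin

text \<open>The unitary is \<open>sqrt (1 - H^2) + I H\<close>. Its skew part returns
  \<open>H\<close>, so that commuting with unitaries can be turned into commuting with
  \<open>H\<close>. Writing the root as \<open>1 - Y\<close>, with \<open>Y\<close> supported and
  commuting like \<open>H^2\<close>, gives the remaining clauses; the support clauses are used for
  unitaries that move only a corner.\<close>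

lemma ex_unitary:
  assumes H: "H \<in> X" "adj H = H" "norm H \<le> 1"
  shows "\<exists>u\<in>unis X. u - adj u = 2 *\<^sub>R (I * H) \<and>
    (\<forall>s. s * I = I * s \<longrightarrow> s * H = H \<longrightarrow> s * (u - 1) = u - 1) \<and>
    (\<forall>s. H * s = H \<longrightarrow> (u - 1) * s = u - 1) \<and>
    (\<forall>y. y * H = H * y \<longrightarrow> y * I = I * y \<longrightarrow> y * u = u * y)"
proof -
  have "norm (H * H) \<le> 1 * 1" by (rule order_trans[OF norm_mult_ineq]) (intro mult_mono H(3), simp_all)
  then obtain Y where Y: "(1 - Y) * (1 - Y) = 1 - H * H" "adj Y = Y"
      "\<And>z. z * (H * H) = H * H * z \<Longrightarrow> z * Y = Y * z"
      "\<And>s. s * (H * H) = H * H \<Longrightarrow> s * Y = Y" "\<And>s. H * H * s = H * H \<Longrightarrow> Y * s = Y"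
    using ex_sqrt_one_minus_endo[of "H * H"] H(2) by auto
  have IH: "H * I = I * H" by (rule I_comm[OF H(1)])
  have IHW: "H * (I * W) = I * (H * W)" for W by (simp only: mult.assoc[symmetric] IH)
  have IIW: "I * (I * W) = - W" for W by (simp only: mult.assoc[symmetric] I_sq) simp
  have HY: "H * Y = Y * H" by (rule Y(3)) (simp add: mult.assoc)
  have IY: "I * Y = Y * I" by (rule Y(3)) (simp add: mult.assoc IH IHW)
  define u where "u = (1 - Y) + I * H"
  have "Y \<in> X" by (rule vna_gen[OF vna, of "H * H"]) (use Y(3) in \<open>auto simp: vna_ops[OF vna] H\<close>)
  then have "u \<in> X" unfolding u_def by (intro vna_ops[OF vna] I_mem H)
  have au: "adj u = (1 - Y) - I * H" by (simp add: u_def Y(2) I_adj H(2) IH)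
  define C where "C = 1 - Y"
  have CI: "C * (I * H) = I * H * C"
  proof -
    have "Y * (I * H) = I * (Y * H)" by (simp only: mult.assoc[symmetric] IY)
    then show ?thesis by (simp add: C_def algebra_simps HY)
  qed
  have IHIH: "I * H * (I * H) = - (H * H)" by (simp add: mult.assoc IHW IIW)
  have u: "u = C + I * H" by (simp only: C_def u_def)
  have au': "adj u = C - I * H" by (simp only: au C_def)
  have "(C + I * H) * (C - I * H) = C * C - I * H * (I * H)" "(C - I * H) * (C + I * H) = C * C - I * H * (I * H)"
    using CI by (simp_all add: distrib_left distrib_right left_diff_distrib right_diff_distrib)
  moreover have "C * C - I * H * (I * H) = 1" unfolding IHIH using Y(1) by (simp add: C_def)
  ultimately have "u * adj u = 1" "adj u * u = 1" unfolding au' unfolding u by simp_all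
  then have "u \<in> unis X" using \<open>u \<in> X\<close> by (simp add: unis_def)
  moreover have "u - adj u = 2 *\<^sub>R (I * H)" unfolding au by (simp add: u_def scaleR_2)
  moreover have "s * (u - 1) = u - 1" if s: "s * I = I * s" "s * H = H" for s
  proof -
    have "s * (H * H) = H * H" by (simp only: mult.assoc[symmetric] s)
    then have "s * Y = Y" by (rule Y(4))
    moreover have "s * (I * H) = I * H" by (simp only: mult.assoc[symmetric] s) (simp only: mult.assoc s)
    ultimately show ?thesis by (simp add: u_def algebra_simps)
  qed
  moreover have "(u - 1) * s = u - 1" if s: "H * s = H" for s
  proof -
    have "H * H * s = H * H" by (simp only: mult.assoc s)
    then have "Y * s = Y" by (rule Y(5))
    moreover have "I * H * s = I * H" by (simp only: mult.assoc s)
    ultimately show ?thesis by (simp add: u_def algebra_simps)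
  qed
  moreover have "y * u = u * y" if y: "y * H = H * y" "y * I = I * y" for y
  proof -
    have "y * (H * H) = H * H * y" by (simp only: mult.assoc[symmetric] y) (simp only: mult.assoc y)
    then have "y * Y = Y * y" by (rule Y(3))
    moreover have "y * (I * H) = I * H * y" by (simp only: mult.assoc[symmetric] y) (simp only: mult.assoc y)
    ultimately show ?thesis by (simp add: u_def algebra_simps)
  qed
  ultimately show ?thesis by blast
qed

lemma I_uni: "I \<in> unis X"
  by (simp add: unis_def I_mem I_adj I_sq)

lemma ex_two_unitaries:
  assumes H: "H \<in> X" "adj H = H" "norm H \<le> 1"
  shows "\<exists>u\<in>unis X. \<exists>v\<in>unis X. 2 *\<^sub>R H = u + v"
proof -
  obtain u where u: "u \<in> unis X" "u - adj u = 2 *\<^sub>R (I * H)" using ex_unitary[OF H] by blast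
  \<comment> \<open>\<open>ex_unitary\<close> prescribes the imaginary part of \<open>u\<close>;
    rotating by \<open>I\<close> makes it a real part.\<close>
  have "adj I * u + I * adj u = - (I * (u - adj u))" by (simp add: I_adj algebra_simps)
  also have "\<dots> = 2 *\<^sub>R H" unfolding u(2) by (simp add: mult.assoc[symmetric] I_sq)
  finally have "2 *\<^sub>R H = adj I * u + I * adj u" by simp
  moreover have "adj I * u \<in> unis X" "I * adj u \<in> unis X"
    by (intro unis_mult[OF vna] unis_adj[OF vna] I_uni u)+
  ultimately show ?thesis by blast
qed

lemma real_imaginary_parts:
  assumes D: "D \<in> X"
  shows "\<exists>H\<in>X. \<exists>J\<in>X. adj H = H \<and> adj J = J \<and> D = H + I * J \<and> norm H \<le> norm D \<and> norm J \<le> norm D"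
proof -
  have I1: "norm (I * T) \<le> norm T" for T :: "'a endo"
    using norm_mult_ineq[of I T] mult_right_mono[OF unis_norm[OF I_uni] norm_ge_zero[of T]] by linarith
  have DI: "D * I = I * D" "adj D * I = I * adj D" by (intro I_comm D vna_adj[OF vna])+
  define H J where "H = (1/2) *\<^sub>R (D + adj D)" and "J = (1/2) *\<^sub>R (I * (adj D - D))"
  have "norm (D + adj D) \<le> 2 * norm D" using norm_triangle_ineq[of D "adj D"] by simp
  then have "norm H \<le> norm D" by (simp add: H_def)
  moreover have "norm (I * (adj D - D)) \<le> 2 * norm D"
    using I1[of "adj D - D"] norm_triangle_ineq4[of "adj D" D] by simp
  then have "norm J \<le> norm D" by (simp add: J_def)
  moreover have "adj H = H" by (simp add: H_def add.commute)
  moreover have "adj J = J" by (simp add: J_def I_adj DI left_diff_distrib right_diff_distrib)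
  moreover have "D = H + I * J"
  proof -
    have "I * (I * W) = - W" for W by (simp only: mult.assoc[symmetric] I_sq) simp
    then have "H + I * J = (1/2) *\<^sub>R D + (1/2) *\<^sub>R D" by (simp add: H_def J_def algebra_simps)
    then show ?thesis by (simp flip: scaleR_left.add)
  qed
  moreover have "H \<in> X" "J \<in> X" unfolding H_def J_def by (intro vna_ops[OF vna] vna_adj[OF vna] D I_mem)+
  ultimately show ?thesis by blast
qed

lemma ex_four_unitaries:
  assumes D: "D \<in> X" "norm D \<le> 1"
  shows "\<exists>u1\<in>unis X. \<exists>u2\<in>unis X. \<exists>u3\<in>unis X. \<exists>u4\<in>unis X. 2 *\<^sub>R D = u1 + u2 + u3 + u4"
proof -
  obtain H J where HJ: "H \<in> X" "J \<in> X" "adj H = H" "adj J = J" "D = H + I * J" "norm H \<le> 1" "norm J \<le> 1"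
    using real_imaginary_parts[OF D(1)] D(2) by (meson order_trans)
  obtain u v where uv: "u \<in> unis X" "v \<in> unis X" "2 *\<^sub>R H = u + v" using ex_two_unitaries HJ by blast
  obtain u' v' where uv': "u' \<in> unis X" "v' \<in> unis X" "2 *\<^sub>R J = u' + v'" using ex_two_unitaries HJ by blast
  have "2 *\<^sub>R D = 2 *\<^sub>R H + I * (2 *\<^sub>R J)" by (simp add: HJ(5) scaleR_add_right)
  also have "\<dots> = u + v + I * u' + I * v'" unfolding uv uv' by (simp add: distrib_left)
  finally show ?thesis using uv uv' unis_mult[OF vna I_uni] by blast
qed

lemma commute_sa_of_unitaries:
  assumes "\<And>u. u \<in> unis X \<Longrightarrow> y * u = u * y" and H: "H \<in> X" "adj H = H"
  shows "y * H = H * y"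
proof -
  define r where "r = 1 / (norm H + 1)"
  have r: "r > 0" by (simp add: r_def add_nonneg_pos)
  have "norm H + 1 > 0" by (simp add: add_nonneg_pos)
  then have "norm (r *\<^sub>R H) \<le> 1" by (simp add: r_def divide_le_eq)
  then obtain u v where uv: "u \<in> unis X" "v \<in> unis X" "2 *\<^sub>R (r *\<^sub>R H) = u + v"
    using ex_two_unitaries[of "r *\<^sub>R H"] H vna_ops(6)[OF vna] by auto
  have "y * (2 *\<^sub>R (r *\<^sub>R H)) = (2 *\<^sub>R (r *\<^sub>R H)) * y"
    unfolding uv(3) using assms(1) uv by (simp add: distrib_left distrib_right)
  then show ?thesis using r by simp
qed

lemma commute_of_unitaries:
  assumes "\<And>u. u \<in> unis X \<Longrightarrow> y * u = u * y"
  shows "y \<in> comm X"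
proof (rule commI)
  fix T assume "T \<in> X"
  then obtain H J where HJ: "H \<in> X" "J \<in> X" "adj H = H" "adj J = J" "T = H + I * J"
    using real_imaginary_parts by blast
  have y: "y * H = H * y" "y * J = J * y" using commute_sa_of_unitaries[OF assms] HJ by auto
  have yI: "y * I = I * y" using assms[OF I_uni] .
  have "y * (I * J) = I * J * y" by (simp only: mult.assoc[symmetric] yI) (simp only: mult.assoc y)
  then show "y * T = T * y" using y HJ(5) by (simp add: distrib_left distrib_right)
qed

lemma complex_unit_comm: "complex_unit (comm X) I"
proof
  show "vna (comm X)" by (rule vna_comm[OF vna])
  show "I \<in> comm X" by (rule commI) (simp add: I_comm)
  show "T * I = I * T" if "T \<in> comm X" for T using commD[OF that I_mem] .
qed (rule I_adj I_sq)+

end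

section \<open>Projections and limits of operators\<close>

lemma ex_projection:
  fixes S :: "'a::hilbert_space set"
  assumes "closed S" "subspace S"
  shows "\<exists>q. adj q = q \<and> q * q = q \<and> (\<forall>x. q \<cdot> x \<in> S) \<and> (\<forall>x\<in>S. q \<cdot> x = x)"
proof -
  obtain f where f: "\<And>x. f x \<in> S" "\<And>x y. y \<in> S \<Longrightarrow> inner (x - f x) y = 0"
    using ex_orthogonal_projection[OF assms] by metis
  have f_eq: "f x = p" if "p \<in> S" "\<And>y. y \<in> S \<Longrightarrow> inner (x - p) y = 0" for x p
  proof -
    have mem: "f x - p \<in> S" using f(1) that(1) assms(2) by (simp add: subspace_diff)
    then have "inner (f x - p) (f x - p) = inner (x - p) (f x - p) - inner (x - f x) (f x - p)"
      by (simp add: inner_diff_left)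
    then show ?thesis using mem that(2) f(2) by simp
  qed
  have "bounded_linear f"
  proof (rule bounded_linear_intro[where K = 1])
    show "f (x + y) = f x + f y" for x y
      by (rule f_eq) (use f assms(2) in \<open>simp_all add: subspace_add inner_add_left add_diff_add\<close>)
    show "f (r *\<^sub>R x) = r *\<^sub>R f x" for r x
      by (rule f_eq) (use f assms(2) in \<open>simp_all add: subspace_scale flip: scaleR_diff_right\<close>)
    show "norm (f x) \<le> norm x * 1" for x
    proof -
      have "inner (x - f x) (f x) = 0" using f by simp
      then have "norm (f x) * norm (f x) = inner x (f x)"
        by (simp add: inner_diff_left dot_square_norm power2_eq_square)
      also have "\<dots> \<le> norm x * norm (f x)" by (rule norm_cauchy_schwarz)
      finally show ?thesis by (cases "f x = 0") auto
    qed
  qed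
  then obtain q where q: "\<And>x. q \<cdot> x = f x" using ex_endo by blast
  have fS: "f x = x" if "x \<in> S" for x by (rule f_eq) (use that in auto)
  have "adj q = q"
  proof (rule adj_eqI)
    fix x y
    have "inner x (f y) = inner (f x) (f y)" using f(2)[of "f y" x] f(1) by (simp add: inner_diff_left)
    also have "\<dots> = inner (f x) y"
      using f(2)[of "f x" y] f(1) by (simp add: inner_diff_left inner_commute[of "f x"])
    finally show "inner x (q \<cdot> y) = inner (q \<cdot> x) y" by (simp add: q)
  qed
  moreover have "q * q = q" by (rule endo_eqI) (simp add: q fS f(1))
  ultimately show ?thesis using f(1) fS by (intro exI[of _ q]) (simp add: q)
qed

lemma projection_commute:
  assumes q: "adj q = q" "\<And>x. q \<cdot> x \<in> S" "\<And>x. x \<in> S \<Longrightarrow> q \<cdot> x = x"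
    and T: "\<And>x. x \<in> S \<Longrightarrow> T \<cdot> x \<in> S" "\<And>x. x \<in> S \<Longrightarrow> adj T \<cdot> x \<in> S"
  shows "q * T = T * q"
proof -
  have 1: "q * (R * q) = R * q" if "\<And>x. x \<in> S \<Longrightarrow> R \<cdot> x \<in> S" for R
    by (rule endo_eqI) (simp add: q that)
  have "q * T = adj (adj T * q)" by (simp add: q)
  also have "\<dots> = adj (q * (adj T * q))" by (simp only: 1[OF T(2)])
  also have "\<dots> = q * (T * q)" by (simp add: q mult.assoc)
  also have "\<dots> = T * q" by (rule 1[OF T(1)])
  finally show ?thesis .
qed

text \<open>The space usually written \<open>[X'V]\<close>. It is invariant under the commutant, so
  its projection lies in \<open>X\<close>. Elements of \<open>X\<close> commute with
  \<open>X'\<close>, hence their convergence on the vectors of \<open>V\<close> spreads to all of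
  \<open>[X'V]\<close> when they are uniformly bounded.\<close>

definition cyc :: "'a::hilbert_space endo set \<Rightarrow> 'a set \<Rightarrow> 'a set" where
  "cyc X V = closure (span {m \<cdot> v | m v. m \<in> comm X \<and> v \<in> V})"

lemma closed_cyc: "closed (cyc X V)"
  by (simp add: cyc_def)

lemma subspace_closure:
  fixes S :: "'a::real_normed_vector set"
  assumes "subspace S" shows "subspace (closure S)"
  unfolding subspace_def
proof (intro conjI ballI allI)
  show "0 \<in> closure S" using closure_subset subspace_0[OF assms] by blast
next
  fix x y assume "x \<in> closure S" "y \<in> closure S"
  then obtain f g where fg: "\<And>n. f n \<in> S" "f \<longlonglongrightarrow> x" "\<And>n. g n \<in> S" "g \<longlonglongrightarrow> y"
    unfolding closure_sequential by blast
  have "(\<lambda>n. f n + g n) \<longlonglongrightarrow> x + y" by (intro tendsto_add fg)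
  moreover have "f n + g n \<in> S" for n by (intro subspace_add[OF assms] fg)
  ultimately show "x + y \<in> closure S" unfolding closure_sequential by (intro exI[of _ "\<lambda>n. f n + g n"]) simp
next
  fix r :: real and x assume "x \<in> closure S"
  then obtain f where f: "\<And>n. f n \<in> S" "f \<longlonglongrightarrow> x" unfolding closure_sequential by blast
  have "(\<lambda>n. r *\<^sub>R f n) \<longlonglongrightarrow> r *\<^sub>R x" by (intro tendsto_intros f)
  moreover have "r *\<^sub>R f n \<in> S" for n by (intro subspace_scale[OF assms] f)
  ultimately show "r *\<^sub>R x \<in> closure S" unfolding closure_sequential by (intro exI[of _ "\<lambda>n. r *\<^sub>R f n"]) simp
qed

lemma subspace_cyc: "subspace (cyc X V)"
  unfolding cyc_def by (intro subspace_closure subspace_span)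

lemma cyc_invariant:
  assumes "\<And>m v. m \<in> comm X \<Longrightarrow> v \<in> V \<Longrightarrow> T \<cdot> m \<cdot> v \<in> cyc X V" and "x \<in> cyc X V"
  shows "T \<cdot> x \<in> cyc X V"
proof -
  have "closed {x. T \<cdot> x \<in> cyc X V}"
    using continuous_closed_vimage[OF closed_cyc, of "\<lambda>x. T \<cdot> x"] linear_continuous_at[OF app.bounded_linear_right]
    by (auto simp: vimage_def)
  moreover have "span {m \<cdot> v | m v. m \<in> comm X \<and> v \<in> V} \<subseteq> {x. T \<cdot> x \<in> cyc X V}"
    by (rule span_minimal) (use assms(1) subspace_cyc in \<open>auto simp: subspace_def\<close>)
  ultimately have "cyc X V \<subseteq> {x. T \<cdot> x \<in> cyc X V}" unfolding cyc_def by (rule closure_minimal[rotated])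
  then show ?thesis using assms(2) by blast
qed

lemma cyc_base: "m \<in> comm X \<Longrightarrow> v \<in> V \<Longrightarrow> m \<cdot> v \<in> cyc X V"
  unfolding cyc_def by (rule subsetD[OF closure_subset], rule span_base) blast

lemma cyc_base': "v \<in> V \<Longrightarrow> v \<in> cyc X V"
  using cyc_base[OF comm_one, of v V X] by simp

lemma cyc_mono: "V \<subseteq> W \<Longrightarrow> cyc X V \<subseteq> cyc X W"
  unfolding cyc_def by (intro closure_mono span_mono) blast

lemma cyc_commutant: "m \<in> comm X \<Longrightarrow> x \<in> cyc X V \<Longrightarrow> m \<cdot> x \<in> cyc X V"
proof (erule cyc_invariant[rotated])
  fix m' v assume m: "m \<in> comm X" "m' \<in> comm X" and v: "v \<in> V"
  show "m \<cdot> m' \<cdot> v \<in> cyc X V" using cyc_base[OF comm_mult[OF m] v] by simp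
qed

lemma ex_cyc_projection:
  assumes X: "vna X"
  shows "\<exists>q\<in>X. adj q = q \<and> q * q = q \<and> (\<forall>x. q \<cdot> x \<in> cyc X V) \<and> (\<forall>x\<in>cyc X V. q \<cdot> x = x)"
proof -
  obtain q where q: "adj q = q" "q * q = q" "\<And>x. q \<cdot> x \<in> cyc X V" "\<And>x. x \<in> cyc X V \<Longrightarrow> q \<cdot> x = x"
    using ex_projection[OF closed_cyc subspace_cyc, of X V] by blast
  have "q \<in> X"
  proof (rule vna_memI[OF X])
    fix m assume m: "m \<in> comm X"
    show "q * m = m * q"
      by (rule projection_commute[OF q(1,3,4)])
        (auto intro: cyc_commutant m comm_adj[OF vna_adj[OF X]])
  qed
  then show ?thesis using q by blast
qed

text \<open>Bounded monotone convergence of the quadratic forms, carried to the bilinear forms by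
  polarization.\<close>

lemma ex_increasing_limit:
  fixes T :: "nat \<Rightarrow> 'a::hilbert_space endo"
  assumes T: "\<And>n. pos (T n)" "\<And>n x. qf (T n) x \<le> qf (T (Suc n)) x" "\<And>n x. qf (T n) x \<le> k * (norm x)\<^sup>2"
    and k: "0 \<le> k"
  shows "\<exists>F. pos F \<and> (\<forall>x y. (\<lambda>n. inner x (T n \<cdot> y)) \<longlonglongrightarrow> inner x (F \<cdot> y)) \<and> (\<forall>n x. qf (T n) x \<le> qf F x)"
proof -
  have inc: "incseq (\<lambda>n. qf (T n) x)" for x by (rule incseq_SucI) (rule T(2))
  have conv: "convergent (\<lambda>n. qf (T n) x)" for x
    using incseq_convergent[OF inc, of x "k * (norm x)\<^sup>2"] T(3) unfolding convergent_def by blast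
  have pol: "inner x (T n \<cdot> y) = (1/4) * (qf (T n) (x + y) - qf (T n) (x - y))" for n x y
    using adj_inner[OF pos_adj[OF T(1)], of n x y]
    by (simp add: inner_add_left inner_add_right inner_diff_left inner_diff_right inner_commute)
  have "convergent (\<lambda>n. (1/4) * (qf (T n) (x + y) - qf (T n) (x - y)))" for x y
    by (intro convergent_mult convergent_const convergent_diff conv)
  then have "convergent (\<lambda>n. inner x (T n \<cdot> y))" for x y by (simp only: pol[symmetric])
  then obtain B where B: "\<And>x y. (\<lambda>n. inner x (T n \<cdot> y)) \<longlonglongrightarrow> B x y" unfolding convergent_def by metis
  have "bounded_bilinear B"
  proof
    fix x x' y y' :: 'a and r :: real
    show "B (x + x') y = B x y + B x' y"
      by (rule LIMSEQ_unique[OF B]) (simp add: inner_add_left, intro tendsto_add B)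
    show "B x (y + y') = B x y + B x y'"
      by (rule LIMSEQ_unique[OF B]) (simp add: inner_add_right, intro tendsto_add B)
    show "B (r *\<^sub>R x) y = r *\<^sub>R B x y"
      by (rule LIMSEQ_unique[OF B]) (simp, intro tendsto_intros B)
    show "B x (r *\<^sub>R y) = r *\<^sub>R B x y"
      by (rule LIMSEQ_unique[OF B]) (simp, intro tendsto_intros B)
    have "norm (B x y) \<le> norm x * norm y * k" for x y
    proof (rule tendsto_upperbound[OF tendsto_norm[OF B]])
      have "norm (inner x (T n \<cdot> y)) \<le> norm x * norm y * k" for n
      proof -
        have "norm (inner x (T n \<cdot> y)) \<le> norm x * norm (T n \<cdot> y)" using Cauchy_Schwarz_ineq2 by simp
        also have "\<dots> \<le> norm x * (norm (T n) * norm y)" by (intro mult_left_mono norm_app) simp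
        also have "\<dots> \<le> norm x * (k * norm y)"
          by (intro mult_left_mono mult_right_mono pos_norm_le T k) simp_all
        finally show ?thesis by (simp add: mult_ac)
      qed
      then show "\<forall>\<^sub>F n in sequentially. norm (inner x (T n \<cdot> y)) \<le> norm x * norm y * k" by simp
    qed simp
    then show "\<exists>K. \<forall>x y. norm (B x y) \<le> norm x * norm y * K" by blast
  qed
  then obtain G where G: "\<And>x y. inner (G \<cdot> x) y = B x y" using ex_form_operator by blast
  define F where "F = adj G"
  have F: "(\<lambda>n. inner x (T n \<cdot> y)) \<longlonglongrightarrow> inner x (F \<cdot> y)" for x y
    using B[of x y] by (simp add: F_def inner_adj_right G)
  have le: "qf (T n) x \<le> qf F x" for n x by (rule incseq_le[OF inc F])
  have "adj F = F"
  proof (rule adj_eqI)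
    fix x y
    have "inner y (T n \<cdot> x) = inner x (T n \<cdot> y)" for n
      using adj_inner[OF pos_adj[OF T(1)], of n y x] by (simp add: inner_commute)
    then have "(\<lambda>n. inner x (T n \<cdot> y)) \<longlonglongrightarrow> inner y (F \<cdot> x)"
      using F[of y x] by simp
    with F[of x y] have "inner x (F \<cdot> y) = inner y (F \<cdot> x)" by (rule LIMSEQ_unique)
    then show "inner x (F \<cdot> y) = inner (F \<cdot> x) y" by (simp add: inner_commute)
  qed
  moreover have "0 \<le> qf F x" for x by (rule order_trans[OF pos_qf[OF T(1)] le])
  ultimately have "pos F" by (simp add: pos_def)
  then show ?thesis using F le by blast
qed

lemma limit_mem_vna:
  assumes X: "vna X" and T: "\<And>n. T n \<in> X" and F: "\<And>x y. (\<lambda>n. inner x (T n \<cdot> y)) \<longlonglongrightarrow> inner x (F \<cdot> y)"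
  shows "F \<in> X"
proof (rule vna_memI[OF X], rule endo_eq_innerI)
  fix m x y assume m: "m \<in> comm X"
  have "(\<lambda>n. inner (adj m \<cdot> x) (T n \<cdot> y)) \<longlonglongrightarrow> inner (adj m \<cdot> x) (F \<cdot> y)" by (rule F)
  moreover have "inner (adj m \<cdot> x) (T n \<cdot> y) = inner x (T n \<cdot> m \<cdot> y)" for n
    using commD[OF m T, of n] by (simp add: inner_adj_left flip: app_simps(6))
  ultimately have "(\<lambda>n. inner x (T n \<cdot> m \<cdot> y)) \<longlonglongrightarrow> inner (adj m \<cdot> x) (F \<cdot> y)" by simp
  with F[of x "m \<cdot> y"] have "inner x (F \<cdot> m \<cdot> y) = inner (adj m \<cdot> x) (F \<cdot> y)" by (rule LIMSEQ_unique)
  then show "inner x ((F * m) \<cdot> y) = inner x ((m * F) \<cdot> y)" by (simp add: inner_adj_left)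
qed

section \<open>The weak operator topology\<close>

text \<open>Pulling back a product of real lines along the matrix coefficients reduces continuity to
  coordinates and compactness of balls to Tychonoff's theorem.\<close>

definition wot :: "'a::hilbert_space endo topology" where
  "wot = pullback_topology UNIV (\<lambda>T (x, y). inner x (T \<cdot> y)) euclidean"

lemma topspace_wot [simp]: "topspace wot = UNIV"
  by (simp add: wot_def topspace_pullback_topology)

lemma continuous_map_wot: "continuous_map wot euclideanreal (\<lambda>T. inner x (T \<cdot> y))"
proof -
  have "continuous_map euclidean euclideanreal (\<lambda>f :: 'a \<times> 'a \<Rightarrow> real. f (x, y))" by simp
  from continuous_map_pullback[OF this, of UNIV "\<lambda>T (x, y). inner x (T \<cdot> y)"]
  show ?thesis by (simp add: wot_def comp_def)
qed

lemma continuous_map_into_wot: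
  assumes "\<And>x y. continuous_map Z euclideanreal (\<lambda>t. inner x (f t \<cdot> y))"
  shows "continuous_map Z wot f"
  unfolding wot_def
proof (rule continuous_map_pullback')
  show "continuous_map Z euclidean ((\<lambda>T (x, y). inner x (T \<cdot> y)) \<circ> f)"
    unfolding euclidean_product_topology[symmetric] continuous_map_componentwise_UNIV
    using assms by (auto simp: comp_def)
qed auto

lemma continuous_map_wot_conj: "continuous_map wot wot (\<lambda>T. S * T * R)"
proof (rule continuous_map_into_wot)
  show "continuous_map wot euclideanreal (\<lambda>T. inner x ((S * T * R) \<cdot> y))" for x y
    using continuous_map_wot[of "adj S \<cdot> x" "R \<cdot> y"] by (simp add: inner_adj_left)
qed

lemma continuous_map_wot_affine: "continuous_map wot wot (\<lambda>T. S + r *\<^sub>R T)"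
  by (rule continuous_map_into_wot) (auto simp: inner_add_right intro!: continuous_intros continuous_map_wot)

lemma closedin_le:
  assumes "continuous_map Z euclideanreal f" "continuous_map Z euclideanreal g"
  shows "closedin Z {x \<in> topspace Z. f x \<le> g x}"
  using closedin_continuous_map_preimage[OF continuous_map_diff[OF assms], of "{..0}"] by simp

lemma closedin_wot_le:
  assumes "continuous_map wot euclideanreal f" "continuous_map wot euclideanreal g"
  shows "closedin wot {x. f x \<le> g x}"
  using closedin_le[OF assms] by simp

lemma closedin_wot_eq:
  assumes "continuous_map wot euclideanreal f" "continuous_map wot euclideanreal g"
  shows "closedin wot {x. f x = g x}"
proof -
  have "{x. f x = g x} = {x. f x \<le> g x} \<inter> {x. g x \<le> f x}" by auto
  then show ?thesis using assms by (simp only:) (intro closedin_Int closedin_wot_le)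
qed

lemma closedin_wot_Collect_all:
  assumes "\<And>i. closedin wot {T. P i T}" shows "closedin wot {T. \<forall>i. P i T}"
proof -
  have "{T. \<forall>i. P i T} = (\<Inter>i. {T. P i T})" by auto
  then show ?thesis using assms by auto
qed

text \<open>The one-sided bound suffices since \<open>x\<close> may be replaced by
  \<open>T y\<close>. In this form a ball is an intersection of weakly closed half-spaces.\<close>

lemma norm_endo_le_iff:
  assumes "0 \<le> R"
  shows "norm T \<le> R \<longleftrightarrow> (\<forall>x y. inner x (T \<cdot> y) \<le> R * norm x * norm y)"
proof
  assume T: "norm T \<le> R"
  show "\<forall>x y. inner x (T \<cdot> y) \<le> R * norm x * norm y"
  proof (intro allI)
    fix x y
    have "inner x (T \<cdot> y) \<le> norm x * (norm T * norm y)"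
      by (rule order_trans[OF norm_cauchy_schwarz]) (intro mult_left_mono norm_app norm_ge_zero)
    also have "\<dots> \<le> norm x * (R * norm y)" by (intro mult_left_mono mult_right_mono T norm_ge_zero)
    finally show "inner x (T \<cdot> y) \<le> R * norm x * norm y" by (simp add: mult_ac)
  qed
next
  assume *: "\<forall>x y. inner x (T \<cdot> y) \<le> R * norm x * norm y"
  show "norm T \<le> R"
  proof (rule norm_endo_le[OF assms])
    fix x
    have "norm (T \<cdot> x) * norm (T \<cdot> x) \<le> norm (T \<cdot> x) * (R * norm x)"
      using *[rule_format, of "T \<cdot> x" x] by (simp add: dot_square_norm power2_eq_square mult_ac)
    then show "norm (T \<cdot> x) \<le> R * norm x"
      using assms by (cases "T \<cdot> x = 0") (auto simp: mult_le_cancel_left_pos)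
  qed
qed

lemma closedin_wot_ball:
  assumes "0 \<le> R" shows "closedin wot {T. norm T \<le> R}"
  unfolding norm_endo_le_iff[OF assms]
  by (intro closedin_wot_Collect_all closedin_wot_le continuous_map_wot) simp

lemma closedin_wot_commutator_ball:
  assumes "0 \<le> R" shows "closedin wot {T. norm (T * S - S * T) \<le> R}"
proof -
  have "inner x ((T * S - S * T) \<cdot> y) = inner x (T \<cdot> S \<cdot> y) - inner (adj S \<cdot> x) (T \<cdot> y)" for T x y
    by (simp add: inner_diff_right inner_adj_left)
  then show ?thesis
    unfolding norm_endo_le_iff[OF assms]
    by (simp only:) (intro closedin_wot_Collect_all closedin_wot_le continuous_map_diff continuous_map_wot, simp)
qed

lemma closedin_wot_comm: "closedin wot (comm X)"
proof -
  have "closedin wot {T. S \<in> X \<longrightarrow> norm (T * S - S * T) \<le> 0}" for S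
    using closedin_wot_commutator_ball[of 0 S] closedin_topspace[of wot] by (cases "S \<in> X") simp_all
  then have "closedin wot {T. \<forall>S. S \<in> X \<longrightarrow> norm (T * S - S * T) \<le> 0}"
    by (rule closedin_wot_Collect_all)
  then show ?thesis by (simp add: comm_def Ball_def)
qed

lemma closedin_wot_vna: "vna X \<Longrightarrow> closedin wot X"
  using closedin_wot_comm[of "comm X"] by (simp add: vna_bicomm)

lemma closedin_wot_sa: "closedin wot {T :: 'a::hilbert_space endo. adj T = T}"
proof -
  have "{T :: 'a endo. adj T = T} = {T. \<forall>x y. inner x (T \<cdot> y) = inner y (T \<cdot> x)}"
  proof -
    have "adj T = T \<longleftrightarrow> (\<forall>x y. inner x (T \<cdot> y) = inner y (T \<cdot> x))" for T :: "'a endo"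
    proof
      assume "adj T = T"
      then show "\<forall>x y. inner x (T \<cdot> y) = inner y (T \<cdot> x)"
        using adj_inner[of T] by (metis inner_commute)
    next
      assume "\<forall>x y. inner x (T \<cdot> y) = inner y (T \<cdot> x)"
      then show "adj T = T" by (intro adj_eqI) (simp add: inner_commute)
    qed
    then show ?thesis by simp
  qed
  then show ?thesis by (simp only:) (intro closedin_wot_Collect_all closedin_wot_eq continuous_map_wot)
qed

text \<open>Bilinear functions bounded by \<open>R * norm x * norm y\<close> form a closed subset
  \<open>C\<close> of a compact product of intervals, and \<open>ex_form_operator\<close> identifies
  \<open>C\<close> with the ball; \<open>g\<close> is the inverse of this identification, and it is
  continuous by the choice of topology.\<close>

lemma compactin_wot_ball:
  fixes R :: real
  assumes R: "0 \<le> R"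
  shows "compactin wot {T :: 'a::hilbert_space endo. norm T \<le> R}"
proof -
  define j :: "'a endo \<Rightarrow> 'a \<times> 'a \<Rightarrow> real" where "j = (\<lambda>T (x, y). inner x (T \<cdot> y))"
  define P where "P = PiE UNIV (\<lambda>(x::'a, y::'a). {- (R * norm x * norm y) .. R * norm x * norm y})"
  define C where "C = P \<inter> {f. (\<forall>x x' y. f (x + x', y) = f (x, y) + f (x', y)) \<and>
    (\<forall>x y y'. f (x, y + y') = f (x, y) + f (x, y')) \<and>
    (\<forall>r x y. f (r *\<^sub>R x, y) = r * f (x, y)) \<and> (\<forall>r x y. f (x, r *\<^sub>R y) = r * f (x, y))}"
  have "compactin (product_topology (\<lambda>_. euclidean) UNIV) P"
    unfolding P_def compactin_PiE by auto
  then have "compact P" by (simp add: euclidean_product_topology)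
  moreover have "closed {f :: 'a \<times> 'a \<Rightarrow> real. (\<forall>x x' y. f (x + x', y) = f (x, y) + f (x', y)) \<and>
    (\<forall>x y y'. f (x, y + y') = f (x, y) + f (x, y')) \<and>
    (\<forall>r x y. f (r *\<^sub>R x, y) = r * f (x, y)) \<and> (\<forall>r x y. f (x, r *\<^sub>R y) = r * f (x, y))}"
    by (intro closed_Collect_conj closed_Collect_all closed_Collect_eq continuous_intros
        continuous_on_product_coordinates)
  ultimately have "compact C" unfolding C_def by (rule compact_Int_closed)
  have bij: "\<exists>T. norm T \<le> R \<and> j T = f" if f: "f \<in> C" for f
  proof -
    have bd: "\<bar>f (x, y)\<bar> \<le> R * norm x * norm y" for x y
      using f by (auto simp: C_def P_def PiE_iff abs_le_iff minus_le_iff)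
    have "bounded_bilinear (\<lambda>y x. f (x, y))"
    proof
      have "norm (f (x, y)) \<le> norm y * norm x * R" for x y using bd[of x y] by (simp add: mult_ac)
      then show "\<exists>K. \<forall>y x. norm (f (x, y)) \<le> norm y * norm x * K" by blast
    qed (use f in \<open>auto simp: C_def\<close>)
    then obtain T where T: "\<And>x y. inner (T \<cdot> y) x = f (x, y)" using ex_form_operator by blast
    then have "j T = f" by (auto simp: j_def inner_commute)
    moreover have "norm T \<le> R"
      unfolding norm_endo_le_iff[OF R] using T bd by (metis abs_le_D1 inner_commute)
    ultimately show ?thesis by blast
  qed
  then obtain g where g: "\<And>f. f \<in> C \<Longrightarrow> norm (g f) \<le> R \<and> j (g f) = f" by metis
  have jC: "j T \<in> C" if "norm T \<le> R" for T
  proof -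
    have "\<bar>inner x (T \<cdot> y)\<bar> \<le> R * norm x * norm y" for x y
      using that norm_endo_le_iff[OF R, of T] by (metis abs_le_iff inner_minus_left norm_minus_cancel)
    then show ?thesis
      by (auto simp: C_def P_def PiE_iff j_def abs_le_iff inner_add_left inner_add_right minus_le_iff)
  qed
  have inj: "S = T" if "j S = j T" for S T
  proof (rule endo_eq_innerI)
    show "inner x (S \<cdot> y) = inner x (T \<cdot> y)" for x y
      using fun_cong[OF that, of "(x, y)"] by (simp add: j_def)
  qed
  have "continuous_map (subtopology euclidean C) wot g"
  proof (rule continuous_map_into_wot)
    fix x y
    have "continuous_map (subtopology euclidean C) euclideanreal (\<lambda>f. f (x, y))"
      by (rule continuous_map_from_subtopology) simp
    then show "continuous_map (subtopology euclidean C) euclideanreal (\<lambda>f. inner x (g f \<cdot> y))"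
    proof (rule continuous_map_eq)
      fix f assume "f \<in> topspace (subtopology euclidean C)"
      then have "j (g f) = f" using g by simp
      from fun_cong[OF this, of "(x, y)"] show "f (x, y) = inner x (g f \<cdot> y)" by (simp add: j_def)
    qed
  qed
  moreover have "compactin (subtopology euclidean C) C"
    using \<open>compact C\<close> by (simp add: compactin_subtopology)
  ultimately have "compactin wot (g ` C)" by (rule image_compactin[rotated])
  also have "g ` C = {T. norm T \<le> R}"
  proof (intro equalityI subsetI)
    fix T :: "'a endo" assume "T \<in> {T. norm T \<le> R}"
    then have "j T \<in> C" using jC by simp
    moreover have "g (j T) = T" using g[OF \<open>j T \<in> C\<close>] inj by blast
    ultimately show "T \<in> g ` C" by (metis imageI)
  qed (use g in auto)
  finally show ?thesis .
qed

lemma wot_compact_Inter: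
  assumes K: "closedin wot K" "\<And>T. T \<in> K \<Longrightarrow> norm T \<le> R"
    and C: "\<And>C. C \<in> \<C> \<Longrightarrow> closedin wot C"
    and fip: "\<And>\<F>. finite \<F> \<Longrightarrow> \<F> \<subseteq> \<C> \<Longrightarrow> K \<inter> \<Inter>\<F> \<noteq> {}"
  shows "K \<inter> \<Inter>\<C> \<noteq> {}"
proof -
  obtain T where "T \<in> K" using fip[of "{}"] by auto
  then have "0 \<le> R" using K(2)[of T] norm_ge_zero[of T] by linarith
  have "compactin wot K"
    by (rule closed_compactin[OF compactin_wot_ball[OF \<open>0 \<le> R\<close>] _ K(1)]) (use K(2) in auto)
  then show ?thesis unfolding compactin_fip using C fip by blast
qed

text \<open>\<open>S \<mapsto> x S + y T\<close> is continuous for fixed \<open>T\<close>, so the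
  closure is taken in one variable at a time.\<close>

lemma convex_wot_closure:
  assumes "convex C" shows "convex (wot closure_of C)"
proof -
  have sub: "C \<subseteq> wot closure_of C" by (rule closure_of_subset) simp
  have step: "x *\<^sub>R S + y *\<^sub>R T \<in> wot closure_of C"
    if S: "\<And>T. T \<in> C \<Longrightarrow> x *\<^sub>R S + y *\<^sub>R T \<in> wot closure_of C" and T: "T \<in> wot closure_of C" for x y S T
  proof -
    have "closedin wot {T \<in> topspace wot. x *\<^sub>R S + y *\<^sub>R T \<in> wot closure_of C}"
      by (rule closedin_continuous_map_preimage[OF continuous_map_wot_affine closedin_closure_of])
    then have "wot closure_of C \<subseteq> {T \<in> topspace wot. x *\<^sub>R S + y *\<^sub>R T \<in> wot closure_of C}"
      by (rule closure_of_minimal[rotated]) (use S in auto)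
    then show ?thesis using T by auto
  qed
  show ?thesis
  proof (rule convexI)
    fix S T :: "'a endo" and u v :: real
    assume ST: "S \<in> wot closure_of C" "T \<in> wot closure_of C" and uv: "0 \<le> u" "0 \<le> v" "u + v = 1"
    have "u *\<^sub>R S + v *\<^sub>R R \<in> wot closure_of C" if "R \<in> C" for R
    proof -
      have "v *\<^sub>R R + u *\<^sub>R S \<in> wot closure_of C"
      proof (rule step[OF _ ST(1)])
        fix Q assume "Q \<in> C"
        then have "v *\<^sub>R R + u *\<^sub>R Q \<in> C" using assms that uv by (simp add: convex_def)
        then show "v *\<^sub>R R + u *\<^sub>R Q \<in> wot closure_of C" using sub by blast
      qed
      then show ?thesis by (simp add: add.commute)
    qed
    then show "u *\<^sub>R S + v *\<^sub>R T \<in> wot closure_of C" using ST(2) by (rule step)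
  qed
qed

text \<open>
  A near-minimizer \<open>c\<close> of the distance separates \<open>w0\<close> from the convex set up to an error that
  depends only on its norm bound; so no duality theorem is needed.
\<close>

lemma sot_approximation:
  assumes C: "convex C" "\<And>w. w \<in> C \<Longrightarrow> norm w \<le> R"
    and w0: "w0 \<in> wot closure_of C" and V: "finite V" and \<delta>: "0 < \<delta>"
  shows "\<exists>w\<in>C. \<forall>v\<in>V. norm (w \<cdot> v - w0 \<cdot> v) < \<delta>"
proof -
  have ne: "C \<noteq> {}" using w0 by auto
  then have R: "0 \<le> R" using C(2) norm_ge_zero order_trans by (metis ex_in_conv)
  define D where "D w = (\<Sum>v\<in>V. (norm (w \<cdot> v - w0 \<cdot> v))\<^sup>2)" for w
  define d where "d = (INF w\<in>C. D w)"
  have D0: "0 \<le> D w" for w unfolding D_def by (intro sum_nonneg) simp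
  then have bdd: "bdd_below (D ` C)" by (intro bdd_belowI[of _ 0]) auto
  have d_le: "d \<le> D w" if "w \<in> C" for w unfolding d_def by (rule cINF_lower[OF bdd that])
  have near: "\<exists>w\<in>C. D w < d + e" if "e > 0" for e
  proof -
    have "(INF w\<in>C. D w) < d + e" using that by (simp add: d_def)
    then show ?thesis using cINF_less_iff[OF ne bdd] by blast
  qed
  have "d \<le> 0"
  proof (rule ccontr)
    assume "\<not> d \<le> 0" then have d: "d > 0" by simp
    define B where "B = 1 + (\<Sum>v\<in>V. (2 * R * norm v)\<^sup>2)"
    have B: "B \<ge> 1" by (simp add: B_def sum_nonneg)
    \<comment> \<open>So small that moving from \<open>c\<close> by \<open>t\<close> towards any
      \<open>w\<close> in \<open>C\<close> has a second-order term of at most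
      \<open>t * d / 2\<close>, uniformly in \<open>w\<close>. The accuracy \<open>t * d / 2\<close>
      of the near-minimizer \<open>c\<close> is matched to it.\<close>
    define t where "t = min 1 (d / (2 * B))"
    have t: "0 < t" "t \<le> 1" "t * B \<le> d / 2" using d B by (auto simp: t_def min_def field_simps)
    obtain c where c: "c \<in> C" "D c < d + t * d / 2" using near[of "t * d / 2"] t d by auto
    define L where "L w = (\<Sum>v\<in>V. inner (c \<cdot> v - w0 \<cdot> v) (w \<cdot> v - w0 \<cdot> v))" for w
    have L: "d / 2 \<le> L w" if w: "w \<in> C" for w
    proof -
      define P where "P = (\<Sum>v\<in>V. inner (c \<cdot> v - w0 \<cdot> v) (w \<cdot> v - c \<cdot> v))"
      define Q where "Q = (\<Sum>v\<in>V. (norm (w \<cdot> v - c \<cdot> v))\<^sup>2)"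
      have "(1 - t) *\<^sub>R c + t *\<^sub>R w \<in> C" using C(1) c(1) w t by (simp add: convex_def)
      then have "d \<le> D ((1 - t) *\<^sub>R c + t *\<^sub>R w)" by (rule d_le)
      also have "\<dots> = D c + 2 * t * P + t\<^sup>2 * Q"
      proof -
        have "(norm (((1 - t) *\<^sub>R c + t *\<^sub>R w) \<cdot> v - w0 \<cdot> v))\<^sup>2
          = (norm (c \<cdot> v - w0 \<cdot> v))\<^sup>2 + 2 * t * inner (c \<cdot> v - w0 \<cdot> v) (w \<cdot> v - c \<cdot> v)
            + t\<^sup>2 * (norm (w \<cdot> v - c \<cdot> v))\<^sup>2" for v
        proof -
          define a b where "a = c \<cdot> v - w0 \<cdot> v" and "b = w \<cdot> v - c \<cdot> v"
          have "((1 - t) *\<^sub>R c + t *\<^sub>R w) \<cdot> v - w0 \<cdot> v = a + t *\<^sub>R b"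
            by (simp add: a_def b_def algebra_simps)
          moreover have "(norm (a + t *\<^sub>R b))\<^sup>2 = (norm a)\<^sup>2 + 2 * t * inner a b + t\<^sup>2 * (norm b)\<^sup>2"
            by (simp only: power2_norm_eq_inner)
              (simp add: inner_add_left inner_add_right inner_commute[of b a] power2_eq_square algebra_simps)
          ultimately show ?thesis by (simp only: a_def b_def)
        qed
        then show ?thesis by (simp add: D_def P_def Q_def sum.distrib sum_distrib_left)
      qed
      also have "t\<^sup>2 * Q \<le> t * (d / 2)"
      proof -
        have "Q \<le> (\<Sum>v\<in>V. (2 * R * norm v)\<^sup>2)"
          unfolding Q_def
        proof (intro sum_mono power_mono)
          fix v
          have "norm (w \<cdot> v - c \<cdot> v) \<le> norm (w - c) * norm v" using norm_app[of "w - c" v] by simp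
          also have "\<dots> \<le> 2 * R * norm v"
            using norm_triangle_ineq4[of w c] C(2)[OF w] C(2)[OF c(1)] by (intro mult_right_mono) auto
          finally show "norm (w \<cdot> v - c \<cdot> v) \<le> 2 * R * norm v" .
        qed simp
        then have "t * Q \<le> t * B" using t by (simp add: B_def)
        then have "t * Q \<le> d / 2" using t(3) by linarith
        then have "t * (t * Q) \<le> t * (d / 2)" using t by (intro mult_left_mono) auto
        then show ?thesis by (simp add: power2_eq_square)
      qed
      finally have "0 \<le> t * (d + 2 * P)" using c(2) by (simp add: algebra_simps)
      then have "- (d / 2) \<le> P" using t by (simp add: zero_le_mult_iff)
      moreover have "L w = P + D c"
        by (simp add: L_def P_def D_def power2_norm_eq_inner flip: sum.distrib inner_add_right)
      ultimately show ?thesis using d_le[OF c(1)] by linarith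
    qed
    \<comment> \<open>A weakly closed half-space containing \<open>C\<close>, whereas
      \<open>L w0 = 0\<close>.\<close>
    have "closedin wot {w. d / 2 \<le> L w}"
      unfolding L_def inner_diff_right
      by (intro closedin_wot_le continuous_map_sum V continuous_map_diff continuous_map_wot) simp_all
    then have "wot closure_of C \<subseteq> {w. d / 2 \<le> L w}" by (rule closure_of_minimal[rotated]) (use L in auto)
    then have "d / 2 \<le> L w0" using w0 by blast
    then show False using d by (simp add: L_def)
  qed
  then obtain w where w: "w \<in> C" "D w < \<delta>\<^sup>2" using near[of "\<delta>\<^sup>2"] \<delta> by fastforce
  have "norm (w \<cdot> v - w0 \<cdot> v) < \<delta>" if "v \<in> V" for v
  proof (rule power2_less_imp_less)
    have "(norm (w \<cdot> v - w0 \<cdot> v))\<^sup>2 \<le> D w" unfolding D_def by (rule member_le_sum[OF that _ V]) simp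
    then show "(norm (w \<cdot> v - w0 \<cdot> v))\<^sup>2 < \<delta>\<^sup>2" using w(2) by linarith
  qed (use \<delta> in simp)
  then show ?thesis using w(1) by blast
qed

lemma closed_subspace_null:
  assumes D: "\<And>k. norm (D k) \<le> B"
  shows "closed {x. (\<lambda>k. D k \<cdot> x) \<longlonglongrightarrow> 0}" and "subspace {x. (\<lambda>k::nat. D k \<cdot> x) \<longlonglongrightarrow> 0}"
proof -
  have B: "0 \<le> B" using D[of 0] norm_ge_zero order_trans by blast
  show "subspace {x. (\<lambda>k. D k \<cdot> x) \<longlonglongrightarrow> 0}"
  proof -
    have "(\<lambda>k. r *\<^sub>R (D k \<cdot> x)) \<longlonglongrightarrow> 0" if "(\<lambda>k. D k \<cdot> x) \<longlonglongrightarrow> 0" for r x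
      using tendsto_scaleR[OF tendsto_const that, of r] by simp
    then show ?thesis by (auto simp: subspace_def intro: tendsto_add_zero)
  qed
  have "x \<in> {x. (\<lambda>k. D k \<cdot> x) \<longlonglongrightarrow> 0}" if s: "\<And>n. s n \<in> {x. (\<lambda>k. D k \<cdot> x) \<longlonglongrightarrow> 0}" "s \<longlonglongrightarrow> x" for s x
  proof -
    have "\<exists>N. \<forall>k\<ge>N. norm (D k \<cdot> x - 0) < e" if e: "e > 0" for e
    proof -
      have "e / (2 * (B + 1)) > 0" using e B by simp
      then obtain n where n: "norm (s n - x) < e / (2 * (B + 1))" using LIMSEQ_D[OF s(2)] by blast
      have "(\<lambda>k. D k \<cdot> s n) \<longlonglongrightarrow> 0" using s(1) by simp
      then obtain N where N: "\<And>k. k \<ge> N \<Longrightarrow> norm (D k \<cdot> s n) < e / 2"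
        using LIMSEQ_D[of "\<lambda>k. D k \<cdot> s n" 0 "e / 2"] e by auto
      have "norm (D k \<cdot> x) < e" if "k \<ge> N" for k
      proof -
        have "norm (D k \<cdot> (s n - x)) \<le> (B + 1) * norm (s n - x)"
          using D[of k] by (intro order_trans[OF norm_app] mult_right_mono) auto
        also have "\<dots> < (B + 1) * (e / (2 * (B + 1)))" using n B by (intro mult_strict_left_mono) auto
        also have "\<dots> = e / 2" using B by (simp add: field_simps)
        finally have "norm (D k \<cdot> s n - D k \<cdot> x) < e / 2" by simp
        moreover have "norm (D k \<cdot> x) \<le> norm (D k \<cdot> s n) + norm (D k \<cdot> s n - D k \<cdot> x)"
          using norm_triangle_ineq4[of "D k \<cdot> s n" "D k \<cdot> s n - D k \<cdot> x"] by simp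
        ultimately show ?thesis using N[OF that] by linarith
      qed
      then show ?thesis by auto
    qed
    then have "(\<lambda>k. D k \<cdot> x) \<longlonglongrightarrow> 0" by (intro LIMSEQ_I)
    then show ?thesis by simp
  qed
  then show "closed {x. (\<lambda>k. D k \<cdot> x) \<longlonglongrightarrow> 0}" unfolding closed_sequential_limits by blast
qed

section \<open>Normal weights are lower semicontinuous\<close>

text \<open>The scalar weights that arise when the operator valued weight is evaluated at one fixed
  vector functional.\<close>

locale normal_weight_on =
  fixes M :: "'a::hilbert_space endo set" and \<phi> :: "'a endo \<Rightarrow> ennreal"
  assumes vnM: "vna M"
    and add: "x \<in> M \<Longrightarrow> pos x \<Longrightarrow> y \<in> M \<Longrightarrow> pos y \<Longrightarrow> \<phi> (x + y) = \<phi> x + \<phi> y"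
    and scale: "0 \<le> r \<Longrightarrow> x \<in> M \<Longrightarrow> pos x \<Longrightarrow> \<phi> (r *\<^sub>R x) = ennreal r * \<phi> x"
    and normal: "D \<noteq> {} \<Longrightarrow> (\<And>y. y \<in> D \<Longrightarrow> y \<in> M \<and> pos y) \<Longrightarrow> x \<in> M \<Longrightarrow> pos x \<Longrightarrow>
      (\<And>y z. y \<in> D \<Longrightarrow> z \<in> D \<Longrightarrow> \<exists>w\<in>D. pos (w - y) \<and> pos (w - z)) \<Longrightarrow> (\<And>y. y \<in> D \<Longrightarrow> pos (x - y)) \<Longrightarrow>
      (\<And>z. z \<in> M \<Longrightarrow> pos z \<Longrightarrow> (\<And>y. y \<in> D \<Longrightarrow> pos (z - y)) \<Longrightarrow> pos (z - x)) \<Longrightarrow> \<phi> x = (SUP y\<in>D. \<phi> y)"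
begin

lemmas ops = vna_ops[OF vnM]

lemma mono:
  assumes "x \<in> M" "pos x" "y \<in> M" "pos y" "\<And>v. qf x v \<le> qf y v"
  shows "\<phi> x \<le> \<phi> y"
proof -
  have "pos (y - x)" using assms by (intro pos_diffI pos_adj)
  then have "\<phi> (x + (y - x)) = \<phi> x + \<phi> (y - x)" using assms by (intro add ops)
  then show ?thesis by simp
qed

lemma weight_zero: "\<phi> 0 = 0"
  using scale[of 0 0] by (simp add: ops pos_zero)

lemma weight_sum:
  "finite J \<Longrightarrow> (\<And>i. i \<in> J \<Longrightarrow> f i \<in> M \<and> pos (f i)) \<Longrightarrow> \<phi> (\<Sum>i\<in>J. f i) = (\<Sum>i\<in>J. \<phi> (f i))"
proof (induction J rule: finite_induct)
  case (insert i J)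
  have "sum f J \<in> M" "pos (sum f J)" using insert by (auto intro: vna_sum[OF vnM] pos_sum)
  then show ?case using insert by (simp add: add)
qed (simp add: weight_zero)

lemma square_mem: "w \<in> M \<Longrightarrow> adj w = w \<Longrightarrow> w * w \<in> M \<and> pos (w * w)"
  by (simp add: ops pos_square)

lemma weight_parallelogram:
  assumes "v \<in> M" "adj v = v" "w \<in> M" "adj w = w"
  shows "\<phi> ((v + w) * (v + w)) + \<phi> ((v - w) * (v - w)) = 2 * \<phi> (v * v) + 2 * \<phi> (w * w)"
proof -
  have m: "(v + w) * (v + w) \<in> M \<and> pos ((v + w) * (v + w))" "(v - w) * (v - w) \<in> M \<and> pos ((v - w) * (v - w))"
    "v * v \<in> M \<and> pos (v * v)" "w * w \<in> M \<and> pos (w * w)"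
    using assms by (intro square_mem ops; simp)+
  have "(v + w) * (v + w) + (v - w) * (v - w) = 2 *\<^sub>R (v * v) + 2 *\<^sub>R (w * w)"
    by (simp add: algebra_simps scaleR_2)
  then have "\<phi> ((v + w) * (v + w) + (v - w) * (v - w)) = \<phi> (2 *\<^sub>R (v * v) + 2 *\<^sub>R (w * w))" by simp
  then show ?thesis using m by (simp add: add scale ops pos_scale)
qed

lemma weight_scale_square:
  assumes "w \<in> M" "adj w = w"
  shows "\<phi> ((r *\<^sub>R w) * (r *\<^sub>R w)) = ennreal (r\<^sup>2) * \<phi> (w * w)"
  using square_mem[OF assms] scale[of "r\<^sup>2" "w * w"] by (simp add: power2_eq_square)

text \<open>Operator convexity of the square, from \<open>s |v x|^2 + t |w x|^2 - |s v x + t w x|^2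
  = s t |v x - w x|^2\<close>.\<close>

lemma convex_sublevel: "convex {w \<in> M. adj w = w \<and> norm w \<le> R \<and> \<phi> (w * w) \<le> ennreal c}" if "0 \<le> c"
proof (rule convexI)
  fix v w :: "'a endo" and s t :: real
  assume v: "v \<in> {w \<in> M. adj w = w \<and> norm w \<le> R \<and> \<phi> (w * w) \<le> ennreal c}"
    and w: "w \<in> {w \<in> M. adj w = w \<and> norm w \<le> R \<and> \<phi> (w * w) \<le> ennreal c}"
    and st: "0 \<le> s" "0 \<le> t" "s + t = 1"
  define u where "u = s *\<^sub>R v + t *\<^sub>R w"
  have u: "u \<in> M" "adj u = u" unfolding u_def using v w by (auto intro: ops)
  have "norm u \<le> s * R + t * R"
    unfolding u_def using v w st by (intro norm_triangle_mono) (auto intro: mult_left_mono)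
  also have "\<dots> = (s + t) * R" by (simp add: distrib_right)
  finally have "norm u \<le> R" using st(3) by simp
  moreover have "\<phi> (u * u) \<le> ennreal c"
  proof -
    have qf: "qf (u * u) x \<le> qf (s *\<^sub>R (v * v) + t *\<^sub>R (w * w)) x" for x
    proof -
      have "s * (norm (v \<cdot> x))\<^sup>2 + t * (norm (w \<cdot> x))\<^sup>2 - (norm (u \<cdot> x))\<^sup>2 = s * t * (norm (v \<cdot> x - w \<cdot> x))\<^sup>2"
      proof -
        define a b where "a = v \<cdot> x" and "b = w \<cdot> x"
        have s: "s = 1 - t" using st by simp
        have ux: "u \<cdot> x = s *\<^sub>R a + t *\<^sub>R b" by (simp add: u_def a_def b_def)
        show ?thesis unfolding ux a_def[symmetric] b_def[symmetric] power2_norm_eq_inner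
          by (simp add: inner_add_left inner_add_right inner_diff_left inner_diff_right inner_commute[of b a] s
              power2_eq_square algebra_simps)
      qed
      moreover have "0 \<le> s * t * (norm (v \<cdot> x - w \<cdot> x))\<^sup>2" using st by simp
      moreover have "qf (u * u) x = (norm (u \<cdot> x))\<^sup>2" by (rule qf_square[OF u(2)])
      moreover have "qf (s *\<^sub>R (v * v) + t *\<^sub>R (w * w)) x = s * (norm (v \<cdot> x))\<^sup>2 + t * (norm (w \<cdot> x))\<^sup>2"
        using v w by (simp only: qf_simps) (simp only: qf_square mem_Collect_eq)
      ultimately show ?thesis by linarith
    qed
    have m: "v * v \<in> M \<and> pos (v * v)" "w * w \<in> M \<and> pos (w * w)" "u * u \<in> M \<and> pos (u * u)"
      using v w u by (simp_all add: square_mem)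
    have "\<phi> (u * u) \<le> \<phi> (s *\<^sub>R (v * v) + t *\<^sub>R (w * w))"
      using m st qf by (intro mono) (auto intro: ops pos_add pos_scale)
    also have "\<dots> = ennreal s * \<phi> (v * v) + ennreal t * \<phi> (w * w)"
      using m st by (simp add: add scale ops pos_scale)
    also have "\<dots> \<le> ennreal s * ennreal c + ennreal t * ennreal c"
      using v w by (intro add_mono mult_left_mono) auto
    also have "\<dots> = ennreal c"
      using st that by (simp flip: ennreal_mult ennreal_plus distrib_right)
    finally show ?thesis .
  qed
  ultimately show "s *\<^sub>R v + t *\<^sub>R w \<in> {w \<in> M. adj w = w \<and> norm w \<le> R \<and> \<phi> (w * w) \<le> ennreal c}"
    using u by (simp add: u_def)
qed

lemma weight_increasing:
  assumes T: "\<And>n. T n \<in> M" "\<And>n. pos (T n)" "\<And>n x. qf (T n) x \<le> qf (T (Suc n)) x" "\<And>n x. qf (T n) x \<le> k * (norm x)\<^sup>2"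
    and k: "0 \<le> k" and c: "\<And>n. \<phi> (T n) \<le> c"
  shows "\<exists>F\<in>M. pos F \<and> (\<forall>x y. (\<lambda>n. inner x (T n \<cdot> y)) \<longlonglongrightarrow> inner x (F \<cdot> y)) \<and> \<phi> F \<le> c"
proof -
  obtain F where F: "pos F" "\<And>x y. (\<lambda>n. inner x (T n \<cdot> y)) \<longlonglongrightarrow> inner x (F \<cdot> y)" "\<And>n x. qf (T n) x \<le> qf F x"
    using ex_increasing_limit[of T k] T k by blast
  have FM: "F \<in> M" by (rule limit_mem_vna[OF vnM T(1) F(2)])
  have le: "qf (T m) x \<le> qf (T n) x" if "m \<le> n" for m n x
    using lift_Suc_mono_le[of "\<lambda>n. qf (T n) x", OF T(3) that] .
  have "\<phi> F = (SUP y\<in>range T. \<phi> y)"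
  proof (rule normal)
    fix y z assume "y \<in> range T" "z \<in> range T"
    then obtain m n where "y = T m" "z = T n" by blast
    then have "pos (T (max m n) - y) \<and> pos (T (max m n) - z)"
      by (simp add: pos_diffI pos_adj T le)
    then show "\<exists>w\<in>range T. pos (w - y) \<and> pos (w - z)" by blast
  next
    fix z assume z: "z \<in> M" "pos z" "\<And>y. y \<in> range T \<Longrightarrow> pos (z - y)"
    have "qf F x \<le> qf z x" for x
    proof (rule LIMSEQ_le_const2[OF F(2)])
      show "\<exists>N. \<forall>n\<ge>N. qf (T n) x \<le> qf z x" using pos_diffD[OF z(3)] by blast
    qed
    then show "pos (z - F)" using F z by (intro pos_diffI pos_adj)
  next
    fix y assume "y \<in> range T"
    then show "pos (F - y)" using F(1,3) T(2) by (auto intro!: pos_diffI pos_adj)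
  qed (use F FM T in auto)
  then have "\<phi> F \<le> c" using c by (auto intro: SUP_least)
  then show ?thesis using F FM by blast
qed

text \<open>\<open>q w\<close>, the value of the weight at \<open>w^2\<close>, is an energy, and the
  \<open>w k\<close> are near-minimizers of it in shrinking strong neighbourhoods of
  \<open>w0\<close> inside \<open>C\<close>. Midpoints stay in these neighbourhoods, so by the
  parallelogram law consecutive terms are close in energy. The vector set \<open>V\<close> is closed
  under \<open>w0\<close> and every \<open>w k\<close>, which makes the projection onto
  \<open>[M'V]\<close> commute with all of them.\<close>

lemma fast_sequence:
  assumes C: "convex C" "\<And>w. w \<in> C \<Longrightarrow> w \<in> M \<and> adj w = w \<and> norm w \<le> R \<and> \<phi> (w * w) \<le> ennreal c" and c: "0 \<le> c"
    and w0: "w0 \<in> wot closure_of C" and S: "finite S"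
  shows "\<exists>w V. (\<forall>k. w k \<in> C) \<and> S \<subseteq> V \<and> (\<forall>v\<in>V. w0 \<cdot> v \<in> V) \<and> (\<forall>k. \<forall>v\<in>V. w k \<cdot> v \<in> V) \<and>
    (\<forall>v\<in>V. (\<lambda>k. w k \<cdot> v) \<longlonglongrightarrow> w0 \<cdot> v) \<and>
    (\<forall>k. \<phi> ((w (Suc k) - w k) * (w (Suc k) - w k)) \<le> ennreal (8 * (1/8)^k))"
proof -
  define q where "q w = enn2real (\<phi> (w * w))" for w
  have fin: "\<phi> (w * w) = ennreal (q w)" if "w \<in> C" for w
  proof -
    have "\<phi> (w * w) < top" using C(2)[OF that] ennreal_less_top[of c] by (meson le_less_trans)
    then show ?thesis by (simp add: q_def)
  qed
  have q: "0 \<le> q w" "q w \<le> c" if "w \<in> C" for w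
    using C(2)[OF that] c unfolding fin[OF that] by (auto simp: q_def ennreal_le_iff)
  define N where "N V \<delta> = {w \<in> C. \<forall>v\<in>V. norm (w \<cdot> v - w0 \<cdot> v) < \<delta>}" for V \<delta>
  define d where "d V \<delta> = (INF w\<in>N V \<delta>. q w)" for V \<delta>
  have ne: "N V \<delta> \<noteq> {}" if "finite V" "0 < \<delta>" for V \<delta>
    using sot_approximation[OF C(1) _ w0 that, of R] C(2) by (auto simp: N_def)
  have bdd: "bdd_below (q ` N V \<delta>)" for V \<delta> by (rule bdd_belowI[of _ 0]) (use q in \<open>auto simp: N_def\<close>)
  have d_le: "d V \<delta> \<le> q w" if "w \<in> N V \<delta>" for V \<delta> w unfolding d_def by (rule cINF_lower[OF bdd that])
  define P where "P = {(V :: 'a set, \<delta> :: real). finite V \<and> 0 < \<delta>}"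
  \<comment> \<open>The lower limit of the energy at \<open>w0\<close> along \<open>C\<close>: the
    supremum over strong neighbourhoods of the infimum of \<open>q\<close> there.\<close>
  define e where "e = (SUP p\<in>P. d (fst p) (snd p))"
  have "bdd_above ((\<lambda>p. d (fst p) (snd p)) ` P)"
  proof (rule bdd_aboveI[of _ c], safe)
    fix V \<delta> assume "(V, \<delta>) \<in> P"
    then obtain w where "w \<in> N V \<delta>" using ne by (auto simp: P_def)
    then show "d (fst (V, \<delta>)) (snd (V, \<delta>)) \<le> c" using d_le q(2) by (force simp: N_def)
  qed
  note bddP = this
  have Pne: "P \<noteq> {}" by (auto simp: P_def intro!: exI[of _ "{}"] exI[of _ 1])
  have d_e: "d V \<delta> \<le> e" if "finite V" "0 < \<delta>" for V \<delta>
    using cSUP_upper[OF _ bddP, of "(V, \<delta>)"] that by (simp add: P_def e_def)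
  have "\<exists>p\<in>P. e - (1/8)^k < d (fst p) (snd p)" for k
    using less_cSUP_iff[OF Pne bddP, of "e - (1/8)^k"] by (simp add: e_def)
  then obtain p where p: "\<And>k. p k \<in> P" "\<And>k. e - (1/8)^k < d (fst (p k)) (snd (p k))" by metis
  have p1: "finite (fst (p k))" "0 < snd (p k)" for k using p(1)[of k] by (auto simp: P_def)
  define \<delta> where "\<delta> k = min ((1/2)^k) (Min ((\<lambda>i. snd (p i)) ` {..k}))" for k :: nat
  have \<delta>: "0 < \<delta> k" "\<delta> k \<le> (1/2)^k" "i \<le> k \<Longrightarrow> \<delta> k \<le> snd (p i)" for k i
    using p1 by (auto simp: \<delta>_def min_le_iff_disj)
  have ex: "\<exists>w. finite V \<longrightarrow> w \<in> N (V \<union> (\<Union>i\<le>k. fst (p i))) (\<delta> k) \<and> q w < e + (1/8)^k" for k V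
  proof (cases "finite V")
    case True
    let ?W = "V \<union> (\<Union>i\<le>k. fst (p i))"
    have fW: "finite ?W" using True p1 by auto
    have "d ?W (\<delta> k) < e + (1/8)^k" using d_e[OF fW \<delta>(1)[of k]] by (rule le_less_trans) simp
    then have "\<exists>w\<in>N ?W (\<delta> k). q w < e + (1/8)^k"
      unfolding d_def by (rule iffD1[OF cINF_less_iff[OF ne[OF fW \<delta>(1)] bdd]])
    then obtain w where "w \<in> N ?W (\<delta> k)" "q w < e + (1/8)^k" by (rule bexE)
    then have "finite V \<longrightarrow> w \<in> N ?W (\<delta> k) \<and> q w < e + (1/8)^k" by (intro impI conjI)
    then show ?thesis by (rule exI)
  qed simp
  define f where "f k V = (SOME w. finite V \<longrightarrow> w \<in> N (V \<union> (\<Union>i\<le>k. fst (p i))) (\<delta> k) \<and> q w < e + (1/8)^k)" for k V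
  have f: "f k V \<in> N (V \<union> (\<Union>i\<le>k. fst (p i))) (\<delta> k)" "q (f k V) < e + (1/8)^k" if "finite V" for k V
    using someI_ex[OF ex[of V k]] that unfolding f_def by blast+
  \<comment> \<open>The state consists of the operators and the vectors met so far. Each stage
    chooses one more operator, adapted to all present vectors, and applies all operators to all
    vectors.\<close>
  define St where "St = rec_nat ({w0}, S) (\<lambda>k (W, V). (insert (f k V) W, V \<union> (\<Union>T\<in>insert (f k V) W. (\<lambda>v. T \<cdot> v) ` V)))"
  define W where "W k = fst (St k)" for k
  define V where "V k = snd (St k)" for k
  define w where "w k = f k (V k)" for k
  have WV0: "W 0 = {w0}" "V 0 = S" by (simp_all add: W_def V_def St_def)
  have WVS: "W (Suc k) = insert (w k) (W k)" "V (Suc k) = V k \<union> (\<Union>T\<in>insert (w k) (W k). (\<lambda>v. T \<cdot> v) ` V k)" for k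
    by (simp_all add: W_def V_def w_def St_def case_prod_beta)
  have finW: "finite (W k) \<and> finite (V k)" for k by (induction k) (auto simp: WV0 WVS S)
  then have finV: "finite (V k)" for k by simp
  have Wm: "W m \<subseteq> W n" if "m \<le> n" for m n by (rule lift_Suc_mono_le[OF _ that]) (auto simp: WVS)
  have Vm: "V m \<subseteq> V n" if "m \<le> n" for m n by (rule lift_Suc_mono_le[OF _ that]) (auto simp: WVS)
  have app: "T \<cdot> v \<in> (\<Union>k. V k)" if "T \<in> W m" "v \<in> V n" for T v m n
  proof -
    have "T \<in> W (max m n)" "v \<in> V (max m n)" using that Wm[of m "max m n"] Vm[of n "max m n"] by auto
    then have "T \<cdot> v \<in> V (Suc (max m n))" by (auto simp: WVS)
    then show ?thesis by blast
  qed
  have wN: "w k \<in> N (V k \<union> (\<Union>i\<le>k. fst (p i))) (\<delta> k)" "q (w k) < e + (1/8)^k" for k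
    unfolding w_def by (rule f[OF finV])+
  then have wC: "w k \<in> C" for k by (auto simp: N_def)
  have "(\<lambda>k. w k \<cdot> v) \<longlonglongrightarrow> w0 \<cdot> v" if v: "v \<in> (\<Union>k. V k)" for v
  proof -
    obtain n where n: "v \<in> V n" using v by blast
    have "norm (w k \<cdot> v - w0 \<cdot> v) \<le> (1/2)^k" if "k \<ge> n" for k
    proof -
      have "v \<in> V k" using n Vm[OF that] by blast
      then have "norm (w k \<cdot> v - w0 \<cdot> v) < \<delta> k" using wN(1)[of k] by (auto simp: N_def)
      then show ?thesis using \<delta>(2)[of k] by linarith
    qed
    then have "\<forall>\<^sub>F k in sequentially. norm (w k \<cdot> v - w0 \<cdot> v) \<le> (1/2)^k"
      unfolding eventually_sequentially by blast
    then have "(\<lambda>k. w k \<cdot> v - w0 \<cdot> v) \<longlonglongrightarrow> 0"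
      by (rule Lim_null_comparison) (rule LIMSEQ_power_zero, simp)
    then show ?thesis by (simp add: LIM_zero_iff)
  qed
  moreover have "\<phi> ((w (Suc k) - w k) * (w (Suc k) - w k)) \<le> ennreal (8 * (1/8)^k)" for k
  proof -
    let ?a = "w (Suc k)" and ?b = "w k"
    \<comment> \<open>The midpoint lies in the \<open>k\<close>-th neighbourhood, so its energy is
      above \<open>e - (1/8)^k\<close>. With both end points below \<open>e + (1/8)^k\<close>, the
      second even below \<open>e + (1/8)^(k+1)\<close>, the parallelogram law bounds the increment
      by \<open>(2 + 1/4 + 4) (1/8)^k\<close>.\<close>
    define m where "m = (1/2) *\<^sub>R ?a + (1/2) *\<^sub>R ?b"
    have near: "norm (w j \<cdot> v - w0 \<cdot> v) < snd (p k)" if "v \<in> fst (p k)" "k \<le> j" for v j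
    proof -
      have "norm (w j \<cdot> v - w0 \<cdot> v) < \<delta> j" using wN(1)[of j] that by (auto simp: N_def)
      then show ?thesis using \<delta>(3)[OF that(2)] by linarith
    qed
    have mC: "m \<in> C" unfolding m_def using C(1) wC by (simp add: convex_def)
    moreover have "norm (m \<cdot> v - w0 \<cdot> v) < snd (p k)" if v: "v \<in> fst (p k)" for v
    proof -
      have "w0 \<cdot> v = (1/2) *\<^sub>R (w0 \<cdot> v) + (1/2) *\<^sub>R (w0 \<cdot> v)" by (simp flip: scaleR_left.add)
      then have "m \<cdot> v - w0 \<cdot> v = (1/2) *\<^sub>R (?a \<cdot> v - w0 \<cdot> v) + (1/2) *\<^sub>R (?b \<cdot> v - w0 \<cdot> v)"
        by (simp add: m_def algebra_simps)
      then have "norm (m \<cdot> v - w0 \<cdot> v) \<le> (1/2) * norm (?a \<cdot> v - w0 \<cdot> v) + (1/2) * norm (?b \<cdot> v - w0 \<cdot> v)"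
        by (metis abs_of_nonneg half_gt_zero_iff less_imp_le norm_scaleR norm_triangle_ineq zero_less_one)
      then show ?thesis using near[OF v, of k] near[OF v, of "Suc k"] by simp
    qed
    ultimately have "m \<in> N (fst (p k)) (snd (p k))" by (simp add: N_def)
    then have qm: "e - (1/8)^k < q m" using d_le p(2)[of k] by fastforce
    have ab: "?a \<in> M" "adj ?a = ?a" "?b \<in> M" "adj ?b = ?b" "m \<in> M" "adj m = m" using C(2) wC mC by auto
    have "\<phi> ((?a + ?b) * (?a + ?b)) = ennreal (4 * q m)"
    proof -
      have "?a + ?b = 2 *\<^sub>R m" by (simp add: m_def scaleR_add_right)
      then show ?thesis using weight_scale_square[OF ab(5,6), of 2] fin[OF mC] q(1)[OF mC] by (simp add: ennreal_mult)
    qed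
    moreover have "2 * \<phi> (?a * ?a) + 2 * \<phi> (?b * ?b) = ennreal (2 * q ?a + 2 * q ?b)"
      using fin[OF wC] q(1)[OF wC] by (simp add: ennreal_mult ennreal_plus)
    ultimately have eq: "ennreal (4 * q m) + \<phi> ((?a - ?b) * (?a - ?b)) = ennreal (2 * q ?a + 2 * q ?b)"
      using weight_parallelogram[OF ab(1-4)] by simp
    have "ennreal (2 * q ?a + 2 * q ?b) \<le> ennreal (4 * q m) + ennreal (8 * (1/8)^k)"
    proof -
      have "2 * q ?a + 2 * q ?b \<le> 4 * q m + 8 * (1/8)^k"
      proof -
        have "(1/8::real)^Suc k = (1/8)^k / 8" "0 \<le> (1/8::real)^k" by simp_all
        then show ?thesis using wN(2)[of k] wN(2)[of "Suc k"] qm by linarith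
      qed
      then show ?thesis using q(1)[OF mC] by (simp flip: ennreal_plus)
    qed
    then show ?thesis unfolding eq[symmetric] by simp
  qed
  moreover have "w0 \<cdot> v \<in> (\<Union>k. V k)" "w j \<cdot> v \<in> (\<Union>k. V k)" if v: "v \<in> (\<Union>k. V k)" for v j
    using v app[of w0 0 v] app[of "w j" "Suc j" v] by (auto simp: WV0 WVS)
  moreover have "S \<subseteq> (\<Union>k. V k)" using WV0 by blast
  ultimately show ?thesis
    using wC by (intro exI[of _ w] exI[of _ "\<Union>k. V k"] conjI allI ballI) assumption+
qed

text \<open>\<open>|a + b|^2 <= 2 |a|^2 + 2 |b|^2\<close>, iterated from the first summand. The
  weights \<open>2^(k+1)\<close> are harmless against increments decaying like
  \<open>(1/4)^k\<close>.\<close>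

lemma norm_sum_square_le:
  fixes d :: "nat \<Rightarrow> 'b::real_inner"
  shows "(norm (\<Sum>k<n. d k))\<^sup>2 \<le> (\<Sum>k<n. 2^Suc k * (norm (d k))\<^sup>2)"
proof (induction n arbitrary: d)
  case (Suc n)
  have "(norm (\<Sum>k<Suc n. d k))\<^sup>2 = (norm (d 0 + (\<Sum>k<n. d (Suc k))))\<^sup>2"
    by (simp only: sum.lessThan_Suc_shift)
  also have "\<dots> \<le> 2 * (norm (d 0))\<^sup>2 + 2 * (norm (\<Sum>k<n. d (Suc k)))\<^sup>2"
    using parallelogram[of "d 0" "\<Sum>k<n. d (Suc k)"] zero_le_power2[of "norm (d 0 - (\<Sum>k<n. d (Suc k)))"] by linarith
  also have "\<dots> \<le> 2 * (norm (d 0))\<^sup>2 + 2 * (\<Sum>k<n. 2^Suc k * (norm (d (Suc k)))\<^sup>2)"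
    using Suc.IH[of "\<lambda>k. d (Suc k)"] by simp
  also have "\<dots> = (\<Sum>k<Suc n. 2^Suc k * (norm (d k))\<^sup>2)"
    by (simp add: sum.lessThan_Suc_shift sum_distrib_left mult.assoc del: sum.lessThan_Suc)
  finally show ?case .
qed simp

text \<open>
  A Fatou argument: the squares of the increments of the sequence may have an unbounded sum, but
  their resolvents converge, and the normality of the weight applies to the bounded operators
  \<open>1 - (1 + S\<^sub>n)\<^sup>-\<^sup>1\<close>. The projection \<open>q\<close> restricts everything to a subspace on which the sequence
  converges strongly.
\<close>

lemma weight_fatou:
  assumes w: "\<And>k. w k \<in> M \<and> adj (w k) = w k \<and> norm (w k) \<le> R" and w0: "w0 \<in> M" "adj w0 = w0" "norm w0 \<le> R"
    and q: "q \<in> M" "adj q = q" "q * q = q" "w0 * q = q * w0" "\<And>k. w k * q = q * w k"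
    and lim: "\<And>x. (\<lambda>k. w k \<cdot> q \<cdot> x) \<longlonglongrightarrow> w0 \<cdot> q \<cdot> x"
    and small: "\<And>k. \<phi> ((w (Suc k) - w k) * (w (Suc k) - w k)) \<le> ennreal (\<epsilon> * (1/4)^k)" and \<epsilon>: "0 \<le> \<epsilon>"
  shows "\<phi> (q * ((w0 - w 0) * (w0 - w 0)) * q) \<le> ennreal ((1 + 4 * R\<^sup>2) * (4 * \<epsilon>))"
proof -
  define d where "d k = w (Suc k) - w k" for k
  have d: "d k \<in> M" "adj (d k) = d k" for k using w by (auto simp: d_def intro: ops)
  \<comment> \<open>The weights are those of \<open>norm_sum_square_le\<close>: \<open>S n\<close>
    dominates \<open>(w n - w 0)^2\<close>, while its weight stays below the sum of
    \<open>2 \<epsilon> (1/2)^k\<close>.\<close>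
  define S where "S n = (\<Sum>k<n. (2^Suc k) *\<^sub>R (d k * d k))" for n
  have Smem: "(2^Suc k) *\<^sub>R (d k * d k) \<in> M \<and> pos ((2^Suc k) *\<^sub>R (d k * d k))" for k
    using square_mem[OF d, of k] by (intro conjI ops(6) pos_scale) auto
  have S: "S n \<in> M" "pos (S n)" for n
    unfolding S_def using Smem by (auto intro!: vna_sum[OF vnM] pos_sum)
  have qS: "qf (S n) x = (\<Sum>k<n. 2^Suc k * (norm (d k \<cdot> x))\<^sup>2)" for n x
    unfolding S_def qf_sum by (intro sum.cong refl) (simp only: qf_simps qf_square[OF d(2)])
  have \<phi>S: "\<phi> (S n) \<le> ennreal (4 * \<epsilon>)" for n
  proof -
    have "\<phi> (S n) = (\<Sum>k<n. \<phi> ((2^Suc k) *\<^sub>R (d k * d k)))"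
      unfolding S_def using Smem by (intro weight_sum) auto
    also have "\<dots> \<le> (\<Sum>k<n. ennreal (2 * \<epsilon> * (1/2)^k))"
    proof (rule sum_mono)
      fix k
      have "\<phi> ((2^Suc k) *\<^sub>R (d k * d k)) = ennreal (2^Suc k) * \<phi> (d k * d k)"
        using square_mem[OF d] by (intro scale) auto
      also have "\<dots> \<le> ennreal (2^Suc k) * ennreal (\<epsilon> * (1/4)^k)"
        using small[of k] by (intro mult_left_mono) (auto simp: d_def)
      also have "\<dots> = ennreal (2^Suc k * (\<epsilon> * (1/4)^k))" using \<epsilon> by (simp add: ennreal_mult)
      also have "2^Suc k * (\<epsilon> * (1/4)^k) = 2 * \<epsilon> * (1/2)^k"
      proof -
        have "(1/2::real)^k = 2^k * (1/4)^k" by (simp flip: power_mult_distrib)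
        then show ?thesis by simp
      qed
      finally show "\<phi> ((2^Suc k) *\<^sub>R (d k * d k)) \<le> ennreal (2 * \<epsilon> * (1/2)^k)" .
    qed
    also have "\<dots> = ennreal (\<Sum>k<n. 2 * \<epsilon> * (1/2)^k)" using \<epsilon> by (intro sum_ennreal) simp
    also have "\<dots> \<le> ennreal (4 * \<epsilon>)"
    proof (rule ennreal_leI)
      have "(\<Sum>k<n. (1/2::real)^k) \<le> 2" by (simp add: sum_gp_strict)
      then have "2 * \<epsilon> * (\<Sum>k<n. (1/2::real)^k) \<le> 2 * \<epsilon> * 2" using \<epsilon> by (intro mult_left_mono) auto
      then show "(\<Sum>k<n. 2 * \<epsilon> * (1/2)^k) \<le> 4 * \<epsilon>" by (simp add: sum_distrib_left)
    qed
    finally show ?thesis .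
  qed
  define h where "h T = 1 - resolvent T" for T :: "'a endo"
  have hS: "h (S n) \<in> M" "pos (h (S n))" for n
    unfolding h_def using one_minus_resolvent_pos[OF S(2)] by (auto intro!: ops vna_resolvent[OF vnM] S)
  have hmono: "qf (h T) x \<le> qf (h T') x" if "pos T" "pos T'" "\<And>x. qf T x \<le> qf T' x" for T T' x
    using resolvent_antimono[OF that] unfolding h_def qf_simps by simp
  have "\<exists>F\<in>M. pos F \<and> (\<forall>x y. (\<lambda>n. inner x (h (S n) \<cdot> y)) \<longlonglongrightarrow> inner x (F \<cdot> y)) \<and> \<phi> F \<le> ennreal (4 * \<epsilon>)"
  proof (rule weight_increasing[where k = 1])
    show "qf (h (S n)) x \<le> qf (h (S (Suc n))) x" for n x
      by (rule hmono[OF S(2) S(2)]) (simp add: qS)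
    show "qf (h (S n)) x \<le> 1 * (norm x)\<^sup>2" for n x
      using pos_qf[OF resolvent_pos[OF S(2)], of x n] unfolding h_def qf_simps by simp
    show "\<phi> (h (S n)) \<le> ennreal (4 * \<epsilon>)" for n
      by (rule order_trans[OF mono \<phi>S[of n]]) (use hS S qf_one_minus_resolvent_le[OF S(2)] in \<open>auto simp: h_def\<close>)
  qed (use hS in auto)
  then obtain F where F: "F \<in> M" "pos F" "\<And>x y. (\<lambda>n. inner x (h (S n) \<cdot> y)) \<longlonglongrightarrow> inner x (F \<cdot> y)"
    "\<phi> F \<le> ennreal (4 * \<epsilon>)" by blast
  define E where "E n = w n - w 0" for n
  define E0 where "E0 = w0 - w 0"
  define T where "T n = E n * E n" for n
  define T0 where "T0 = E0 * E0"
  have E: "E n \<in> M" "adj (E n) = E n" "norm (E n) \<le> 2 * R" "E n * q = q * E n" for n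
    using w[of n] w[of 0] q(5)[of n] q(5)[of 0] norm_triangle_ineq4[of "w n" "w 0"]
    by (auto simp: E_def algebra_simps intro: ops)
  have E0: "E0 \<in> M" "adj E0 = E0" "norm E0 \<le> 2 * R" "E0 * q = q * E0"
    using w0 w[of 0] q(4) q(5)[of 0] norm_triangle_ineq4[of w0 "w 0"]
    by (auto simp: E0_def algebra_simps intro: ops)
  have R: "0 \<le> R" using w0(3) norm_ge_zero[of w0] by linarith
  have Tp: "T n \<in> M" "pos (T n)" for n using square_mem[OF E(1,2)] by (auto simp: T_def)
  have T0p: "T0 \<in> M" "pos T0" using square_mem[OF E0(1,2)] by (auto simp: T0_def)
  have T_le: "qf (T n) x \<le> qf (S n) x" for n x
  proof -
    have "E n \<cdot> x = (\<Sum>k<n. d k \<cdot> x)" 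
      using sum_lessThan_telescope[of "\<lambda>k. w k \<cdot> x" n] by (simp add: E_def d_def)
    then show ?thesis unfolding T_def qS qf_square[OF E(2)] by (simp only: norm_sum_square_le)
  qed
  have limE: "(\<lambda>n. E n \<cdot> q \<cdot> x) \<longlonglongrightarrow> E0 \<cdot> q \<cdot> x" for x
    unfolding E_def E0_def app_simps by (intro tendsto_diff lim tendsto_const)
  have qq: "q \<cdot> q \<cdot> x = q \<cdot> x" for x using arg_cong[OF q(3), of "\<lambda>T. T \<cdot> x"] by simp
  have E0q: "E0 \<cdot> q \<cdot> x = q \<cdot> E0 \<cdot> q \<cdot> x" for x
    using arg_cong[OF E0(4), of "\<lambda>T. T \<cdot> q \<cdot> x"] by (simp add: qq)
  have limT: "(\<lambda>n. (T n - T0) \<cdot> q \<cdot> x) \<longlonglongrightarrow> 0" for x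
  proof (rule Lim_null_comparison)
    define y where "y = E0 \<cdot> q \<cdot> x"
    have y: "y = q \<cdot> y" unfolding y_def by (rule E0q)
    show "\<forall>\<^sub>F n in sequentially. norm ((T n - T0) \<cdot> q \<cdot> x)
        \<le> 2 * R * norm (E n \<cdot> q \<cdot> x - y) + norm (E n \<cdot> q \<cdot> y - E0 \<cdot> q \<cdot> y)"
    proof (rule always_eventually, rule allI)
      fix n
      have "(T n - T0) \<cdot> q \<cdot> x = E n \<cdot> (E n \<cdot> q \<cdot> x - y) + (E n \<cdot> y - E0 \<cdot> y)"
        by (simp add: T_def T0_def y_def)
      also have "norm \<dots> \<le> norm (E n \<cdot> (E n \<cdot> q \<cdot> x - y)) + norm (E n \<cdot> y - E0 \<cdot> y)"
        by (rule norm_triangle_ineq)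
      also have "norm (E n \<cdot> (E n \<cdot> q \<cdot> x - y)) \<le> 2 * R * norm (E n \<cdot> q \<cdot> x - y)"
        by (rule order_trans[OF norm_app]) (intro mult_right_mono E norm_ge_zero)
      finally show "norm ((T n - T0) \<cdot> q \<cdot> x) \<le> 2 * R * norm (E n \<cdot> q \<cdot> x - y) + norm (E n \<cdot> q \<cdot> y - E0 \<cdot> q \<cdot> y)"
        unfolding y[symmetric] by simp
    qed
    have "(\<lambda>n. 2 * R * norm (E n \<cdot> q \<cdot> x - y) + norm (E n \<cdot> q \<cdot> y - E0 \<cdot> q \<cdot> y))
        \<longlonglongrightarrow> 2 * R * norm (E0 \<cdot> q \<cdot> x - y) + norm (E0 \<cdot> q \<cdot> y - E0 \<cdot> q \<cdot> y)"
      by (intro tendsto_intros limE)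
    then show "(\<lambda>n. 2 * R * norm (E n \<cdot> q \<cdot> x - y) + norm (E n \<cdot> q \<cdot> y - E0 \<cdot> q \<cdot> y)) \<longlonglongrightarrow> 0"
      by (simp add: y_def)
  qed
  have T0q: "q * T0 = T0 * q"
  proof -
    have "q * (E0 * E0) = E0 * E0 * q"
      by (simp only: mult.assoc[symmetric] E0(4)[symmetric]) (simp only: mult.assoc E0(4)[symmetric])
    then show ?thesis by (simp only: T0_def)
  qed
  have limh: "(\<lambda>n. qf (h (T n)) (q \<cdot> x)) \<longlonglongrightarrow> qf (h T0) (q \<cdot> x)" for x
  proof -
    define y where "y = resolvent T0 \<cdot> q \<cdot> x"
    have y: "y = q \<cdot> y"
      using arg_cong[OF resolvent_commute[OF T0p(2) T0q], of "\<lambda>T. T \<cdot> q \<cdot> x"] by (simp add: y_def qq)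
    \<comment> \<open>The second resolvent identity. It turns strong convergence of
      \<open>T n\<close> on the range of \<open>q\<close> into strong convergence of the resolvents
      there, since \<open>y\<close> again lies in that range.\<close>
    have eq: "resolvent (T n) \<cdot> q \<cdot> x - y = - (resolvent (T n) \<cdot> (T n - T0) \<cdot> q \<cdot> y)" for n
    proof -
      have "q \<cdot> x = y + T0 \<cdot> y" unfolding y_def by (rule resolvent_split[OF T0p(2)])
      moreover have "resolvent (T n) \<cdot> (y + T n \<cdot> y) = y"
        using arg_cong[OF resolvent_left[OF Tp(2)], of "\<lambda>T. T \<cdot> y" n] by simp
      moreover have "(T n - T0) \<cdot> y = (y + T n \<cdot> y) - (y + T0 \<cdot> y)" by simp
      ultimately show ?thesis unfolding y[symmetric] by (simp only: app_right_simps) simp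
    qed
    have "(\<lambda>n. resolvent (T n) \<cdot> q \<cdot> x - y) \<longlonglongrightarrow> 0"
    proof (rule Lim_null_comparison[OF _ tendsto_norm_zero[OF limT[of y]]])
      show "\<forall>\<^sub>F n in sequentially. norm (resolvent (T n) \<cdot> q \<cdot> x - y) \<le> norm ((T n - T0) \<cdot> q \<cdot> y)"
        unfolding eq norm_minus_cancel by (rule always_eventually) (simp only: norm_resolvent_app[OF Tp(2)] simp_thms)
    qed
    then have "(\<lambda>n. resolvent (T n) \<cdot> q \<cdot> x) \<longlonglongrightarrow> y" by (simp add: LIM_zero_iff)
    then show ?thesis unfolding h_def y_def app_simps by (intro tendsto_intros)
  qed
  have hle: "qf (h T0) (q \<cdot> x) \<le> qf F (q \<cdot> x)" for x
  proof (rule LIMSEQ_le[OF limh F(3)])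
    show "\<exists>N. \<forall>n\<ge>N. qf (h (T n)) (q \<cdot> x) \<le> qf (h (S n)) (q \<cdot> x)"
      using hmono[OF Tp(2) S(2) T_le] by blast
  qed
  have qd: "q * d k = d k * q" for k by (simp add: d_def algebra_simps q(5))
  have qSn: "q * S n = S n * q" for n
  proof -
    have "q * (d k * d k) = d k * d k * q" for k by (simp only: mult.assoc[symmetric] qd) (simp only: mult.assoc qd)
    then show ?thesis by (simp add: S_def sum_distrib_left sum_distrib_right)
  qed
  have qF: "q * F = F * q"
  proof (rule endo_eq_innerI)
    fix x y
    have "inner (q \<cdot> x) (h (S n) \<cdot> y) = inner x (h (S n) \<cdot> q \<cdot> y)" for n
      using arg_cong[OF resolvent_commute[OF S(2) qSn], of "\<lambda>T. T \<cdot> y" n]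
      by (simp add: adj_inner[OF q(2)] h_def inner_diff_right)
    then have "(\<lambda>n. inner (q \<cdot> x) (h (S n) \<cdot> y)) \<longlonglongrightarrow> inner x (F \<cdot> q \<cdot> y)" using F(3) by simp
    with F(3)[of "q \<cdot> x" y] have "inner (q \<cdot> x) (F \<cdot> y) = inner x (F \<cdot> q \<cdot> y)" by (rule LIMSEQ_unique)
    then show "inner x ((q * F) \<cdot> y) = inner x ((F * q) \<cdot> y)" by (simp add: adj_inner[OF q(2)])
  qed
  have qFle: "qf F (q \<cdot> x) \<le> qf F x" for x
  proof -
    have c: "F \<cdot> q \<cdot> x = q \<cdot> F \<cdot> x" using arg_cong[OF qF, of "\<lambda>T. T \<cdot> x"] by simp
    have "qf F (x - q \<cdot> x) = qf F x - qf F (q \<cdot> x)"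
      by (simp add: inner_diff_left inner_diff_right c adj_inner[OF q(2)] qq)
    then show ?thesis using pos_qf[OF F(2), of "x - q \<cdot> x"] by linarith
  qed
  have qfc: "qf (q * A * q) x = qf A (q \<cdot> x)" for A x using qf_conj[of x q A] by (simp add: q(2))
  have T0n: "qf T0 x \<le> (4 * R\<^sup>2) * (norm x)\<^sup>2" for x
  proof -
    have "norm (E0 \<cdot> x) \<le> 2 * R * norm x"
      by (rule order_trans[OF norm_app]) (intro mult_right_mono E0 norm_ge_zero)
    then have "(norm (E0 \<cdot> x))\<^sup>2 \<le> (2 * R * norm x)\<^sup>2" by (intro power_mono) auto
    then show ?thesis unfolding T0_def qf_square[OF E0(2)] by (simp add: power_mult_distrib)
  qed
  have c4: "0 \<le> 1 + 4 * R\<^sup>2" by (simp add: add_nonneg_nonneg)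
  \<comment> \<open>\<open>norm E0 <= 2 R\<close> gives \<open>T0 <= 4 R^2\<close>, so the cut-off
    \<open>h\<close> is undone at the price of the factor \<open>1 + 4 R^2\<close>.\<close>
  have "\<phi> (q * T0 * q) \<le> \<phi> ((1 + 4 * R\<^sup>2) *\<^sub>R F)"
  proof (rule mono)
    fix x
    have "qf T0 (q \<cdot> x) \<le> (1 + 4 * R\<^sup>2) * qf (h T0) (q \<cdot> x)"
      unfolding h_def by (rule qf_le_one_minus_resolvent[OF T0p(2) _ T0n]) simp
    also have "\<dots> \<le> (1 + 4 * R\<^sup>2) * qf F x"
      using hle[of x] qFle[of x] c4 by (intro mult_left_mono) auto
    finally show "qf (q * T0 * q) x \<le> qf ((1 + 4 * R\<^sup>2) *\<^sub>R F) x" unfolding qfc by (simp only: qf_simps)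
  qed (use T0p F q c4 in \<open>auto intro!: ops pos_conj_sa pos_scale\<close>)
  also have "\<dots> = ennreal (1 + 4 * R\<^sup>2) * \<phi> F" by (rule scale[OF c4 F(1,2)])
  also have "\<dots> \<le> ennreal (1 + 4 * R\<^sup>2) * ennreal (4 * \<epsilon>)" by (intro mult_left_mono F) simp
  also have "\<dots> = ennreal ((1 + 4 * R\<^sup>2) * (4 * \<epsilon>))" using c4 \<epsilon> by (simp add: ennreal_mult)
  finally show ?thesis by (simp only: T0_def E0_def)
qed

end

section \<open>Weak closedness of the sublevel sets of
  \<open>w \<mapsto> \<phi> (w^2)\<close>\<close>

context normal_weight_on
begin

text \<open>If \<open>q\<close> projects onto \<open>[M'V]\<close> for the \<open>V\<close> of
  \<open>fast_sequence\<close>, then \<open>p <= q\<close>, so \<open>w0 p w0\<close> is at most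
  \<open>q w0^2 q\<close>. This is compared with \<open>w N\<close>, whose weight is at most
  \<open>c\<close>, and with the tail \<open>q (w0 - w N)^2 q\<close>, whose weight is small by
  \<open>weight_fatou\<close> applied to the shifted sequence.\<close>

lemma weight_projection_le:
  assumes c: "0 \<le> c" and w0: "w0 \<in> wot closure_of {w \<in> M. adj w = w \<and> norm w \<le> R \<and> \<phi> (w * w) \<le> ennreal c}"
    and S: "finite S" and p: "p \<in> M" "adj p = p" "p * p = p" "\<And>x. p \<cdot> x \<in> cyc M S"
  shows "\<phi> (w0 * p * w0) \<le> ennreal c"
proof -
  define C where "C = {w \<in> M. adj w = w \<and> norm w \<le> R \<and> \<phi> (w * w) \<le> ennreal c}"
  have C: "convex C" unfolding C_def by (rule convex_sublevel[OF c])
  have R: "0 \<le> R"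
  proof -
    have "C \<noteq> {}" using w0 unfolding C_def[symmetric] by auto
    then obtain w :: "'a endo" where "norm w \<le> R" by (auto simp: C_def)
    then show ?thesis using norm_ge_zero[of w] by linarith
  qed
  have "closedin wot (M \<inter> ({w. adj w = w} \<inter> {w. norm w \<le> R}))"
    by (intro closedin_Int closedin_wot_vna vnM closedin_wot_sa closedin_wot_ball R)
  then have "wot closure_of C \<subseteq> M \<inter> ({w. adj w = w} \<inter> {w. norm w \<le> R})"
    by (rule closure_of_minimal[rotated]) (auto simp: C_def)
  then have w0': "w0 \<in> M" "adj w0 = w0" "norm w0 \<le> R" using w0 by (auto simp: C_def)
  have CD: "w \<in> M \<and> adj w = w \<and> norm w \<le> R \<and> \<phi> (w * w) \<le> ennreal c" if "w \<in> C" for w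
    using that by (simp add: C_def)
  have "\<exists>w V. (\<forall>k. w k \<in> C) \<and> S \<subseteq> V \<and> (\<forall>v\<in>V. w0 \<cdot> v \<in> V) \<and> (\<forall>k. \<forall>v\<in>V. w k \<cdot> v \<in> V) \<and>
    (\<forall>v\<in>V. (\<lambda>k. w k \<cdot> v) \<longlonglongrightarrow> w0 \<cdot> v) \<and>
    (\<forall>k. \<phi> ((w (Suc k) - w k) * (w (Suc k) - w k)) \<le> ennreal (8 * (1/8)^k))" (is "\<exists>w V. ?P w V")
    by (rule fast_sequence[OF C _ c w0[folded C_def] S]) (rule CD)
  then obtain w V where wV: "?P w V" by (elim exE)
  have w: "w k \<in> C" for k using wV by simp
  have V: "S \<subseteq> V" "v \<in> V \<Longrightarrow> w0 \<cdot> v \<in> V" "v \<in> V \<Longrightarrow> w k \<cdot> v \<in> V" for k v using wV by simp_all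
  have lim: "(\<lambda>k. w k \<cdot> v) \<longlonglongrightarrow> w0 \<cdot> v" if "v \<in> V" for v using wV that by simp
  have small: "\<phi> ((w (Suc k) - w k) * (w (Suc k) - w k)) \<le> ennreal (8 * (1/8)^k)" for k
    using wV by (elim conjE allE)
  have wk: "w k \<in> M" "adj (w k) = w k" "norm (w k) \<le> R" "\<phi> (w k * w k) \<le> ennreal c" for k
    using w[of k] by (auto simp: C_def)
  obtain q where q: "q \<in> M" "adj q = q" "q * q = q" "\<And>x. q \<cdot> x \<in> cyc M V" "\<And>x. x \<in> cyc M V \<Longrightarrow> q \<cdot> x = x"
    using ex_cyc_projection[OF vnM, of V] by blast
  have qcomm: "T * q = q * T" if T: "T \<in> M" "adj T = T" "\<And>v. v \<in> V \<Longrightarrow> T \<cdot> v \<in> V" for T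
  proof (rule projection_commute[OF q(2,4,5), symmetric])
    have "T \<cdot> x \<in> cyc M V" if "x \<in> cyc M V" for x
    proof (rule cyc_invariant[OF _ that])
      fix m v assume mv: "m \<in> comm M" "v \<in> V"
      have "T \<cdot> m \<cdot> v = m \<cdot> T \<cdot> v" using arg_cong[OF commD[OF mv(1) T(1)], of "\<lambda>T. T \<cdot> v"] by simp
      then show "T \<cdot> m \<cdot> v \<in> cyc M V" using cyc_base[OF mv(1) T(3)[OF mv(2)]] by simp
    qed
    then show "\<And>x. x \<in> cyc M V \<Longrightarrow> T \<cdot> x \<in> cyc M V" "\<And>x. x \<in> cyc M V \<Longrightarrow> adj T \<cdot> x \<in> cyc M V"
      using T(2) by auto
  qed
  \<comment> \<open>Convergence on \<open>V\<close> spreads to \<open>[M'V]\<close>: operators of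
    the commutant may be pulled out, and the vectors on which a bounded sequence tends to
    \<open>0\<close> form a closed subspace.\<close>
  have limq: "(\<lambda>k. w k \<cdot> q \<cdot> x) \<longlonglongrightarrow> w0 \<cdot> q \<cdot> x" for x
  proof -
    let ?N = "{x. (\<lambda>k. (w k - w0) \<cdot> x) \<longlonglongrightarrow> 0}"
    have bd: "norm (w k - w0) \<le> 2 * R" for k using norm_triangle_ineq4[of "w k" w0] wk(3)[of k] w0'(3) by linarith
    have "m \<cdot> v \<in> ?N" if mv: "m \<in> comm M" "v \<in> V" for m v
    proof -
      have "(w k - w0) \<cdot> m \<cdot> v = m \<cdot> (w k \<cdot> v - w0 \<cdot> v)" for k
        using arg_cong[OF commD[OF mv(1) ops(4)[OF wk(1) w0'(1)]], of "\<lambda>T. T \<cdot> v" k] by simp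
      moreover have "(\<lambda>k. m \<cdot> (w k \<cdot> v - w0 \<cdot> v)) \<longlonglongrightarrow> m \<cdot> (w0 \<cdot> v - w0 \<cdot> v)"
        by (intro app.tendsto tendsto_intros lim mv)
      ultimately show ?thesis by simp
    qed
    then have "span {m \<cdot> v | m v. m \<in> comm M \<and> v \<in> V} \<subseteq> ?N"
      by (intro span_minimal closed_subspace_null(2)[OF bd]) blast
    then have "cyc M V \<subseteq> ?N" unfolding cyc_def by (rule closure_minimal[OF _ closed_subspace_null(1)[OF bd]])
    then have "(\<lambda>k. w k \<cdot> q \<cdot> x - w0 \<cdot> q \<cdot> x) \<longlonglongrightarrow> 0" using q(4)[of x] by auto
    then show ?thesis by (simp add: LIM_zero_iff)
  qed
  define K where "K = (1 + 4 * R\<^sup>2) * 32"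
  have K: "0 \<le> K" by (simp add: K_def)
  have qfc: "qf (q * A * q) x = qf A (q \<cdot> x)" for A x using qf_conj[of x q A] by (simp add: q(2))
  have tail: "\<phi> (q * ((w0 - w N) * (w0 - w N)) * q) \<le> ennreal (K * (1/8)^N)" for N
  proof -
    have "\<phi> (q * ((w0 - w (N + 0)) * (w0 - w (N + 0))) * q) \<le> ennreal ((1 + 4 * R\<^sup>2) * (4 * (8 * (1/8)^N)))"
    proof (rule weight_fatou[of "\<lambda>k. w (N + k)" R w0 q "8 * (1/8)^N"])
      fix k
      have "\<phi> ((w (N + Suc k) - w (N + k)) * (w (N + Suc k) - w (N + k))) \<le> ennreal (8 * (1/8)^(N + k))"
        using small[of "N + k"] by simp
      also have "\<dots> \<le> ennreal (8 * (1/8)^N * (1/4)^k)"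
        by (rule ennreal_leI) (simp add: power_add power_mono mult_left_mono)
      finally show "\<phi> ((w (N + Suc k) - w (N + k)) * (w (N + Suc k) - w (N + k))) \<le> ennreal (8 * (1/8)^N * (1/4)^k)" .
    next
      fix x show "(\<lambda>k. w (N + k) \<cdot> q \<cdot> x) \<longlonglongrightarrow> w0 \<cdot> q \<cdot> x"
        using LIMSEQ_ignore_initial_segment[OF limq, of N x] by (simp add: add.commute)
    qed (use wk w0' q(1-3) qcomm V in auto)
    moreover have "(1 + 4 * R\<^sup>2) * (4 * (8 * (1/8)^N)) = K * (1/8)^N" by (simp add: K_def)
    ultimately show ?thesis by (simp only: add_0_right)
  qed
  \<comment> \<open>From \<open>|a + b|^2 <= (1 + e) |a|^2 + (1 + 1/e) |b|^2\<close>, with the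
    leading term going to \<open>w N\<close> so that no constant other than \<open>1 + e\<close>
    multiplies \<open>c\<close>.\<close>
  have main: "\<phi> (w0 * p * w0) \<le> ennreal ((1 + e) * c + (1 + 1/e) * (K * (1/8)^N))" if e: "e > 0" for e N
  proof -
    let ?T = "q * ((w0 - w N) * (w0 - w N)) * q"
    have Tm: "?T \<in> M" "pos ?T"
      using square_mem[of "w0 - w N"] wk[of N] w0' q(1,2) by (auto intro!: ops(7) pos_conj_sa ops(4))
    have wm: "w N * w N \<in> M" "pos (w N * w N)" using square_mem wk by auto
    have e1: "0 \<le> 1 + e" "0 \<le> 1 + 1/e" using e by auto
    have "\<phi> (w0 * p * w0) \<le> \<phi> ((1 + e) *\<^sub>R (w N * w N) + (1 + 1/e) *\<^sub>R ?T)"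
    proof (rule mono)
      show "w0 * p * w0 \<in> M" by (intro ops w0' p)
      have "pos p" using pos_square[OF p(2)] p(3) by simp
      then show "pos (w0 * p * w0)" by (rule pos_conj_sa) (rule w0'(2))
      show "(1 + e) *\<^sub>R (w N * w N) + (1 + 1/e) *\<^sub>R ?T \<in> M" by (intro ops(3,6) wm Tm)
      show "pos ((1 + e) *\<^sub>R (w N * w N) + (1 + 1/e) *\<^sub>R ?T)" by (intro pos_add pos_scale wm Tm e1)
      fix x
      have pq: "p * q = p"
      proof -
        have "q * p = p"
          by (rule endo_eqI, simp only: app_simps, rule q(5), rule subsetD[OF cyc_mono[OF V(1)]], rule p(4))
        from arg_cong[OF this, of adj] show ?thesis by (simp add: p(2) q(2))
      qed
      have contr: "norm (r \<cdot> y) \<le> norm y" if r: "adj r = r" "r * r = r" for r :: "'a endo" and y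
      proof -
        have "norm (r \<cdot> y) * norm (r \<cdot> y) = inner y (r \<cdot> y)"
          using qf_square[OF r(1), of y] r(2) by (simp add: power2_eq_square)
        also have "\<dots> \<le> norm y * norm (r \<cdot> y)" by (rule norm_cauchy_schwarz)
        finally show ?thesis by (cases "r \<cdot> y = 0") auto
      qed
      have "qf (w0 * p * w0) x = (norm (p \<cdot> w0 \<cdot> x))\<^sup>2"
      proof -
        have "qf (w0 * p * w0) x = qf (p * p) (w0 \<cdot> x)"
          using qf_conj[of x w0 p] w0'(2) by (simp add: p(3))
        then show ?thesis unfolding qf_square[OF p(2)] .
      qed
      also have "p \<cdot> w0 \<cdot> x = p \<cdot> q \<cdot> w0 \<cdot> x" using arg_cong[OF pq, of "\<lambda>T. T \<cdot> w0 \<cdot> x"] by simp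
      also have "q \<cdot> w0 \<cdot> x = w0 \<cdot> q \<cdot> x"
        using arg_cong[OF qcomm[OF w0'(1,2) V(2)], of "\<lambda>T. T \<cdot> x"] by simp
      also have "(norm (p \<cdot> w0 \<cdot> q \<cdot> x))\<^sup>2 \<le> (norm (w0 \<cdot> q \<cdot> x))\<^sup>2"
        by (intro power_mono contr p norm_ge_zero)
      also have "\<dots> = (norm (w N \<cdot> q \<cdot> x + (w0 - w N) \<cdot> q \<cdot> x))\<^sup>2" by simp
      also have "\<dots> \<le> (1 + e) * (norm (w N \<cdot> q \<cdot> x))\<^sup>2 + (1 + 1/e) * (norm ((w0 - w N) \<cdot> q \<cdot> x))\<^sup>2"
      proof -
        define a b where "a = norm (w N \<cdot> q \<cdot> x)" and "b = norm ((w0 - w N) \<cdot> q \<cdot> x)"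
        have "(norm (w N \<cdot> q \<cdot> x + (w0 - w N) \<cdot> q \<cdot> x))\<^sup>2 \<le> (a + b)\<^sup>2"
          unfolding a_def b_def by (intro power_mono norm_triangle_ineq norm_ge_zero)
        also have "(a + b)\<^sup>2 \<le> (1 + e) * a\<^sup>2 + (1 + 1/e) * b\<^sup>2"
        proof -
          have "0 \<le> (e * a - b)\<^sup>2 / e" using e by simp
          also have "\<dots> = e * a\<^sup>2 - 2 * a * b + b\<^sup>2 / e" using e by (simp add: power2_eq_square field_simps)
          finally show ?thesis by (simp add: power2_eq_square algebra_simps)
        qed
        finally show ?thesis by (simp only: a_def b_def)
      qed
      also have "(norm ((w0 - w N) \<cdot> q \<cdot> x))\<^sup>2 = qf ?T x"
        unfolding qfc by (rule qf_square[symmetric]) (simp add: w0' wk)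
      also have "(norm (w N \<cdot> q \<cdot> x))\<^sup>2 \<le> qf (w N * w N) x"
      proof -
        have "w N \<cdot> q \<cdot> x = q \<cdot> w N \<cdot> x"
          using arg_cong[OF qcomm[OF wk(1,2) V(3)], of "\<lambda>T. T \<cdot> x"] by simp
        then show ?thesis unfolding qf_square[OF wk(2)] by (simp add: contr q power_mono)
      qed
      finally show "qf (w0 * p * w0) x \<le> qf ((1 + e) *\<^sub>R (w N * w N) + (1 + 1/e) *\<^sub>R ?T) x"
        using e1 by (simp only: qf_simps) (simp add: mult_left_mono)
    qed
    also have "\<dots> = ennreal (1 + e) * \<phi> (w N * w N) + ennreal (1 + 1/e) * \<phi> ?T"
      using e1 wm Tm by (simp add: add scale ops pos_scale)
    also have "\<dots> \<le> ennreal (1 + e) * ennreal c + ennreal (1 + 1/e) * ennreal (K * (1/8)^N)"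
      by (intro add_mono mult_left_mono wk tail) auto
    also have "\<dots> = ennreal ((1 + e) * c + (1 + 1/e) * (K * (1/8)^N))"
      using e1 c K by (simp add: ennreal_mult ennreal_plus)
    finally show ?thesis .
  qed
  \<comment> \<open>The order of limits matters: \<open>N\<close> tends to infinity for fixed
    \<open>e\<close>, killing the tail in spite of the factor \<open>1 + 1/e\<close>; only then
    \<open>e\<close> tends to \<open>0\<close>.\<close>
  have "\<phi> (w0 * p * w0) \<le> ennreal ((1 + e) * c)" if e: "e > 0" for e
  proof -
    have "(\<lambda>N. ennreal ((1 + e) * c + (1 + 1/e) * (K * (1/8)^N))) \<longlonglongrightarrow> ennreal ((1 + e) * c + (1 + 1/e) * (K * 0))"
      by (intro tendsto_ennrealI tendsto_intros LIMSEQ_power_zero) simp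
    then have "(\<lambda>N. ennreal ((1 + e) * c + (1 + 1/e) * (K * (1/8)^N))) \<longlonglongrightarrow> ennreal ((1 + e) * c)" by simp
    then show ?thesis by (rule LIMSEQ_le_const) (use main[OF e] in blast)
  qed
  note le = this
  have "(\<lambda>n. ennreal ((1 + inverse (real (Suc n))) * c)) \<longlonglongrightarrow> ennreal ((1 + 0) * c)"
    by (intro tendsto_ennrealI tendsto_intros LIMSEQ_inverse_real_of_nat)
  then have "(\<lambda>n. ennreal ((1 + inverse (real (Suc n))) * c)) \<longlonglongrightarrow> ennreal c" by simp
  then show ?thesis by (rule LIMSEQ_le_const) (use le in auto)
qed

text \<open>The compressions \<open>w0 p w0\<close>, with \<open>p\<close> the projections onto
  \<open>[M'S]\<close> for finite \<open>S\<close>, are directed and have supremum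
  \<open>w0^2\<close>. Normality therefore reduces the claim to \<open>weight_projection_le\<close>,
  where finitely many vectors, hence sequences, suffice.\<close>

theorem weight_closed_sublevel:
  assumes c: "0 \<le> c"
  shows "closedin wot {w \<in> M. adj w = w \<and> norm w \<le> R \<and> \<phi> (w * w) \<le> ennreal c}" (is "closedin wot ?C")
proof -
  have "wot closure_of ?C \<subseteq> ?C"
  proof
    fix w0 assume w0: "w0 \<in> wot closure_of ?C"
    have R: "0 \<le> R"
    proof -
      have "?C \<noteq> {}" using w0 by (intro notI) simp
      then obtain w :: "'a endo" where "norm w \<le> R" by blast
      then show ?thesis using norm_ge_zero[of w] by linarith
    qed
    have "closedin wot (M \<inter> ({w. adj w = w} \<inter> {w. norm w \<le> R}))"
      by (intro closedin_Int closedin_wot_vna vnM closedin_wot_sa closedin_wot_ball R)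
    then have "wot closure_of ?C \<subseteq> M \<inter> ({w. adj w = w} \<inter> {w. norm w \<le> R})"
      by (rule closure_of_minimal[rotated]) auto
    then have w0': "w0 \<in> M" "adj w0 = w0" "norm w0 \<le> R" using w0 by auto
    have "\<exists>p. \<forall>S. p S \<in> M \<and> adj (p S) = p S \<and> p S * p S = p S \<and> (\<forall>x. p S \<cdot> x \<in> cyc M S) \<and> (\<forall>x\<in>cyc M S. p S \<cdot> x = x)"
      by (rule choice) (use ex_cyc_projection[OF vnM] in blast)
    then obtain p where p: "\<And>S. p S \<in> M" "\<And>S. adj (p S) = p S" "\<And>S. p S * p S = p S"
      "\<And>S x. p S \<cdot> x \<in> cyc M S" "\<And>S x. x \<in> cyc M S \<Longrightarrow> p S \<cdot> x = x" by blast
    define D where "D = {w0 * p S * w0 | S. finite S}"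
    have qfp: "qf (w0 * p S * w0) x = (norm (p S \<cdot> w0 \<cdot> x))\<^sup>2" for S x
    proof -
      have "qf (w0 * p S * w0) x = qf (p S * p S) (w0 \<cdot> x)"
        using qf_conj[of x w0 "p S"] w0'(2) by (simp add: p(3))
      then show ?thesis unfolding qf_square[OF p(2)] .
    qed
    have contr: "norm (p S \<cdot> y) \<le> norm y" for S y
    proof -
      have "norm (p S \<cdot> y) * norm (p S \<cdot> y) = inner y (p S \<cdot> y)"
        using qf_square[OF p(2), of y S] p(3) by (simp add: power2_eq_square)
      also have "\<dots> \<le> norm y * norm (p S \<cdot> y)" by (rule norm_cauchy_schwarz)
      finally show ?thesis by (cases "p S \<cdot> y = 0") auto
    qed
    have pmono: "norm (p S \<cdot> y) \<le> norm (p S' \<cdot> y)" if "S \<subseteq> S'" for S S' y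
    proof -
      have "p S' * p S = p S"
        by (rule endo_eqI, simp only: app_simps, rule p(5), rule subsetD[OF cyc_mono[OF that]], rule p(4))
      from arg_cong[OF this, of adj] have "p S * p S' = p S" by (simp add: p(2))
      from arg_cong[OF this, of "\<lambda>T. T \<cdot> y"] have "p S \<cdot> y = p S \<cdot> p S' \<cdot> y" by simp
      then show ?thesis using contr[of S "p S' \<cdot> y"] by simp
    qed
    have Dmem: "w0 * p S * w0 \<in> M" "pos (w0 * p S * w0)" for S
    proof -
      show "w0 * p S * w0 \<in> M" by (intro ops w0' p)
      have "pos (p S)" using pos_square[OF p(2), of S] p(3) by simp
      then show "pos (w0 * p S * w0)" by (rule pos_conj_sa) (rule w0'(2))
    qed
    have w0m: "w0 * w0 \<in> M" "pos (w0 * w0)" using square_mem w0' by auto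
    have "\<phi> (w0 * w0) = (SUP y\<in>D. \<phi> y)"
    proof (rule normal[OF _ _ w0m])
      show "D \<noteq> {}" unfolding D_def by blast
      show "\<And>y. y \<in> D \<Longrightarrow> y \<in> M \<and> pos y" using Dmem by (auto simp: D_def)
    next
      fix y z assume "y \<in> D" "z \<in> D"
      then obtain S S' where S: "finite S" "finite S'" "y = w0 * p S * w0" "z = w0 * p S' * w0"
        unfolding D_def by blast
      have "pos (w0 * p (S \<union> S') * w0 - y) \<and> pos (w0 * p (S \<union> S') * w0 - z)"
        unfolding S by (intro conjI pos_diffI pos_adj Dmem; simp only: qfp; intro power_mono pmono) auto
      then show "\<exists>w\<in>D. pos (w - y) \<and> pos (w - z)" using S unfolding D_def by blast
    next
      fix y assume "y \<in> D"
      then obtain S where S: "y = w0 * p S * w0" unfolding D_def by blast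
      show "pos (w0 * w0 - y)" unfolding S
        by (intro pos_diffI pos_adj Dmem w0m; simp only: qfp qf_square[OF w0'(2)]; intro power_mono contr) auto
    next
      fix z assume z: "z \<in> M" "pos z" "\<And>y. y \<in> D \<Longrightarrow> pos (z - y)"
      show "pos (z - w0 * w0)"
      proof (rule pos_diffI[OF pos_adj[OF w0m(2)] pos_adj[OF z(2)]])
        fix v
        \<comment> \<open>An upper bound need only be tested at one vector \<open>v\<close> at a
          time, and \<open>S = {w0 v}\<close> already gives equality at \<open>v\<close>.\<close>
        have "w0 * p {w0 \<cdot> v} * w0 \<in> D" unfolding D_def by blast
        then have "qf (w0 * p {w0 \<cdot> v} * w0) v \<le> qf z v" by (intro pos_diffD z)
        moreover have "p {w0 \<cdot> v} \<cdot> w0 \<cdot> v = w0 \<cdot> v" by (rule p(5)) (rule cyc_base', simp)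
        ultimately show "qf (w0 * w0) v \<le> qf z v" by (simp only: qfp qf_square[OF w0'(2)])
      qed
    qed
    also have "\<dots> \<le> ennreal c"
      using weight_projection_le[OF c w0 _ p(1,2,3,4)] by (auto simp: D_def intro: SUP_least)
    finally show "w0 \<in> ?C" using w0' by simp
  qed
  then show ?thesis using closure_of_subset_eq[of ?C wot] by simp
qed

end

section \<open>A finite minimax principle\<close>

definition cvx :: "'v::real_vector set \<Rightarrow> ('v \<Rightarrow> real) \<Rightarrow> bool" where
  "cvx K f \<longleftrightarrow> (\<forall>x\<in>K. \<forall>y\<in>K. \<forall>t. 0 \<le> t \<longrightarrow> t \<le> 1 \<longrightarrow> f ((1 - t) *\<^sub>R x + t *\<^sub>R y) \<le> (1 - t) * f x + t * f y)"

lemma cvxD: "cvx K f \<Longrightarrow> x \<in> K \<Longrightarrow> y \<in> K \<Longrightarrow> 0 \<le> t \<Longrightarrow> t \<le> 1 \<Longrightarrow>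
    f ((1 - t) *\<^sub>R x + t *\<^sub>R y) \<le> (1 - t) * f x + t * f y"
  by (simp add: cvx_def)

lemma cvx_subset: "cvx K f \<Longrightarrow> L \<subseteq> K \<Longrightarrow> cvx L f"
  unfolding cvx_def by blast

lemma cvx_add: "cvx K f \<Longrightarrow> cvx K g \<Longrightarrow> cvx K (\<lambda>x. f x + g x)"
proof -
  assume f: "cvx K f" and g: "cvx K g"
  have "f ((1 - t) *\<^sub>R x + t *\<^sub>R y) + g ((1 - t) *\<^sub>R x + t *\<^sub>R y) \<le> (1 - t) * (f x + g x) + t * (f y + g y)"
    if "x \<in> K" "y \<in> K" "0 \<le> t" "t \<le> 1" for x y t
    using add_mono[OF cvxD[OF f that] cvxD[OF g that]] by (simp add: algebra_simps)
  then show ?thesis by (simp add: cvx_def)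
qed

lemma cvx_scale: "0 \<le> r \<Longrightarrow> cvx K f \<Longrightarrow> cvx K (\<lambda>x. r * f x)"
proof -
  assume r: "0 \<le> r" and f: "cvx K f"
  have "r * f ((1 - t) *\<^sub>R x + t *\<^sub>R y) \<le> (1 - t) * (r * f x) + t * (r * f y)"
    if "x \<in> K" "y \<in> K" "0 \<le> t" "t \<le> 1" for x y t
    using mult_left_mono[OF cvxD[OF f that] r] by (simp add: algebra_simps)
  then show ?thesis by (simp add: cvx_def)
qed

lemma cvx_sum: "finite J \<Longrightarrow> (\<And>i. i \<in> J \<Longrightarrow> cvx K (f i)) \<Longrightarrow> cvx K (\<lambda>x. \<Sum>i\<in>J. f i x)"
proof (induction J rule: finite_induct)
  case (insert i J) then show ?case using cvx_add[of K "f i" "\<lambda>x. \<Sum>i\<in>J. f i x"] by simp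
qed (simp add: cvx_def)

text \<open>In the plane, the quadrant below \<open>(c, c)\<close> is disjoint from the convex set
  of pairs dominating some \<open>(h y, f y)\<close>. The quadrant is unbounded downwards, so a
  separating normal has nonnegative entries; normalizing it yields the weights \<open>1 - t\<close>
  and \<open>t\<close>.\<close>

lemma minimax_two:
  assumes K: "convex K" "K \<noteq> {}" and h: "cvx K h" and f: "cvx K f" and c: "\<And>y. y \<in> K \<Longrightarrow> h y > c \<or> f y > c"
  shows "\<exists>t. 0 \<le> t \<and> t \<le> 1 \<and> (\<forall>y\<in>K. (1 - t) * h y + t * f y \<ge> c)"
proof -
  define S where "S = {(a::real, b::real). a \<le> c \<and> b \<le> c}"
  define T where "T = {(a, b). \<exists>y\<in>K. h y \<le> a \<and> f y \<le> b}"
  have "convex S"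
    unfolding S_def convex_def by (auto intro!: convex_bound_le)
  moreover have "convex T"
    unfolding convex_alt
  proof (intro ballI allI impI)
    fix p q and u :: real assume "p \<in> T" "q \<in> T" and u: "0 \<le> u \<and> u \<le> 1"
    then obtain x y where x: "x \<in> K" "h x \<le> fst p" "f x \<le> snd p" and y: "y \<in> K" "h y \<le> fst q" "f y \<le> snd q"
      by (auto simp: T_def)
    have "(1 - u) *\<^sub>R x + u *\<^sub>R y \<in> K" using K(1) x(1) y(1) u by (simp add: convex_alt)
    moreover have "h ((1 - u) *\<^sub>R x + u *\<^sub>R y) \<le> (1 - u) * fst p + u * fst q"
      using x y u by (intro order_trans[OF cvxD[OF h]] add_mono mult_left_mono) auto
    moreover have "f ((1 - u) *\<^sub>R x + u *\<^sub>R y) \<le> (1 - u) * snd p + u * snd q"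
      using x y u by (intro order_trans[OF cvxD[OF f]] add_mono mult_left_mono) auto
    ultimately show "(1 - u) *\<^sub>R p + u *\<^sub>R q \<in> T" by (cases p, cases q) (auto simp: T_def)
  qed
  moreover have "S \<noteq> {}" by (auto simp: S_def intro!: exI[of _ c])
  moreover have "T \<noteq> {}" using K(2) by (auto simp: T_def)
  moreover have "S \<inter> T = {}" using c by (force simp: S_def T_def)
  ultimately obtain p b where p: "p \<noteq> 0" "\<And>x. x \<in> S \<Longrightarrow> inner p x \<le> b" "\<And>x. x \<in> T \<Longrightarrow> inner p x \<ge> b"
    using separating_hyperplane_sets[of S T] by metis
  obtain \<alpha> \<beta> where ab: "p = (\<alpha>, \<beta>)" by (cases p)
  have Sle: "\<alpha> * x + \<beta> * y \<le> b" if "x \<le> c" "y \<le> c" for x y using p(2)[of "(x, y)"] that by (simp add: S_def ab)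
  have "0 \<le> \<alpha>"
  proof (rule ccontr)
    assume "\<not> 0 \<le> \<alpha>"
    define x where "x = min c ((b + 1 - \<beta> * c) / \<alpha>)"
    have "x \<le> (b + 1 - \<beta> * c) / \<alpha>" by (simp add: x_def)
    then have "\<alpha> * x \<ge> b + 1 - \<beta> * c" using \<open>\<not> 0 \<le> \<alpha>\<close> by (simp add: field_simps)
    then show False using Sle[of x c] by (simp add: x_def)
  qed
  have "0 \<le> \<beta>"
  proof (rule ccontr)
    assume "\<not> 0 \<le> \<beta>"
    define x where "x = min c ((b + 1 - \<alpha> * c) / \<beta>)"
    have "x \<le> (b + 1 - \<alpha> * c) / \<beta>" by (simp add: x_def)
    then have "\<beta> * x \<ge> b + 1 - \<alpha> * c" using \<open>\<not> 0 \<le> \<beta>\<close> by (simp add: field_simps)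
    then show False using Sle[of c x] by (simp add: x_def)
  qed
  have s: "\<alpha> + \<beta> > 0" using \<open>0 \<le> \<alpha>\<close> \<open>0 \<le> \<beta>\<close> p(1) ab by (cases "\<alpha> = 0"; cases "\<beta> = 0") (auto simp: zero_prod_def)
  have "(1 - \<beta> / (\<alpha> + \<beta>)) * h y + \<beta> / (\<alpha> + \<beta>) * f y \<ge> c" if "y \<in> K" for y
  proof -
    have "\<alpha> * h y + \<beta> * f y \<ge> b" using p(3)[of "(h y, f y)"] that by (auto simp: T_def ab)
    then have "(\<alpha> + \<beta>) * c \<le> \<alpha> * h y + \<beta> * f y" using Sle[of c c] by (simp add: distrib_right)
    then have "c \<le> (\<alpha> * h y + \<beta> * f y) / (\<alpha> + \<beta>)" using s by (simp add: pos_le_divide_eq mult.commute)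
    moreover have "1 - \<beta> / (\<alpha> + \<beta>) = \<alpha> / (\<alpha> + \<beta>)" using s by (simp add: field_simps)
    ultimately show ?thesis by (simp add: add_divide_distrib)
  qed
  then show ?thesis using \<open>0 \<le> \<alpha>\<close> \<open>0 \<le> \<beta>\<close> s by (intro exI[of _ "\<beta> / (\<alpha> + \<beta>)"]) auto
qed

text \<open>Induction with the set allowed to shrink: on the part of \<open>K\<close> where
  \<open>f i\<close> is at most \<open>c\<close>, the other functions already satisfy the hypothesis
  and have a good mixture there; elsewhere \<open>f i\<close> itself exceeds \<open>c\<close>.
  \<open>minimax_two\<close> merges the mixture with \<open>f i\<close>. It needs strict
  inequalities, which is why the level drops from \<open>c\<close> to \<open>c'\<close>, in each
  step only half of the way.\<close>

lemma minimax:
  assumes "finite J" "convex K" "K \<noteq> {}" "\<And>i. i \<in> J \<Longrightarrow> cvx K (f i)"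
    and "\<And>y. y \<in> K \<Longrightarrow> \<exists>i\<in>J. f i y > c" and "c' < c"
  shows "\<exists>\<kappa>. (\<forall>i\<in>J. 0 \<le> \<kappa> i) \<and> sum \<kappa> J = 1 \<and> (\<forall>y\<in>K. (\<Sum>i\<in>J. \<kappa> i * f i y) \<ge> (c'::real))"
  using assms
proof (induction J arbitrary: K c c' rule: finite_induct)
  case empty then show ?case by blast
next
  case (insert i J)
  define K' where "K' = {y \<in> K. f i y \<le> c}"
  show ?case
  proof (cases "K' = {}")
    case True
    then have "c' \<le> f i y" if "y \<in> K" for y using that insert.prems(5) by (force simp: K'_def)
    moreover have "(\<Sum>j\<in>insert i J. (if j = i then 1 else 0) * f j y) = f i y" for y
    proof -
      have "(\<Sum>j\<in>J. (if j = i then 1 else 0) * f j y) = 0"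
        by (rule sum.neutral) (use insert.hyps in auto)
      then show ?thesis using insert.hyps by simp
    qed
    moreover have "(\<Sum>j\<in>insert i J. if j = i then 1 else 0::real) = 1"
      using insert.hyps by (simp add: sum.delta)
    ultimately show ?thesis
      by (intro exI[of _ "\<lambda>j. if j = i then 1 else 0"]) auto
  next
    case False
    have cf: "cvx K (f i)" using insert.prems(3) by simp
    have "convex K'"
      unfolding convex_alt
    proof (intro ballI allI impI)
      fix x y and u :: real assume xy: "x \<in> K'" "y \<in> K'" and u: "0 \<le> u \<and> u \<le> 1"
      have "f i ((1 - u) *\<^sub>R x + u *\<^sub>R y) \<le> (1 - u) * c + u * c"
        using xy u by (intro order_trans[OF cvxD[OF cf]] add_mono mult_left_mono) (auto simp: K'_def)
      then show "(1 - u) *\<^sub>R x + u *\<^sub>R y \<in> K'"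
        using xy u insert.prems(1) by (auto simp: K'_def convex_alt algebra_simps)
    qed
    define c'' where "c'' = (c + c') / 2"
    have c'': "c' < c''" "c'' < c" using insert.prems(5) by (auto simp: c''_def)
    have "\<exists>\<kappa>. (\<forall>j\<in>J. 0 \<le> \<kappa> j) \<and> sum \<kappa> J = 1 \<and> (\<forall>y\<in>K'. (\<Sum>j\<in>J. \<kappa> j * f j y) \<ge> c'')"
    proof (rule insert.IH[OF \<open>convex K'\<close> False _ _ c''(2)])
      show "cvx K' (f j)" if "j \<in> J" for j
        using insert.prems(3)[of j] that cvx_subset[of K "f j" K'] by (auto simp: K'_def)
      show "\<exists>j\<in>J. c < f j y" if "y \<in> K'" for y using insert.prems(4)[of y] that by (force simp: K'_def)
    qed
    then obtain \<kappa> where \<kappa>: "\<And>j. j \<in> J \<Longrightarrow> 0 \<le> \<kappa> j" "sum \<kappa> J = 1" "\<And>y. y \<in> K' \<Longrightarrow> (\<Sum>j\<in>J. \<kappa> j * f j y) \<ge> c''" by blast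
    have "cvx K (\<lambda>y. \<Sum>j\<in>J. \<kappa> j * f j y)"
      using insert by (intro cvx_sum cvx_scale \<kappa>) auto
    moreover have "c' < (\<Sum>j\<in>J. \<kappa> j * f j y) \<or> c' < f i y" if "y \<in> K" for y
      using \<kappa>(3)[of y] that c'' by (force simp: K'_def)
    ultimately obtain t where t: "0 \<le> t" "t \<le> 1" "\<And>y. y \<in> K \<Longrightarrow> (1 - t) * (\<Sum>j\<in>J. \<kappa> j * f j y) + t * f i y \<ge> c'"
      using minimax_two[OF insert.prems(1,2) _ cf] by blast
    define \<mu> where "\<mu> j = (if j = i then t else (1 - t) * \<kappa> j)" for j
    have \<mu>J: "\<mu> j = (1 - t) * \<kappa> j" if "j \<in> J" for j using that insert.hyps by (auto simp: \<mu>_def)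
    have "(\<Sum>j\<in>insert i J. \<mu> j * f j y) = (1 - t) * (\<Sum>j\<in>J. \<kappa> j * f j y) + t * f i y" for y
      using insert.hyps \<mu>J by (simp add: \<mu>_def[of i] sum_distrib_left mult.assoc)
    moreover have "sum \<mu> (insert i J) = 1"
      using insert.hyps \<mu>J \<kappa>(2) by (simp add: \<mu>_def[of i] flip: sum_distrib_left)
    ultimately show ?thesis using t \<kappa>(1) by (intro exI[of _ \<mu>]) (auto simp: \<mu>_def)
  qed
qed

section \<open>Operator valued weights evaluated at vector functionals\<close>

text \<open>
  \<open>e x \<xi>\<close> stands for the value at the functional \<open>\<langle>\<xi>, \<cdot> \<xi>\<rangle>\<close> of the operator valued weight of \<open>x\<close>.
  The axioms \<open>e_add3\<close> and \<open>e_scaleR\<close> say that \<open>e x\<close> is a quadratic form, in a way that makes sense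
  when infinite values occur.
\<close>

locale opval_weight = complex_unit A I
  for A :: "'a::hilbert_space endo set" and I :: "'a endo" +
  fixes M :: "'a endo set" and e :: "'a endo \<Rightarrow> 'a \<Rightarrow> ennreal"
  assumes vnM: "vna M" and A_sub: "A \<subseteq> M" and I_M: "T \<in> M \<Longrightarrow> T * I = I * T"
    and weight: "normal_weight_on M (\<lambda>x. e x \<xi>)"
    and e_conj: "x \<in> M \<Longrightarrow> pos x \<Longrightarrow> a \<in> A \<Longrightarrow> e (adj a * x * a) \<xi> = e x (a \<cdot> \<xi>)"
    and e_add3: "x \<in> M \<Longrightarrow> pos x \<Longrightarrow>
      e x (\<xi> + (\<eta> + \<zeta>)) + e x (\<xi> - \<eta>) + e x (\<xi> - \<zeta>) = e x (\<xi> - (\<eta> + \<zeta>)) + e x (\<xi> + \<eta>) + e x (\<xi> + \<zeta>)"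
    and e_scaleR: "x \<in> M \<Longrightarrow> pos x \<Longrightarrow> 0 \<le> r \<Longrightarrow>
      e x (\<xi> + r *\<^sub>R \<eta>) + ennreal r * e x (\<xi> - \<eta>) = e x (\<xi> - r *\<^sub>R \<eta>) + ennreal r * e x (\<xi> + \<eta>)"
    and e_comm: "x \<in> M \<Longrightarrow> pos x \<Longrightarrow> u \<in> unis (comm A) \<Longrightarrow> e x (u \<cdot> \<xi>) = e x \<xi>"
    and e_faithful: "x \<in> M \<Longrightarrow> pos x \<Longrightarrow> (\<And>\<xi>. e x \<xi> = 0) \<Longrightarrow> x = 0"
begin

lemmas opsM = vna_ops[OF vnM] and opsA = vna_ops[OF vna]

lemma memA: "a \<in> A \<Longrightarrow> a \<in> M"
  using A_sub by blast

lemma e_homogeneous: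
  assumes "x \<in> M" "pos x" shows "e x (r *\<^sub>R \<xi>) = ennreal (r\<^sup>2) * e x \<xi>"
proof -
  have "r *\<^sub>R 1 \<in> A" by (intro opsA)
  from e_conj[OF assms this, of \<xi>] have "e x (r *\<^sub>R \<xi>) = e (r\<^sup>2 *\<^sub>R x) \<xi>" by (simp add: power2_eq_square)
  then show ?thesis using normal_weight_on.scale[OF weight, of "r\<^sup>2" x] assms by simp
qed

text \<open>The form \<open>e x\<close> is polarized; it commutes with the unitaries of the commutant, so its operator lies in \<open>A\<close>.\<close>

lemma ex_form_operator_A:
  assumes x: "x \<in> M" "pos x" and c: "0 \<le> c" "\<And>\<xi>. e x \<xi> \<le> ennreal (c * (norm \<xi>)\<^sup>2)"
  shows "\<exists>b\<in>A. pos b \<and> (\<forall>\<xi>. e x \<xi> = ennreal (qf b \<xi>))"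
proof -
  define r where "r \<xi> = enn2real (e x \<xi>)" for \<xi>
  have er: "e x \<xi> = ennreal (r \<xi>)" for \<xi>
  proof -
    have "e x \<xi> < top" using c(2)[of \<xi>] ennreal_less_top by (rule le_less_trans)
    then show ?thesis by (simp add: r_def)
  qed
  have r0: "0 \<le> r \<xi>" for \<xi> by (simp add: r_def)
  have rc: "r \<xi> \<le> c * (norm \<xi>)\<^sup>2" for \<xi> using c(2)[of \<xi>] c(1) unfolding er by (simp add: ennreal_le_iff)
  have r_scale: "r (t *\<^sub>R \<xi>) = t\<^sup>2 * r \<xi>" for t \<xi>
    using e_homogeneous[OF x, of t \<xi>] r0 unfolding er by (simp flip: ennreal_mult)
  have r_minus: "r (\<xi> - \<eta>) = r (\<eta> - \<xi>)" for \<xi> \<eta> using r_scale[of "-1" "\<eta> - \<xi>"] by simp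
  have r3: "r (\<xi> + (\<eta> + \<zeta>)) + r (\<xi> - \<eta>) + r (\<xi> - \<zeta>) = r (\<xi> - (\<eta> + \<zeta>)) + r (\<xi> + \<eta>) + r (\<xi> + \<zeta>)" for \<xi> \<eta> \<zeta>
    using e_add3[OF x, of \<xi> \<eta> \<zeta>] r0 unfolding er by (simp flip: ennreal_plus add: ennreal_inj add_nonneg_nonneg)
  have rs: "r (\<xi> + t *\<^sub>R \<eta>) + t * r (\<xi> - \<eta>) = r (\<xi> - t *\<^sub>R \<eta>) + t * r (\<xi> + \<eta>)" if "0 \<le> t" for t \<xi> \<eta>
    using e_scaleR[OF x that, of \<xi> \<eta>] r0 that unfolding er
    by (simp flip: ennreal_plus ennreal_mult add: ennreal_inj add_nonneg_nonneg)
  define B where "B \<xi> \<eta> = (1/4) * (r (\<xi> + \<eta>) - r (\<xi> - \<eta>))" for \<xi> \<eta>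
  have sym: "B \<xi> \<eta> = B \<eta> \<xi>" for \<xi> \<eta> unfolding B_def using r_minus[of \<xi> \<eta>] by (simp add: add.commute)
  have Badd: "B \<xi> (\<eta> + \<zeta>) = B \<xi> \<eta> + B \<xi> \<zeta>" for \<xi> \<eta> \<zeta> unfolding B_def using r3[of \<xi> \<eta> \<zeta>] by (simp add: field_simps)
  have Bs: "B \<xi> (t *\<^sub>R \<eta>) = t * B \<xi> \<eta>" for \<xi> \<eta> t
  proof (cases "0 \<le> t")
    case True then show ?thesis unfolding B_def using rs[OF True, of \<xi> \<eta>] by (simp add: algebra_simps)
  next
    case False
    then have "0 \<le> - t" by simp
    from rs[OF this, of \<xi> \<eta>] show ?thesis unfolding B_def by (simp add: algebra_simps)
  qed
  have B1: "\<bar>B \<xi> \<eta>\<bar> \<le> c" if "norm \<xi> \<le> 1" "norm \<eta> \<le> 1" for \<xi> \<eta>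
  proof -
    have "c * (norm (\<xi> + \<eta>))\<^sup>2 \<le> c * 2\<^sup>2" "c * (norm (\<xi> - \<eta>))\<^sup>2 \<le> c * 2\<^sup>2"
      using norm_triangle_ineq[of \<xi> \<eta>] norm_triangle_ineq4[of \<xi> \<eta>] that
      by (intro mult_left_mono power_mono c; simp)+
    then have "r (\<xi> + \<eta>) \<le> 4 * c" "r (\<xi> - \<eta>) \<le> 4 * c" using rc[of "\<xi> + \<eta>"] rc[of "\<xi> - \<eta>"] by simp_all
    then show ?thesis unfolding B_def using r0[of "\<xi> + \<eta>"] r0[of "\<xi> - \<eta>"] by (simp add: abs_le_iff)
  qed
  have "bounded_bilinear B"
  proof
    fix \<xi> \<xi>' \<eta> \<eta>' :: 'a and t :: real
    show "B \<xi> (\<eta> + \<eta>') = B \<xi> \<eta> + B \<xi> \<eta>'" by (rule Badd)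
    show "B (\<xi> + \<xi>') \<eta> = B \<xi> \<eta> + B \<xi>' \<eta>" using Badd[of \<eta> \<xi> \<xi>'] by (simp add: sym[of _ \<eta>])
    show "B \<xi> (t *\<^sub>R \<eta>) = t *\<^sub>R B \<xi> \<eta>" by (simp add: Bs)
    show "B (t *\<^sub>R \<xi>) \<eta> = t *\<^sub>R B \<xi> \<eta>" using Bs[of \<eta> t \<xi>] by (simp add: sym[of _ \<eta>])
    have "norm (B \<xi> \<eta>) \<le> norm \<xi> * norm \<eta> * c" for \<xi> \<eta>
    proof -
      define u v where "u = (inverse (norm \<xi>)) *\<^sub>R \<xi>" and "v = (inverse (norm \<eta>)) *\<^sub>R \<eta>"
      have uv: "\<xi> = norm \<xi> *\<^sub>R u" "\<eta> = norm \<eta> *\<^sub>R v" "norm u \<le> 1" "norm v \<le> 1"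
        by (cases "\<xi> = 0"; cases "\<eta> = 0"; simp add: u_def v_def)+
      have "B \<xi> \<eta> = norm \<eta> * B \<xi> v" using Bs[of \<xi> "norm \<eta>" v] uv(2) by simp
      also have "B \<xi> v = norm \<xi> * B u v" using Bs[of v "norm \<xi>" u] uv(1) by (simp add: sym[of _ v])
      finally have "norm (B \<xi> \<eta>) = norm \<xi> * norm \<eta> * \<bar>B u v\<bar>" by (simp add: abs_mult mult_ac)
      also have "\<dots> \<le> norm \<xi> * norm \<eta> * c" using B1[OF uv(3,4)] by (intro mult_left_mono) auto
      finally show ?thesis .
    qed
    then show "\<exists>K. \<forall>\<xi> \<eta>. norm (B \<xi> \<eta>) \<le> norm \<xi> * norm \<eta> * K" by blast
  qed
  then obtain b where b: "\<And>\<xi> \<eta>. inner (b \<cdot> \<xi>) \<eta> = B \<xi> \<eta>" using ex_form_operator by blast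
  have bsa: "adj b = b" by (rule adj_eqI) (metis b inner_commute sym)
  have "r (\<xi> + \<xi>) = 4 * r \<xi>" for \<xi> using r_scale[of 2 \<xi>] by (simp add: scaleR_2)
  moreover have "r 0 = 0" using r_scale[of 0 0] by simp
  ultimately have qb: "qf b \<xi> = r \<xi>" for \<xi> using b[of \<xi> \<xi>] by (simp add: inner_commute B_def)
  have "b \<in> comm (comm A)"
  proof (rule complex_unit.commute_of_unitaries[OF complex_unit_comm])
    fix u assume u: "u \<in> unis (comm A)"
    have "adj u * b * u = b"
    proof (rule form_eqI)
      fix \<xi>
      have "ennreal (r (u \<cdot> \<xi>)) = ennreal (r \<xi>)" using e_comm[OF x u, of \<xi>] unfolding er .
      then show "qf (adj u * b * u) \<xi> = qf b \<xi>" unfolding qf_conj qb by (simp add: r0)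
    qed (simp_all add: bsa mult.assoc)
    then have "u * (adj u * b * u) = u * b" by simp
    then have "(u * adj u) * b * u = u * b" by (simp only: mult.assoc)
    then show "b * u = u * b" using unisD[OF u] by simp
  qed
  then have "b \<in> A" using vna_bicomm[OF vna] by simp
  moreover have "pos b" using bsa qb r0 by (simp add: pos_def)
  ultimately show ?thesis using er qb by auto
qed

text \<open>The self-adjoint part of the left ideal usually written \<open>n_E\<close>, the elements
  with \<open>E(y^*y)\<close> bounded.\<close>

definition fin :: "'a endo set" where
  "fin = {y \<in> M. adj y = y \<and> (\<exists>c\<ge>0. \<forall>\<xi>. e (y * y) \<xi> \<le> ennreal (c * (norm \<xi>)\<^sup>2))}"

text \<open>The operator \<open>b_y\<close> of the overview, that is \<open>E(y^2)\<close> as an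
  element of \<open>A\<close>.\<close>

definition bo :: "'a endo \<Rightarrow> 'a endo" where
  "bo y = (SOME b. b \<in> A \<and> pos b \<and> (\<forall>\<xi>. e (y * y) \<xi> = ennreal (qf b \<xi>)))"

lemma finD: "y \<in> fin \<Longrightarrow> y \<in> M" "y \<in> fin \<Longrightarrow> adj y = y" "y \<in> fin \<Longrightarrow> y * y \<in> M" "y \<in> fin \<Longrightarrow> pos (y * y)"
  by (auto simp: fin_def pos_square opsM)

lemma bo:
  assumes "y \<in> fin" shows "bo y \<in> A" "pos (bo y)" "e (y * y) \<xi> = ennreal (qf (bo y) \<xi>)"
proof -
  obtain c where "0 \<le> c" "\<And>\<xi>. e (y * y) \<xi> \<le> ennreal (c * (norm \<xi>)\<^sup>2)" using assms by (auto simp: fin_def)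
  then have "\<exists>b. b \<in> A \<and> pos b \<and> (\<forall>\<xi>. e (y * y) \<xi> = ennreal (qf b \<xi>))"
    using ex_form_operator_A[of "y * y" c] finD[OF assms] by blast
  from someI_ex[OF this] show "bo y \<in> A" "pos (bo y)" "e (y * y) \<xi> = ennreal (qf (bo y) \<xi>)"
    unfolding bo_def by blast+
qed

lemma bo_nonneg: "y \<in> fin \<Longrightarrow> 0 \<le> qf (bo y) \<xi>"
  using bo(2) pos_qf by blast

lemma e_sum2:
  assumes "x \<in> M" "pos x" "y \<in> M" "pos y" "0 \<le> s" "0 \<le> t"
  shows "e (s *\<^sub>R x + t *\<^sub>R y) \<xi> = ennreal s * e x \<xi> + ennreal t * e y \<xi>"
  using assms normal_weight_on.add[OF weight, of "s *\<^sub>R x" "t *\<^sub>R y"] normal_weight_on.scale[OF weight]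
  by (simp add: opsM pos_scale)

lemma e_mono: "x \<in> M \<Longrightarrow> pos x \<Longrightarrow> y \<in> M \<Longrightarrow> pos y \<Longrightarrow> (\<And>v. qf x v \<le> qf y v) \<Longrightarrow> e x \<xi> \<le> e y \<xi>"
  using normal_weight_on.mono[OF weight] .

lemma fin_combination:
  assumes y: "y \<in> fin" and z: "z \<in> fin"
  shows "s *\<^sub>R y + t *\<^sub>R z \<in> fin"
proof -
  let ?w = "s *\<^sub>R y + t *\<^sub>R z"
  obtain c d where c: "0 \<le> c" "\<And>\<xi>. e (y * y) \<xi> \<le> ennreal (c * (norm \<xi>)\<^sup>2)"
    and d: "0 \<le> d" "\<And>\<xi>. e (z * z) \<xi> \<le> ennreal (d * (norm \<xi>)\<^sup>2)"
    using y z by (auto simp: fin_def)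
  have w: "?w \<in> M" "adj ?w = ?w" using finD[OF y] finD[OF z] by (auto intro: opsM)
  have "e (?w * ?w) \<xi> \<le> ennreal ((2 * s\<^sup>2 * c + 2 * t\<^sup>2 * d) * (norm \<xi>)\<^sup>2)" for \<xi>
  proof -
    have "e (?w * ?w) \<xi> \<le> e ((2 * s\<^sup>2) *\<^sub>R (y * y) + (2 * t\<^sup>2) *\<^sub>R (z * z)) \<xi>"
    proof (rule e_mono)
      fix v
      have "(norm (s *\<^sub>R (y \<cdot> v) + t *\<^sub>R (z \<cdot> v)))\<^sup>2 \<le> 2 * (norm (s *\<^sub>R (y \<cdot> v)))\<^sup>2 + 2 * (norm (t *\<^sub>R (z \<cdot> v)))\<^sup>2"
        using parallelogram[of "s *\<^sub>R (y \<cdot> v)" "t *\<^sub>R (z \<cdot> v)"]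
          zero_le_power2[of "norm (s *\<^sub>R (y \<cdot> v) - t *\<^sub>R (z \<cdot> v))"] by linarith
      moreover have "qf ((2 * s\<^sup>2) *\<^sub>R (y * y) + (2 * t\<^sup>2) *\<^sub>R (z * z)) v = 2 * s\<^sup>2 * (norm (y \<cdot> v))\<^sup>2 + 2 * t\<^sup>2 * (norm (z \<cdot> v))\<^sup>2"
        by (simp only: qf_simps) (simp only: qf_square finD[OF y] finD[OF z])
      ultimately show "qf (?w * ?w) v \<le> qf ((2 * s\<^sup>2) *\<^sub>R (y * y) + (2 * t\<^sup>2) *\<^sub>R (z * z)) v"
        unfolding qf_square[OF w(2)] by (simp add: power_mult_distrib)
    qed (use w finD[OF y] finD[OF z] in \<open>auto intro!: pos_add pos_scale pos_square opsM\<close>)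
    also have "\<dots> = ennreal (2 * s\<^sup>2) * e (y * y) \<xi> + ennreal (2 * t\<^sup>2) * e (z * z) \<xi>"
      using finD[OF y] finD[OF z] by (intro e_sum2) auto
    also have "\<dots> \<le> ennreal (2 * s\<^sup>2) * ennreal (c * (norm \<xi>)\<^sup>2) + ennreal (2 * t\<^sup>2) * ennreal (d * (norm \<xi>)\<^sup>2)"
      by (intro add_mono mult_left_mono c d) auto
    also have "\<dots> = ennreal (2 * s\<^sup>2 * (c * (norm \<xi>)\<^sup>2) + 2 * t\<^sup>2 * (d * (norm \<xi>)\<^sup>2))"
      using c(1) d(1) by (simp flip: ennreal_mult ennreal_plus)
    finally show ?thesis by (simp add: algebra_simps)
  qed
  moreover have "0 \<le> 2 * s\<^sup>2 * c + 2 * t\<^sup>2 * d" using c(1) d(1) by simp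
  ultimately show ?thesis using w unfolding fin_def by blast
qed

lemma fin_diff: "y \<in> fin \<Longrightarrow> z \<in> fin \<Longrightarrow> y - z \<in> fin"
  using fin_combination[of y z 1 "-1"] by simp

text \<open>Algebraically \<open>(1 - t) y^2 + t z^2 = w^2 + t (1 - t) (y - z)^2\<close> for
  \<open>w = (1 - t) y + t z\<close>. Both sides are sums of positive terms, so the identity
  survives additivity of a weight with values in \<open>[0, \<infinity>]\<close>. It provides
  convexity of \<open>bo\<close> together with its exact defect.\<close>

lemma bo_convex_identity:
  assumes y: "y \<in> fin" and z: "z \<in> fin" and t: "0 \<le> t" "t \<le> 1"
  shows "(1 - t) * qf (bo y) \<xi> + t * qf (bo z) \<xi>
    = qf (bo ((1 - t) *\<^sub>R y + t *\<^sub>R z)) \<xi> + t * (1 - t) * qf (bo (y - z)) \<xi>"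
proof -
  let ?w = "(1 - t) *\<^sub>R y + t *\<^sub>R z"
  have w: "?w \<in> fin" "y - z \<in> fin" by (intro fin_combination fin_diff y z)+
  have t1: "0 \<le> 1 - t" "0 \<le> t * (1 - t)" using t by auto
  have "?w * ?w = (1 - t)\<^sup>2 *\<^sub>R (y * y) + (t * (1 - t)) *\<^sub>R (y * z + z * y) + t\<^sup>2 *\<^sub>R (z * z)"
    by (simp add: power2_eq_square distrib_left distrib_right scaleR_add_right mult.commute[of "1 - t" t])
  also have "y * z + z * y = y * y + z * z - (y - z) * (y - z)" by (simp add: algebra_simps)
  also have "(1 - t)\<^sup>2 *\<^sub>R (y * y) + (t * (1 - t)) *\<^sub>R (y * y + z * z - (y - z) * (y - z)) + t\<^sup>2 *\<^sub>R (z * z)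
    = ((1 - t)\<^sup>2 + t * (1 - t)) *\<^sub>R (y * y) + (t * (1 - t) + t\<^sup>2) *\<^sub>R (z * z) - (t * (1 - t)) *\<^sub>R ((y - z) * (y - z))"
    unfolding scaleR_add_right scaleR_diff_right scaleR_add_left by (simp only: add_diff_eq diff_add_eq) (simp only: ac_simps)
  also have "(1 - t)\<^sup>2 + t * (1 - t) = 1 - t" by (simp add: power2_eq_square algebra_simps)
  also have "t * (1 - t) + t\<^sup>2 = t" by (simp add: power2_eq_square algebra_simps)
  finally have "(1 - t) *\<^sub>R (y * y) + t *\<^sub>R (z * z) = 1 *\<^sub>R (?w * ?w) + (t * (1 - t)) *\<^sub>R ((y - z) * (y - z))" by simp
  then have "e ((1 - t) *\<^sub>R (y * y) + t *\<^sub>R (z * z)) \<xi> = e (1 *\<^sub>R (?w * ?w) + (t * (1 - t)) *\<^sub>R ((y - z) * (y - z))) \<xi>" by simp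
  then have "ennreal (1 - t) * e (y * y) \<xi> + ennreal t * e (z * z) \<xi>
      = ennreal 1 * e (?w * ?w) \<xi> + ennreal (t * (1 - t)) * e ((y - z) * (y - z)) \<xi>"
    using finD[OF y] finD[OF z] finD[OF w(1)] finD[OF w(2)] t t1 by (simp only: e_sum2 zero_le_one)
  then have "ennreal ((1 - t) * qf (bo y) \<xi> + t * qf (bo z) \<xi>)
      = ennreal (1 * qf (bo ?w) \<xi> + t * (1 - t) * qf (bo (y - z)) \<xi>)"
    unfolding bo(3)[OF y] bo(3)[OF z] bo(3)[OF w(1)] bo(3)[OF w(2)]
    using t t1 bo_nonneg[OF y, of \<xi>] bo_nonneg[OF z, of \<xi>] bo_nonneg[OF w(1), of \<xi>] bo_nonneg[OF w(2), of \<xi>]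
    by (simp only: ennreal_mult[symmetric] ennreal_plus[symmetric] mult_nonneg_nonneg zero_le_one)
  moreover have "0 \<le> (1 - t) * qf (bo y) \<xi> + t * qf (bo z) \<xi>"
    "0 \<le> 1 * qf (bo ?w) \<xi> + t * (1 - t) * qf (bo (y - z)) \<xi>"
    using t t1 bo_nonneg[OF y, of \<xi>] bo_nonneg[OF z, of \<xi>] bo_nonneg[OF w(1), of \<xi>] bo_nonneg[OF w(2), of \<xi>]
    by (simp_all only: add_nonneg_nonneg mult_nonneg_nonneg zero_le_one)
  ultimately show ?thesis by (simp only: ennreal_inj mult_1)
qed

lemma fin_conj:
  assumes y: "y \<in> fin" and u: "u \<in> unis A"
  shows "u * y * adj u \<in> fin" "qf (bo (u * y * adj u)) \<xi> = qf (bo y) (adj u \<cdot> \<xi>)"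
proof -
  have uA: "adj u \<in> A" "u \<in> A" using unisD(1)[OF unis_adj[OF vna u]] unisD(1)[OF u] by auto
  have sq: "(u * y * adj u) * (u * y * adj u) = adj (adj u) * (y * y) * adj u"
  proof -
    have "(u * y * adj u) * (u * y * adj u) = u * y * (adj u * u) * y * adj u" by (simp only: mult.assoc)
    then show ?thesis using unisD[OF u] by (simp add: mult.assoc)
  qed
  have eq: "e ((u * y * adj u) * (u * y * adj u)) \<xi> = e (y * y) (adj u \<cdot> \<xi>)" for \<xi>
    unfolding sq by (rule e_conj[OF finD(3,4)[OF y] uA(1)])
  obtain c where c: "0 \<le> c" "\<And>\<xi>. e (y * y) \<xi> \<le> ennreal (c * (norm \<xi>)\<^sup>2)" using y by (auto simp: fin_def)
  have "e ((u * y * adj u) * (u * y * adj u)) \<xi> \<le> ennreal (c * (norm \<xi>)\<^sup>2)" for \<xi>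
    unfolding eq using c(2)[of "adj u \<cdot> \<xi>"] by (simp add: unis_adj_norm_app[OF u])
  moreover have "u * y * adj u \<in> M" using memA[OF uA(1)] memA[OF uA(2)] finD[OF y] by (intro opsM)
  moreover have "adj (u * y * adj u) = u * y * adj u" using finD[OF y] by (simp add: mult.assoc)
  ultimately show f: "u * y * adj u \<in> fin" using c(1) unfolding fin_def by blast
  show "qf (bo (u * y * adj u)) \<xi> = qf (bo y) (adj u \<cdot> \<xi>)"
    using eq[of \<xi>] unfolding bo(3)[OF f] bo(3)[OF y]
    using bo_nonneg[OF f, of \<xi>] bo_nonneg[OF y, of "adj u \<cdot> \<xi>"] by (simp only: ennreal_inj)
qed

lemma bo_conj:
  assumes y: "y \<in> fin" and u: "u \<in> unis A"
  shows "bo (u * y * adj u) = u * bo y * adj u"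
proof (rule form_eqI)
  show "adj (bo (u * y * adj u)) = bo (u * y * adj u)" by (rule pos_adj[OF bo(2)[OF fin_conj(1)[OF y u]]])
  show "adj (u * bo y * adj u) = u * bo y * adj u" by (rule pos_adj[OF pos_conj'[OF bo(2)[OF y]]])
  show "qf (bo (u * y * adj u)) \<xi> = qf (u * bo y * adj u) \<xi>" for \<xi>
    using fin_conj(2)[OF y u, of \<xi>] qf_conj[of \<xi> "adj u" "bo y"] by simp
qed

lemma bo_eq_0:
  assumes y: "y \<in> fin" and "bo y = 0" shows "y = 0"
proof -
  have "y * y = 0" using bo(3)[OF y] assms(2) by (intro e_faithful finD[OF y]) simp
  then show ?thesis using adj_mult_eq_0[of y] finD[OF y] by simp
qed

text \<open>The two bounds have different purposes: \<open>R\<close> makes the set weakly compact,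
  and \<open>c\<close> makes all operators \<open>bo y\<close> uniformly bounded.\<close>

definition adm :: "real \<Rightarrow> real \<Rightarrow> 'a endo set \<Rightarrow> bool" where
  "adm R c K \<longleftrightarrow> K \<noteq> {} \<and> closedin wot K \<and> convex K \<and>
    (\<forall>y\<in>K. y \<in> M \<and> adj y = y \<and> norm y \<le> R \<and> (\<forall>\<xi>. e (y * y) \<xi> \<le> ennreal (c * (norm \<xi>)\<^sup>2)))"

definition ginv :: "'a endo set \<Rightarrow> 'a endo set \<Rightarrow> bool" where
  "ginv G K \<longleftrightarrow> (\<forall>u\<in>G. \<forall>y\<in>K. u * y * adj u \<in> K)"

definition grp :: "'a endo set \<Rightarrow> bool" where
  "grp G \<longleftrightarrow> G \<subseteq> unis A \<and> 1 \<in> G \<and> (\<forall>u\<in>G. \<forall>v\<in>G. u * v \<in> G) \<and> (\<forall>u\<in>G. adj u \<in> G)"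

definition minimal :: "real \<Rightarrow> real \<Rightarrow> 'a endo set \<Rightarrow> 'a endo set \<Rightarrow> bool" where
  "minimal R c G K \<longleftrightarrow> adm R c K \<and> ginv G K \<and> (\<forall>L\<subseteq>K. adm R c L \<longrightarrow> ginv G L \<longrightarrow> L = K)"

lemma adm_nonneg: "0 \<le> c \<Longrightarrow> adm R c K \<Longrightarrow> y \<in> K \<Longrightarrow> y \<in> fin"
  by (auto simp: adm_def fin_def)

lemma adm_subset: "adm R c K \<Longrightarrow> L \<subseteq> K \<Longrightarrow> L \<noteq> {} \<Longrightarrow> closedin wot L \<Longrightarrow> convex L \<Longrightarrow> adm R c L"
  unfolding adm_def by blast

lemma adm_Inter:
  assumes "adm R c K" and C: "\<And>C. C \<in> \<C> \<Longrightarrow> closedin wot C"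
    and fip: "\<And>\<F>. finite \<F> \<Longrightarrow> \<F> \<subseteq> \<C> \<Longrightarrow> K \<inter> \<Inter>\<F> \<noteq> {}"
  shows "K \<inter> \<Inter>\<C> \<noteq> {}"
  by (rule wot_compact_Inter[where R = R]) (use assms in \<open>auto simp: adm_def\<close>)

text \<open>Zorn's lemma for decreasing chains, run on complements because the principle used
  produces maximal elements. Weak compactness keeps the intersection of a chain nonempty.\<close>

lemma ex_minimal:
  assumes K: "adm R c K" "ginv G K"
  shows "\<exists>K'\<subseteq>K. minimal R c G K'"
proof -
  define \<A> where "\<A> = uminus ` {L. L \<subseteq> K \<and> adm R c L \<and> ginv G L}"
  have "\<exists>N\<in>\<A>. \<forall>X\<in>\<A>. N \<subseteq> X \<longrightarrow> X = N"
  proof (rule subset_Zorn_nonempty)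
    show "\<A> \<noteq> {}" using K by (auto simp: \<A>_def)
    fix \<C> assume ne: "\<C> \<noteq> {}" and ch: "subset.chain \<A> \<C>"
    define \<L> where "\<L> = uminus ` \<C>"
    have \<L>: "L \<subseteq> K \<and> adm R c L \<and> ginv G L" if "L \<in> \<L>" for L
      using that ch unfolding \<L>_def subset.chain_def \<A>_def by auto
    have lin: "L \<subseteq> L' \<or> L' \<subseteq> L" if "L \<in> \<L>" "L' \<in> \<L>" for L L'
      using that ch unfolding \<L>_def subset.chain_def by fastforce
    obtain L0 where L0: "L0 \<in> \<L>" using ne by (auto simp: \<L>_def)
    have least: "\<exists>L\<in>\<L>. L \<subseteq> \<Inter>\<F>" if "finite \<F>" "\<F> \<subseteq> \<L>" for \<F>
      using that
    proof (induction \<F> rule: finite_induct)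
      case (insert L \<F>)
      then obtain L' where "L' \<in> \<L>" "L' \<subseteq> \<Inter>\<F>" by auto
      then show ?case using lin[of L L'] insert.prems by (metis Inter_insert Int_greatest insert_subset order_refl subset_trans)
    qed (use L0 in auto)
    have "K \<inter> \<Inter>\<L> \<noteq> {}"
    proof (rule adm_Inter[OF K(1)])
      show "closedin wot C" if "C \<in> \<L>" for C using \<L>[OF that] by (simp add: adm_def)
      show "K \<inter> \<Inter>\<F> \<noteq> {}" if \<F>: "finite \<F>" "\<F> \<subseteq> \<L>" for \<F>
      proof -
        obtain L where L: "L \<in> \<L>" "L \<subseteq> \<Inter>\<F>" using least[OF \<F>] by blast
        have "L \<noteq> {}" "L \<subseteq> K" using \<L>[OF L(1)] by (auto simp: adm_def)
        then show ?thesis using L(2) by blast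
      qed
    qed
    then have ne': "\<Inter>\<L> \<noteq> {}" by blast
    have sub: "\<Inter>\<L> \<subseteq> K" using L0 \<L> by blast
    have "adm R c (\<Inter>\<L>)"
    proof (rule adm_subset[OF K(1) sub ne'])
      show "closedin wot (\<Inter>\<L>)" using L0 \<L> by (intro closedin_Inter) (auto simp: adm_def)
      show "convex (\<Inter>\<L>)" using \<L> by (intro convex_Inter) (auto simp: adm_def)
    qed
    moreover have "ginv G (\<Inter>\<L>)" using \<L> by (auto simp: ginv_def)
    moreover have "\<Union>\<C> = - \<Inter>\<L>" by (auto simp: \<L>_def)
    ultimately show "\<Union>\<C> \<in> \<A>" using sub by (auto simp: \<A>_def)
  qed
  then obtain N where N: "N \<in> \<A>" "\<forall>X\<in>\<A>. N \<subseteq> X \<longrightarrow> X = N" by (rule bexE)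
  define L where "L = - N"
  have L: "L \<subseteq> K" "adm R c L" "ginv G L" using N(1) by (auto simp: \<A>_def L_def)
  have min: "X = - L" if "X \<in> \<A>" "- L \<subseteq> X" for X using N(2) that by (simp add: L_def)
  have "L' = L" if "L' \<subseteq> L" "adm R c L'" "ginv G L'" for L'
    using min[of "- L'"] that L(1) by (auto simp: \<A>_def)
  then show ?thesis using L by (auto simp: minimal_def)
qed

section \<open>Lower semicontinuous convex functions on minimal sets\<close>

definition lscK :: "'a endo set \<Rightarrow> ('a endo \<Rightarrow> real) \<Rightarrow> bool" where
  "lscK K f \<longleftrightarrow> (\<forall>c. closedin wot {y \<in> K. f y \<le> c})"

lemma lscK_add:
  assumes "lscK K f" "lscK K g" shows "lscK K (\<lambda>y. f y + g y)"
  unfolding lscK_def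
proof
  fix c
  \<comment> \<open>If \<open>f y + g y > c\<close>, some threshold \<open>r\<close> lies strictly
    between \<open>c - g y\<close> and \<open>f y\<close>, for instance their mean; so the sublevel
    set is an intersection of unions of two closed sets.\<close>
  have "{y \<in> K. f y + g y \<le> c} = (\<Inter>r. {y \<in> K. f y \<le> r} \<union> {y \<in> K. g y \<le> c - r})"
  proof (intro equalityI subsetI)
    fix y assume y: "y \<in> (\<Inter>r. {y \<in> K. f y \<le> r} \<union> {y \<in> K. g y \<le> c - r})"
    show "y \<in> {y \<in> K. f y + g y \<le> c}"
    proof (rule ccontr)
      assume *: "y \<notin> {y \<in> K. f y + g y \<le> c}"
      from y have "y \<in> {y \<in> K. f y \<le> (c - g y + f y) / 2} \<union> {y \<in> K. g y \<le> c - (c - g y + f y) / 2}" by blast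
      then show False using * by (auto simp: field_simps)
    qed
  qed auto
  also have "closedin wot \<dots>" using assms by (intro closedin_INT closedin_Un) (auto simp: lscK_def)
  finally show "closedin wot {y \<in> K. f y + g y \<le> c}" .
qed

lemma lscK_sum:
  assumes "closedin wot K" "finite F" "\<And>i. i \<in> F \<Longrightarrow> lscK K (f i)" shows "lscK K (\<lambda>y. \<Sum>i\<in>F. f i y)"
  using assms(2,3)
proof (induction F rule: finite_induct)
  case empty
  have "{y \<in> K. (0::real) \<le> c} = (if 0 \<le> c then K else {})" for c by auto
  then show ?case using assms(1) by (simp add: lscK_def)
next
  case (insert i F) then show ?case using lscK_add[of K "f i" "\<lambda>y. \<Sum>i\<in>F. f i y"] by simp
qed

lemma lscK_bo:
  assumes K: "adm R c K" and c: "0 \<le> c"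
  shows "lscK K (\<lambda>y. qf (bo y) \<xi>)"
  unfolding lscK_def
proof
  fix d
  show "closedin wot {y \<in> K. qf (bo y) \<xi> \<le> d}"
  proof (cases "0 \<le> d")
    case True
    have "{y \<in> K. qf (bo y) \<xi> \<le> d} = K \<inter> {w \<in> M. adj w = w \<and> norm w \<le> R \<and> e (w * w) \<xi> \<le> ennreal d}"
    proof -
      have "e (y * y) \<xi> \<le> ennreal d \<longleftrightarrow> qf (bo y) \<xi> \<le> d" if "y \<in> K" for y
        unfolding bo(3)[OF adm_nonneg[OF c K that]] by (rule ennreal_le_iff[OF True])
      then show ?thesis using K by (auto simp: adm_def)
    qed
    also have "closedin wot \<dots>"
      using K normal_weight_on.weight_closed_sublevel[OF weight True] by (intro closedin_Int) (auto simp: adm_def)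
    finally show ?thesis .
  next
    case False
    have "d < qf (bo y) \<xi>" if "y \<in> K" for y
      using bo_nonneg[OF adm_nonneg[OF c K that], of \<xi>] False by linarith
    then have "{y \<in> K. qf (bo y) \<xi> \<le> d} = {}" by force
    then show ?thesis by (simp only: closedin_empty)
  qed
qed

lemma cvx_bo:
  assumes K: "adm R c K" and c: "0 \<le> c"
  shows "cvx K (\<lambda>y. qf (bo y) \<xi>)"
  unfolding cvx_def
proof (intro ballI allI impI)
  fix y z and t :: real assume yz: "y \<in> K" "z \<in> K" and t: "0 \<le> t" "t \<le> 1"
  have f: "y \<in> fin" "z \<in> fin" using adm_nonneg[OF c K] yz by auto
  have "0 \<le> t * (1 - t) * qf (bo (y - z)) \<xi>" using t bo_nonneg[OF fin_diff[OF f]] by simp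
  then show "qf (bo ((1 - t) *\<^sub>R y + t *\<^sub>R z)) \<xi> \<le> (1 - t) * qf (bo y) \<xi> + t * qf (bo z) \<xi>"
    using bo_convex_identity[OF f t, of \<xi>] by linarith
qed

text \<open>
  On a minimal set every invariant lower semicontinuous convex function is constant. Applied to
  \<open>y \<mapsto> sup\<^sub>u \<Sum>\<^sub>\<xi> \<langle>u\<xi>, E(y\<^sup>2)u\<xi>\<rangle>\<close>, the minimax principle turns the supremum into an
  average, and the parallelogram law does the rest.
\<close>

lemma averaged_contraction:
  assumes G: "grp G" and K: "minimal R c G K" and c: "0 \<le> c" and F: "finite F" and \<epsilon>: "0 < \<epsilon>"
  shows "\<exists>J \<kappa>. finite J \<and> J \<subseteq> G \<and> (\<forall>u\<in>J. 0 \<le> \<kappa> u) \<and> sum \<kappa> J = 1 \<and>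
    (\<forall>y\<in>K. \<forall>z\<in>K. (\<Sum>u\<in>J. \<kappa> u * (\<Sum>\<xi>\<in>F. qf (bo (y - z)) (u \<cdot> \<xi>))) \<le> (\<epsilon>::real))"
proof -
  have adm: "adm R c K" and inv: "ginv G K" and min: "\<And>L. L \<subseteq> K \<Longrightarrow> adm R c L \<Longrightarrow> ginv G L \<Longrightarrow> L = K"
    using K by (auto simp: minimal_def)
  have Kfin: "y \<in> fin" if "y \<in> K" for y by (rule adm_nonneg[OF c adm that])
  have Kc: "convex K" "K \<noteq> {}" "closedin wot K" using adm by (auto simp: adm_def)
  have Gu: "u \<in> unis A" if "u \<in> G" for u using G that by (auto simp: grp_def)
  define f where "f u y = (\<Sum>\<xi>\<in>F. qf (bo y) (u \<cdot> \<xi>))" for u y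
  have lsc: "lscK K (f u)" for u unfolding f_def by (rule lscK_sum[OF Kc(3) F lscK_bo[OF adm c]])
  have cv: "cvx K (f u)" for u unfolding f_def by (rule cvx_sum[OF F cvx_bo[OF adm c]])
  define B where "B = (\<Sum>\<xi>\<in>F. c * (norm \<xi>)\<^sup>2)"
  have fB: "f u y \<le> B" if "u \<in> G" "y \<in> K" for u y
    unfolding f_def B_def
  proof (rule sum_mono)
    fix \<xi>
    have "e (y * y) (u \<cdot> \<xi>) \<le> ennreal (c * (norm \<xi>)\<^sup>2)"
      using adm that(2) unis_norm_app[OF Gu[OF that(1)], of \<xi>] by (metis adm_def)
    then show "qf (bo y) (u \<cdot> \<xi>) \<le> c * (norm \<xi>)\<^sup>2"
      unfolding bo(3)[OF Kfin[OF that(2)]] using c by (simp add: ennreal_le_iff)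
  qed
  have fconj: "f u (v * y * adj v) = f (adj v * u) y" if "y \<in> K" "v \<in> G" for u v y
    unfolding f_def by (simp add: fin_conj(2)[OF Kfin[OF that(1)] Gu[OF that(2)]])
  have bdd: "bdd_above ((\<lambda>u. f u y) ` G)" if "y \<in> K" for y
    by (rule bdd_aboveI[of _ B]) (use fB that in auto)
  have G1: "G \<noteq> {}" using G by (auto simp: grp_def)
  \<comment> \<open>The points at which every \<open>f u\<close> is at most \<open>d\<close> form a
    closed convex set, invariant since conjugation by \<open>v\<close> only permutes the indices
    \<open>u\<close>. If nonempty it is all of \<open>K\<close> by minimality.\<close>
  have const: "f u z \<le> d" if d: "\<And>u. u \<in> G \<Longrightarrow> f u y \<le> d" and y: "y \<in> K" and z: "z \<in> K" and u: "u \<in> G" for y z u d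
  proof -
    define L where "L = (\<Inter>u\<in>G. {y \<in> K. f u y \<le> d})"
    have LK: "L \<subseteq> K" using G1 by (auto simp: L_def)
    have "L = K"
    proof (rule min[OF LK])
      show "adm R c L"
      proof (rule adm_subset[OF adm LK])
        show "L \<noteq> {}" using d y by (auto simp: L_def)
        show "closedin wot L" unfolding L_def using G1 lsc by (intro closedin_INT) (auto simp: lscK_def)
        show "convex L" unfolding L_def
        proof (intro convex_INT)
          fix u
          show "convex {y \<in> K. f u y \<le> d}"
            unfolding convex_alt
          proof (intro ballI allI impI)
            fix x y and t :: real assume xy: "x \<in> {y \<in> K. f u y \<le> d}" "y \<in> {y \<in> K. f u y \<le> d}" and t: "0 \<le> t \<and> t \<le> 1"
            have "f u ((1 - t) *\<^sub>R x + t *\<^sub>R y) \<le> (1 - t) * d + t * d"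
              using xy t by (intro order_trans[OF cvxD[OF cv]] add_mono mult_left_mono) auto
            then show "(1 - t) *\<^sub>R x + t *\<^sub>R y \<in> {y \<in> K. f u y \<le> d}"
              using xy t Kc(1) by (auto simp: convex_alt algebra_simps)
          qed
        qed
      qed
      show "ginv G L"
        unfolding ginv_def
      proof (intro ballI)
        fix v y assume v: "v \<in> G" and y: "y \<in> L"
        then have yK: "y \<in> K" using LK by blast
        have "f u (v * y * adj v) \<le> d" if "u \<in> G" for u
        proof -
          have "adj v * u \<in> G" using G v that by (auto simp: grp_def)
          then show ?thesis using y by (auto simp: fconj[OF yK v] L_def)
        qed
        moreover have "v * y * adj v \<in> K" using inv v yK by (auto simp: ginv_def)
        ultimately show "v * y * adj v \<in> L" by (auto simp: L_def)
      qed
    qed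
    then show ?thesis using z u by (auto simp: L_def)
  qed
  obtain y0 where y0: "y0 \<in> K" using Kc(2) by blast
  define d where "d = (SUP u\<in>G. f u y0)"
  have le_d: "f u y \<le> d" if "u \<in> G" "y \<in> K" for u y
    by (rule const[OF _ y0 that(2,1)]) (auto simp: d_def intro: cSUP_upper bdd[OF y0])
  have ge_d: "d \<le> d'" if "y \<in> K" "\<And>u. u \<in> G \<Longrightarrow> f u y \<le> d'" for y d'
    unfolding d_def by (rule cSUP_least[OF G1]) (rule const[OF that(2,1) y0])
  \<comment> \<open>The loss adds up to \<open>2 d + 2 d - 4 (d - 2 \<delta>) = 8 \<delta>\<close>,
    once for each end point and four times at the midpoint.\<close>
  define \<delta> where "\<delta> = \<epsilon> / 8"
  have \<delta>: "0 < \<delta>" using \<epsilon> by (simp add: \<delta>_def)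
  define \<C> where "\<C> = (\<lambda>u. {y \<in> K. f u y \<le> d - \<delta>}) ` G"
  have "K \<inter> \<Inter>\<C> = {}"
  proof (rule ccontr)
    assume "K \<inter> \<Inter>\<C> \<noteq> {}"
    then obtain y where "y \<in> K" "\<And>u. u \<in> G \<Longrightarrow> f u y \<le> d - \<delta>" by (auto simp: \<C>_def)
    then have "d \<le> d - \<delta>" by (rule ge_d)
    then show False using \<delta> by simp
  qed
  moreover have "closedin wot C" if "C \<in> \<C>" for C using that lsc by (auto simp: \<C>_def lscK_def)
  ultimately obtain \<F> where \<F>: "finite \<F>" "\<F> \<subseteq> \<C>" "K \<inter> \<Inter>\<F> = {}" using adm_Inter[OF adm, of \<C>] by blast
  obtain J where J: "J \<subseteq> G" "finite J" "\<F> = (\<lambda>u. {y \<in> K. f u y \<le> d - \<delta>}) ` J"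
    using finite_subset_image[OF \<F>(1) \<F>(2)[unfolded \<C>_def]] by blast
  have gt: "\<exists>u\<in>J. d - \<delta> < f u y" if "y \<in> K" for y
    using \<F>(3) that unfolding J(3) by fastforce
  \<comment> \<open>By compactness finitely many \<open>u\<close> suffice, and the mixture
    \<open>\<kappa>\<close> does not depend on \<open>y\<close>. The resulting bound is uniform over
    \<open>K\<close>, which \<open>averaged_contraction_ball\<close> relies on.\<close>
  have "\<exists>\<kappa>. (\<forall>u\<in>J. 0 \<le> \<kappa> u) \<and> sum \<kappa> J = 1 \<and> (\<forall>y\<in>K. (\<Sum>u\<in>J. \<kappa> u * f u y) \<ge> d - 2 * \<delta>)" (is "\<exists>\<kappa>. ?P \<kappa>")
    by (rule minimax[OF J(2) Kc(1,2) cv gt]) (use \<delta> in auto)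
  then obtain \<kappa> where P: "?P \<kappa>" by (elim exE)
  have \<kappa>: "u \<in> J \<Longrightarrow> 0 \<le> \<kappa> u" "sum \<kappa> J = 1" "y \<in> K \<Longrightarrow> (\<Sum>u\<in>J. \<kappa> u * f u y) \<ge> d - 2 * \<delta>" for u y
    using P by auto
  have up: "(\<Sum>u\<in>J. \<kappa> u * f u y) \<le> d" if "y \<in> K" for y
  proof -
    have "(\<Sum>u\<in>J. \<kappa> u * f u y) \<le> (\<Sum>u\<in>J. \<kappa> u * d)"
      using le_d that J(1) \<kappa>(1) by (intro sum_mono mult_left_mono) auto
    then show ?thesis using \<kappa>(2) by (simp flip: sum_distrib_right)
  qed
  have "(\<Sum>u\<in>J. \<kappa> u * f u (y - z)) \<le> \<epsilon>" if yz: "y \<in> K" "z \<in> K" for y z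
  proof -
    let ?m = "(1 - 1/2) *\<^sub>R y + (1/2) *\<^sub>R z"
    have m: "?m \<in> K" by (rule convexD_alt[OF Kc(1) yz]) simp_all
    have eq: "f u (y - z) = 2 * f u y + 2 * f u z - 4 * f u ?m" for u
    proof -
      have "qf (bo (y - z)) \<xi> = 2 * qf (bo y) \<xi> + 2 * qf (bo z) \<xi> - 4 * qf (bo ?m) \<xi>" for \<xi>
        using bo_convex_identity[OF Kfin[OF yz(1)] Kfin[OF yz(2)], of "1/2" \<xi>] by (simp add: field_simps)
      then show ?thesis by (simp only: f_def sum.distrib sum_subtractf sum_distrib_left)
    qed
    have "(\<Sum>u\<in>J. \<kappa> u * f u (y - z))
        = 2 * (\<Sum>u\<in>J. \<kappa> u * f u y) + 2 * (\<Sum>u\<in>J. \<kappa> u * f u z) - 4 * (\<Sum>u\<in>J. \<kappa> u * f u ?m)"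
    proof -
      have "(\<Sum>u\<in>J. \<kappa> u * f u (y - z)) = (\<Sum>u\<in>J. 2 * (\<kappa> u * f u y) + 2 * (\<kappa> u * f u z) - 4 * (\<kappa> u * f u ?m))"
        unfolding eq by (intro sum.cong refl) (simp only: right_diff_distrib distrib_left mult.left_commute)
      then show ?thesis by (simp only: sum.distrib sum_subtractf sum_distrib_left)
    qed
    then show ?thesis using up[OF yz(1)] up[OF yz(2)] \<kappa>(3)[OF m] by (simp add: \<delta>_def)
  qed
  then show ?thesis using J(1,2) \<kappa>(1,2) unfolding f_def
    by (intro exI[of _ J] exI[of _ \<kappa>] conjI ballI) simp_all
qed

lemma ex_contracting_unitary:
  assumes G: "grp G" and K: "minimal R c G K" and c: "0 \<le> c" and F: "finite F" and \<epsilon>: "0 < \<epsilon>"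
    and yz: "y \<in> K" "z \<in> K"
  shows "\<exists>u\<in>G. (\<Sum>\<xi>\<in>F. qf (bo (y - z)) (u \<cdot> \<xi>)) \<le> \<epsilon>"
proof -
  obtain J \<kappa> where J: "finite J" "J \<subseteq> G" "\<And>u. u \<in> J \<Longrightarrow> 0 \<le> \<kappa> u" "sum \<kappa> J = 1"
    and le: "(\<Sum>u\<in>J. \<kappa> u * (\<Sum>\<xi>\<in>F. qf (bo (y - z)) (u \<cdot> \<xi>))) \<le> \<epsilon>"
    using averaged_contraction[OF G K c F \<epsilon>] yz by blast
  have "\<exists>u\<in>J. (\<Sum>\<xi>\<in>F. qf (bo (y - z)) (u \<cdot> \<xi>)) \<le> \<epsilon>"
  proof (rule ccontr)
    assume "\<not> ?thesis"
    then have gt: "\<epsilon> < (\<Sum>\<xi>\<in>F. qf (bo (y - z)) (u \<cdot> \<xi>))" if "u \<in> J" for u using that by force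
    have "\<exists>u\<in>J. 0 < \<kappa> u"
      using J(3,4) by (metis less_eq_real_def sum.neutral zero_neq_one)
    then have "(\<Sum>u\<in>J. \<kappa> u * \<epsilon>) < (\<Sum>u\<in>J. \<kappa> u * (\<Sum>\<xi>\<in>F. qf (bo (y - z)) (u \<cdot> \<xi>)))"
      using gt J(3) by (intro sum_strict_mono_ex1 J(1)) (auto intro: mult_left_mono less_imp_le mult_strict_left_mono)
    then show False using le J(4) by (simp flip: sum_distrib_right)
  qed
  then show ?thesis using J(2) by blast
qed


section \<open>The ideal of elements on which the adjoint is strongly continuous\<close>

text \<open>
  \<open>b \<in> Jp\<close> says that \<open>a b a\<^sup>* \<rightarrow> 0\<close> weakly for every bounded net \<open>a \<rightarrow> 0\<close> in the strong topology of
  \<open>A\<close>. The span of \<open>Jp\<close> is a two-sided ideal; it plays the role of the compact operators relative to \<open>A\<close>.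
\<close>

definition Jp :: "'a endo set" where
  "Jp = {b \<in> A. pos b \<and> (\<forall>\<xi> \<epsilon>. 0 < \<epsilon> \<longrightarrow> (\<exists>V \<delta>. finite V \<and> 0 < \<delta> \<and>
    (\<forall>a\<in>A. norm a \<le> 1 \<longrightarrow> (\<forall>v\<in>V. norm (a \<cdot> v) \<le> \<delta>) \<longrightarrow> qf b (adj a \<cdot> \<xi>) \<le> \<epsilon>)))}"

lemma JpI:
  assumes "b \<in> A" "pos b"
    and "\<And>\<xi> \<epsilon>. 0 < \<epsilon> \<Longrightarrow> \<exists>V \<delta>. finite V \<and> 0 < \<delta> \<and>
      (\<forall>a\<in>A. norm a \<le> 1 \<longrightarrow> (\<forall>v\<in>V. norm (a \<cdot> v) \<le> \<delta>) \<longrightarrow> qf b (adj a \<cdot> \<xi>) \<le> \<epsilon>)"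
  shows "b \<in> Jp"
  using assms unfolding Jp_def by blast

lemma JpE:
  assumes "b \<in> Jp" "0 < \<epsilon>"
  obtains V \<delta> where "finite V" "0 < \<delta>"
    "\<forall>a\<in>A. norm a \<le> 1 \<longrightarrow> (\<forall>v\<in>V. norm (a \<cdot> v) \<le> \<delta>) \<longrightarrow> qf b (adj a \<cdot> \<xi>) \<le> \<epsilon>"
proof -
  have "\<exists>V \<delta>. finite V \<and> 0 < \<delta> \<and>
    (\<forall>a\<in>A. norm a \<le> 1 \<longrightarrow> (\<forall>v\<in>V. norm (a \<cdot> v) \<le> \<delta>) \<longrightarrow> qf b (adj a \<cdot> \<xi>) \<le> \<epsilon>)"
    using assms unfolding Jp_def by blast
  then show ?thesis using that by blast
qed

lemma Jp_A: "b \<in> Jp \<Longrightarrow> b \<in> A" and Jp_pos: "b \<in> Jp \<Longrightarrow> pos b"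
  by (auto simp: Jp_def)

lemma Jp_hereditary:
  assumes b: "b \<in> Jp" and b': "b' \<in> A" "pos b'" and le: "\<And>v. qf b' v \<le> qf b v"
  shows "b' \<in> Jp"
proof (rule JpI[OF b'])
  fix \<xi> and \<epsilon> :: real assume "0 < \<epsilon>"
  with b obtain V \<delta> where V: "finite V" "0 < \<delta>"
    "\<forall>a\<in>A. norm a \<le> 1 \<longrightarrow> (\<forall>v\<in>V. norm (a \<cdot> v) \<le> \<delta>) \<longrightarrow> qf b (adj a \<cdot> \<xi>) \<le> \<epsilon>"
    by (rule JpE[where \<xi> = \<xi>])
  then show "\<exists>V \<delta>. finite V \<and> 0 < \<delta> \<and>
      (\<forall>a\<in>A. norm a \<le> 1 \<longrightarrow> (\<forall>v\<in>V. norm (a \<cdot> v) \<le> \<delta>) \<longrightarrow> qf b' (adj a \<cdot> \<xi>) \<le> \<epsilon>)"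
    using le order_trans by (intro exI[of _ V] exI[of _ \<delta>]) blast
qed

lemma Jp_zero: "0 \<in> Jp"
  by (rule JpI) (auto simp: opsA pos_zero intro!: exI[of _ "{}"] exI[of _ 1])

lemma Jp_add:
  assumes b: "b \<in> Jp" "b' \<in> Jp" shows "b + b' \<in> Jp"
proof (rule JpI)
  show "b + b' \<in> A" "pos (b + b')" using b by (auto intro: opsA pos_add Jp_A Jp_pos)
  fix \<xi> and \<epsilon> :: real assume "0 < \<epsilon>"
  then have e2: "0 < \<epsilon> / 2" by simp
  from b(1) e2 obtain V \<delta> where V: "finite V" "0 < \<delta>"
    "\<forall>a\<in>A. norm a \<le> 1 \<longrightarrow> (\<forall>v\<in>V. norm (a \<cdot> v) \<le> \<delta>) \<longrightarrow> qf b (adj a \<cdot> \<xi>) \<le> \<epsilon> / 2" by (rule JpE[where \<xi> = \<xi>])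
  from b(2) e2 obtain V' \<delta>' where V': "finite V'" "0 < \<delta>'"
    "\<forall>a\<in>A. norm a \<le> 1 \<longrightarrow> (\<forall>v\<in>V'. norm (a \<cdot> v) \<le> \<delta>') \<longrightarrow> qf b' (adj a \<cdot> \<xi>) \<le> \<epsilon> / 2" by (rule JpE[where \<xi> = \<xi>])
  have "qf (b + b') (adj a \<cdot> \<xi>) \<le> \<epsilon>"
    if a: "a \<in> A" "norm a \<le> 1" and s: "\<And>v. v \<in> V \<union> V' \<Longrightarrow> norm (a \<cdot> v) \<le> min \<delta> \<delta>'" for a
  proof -
    have "qf b (adj a \<cdot> \<xi>) \<le> \<epsilon> / 2" by (rule V(3)[rule_format, OF a]) (use s in auto)
    moreover have "qf b' (adj a \<cdot> \<xi>) \<le> \<epsilon> / 2" by (rule V'(3)[rule_format, OF a]) (use s in auto)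
    ultimately show ?thesis unfolding qf_simps by linarith
  qed
  then show "\<exists>V \<delta>. finite V \<and> 0 < \<delta> \<and>
      (\<forall>a\<in>A. norm a \<le> 1 \<longrightarrow> (\<forall>v\<in>V. norm (a \<cdot> v) \<le> \<delta>) \<longrightarrow> qf (b + b') (adj a \<cdot> \<xi>) \<le> \<epsilon>)"
    using V(1,2) V'(1,2) by (intro exI[of _ "V \<union> V'"] exI[of _ "min \<delta> \<delta>'"]) auto
qed

lemma Jp_sum: "finite F \<Longrightarrow> F \<subseteq> Jp \<Longrightarrow> \<Sum>F \<in> Jp"
  by (induction F rule: finite_induct) (auto intro: Jp_zero Jp_add)

lemma Jp_scale:
  assumes b: "b \<in> Jp" and r: "0 \<le> r" shows "r *\<^sub>R b \<in> Jp"
proof (rule JpI)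
  show "r *\<^sub>R b \<in> A" "pos (r *\<^sub>R b)" using b r by (auto intro: opsA pos_scale Jp_A Jp_pos)
  fix \<xi> and \<epsilon> :: real assume "0 < \<epsilon>"
  then have e2: "0 < \<epsilon> / (r + 1)" using r by simp
  from b e2 obtain V \<delta> where V: "finite V" "0 < \<delta>"
    "\<forall>a\<in>A. norm a \<le> 1 \<longrightarrow> (\<forall>v\<in>V. norm (a \<cdot> v) \<le> \<delta>) \<longrightarrow> qf b (adj a \<cdot> \<xi>) \<le> \<epsilon> / (r + 1)" by (rule JpE[where \<xi> = \<xi>])
  have "qf (r *\<^sub>R b) (adj a \<cdot> \<xi>) \<le> \<epsilon>"
    if a: "a \<in> A" "norm a \<le> 1" and s: "\<And>v. v \<in> V \<Longrightarrow> norm (a \<cdot> v) \<le> \<delta>" for a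
  proof -
    have "r * qf b (adj a \<cdot> \<xi>) \<le> (r + 1) * (\<epsilon> / (r + 1))"
      using V(3)[rule_format, OF a s] r pos_qf[OF Jp_pos[OF b], of "adj a \<cdot> \<xi>"] by (intro mult_mono) auto
    then show ?thesis unfolding qf_simps using r by simp
  qed
  then show "\<exists>V \<delta>. finite V \<and> 0 < \<delta> \<and>
      (\<forall>a\<in>A. norm a \<le> 1 \<longrightarrow> (\<forall>v\<in>V. norm (a \<cdot> v) \<le> \<delta>) \<longrightarrow> qf (r *\<^sub>R b) (adj a \<cdot> \<xi>) \<le> \<epsilon>)"
    using V(1,2) by (intro exI[of _ V] exI[of _ \<delta>]) auto
qed

lemma Jp_conj:
  assumes b: "b \<in> Jp" and u: "u \<in> unis A" shows "u * b * adj u \<in> Jp"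
proof (rule JpI)
  show "u * b * adj u \<in> A" using Jp_A[OF b] unisD(1)[OF u] vna_adj[OF vna] by (intro opsA) auto
  show "pos (u * b * adj u)" by (rule pos_conj'[OF Jp_pos[OF b]])
  fix \<xi> and \<epsilon> :: real assume "0 < \<epsilon>"
  with b obtain V \<delta> where V: "finite V" "0 < \<delta>"
    "\<forall>a\<in>A. norm a \<le> 1 \<longrightarrow> (\<forall>v\<in>V. norm (a \<cdot> v) \<le> \<delta>) \<longrightarrow> qf b (adj a \<cdot> \<xi>) \<le> \<epsilon>" by (rule JpE[where \<xi> = \<xi>])
  have "qf (u * b * adj u) (adj a \<cdot> \<xi>) \<le> \<epsilon>"
    if a: "a \<in> A" "norm a \<le> 1" and s: "\<And>v. v \<in> (\<lambda>v. u \<cdot> v) ` V \<Longrightarrow> norm (a \<cdot> v) \<le> \<delta>" for a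
  proof -
    have "norm (a * u) \<le> 1 * 1" using a(2) unis_norm[OF u] by (intro order_trans[OF norm_mult_ineq] mult_mono) auto
    moreover have "a * u \<in> A" using a(1) unisD(1)[OF u] by (intro opsA)
    ultimately have "qf b (adj (a * u) \<cdot> \<xi>) \<le> \<epsilon>" using s by (intro V(3)[rule_format]) auto
    then show ?thesis using qf_conj[of "adj a \<cdot> \<xi>" "adj u" b] by simp
  qed
  then show "\<exists>V \<delta>. finite V \<and> 0 < \<delta> \<and>
      (\<forall>a\<in>A. norm a \<le> 1 \<longrightarrow> (\<forall>v\<in>V. norm (a \<cdot> v) \<le> \<delta>) \<longrightarrow> qf (u * b * adj u) (adj a \<cdot> \<xi>) \<le> \<epsilon>)"
    using V(1,2) by (intro exI[of _ "(\<lambda>v. u \<cdot> v) ` V"] exI[of _ \<delta>]) auto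
qed

text \<open>
  Almost orthogonal families. A new element can only be made small on finitely many vectors, so it
  is the new element that is corrected, by the resolvent \<open>G\<close> of a large multiple of \<open>\<Sum> z z\<^sup>*\<close> over the old ones \<open>z\<close>.
\<close>

lemma orthogonal_family:
  fixes n :: nat
  assumes r: "r \<in> A" and R: "0 \<le> R"
    and hyp: "\<And>V \<delta>. finite V \<Longrightarrow> 0 < \<delta> \<Longrightarrow>
      \<exists>c\<in>A. norm (r * c) \<le> R \<and> c0 \<le> norm ((r * c) \<cdot> \<xi>) \<and> (\<forall>v\<in>V. norm (adj (r * c) \<cdot> v) \<le> \<delta>)"
    and c1: "c1 < c0" and \<kappa>: "0 < (\<kappa>::real)" and V: "finite V" and \<delta>: "0 < \<delta>"
  shows "\<exists>c. (\<forall>i<n. c i \<in> A \<and> norm (r * c i) \<le> R \<and> c1 \<le> norm ((r * c i) \<cdot> \<xi>) \<and> (\<forall>v\<in>V. norm (adj (r * c i) \<cdot> v) \<le> \<delta>)) \<and>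
    (\<forall>i<n. \<forall>j<n. i \<noteq> j \<longrightarrow> norm (adj (r * c i) * (r * c j)) \<le> \<kappa>)"
  using V \<delta>
proof (induction n arbitrary: V \<delta>)
  case 0 then show ?case by simp
next
  case (Suc n)
  obtain c where c: "c \<in> A" "norm (r * c) \<le> R" "c0 \<le> norm ((r * c) \<cdot> \<xi>)" "\<And>v. v \<in> V \<Longrightarrow> norm (adj (r * c) \<cdot> v) \<le> \<delta> / 2"
    using hyp[of V "\<delta> / 2"] Suc.prems by auto
  define z where "z = r * c"
  \<comment> \<open>Chosen so that \<open>sqrt k * R <= \<kappa>\<close>; below, the old elements
    satisfy \<open>norm (adj z_i * G) <= sqrt k\<close>.\<close>
  define k where "k = (\<kappa> / (R + 1))\<^sup>2"
  have k: "0 < k" using \<kappa> R by (simp add: k_def)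
  define \<eta> where "\<eta> = min (c0 - c1) (\<delta> / (2 * (R + 1)))"
  have \<eta>: "0 < \<eta>" "\<eta> \<le> c0 - c1" "R * \<eta> \<le> \<delta> / 2"
  proof -
    show "0 < \<eta>" using c1 Suc.prems(2) R by (simp add: \<eta>_def)
    show "\<eta> \<le> c0 - c1" by (simp add: \<eta>_def)
    have "R * \<eta> \<le> (R + 1) * (\<delta> / (2 * (R + 1)))"
      using R \<open>0 < \<eta>\<close> by (intro mult_mono) (auto simp: \<eta>_def)
    also have "(R + 1) * (\<delta> / (2 * (R + 1))) = \<delta> / 2"
    proof -
      have "R + 1 \<noteq> 0" using R by simp
      then show ?thesis by (simp only: times_divide_eq_right mult_divide_mult_cancel_left mult.commute[of 2 "R + 1"] mult_divide_mult_cancel_left_if) simp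
    qed
    finally show "R * \<eta> \<le> \<delta> / 2" .
  qed
  \<comment> \<open>Makes the sum of \<open>n\<close> terms \<open>d^2\<close> at most
    \<open>k * \<eta>^2\<close>. The form of \<open>Y\<close> is then at most
    \<open>\<eta>^2\<close> at the critical vectors, and \<open>G\<close> moves these by at most
    \<open>\<eta>\<close>.\<close>
  define d where "d = min \<delta> (\<eta> * sqrt (k / (real n + 1)))"
  have d: "0 < d" using Suc.prems(2) \<eta>(1) k by (simp add: d_def)
  have d2: "real n * d\<^sup>2 \<le> k * \<eta>\<^sup>2"
  proof -
    have "d\<^sup>2 \<le> (\<eta> * sqrt (k / (real n + 1)))\<^sup>2" using d by (intro power_mono) (auto simp: d_def)
    also have "\<dots> = \<eta>\<^sup>2 * (k / (real n + 1))" using k by (simp add: power_mult_distrib)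
    finally have "real n * d\<^sup>2 \<le> (real n + 1) * (\<eta>\<^sup>2 * (k / (real n + 1)))" by (intro mult_mono) auto
    then show ?thesis by (simp add: mult.commute)
  qed
  \<comment> \<open>The induction hypothesis enters after \<open>z\<close> is fixed: the other
    \<open>n\<close> elements are made small on \<open>z \<xi>\<close> and on \<open>V\<close>, so
    that the correction of \<open>z\<close> hardly affects its own estimates.\<close>
  obtain cs where cs: "\<And>i. i < n \<Longrightarrow> cs i \<in> A" "\<And>i. i < n \<Longrightarrow> norm (r * cs i) \<le> R" "\<And>i. i < n \<Longrightarrow> c1 \<le> norm ((r * cs i) \<cdot> \<xi>)"
    "\<And>i v. i < n \<Longrightarrow> v \<in> insert (z \<cdot> \<xi>) V \<Longrightarrow> norm (adj (r * cs i) \<cdot> v) \<le> d"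
    "\<And>i j. i < n \<Longrightarrow> j < n \<Longrightarrow> i \<noteq> j \<Longrightarrow> norm (adj (r * cs i) * (r * cs j)) \<le> \<kappa>"
  proof -
    have "finite (insert (z \<cdot> \<xi>) V)" using Suc.prems(1) by simp
    from Suc.IH[OF this d] show ?thesis
    proof (elim exE conjE, goal_cases)
      case (1 cs)
      show ?case by (rule that[of cs]) (use 1 in blast)+
    qed
  qed
  define Z where "Z = (\<Sum>i<n. cs i * adj (r * cs i))"
  define Y where "Y = (1/k) *\<^sub>R (r * Z)"
  have rZ: "r * Z = (\<Sum>i<n. (r * cs i) * adj (r * cs i))" by (simp add: Z_def sum_distrib_left mult.assoc)
  have Yp: "pos Y" unfolding Y_def rZ using k by (intro pos_scale pos_sum pos_mult_adj) simp
  have ZA: "Z \<in> A" unfolding Z_def using cs(1) r by (intro vna_sum[OF vna] opsA vna_adj[OF vna]) auto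
  have YA: "Y \<in> A" unfolding Y_def by (intro opsA ZA r)
  have qY: "k * qf Y v = (\<Sum>i<n. (norm (adj (r * cs i) \<cdot> v))\<^sup>2)" for v
  proof -
    have "k * qf Y v = qf (r * Z) v" using k unfolding Y_def qf_simps by simp
    also have "\<dots> = (\<Sum>i<n. (norm (adj (r * cs i) \<cdot> v))\<^sup>2)"
      unfolding rZ qf_sum by (intro sum.cong refl) (metis adj_adj qf_adj_mult)
    finally show ?thesis .
  qed
  define G where "G = resolvent Y"
  have GA: "G \<in> A" unfolding G_def by (rule vna_resolvent[OF vna YA Yp])
  \<comment> \<open>Solves \<open>r * c' = G * z\<close>, so the corrected element still has left
    factor \<open>r\<close>; the identity \<open>1 - G = Y G\<close> allows this because
    \<open>Y\<close> starts with \<open>r\<close>.\<close>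
  define c' where "c' = c - (1/k) *\<^sub>R (Z * G * z)"
  have c'A: "c' \<in> A" unfolding c'_def z_def by (intro opsA c ZA GA r)
  have rc': "r * c' = G * z"
  proof -
    have "r * c' = z - Y * G * z" by (simp add: c'_def z_def Y_def right_diff_distrib mult.assoc)
    also have "Y * G = 1 - G" unfolding G_def by (rule one_minus_resolvent(1)[OF Yp, symmetric])
    finally show ?thesis by (simp add: left_diff_distrib)
  qed
  have near: "norm (v - G \<cdot> v) \<le> \<eta>" if v: "v \<in> insert (z \<cdot> \<xi>) V" for v
  proof (rule power2_le_imp_le)
    have "k * (norm (v - G \<cdot> v))\<^sup>2 \<le> k * qf Y v"
      using norm_one_minus_resolvent_app[OF Yp, of v] qf_one_minus_resolvent_le[OF Yp, of v] k
      by (intro mult_left_mono) (auto simp: G_def)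
    also have "\<dots> \<le> (\<Sum>i<n. d\<^sup>2)" unfolding qY using cs(4) v by (intro sum_mono power_mono) auto
    also have "\<dots> \<le> k * \<eta>\<^sup>2" using d2 by simp
    finally show "(norm (v - G \<cdot> v))\<^sup>2 \<le> \<eta>\<^sup>2" using k by simp
  qed (use \<eta> in simp)
  have Gn: "norm (G \<cdot> v) \<le> norm v" for v unfolding G_def by (rule norm_resolvent_app[OF Yp])
  have Gsa: "adj G = G" unfolding G_def by (rule resolvent_adj[OF Yp])
  have zR: "norm (z \<cdot> v) \<le> R * norm v" "norm (adj z \<cdot> v) \<le> R * norm v" for v
    using norm_app[of z v] norm_app[of "adj z" v] mult_right_mono[OF c(2)[folded z_def] norm_ge_zero[of v]] by simp_all
  have n1: "norm (r * c') \<le> R" unfolding rc'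
    by (rule norm_endo_le[OF R]) (use Gn zR order_trans in \<open>simp; blast\<close>)
  have n2: "c1 \<le> norm ((r * c') \<cdot> \<xi>)"
    using near[of "z \<cdot> \<xi>"] c(3) \<eta>(2) norm_triangle_ineq2[of "z \<cdot> \<xi>" "z \<cdot> \<xi> - G \<cdot> z \<cdot> \<xi>"]
    unfolding rc' by (simp add: z_def)
  have n3: "norm (adj (r * c') \<cdot> v) \<le> \<delta>" if v: "v \<in> V" for v
  proof -
    have "adj (r * c') \<cdot> v = adj z \<cdot> v - adj z \<cdot> (v - G \<cdot> v)" unfolding rc' by (simp add: Gsa)
    then have "norm (adj (r * c') \<cdot> v) \<le> norm (adj z \<cdot> v) + norm (adj z \<cdot> (v - G \<cdot> v))"
      using norm_triangle_ineq4 by metis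
    also have "norm (adj z \<cdot> (v - G \<cdot> v)) \<le> R * \<eta>"
      using zR(2)[of "v - G \<cdot> v"] mult_left_mono[OF near[OF insertI2[OF v]] R] by linarith
    also have "norm (adj z \<cdot> v) \<le> \<delta> / 2" unfolding z_def by (rule c(4)[OF v])
    finally show ?thesis using \<eta>(3) by linarith
  qed
  have n4: "norm (adj (r * cs i) * (r * c')) \<le> \<kappa>" if i: "i < n" for i
  proof -
    have "norm (adj (r * cs i) * G) \<le> sqrt k"
    proof (rule norm_endo_le)
      fix v
      have "(norm (adj (r * cs i) \<cdot> G \<cdot> v))\<^sup>2 \<le> k * qf Y (G \<cdot> v)"
        unfolding qY using i by (intro member_le_sum) auto
      also have "\<dots> \<le> k * (norm v)\<^sup>2"
        using k qf_T_resolvent_le[OF Yp, of v] by (intro mult_left_mono) (auto simp: G_def)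
      also have "\<dots> = (sqrt k * norm v)\<^sup>2" using k by (simp add: power_mult_distrib)
      finally have "norm (adj (r * cs i) \<cdot> G \<cdot> v) \<le> sqrt k * norm v" by (rule power2_le_imp_le) (use k in simp)
      then show "norm ((adj (r * cs i) * G) \<cdot> v) \<le> sqrt k * norm v" by simp
    qed (use k in simp)
    moreover have "sqrt k = \<kappa> / (R + 1)" using \<kappa> R by (simp add: k_def)
    ultimately have "norm (adj (r * cs i) * G * z) \<le> \<kappa> / (R + 1) * R"
      using c(2) R \<kappa> by (intro order_trans[OF norm_mult_ineq[of "adj (r * cs i) * G"]] mult_mono) (auto simp: z_def simp del: adj_simps)
    also have "\<dots> \<le> \<kappa>" using R \<kappa> by (simp add: field_simps)
    finally show ?thesis unfolding rc' by (simp only: mult.assoc)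
  qed
  have n5: "norm (adj (r * c') * (r * cs i)) \<le> \<kappa>" if i: "i < n" for i
    using n4[OF i] norm_adj[of "adj (r * cs i) * (r * c')"] by (simp only: adj_simps adj_adj)
  have d\<delta>: "d \<le> \<delta>" by (simp add: d_def)
  let ?c = "cs(n := c')"
  have "?c i \<in> A \<and> norm (r * ?c i) \<le> R \<and> c1 \<le> norm ((r * ?c i) \<cdot> \<xi>) \<and> (\<forall>v\<in>V. norm (adj (r * ?c i) \<cdot> v) \<le> \<delta>)"
    if i: "i < Suc n" for i
  proof (cases "i = n")
    case True
    then show ?thesis using c'A n1 n2 n3 by (simp del: app_simps adj_simps)
  next
    case False
    then have "i < n" using i by simp
    then show ?thesis using cs(1,2,3)[of i] cs(4)[of i] d\<delta> by (force simp del: app_simps adj_simps)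
  qed
  moreover have "norm (adj (r * ?c i) * (r * ?c j)) \<le> \<kappa>" if "i < Suc n" "j < Suc n" "i \<noteq> j" for i j
    using that n4[of i] n5[of j] cs(5)[of i j] by (cases "i = n"; cases "j = n") (auto simp del: app_simps adj_simps)
  ultimately show ?case by (intro exI[of _ ?c]) blast
qed

text \<open>Discarding the diagonal terms other than the \<open>k\<close>-th only decreases the
  square, and each of at most \<open>n^2\<close> pairs costs at most \<open>K\<close>.\<close>

lemma norm_sum_ge:
  fixes x :: "nat \<Rightarrow> 'b::real_inner"
  assumes "k < n" "0 \<le> K" "\<And>i j. i < n \<Longrightarrow> j < n \<Longrightarrow> i \<noteq> j \<Longrightarrow> - K \<le> inner (x i) (x j)"
  shows "(norm (x k))\<^sup>2 - (real n)\<^sup>2 * K \<le> (norm (\<Sum>i<n. x i))\<^sup>2"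
proof -
  have "(\<Sum>i<n. \<Sum>j<n. (if i = k \<and> j = k then (norm (x k))\<^sup>2 else 0) - K) \<le> (\<Sum>i<n. \<Sum>j<n. inner (x i) (x j))"
  proof (intro sum_mono)
    fix i j assume "i \<in> {..<n}" "j \<in> {..<n}"
    moreover have "- K \<le> inner (x i) (x i)" using assms(2) inner_ge_zero[of "x i"] by linarith
    ultimately show "(if i = k \<and> j = k then (norm (x k))\<^sup>2 else 0) - K \<le> inner (x i) (x j)"
      using assms(2) assms(3)[of i j] by (cases "i = j") (auto simp: power2_norm_eq_inner)
  qed
  also have "\<dots> = (norm (\<Sum>i<n. x i))\<^sup>2"
    unfolding power2_norm_eq_inner inner_sum_left inner_sum_right by (rule sum.swap)
  also have "(\<Sum>i<n. \<Sum>j<n. (if i = k \<and> j = k then (norm (x k))\<^sup>2 else 0) - K) = (norm (x k))\<^sup>2 - (real n)\<^sup>2 * K"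
  proof -
    have "(\<Sum>j<n. if i = k \<and> j = k then (norm (x k))\<^sup>2 else 0) = (if i = k then (norm (x k))\<^sup>2 else 0)" for i
      using assms(1) by (cases "i = k") auto
    then show ?thesis using assms(1) by (simp add: sum_subtractf power2_eq_square)
  qed
  finally show ?thesis .
qed

section \<open>From unitaries to contractions, and membership of \<open>bo (y - z)\<close> in the
  ideal\<close>

lemma qf_add_le:
  assumes "pos b" shows "qf b (x + y) \<le> 2 * qf b x + 2 * qf b y"
proof -
  have "qf b (x + y) + qf b (x - y) = 2 * qf b x + 2 * qf b y"
    by (simp add: inner_add_left inner_add_right inner_diff_left inner_diff_right)
  then show ?thesis using pos_qf[OF assms, of "x - y"] by linarith
qed

lemma grp_unis: "grp (unis A)"
  using unis_one[OF vna] unis_mult[OF vna] unis_adj[OF vna] by (auto simp: grp_def)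


text \<open>\<open>2 D\<close> is a sum of four unitaries. Two rounds of \<open>qf_add_le\<close>
  cost a factor \<open>4\<close>, which the \<open>2\<close> in front of \<open>D\<close>
  compensates.\<close>

lemma qf_contraction_le:
  assumes b: "pos b" and D: "D \<in> A" "norm D \<le> 1"
  shows "\<exists>u1\<in>unis A. \<exists>u2\<in>unis A. \<exists>u3\<in>unis A. \<exists>u4\<in>unis A. \<forall>\<eta>.
    qf b (D \<cdot> \<eta>) \<le> qf b (u1 \<cdot> \<eta>) + qf b (u2 \<cdot> \<eta>) + qf b (u3 \<cdot> \<eta>) + qf b (u4 \<cdot> \<eta>)"
proof -
  obtain u1 u2 u3 u4 where u: "u1 \<in> unis A" "u2 \<in> unis A" "u3 \<in> unis A" "u4 \<in> unis A"
    and D2: "2 *\<^sub>R D = u1 + u2 + u3 + u4" using ex_four_unitaries[OF D] by blast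
  have "qf b (D \<cdot> \<eta>) \<le> qf b (u1 \<cdot> \<eta>) + qf b (u2 \<cdot> \<eta>) + qf b (u3 \<cdot> \<eta>) + qf b (u4 \<cdot> \<eta>)" for \<eta>
  proof -
    have "4 * qf b (D \<cdot> \<eta>) = qf b ((2 *\<^sub>R D) \<cdot> \<eta>)" by simp
    also have "(2 *\<^sub>R D) \<cdot> \<eta> = (u1 \<cdot> \<eta> + u2 \<cdot> \<eta>) + (u3 \<cdot> \<eta> + u4 \<cdot> \<eta>)" unfolding D2 by (simp add: add.assoc)
    finally show ?thesis
      using qf_add_le[OF b, of "u1 \<cdot> \<eta> + u2 \<cdot> \<eta>" "u3 \<cdot> \<eta> + u4 \<cdot> \<eta>"]
        qf_add_le[OF b, of "u1 \<cdot> \<eta>" "u2 \<cdot> \<eta>"] qf_add_le[OF b, of "u3 \<cdot> \<eta>" "u4 \<cdot> \<eta>"] by linarith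
  qed
  then show ?thesis using u by blast
qed

text \<open>A unitary \<open>v\<close> in front of \<open>u\<close> can be moved into the points: it
  replaces \<open>y\<close>, \<open>z\<close> by their conjugates under \<open>adj v\<close>, again
  in \<open>K\<close>, where the same average applies. \<open>qf_contraction_le\<close> extends this
  to contractions, hence accuracy \<open>\<epsilon> / 4\<close> at the start.\<close>

lemma averaged_contraction_ball:
  assumes K: "minimal R c (unis A) K" and c: "0 \<le> c" and \<epsilon>: "0 < (\<epsilon>::real)"
  shows "\<exists>J \<kappa>. finite J \<and> J \<subseteq> unis A \<and> (\<forall>u\<in>J. 0 \<le> \<kappa> u) \<and> sum \<kappa> J = 1 \<and>
    (\<forall>y\<in>K. \<forall>z\<in>K. \<forall>D\<in>A. norm D \<le> 1 \<longrightarrow> (\<Sum>u\<in>J. \<kappa> u * qf (bo (y - z)) (D \<cdot> u \<cdot> \<xi>)) \<le> \<epsilon>)"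
proof -
  have adm: "adm R c K" and inv: "ginv (unis A) K" using K by (auto simp: minimal_def)
  obtain J \<kappa> where J: "finite J" "J \<subseteq> unis A" "\<forall>u\<in>J. 0 \<le> \<kappa> u" "sum \<kappa> J = 1"
    and le: "\<forall>y\<in>K. \<forall>z\<in>K. (\<Sum>u\<in>J. \<kappa> u * (\<Sum>\<xi>\<in>{\<xi>}. qf (bo (y - z)) (u \<cdot> \<xi>))) \<le> \<epsilon> / 4"
    using averaged_contraction[OF grp_unis K c, of "{\<xi>}" "\<epsilon> / 4"] \<epsilon> by auto
  have "(\<Sum>u\<in>J. \<kappa> u * qf (bo (y - z)) (D \<cdot> u \<cdot> \<xi>)) \<le> \<epsilon>"
    if yz: "y \<in> K" "z \<in> K" and D: "D \<in> A" "norm D \<le> 1" for y z D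
  proof -
    define b where "b = bo (y - z)"
    have f: "y - z \<in> fin" using yz by (intro fin_diff adm_nonneg[OF c adm])
    have unit: "(\<Sum>u\<in>J. \<kappa> u * qf b (v \<cdot> u \<cdot> \<xi>)) \<le> \<epsilon> / 4" if v: "v \<in> unis A" for v
    proof -
      have v': "adj v \<in> unis A" by (rule unis_adj[OF vna v])
      have mem: "adj v * x * v \<in> K" if "x \<in> K" for x
        using bspec[OF bspec[OF inv[unfolded ginv_def] v'] that] by simp
      have "qf b (v \<cdot> u \<cdot> \<xi>) = qf (bo (adj v * y * v - adj v * z * v)) (u \<cdot> \<xi>)" for u
        using fin_conj(2)[OF f v', of "u \<cdot> \<xi>"] by (simp add: b_def algebra_simps)
      then show ?thesis using le[rule_format, OF mem[OF yz(1)] mem[OF yz(2)]] by simp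
    qed
    obtain u1 u2 u3 u4 where u: "u1 \<in> unis A" "u2 \<in> unis A" "u3 \<in> unis A" "u4 \<in> unis A"
      and ub: "\<And>\<eta>. qf b (D \<cdot> \<eta>) \<le> qf b (u1 \<cdot> \<eta>) + qf b (u2 \<cdot> \<eta>) + qf b (u3 \<cdot> \<eta>) + qf b (u4 \<cdot> \<eta>)"
      using qf_contraction_le[OF bo(2)[OF f] D] unfolding b_def by blast
    have "(\<Sum>u\<in>J. \<kappa> u * qf b (D \<cdot> u \<cdot> \<xi>)) \<le> (\<Sum>u\<in>J. \<kappa> u * qf b (u1 \<cdot> u \<cdot> \<xi>) + \<kappa> u * qf b (u2 \<cdot> u \<cdot> \<xi>)
        + \<kappa> u * qf b (u3 \<cdot> u \<cdot> \<xi>) + \<kappa> u * qf b (u4 \<cdot> u \<cdot> \<xi>))"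
      unfolding distrib_left[symmetric] by (intro sum_mono mult_left_mono ub) (use J(3) in blast)
    also have "\<dots> \<le> \<epsilon>"
      unfolding sum.distrib using unit[OF u(1)] unit[OF u(2)] unit[OF u(3)] unit[OF u(4)] by linarith
    finally show ?thesis unfolding b_def .
  qed
  then show ?thesis using J by blast
qed

text \<open>With an almost orthogonal family \<open>r c_i\<close> the operator \<open>T\<close>, the
  sum of \<open>r c_i * adj (h i)\<close>, is large on every \<open>h i \<xi>\<close>; multiplying
  by \<open>S = (1 + adj T * T)^(-1/2)\<close> makes it a contraction. The point is that the lower
  bound depends on \<open>R\<close> and \<open>c1\<close> but not on \<open>n\<close>.\<close>

lemma ex_separating_contraction:
  fixes n :: nat
  assumes r: "r \<in> A" and R: "0 \<le> R"
    and hyp: "\<And>V \<delta>. finite V \<Longrightarrow> 0 < \<delta> \<Longrightarrow>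
      \<exists>c\<in>A. norm (r * c) \<le> R \<and> c0 \<le> norm ((r * c) \<cdot> \<xi>) \<and> (\<forall>v\<in>V. norm (adj (r * c) \<cdot> v) \<le> \<delta>)"
    and c1: "0 < c1" "c1 < c0" and h: "\<And>i. i < n \<Longrightarrow> h i \<in> unis A"
  shows "\<exists>Z\<in>A. norm (r * Z) \<le> 1 \<and> (\<forall>i<n. c1 \<le> 2 * (1 + R) * norm ((r * Z) \<cdot> h i \<cdot> \<xi>))"
proof -
  \<comment> \<open>Limits the total interference of the \<open>n^2\<close> pairs at vectors of norm
    at most \<open>norm \<xi>\<close> to \<open>(c1 / 2)^2\<close>. The added ones avoid division by
    zero.\<close>
  define \<kappa> where "\<kappa> = (c1 / 2)\<^sup>2 / (((real n)\<^sup>2 + 1) * ((norm \<xi>)\<^sup>2 + 1))"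
  have \<kappa>: "0 < \<kappa>" using c1 unfolding \<kappa>_def by (intro divide_pos_pos mult_pos_pos) (auto intro: add_nonneg_pos)
  have \<kappa>2: "(real n)\<^sup>2 * (\<kappa> * (norm \<xi>)\<^sup>2) \<le> (c1 / 2)\<^sup>2"
  proof -
    have "(real n)\<^sup>2 * (norm \<xi>)\<^sup>2 \<le> ((real n)\<^sup>2 + 1) * ((norm \<xi>)\<^sup>2 + 1)" by (intro mult_mono) auto
    then have "\<kappa> * ((real n)\<^sup>2 * (norm \<xi>)\<^sup>2) \<le> \<kappa> * (((real n)\<^sup>2 + 1) * ((norm \<xi>)\<^sup>2 + 1))"
      using \<kappa> by (intro mult_left_mono) auto
    also have "\<dots> = (c1 / 2)\<^sup>2"
    proof -
      have ne: "((real n)\<^sup>2 + 1) * ((norm \<xi>)\<^sup>2 + 1) \<noteq> 0"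
        by (metis add_pos_nonneg mult_eq_0_iff add.commute order_less_irrefl zero_le_power2 zero_less_one)
      show ?thesis unfolding \<kappa>_def by (rule iffD1[OF nonzero_eq_divide_eq[OF ne] refl])
    qed
    finally show ?thesis by (simp add: mult_ac)
  qed
  have "\<exists>c. (\<forall>i<n. c i \<in> A \<and> norm (r * c i) \<le> R \<and> c1 \<le> norm ((r * c i) \<cdot> \<xi>) \<and> (\<forall>v\<in>{}. norm (adj (r * c i) \<cdot> v) \<le> 1)) \<and>
    (\<forall>i<n. \<forall>j<n. i \<noteq> j \<longrightarrow> norm (adj (r * c i) * (r * c j)) \<le> \<kappa>)"
    by (rule orthogonal_family[OF r R _ c1(2) \<kappa>]) (assumption | rule hyp finite.emptyI zero_less_one)+
  then obtain cs where cs: "\<And>i. i < n \<Longrightarrow> cs i \<in> A" "\<And>i. i < n \<Longrightarrow> norm (r * cs i) \<le> R" "\<And>i. i < n \<Longrightarrow> c1 \<le> norm ((r * cs i) \<cdot> \<xi>)"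
    and orth: "\<And>i j. i < n \<Longrightarrow> j < n \<Longrightarrow> i \<noteq> j \<Longrightarrow> norm (adj (r * cs i) * (r * cs j)) \<le> \<kappa>"
  proof (elim exE conjE, goal_cases)
    case (1 cs)
    show ?case by (rule 1(1)[of cs]) (use 1 in blast)+
  qed
  define B where "B i = (r * cs i) * adj (h i)" for i
  define C where "C = (\<Sum>i<n. cs i * adj (h i))"
  define T where "T = r * C"
  have TB: "T = (\<Sum>i<n. B i)" by (simp add: T_def C_def B_def sum_distrib_left mult.assoc)
  have CA: "C \<in> A" unfolding C_def using cs(1) unisD(1)[OF h] by (intro vna_sum[OF vna] opsA vna_adj[OF vna]) auto
  have TA: "T \<in> A" unfolding T_def by (intro opsA r CA)
  define Y where "Y = adj T * T"
  have Yp: "pos Y" unfolding Y_def by (rule pos_adj_mult)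
  have YA: "Y \<in> A" unfolding Y_def by (intro opsA TA vna_adj[OF vna])
  define G where "G = resolvent Y"
  have GA: "G \<in> A" unfolding G_def by (rule vna_resolvent[OF vna YA Yp])
  obtain S where S: "pos S" "S * S = G" "\<And>z. z * G = G * z \<Longrightarrow> z * S = S * z"
    using ex_sqrt[OF resolvent_pos[OF Yp]] unfolding G_def by blast
  have SA: "S \<in> A" by (rule vna_gen[OF vna GA]) (rule S(3))
  have YS: "Y * S = S * Y" by (rule S(3)) (simp add: G_def resolvent_commute[OF Yp])
  \<comment> \<open>\<open>adj (T S) * (T S) = Y S^2 = Y (1 + Y)^-1 = 1 - G\<close>, which is at
    most \<open>1\<close>.\<close>
  have eq: "(norm ((T * S) \<cdot> v))\<^sup>2 = qf (1 - G) v" for v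
  proof -
    have "(norm ((T * S) \<cdot> v))\<^sup>2 = qf (adj (T * S) * (T * S)) v" by (rule qf_adj_mult[symmetric])
    also have "adj (T * S) * (T * S) = S * Y * S" by (simp add: Y_def pos_adj[OF S(1)] mult.assoc)
    also have "\<dots> = Y * (S * S)" by (simp only: YS[symmetric] mult.assoc)
    also have "\<dots> = 1 - G" unfolding S(2) unfolding G_def by (rule one_minus_resolvent(1)[OF Yp, symmetric])
    finally show ?thesis .
  qed
  have "norm (T * S) \<le> 1"
  proof (rule norm_endo_le)
    fix v
    have "(norm ((T * S) \<cdot> v))\<^sup>2 \<le> (norm v)\<^sup>2"
      unfolding eq qf_simps using pos_qf[OF resolvent_pos[OF Yp]] by (simp add: G_def)
    then have "norm ((T * S) \<cdot> v) \<le> norm v" by (rule power2_le_imp_le) simp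
    then show "norm ((T * S) \<cdot> v) \<le> 1 * norm v" by simp
  qed simp
  moreover have "c1 \<le> 2 * (1 + R) * norm ((T * S) \<cdot> h i \<cdot> \<xi>)" if i: "i < n" for i
  proof -
    define \<eta> where "\<eta> = h i \<cdot> \<xi>"
    define y where "y = G \<cdot> \<eta>"
    define L where "L = norm ((T * S) \<cdot> \<eta>)"
    have L0: "0 \<le> L" by (simp add: L_def)
    have ny: "norm y \<le> norm \<xi>"
      using norm_resolvent_app[OF Yp, of \<eta>] unis_norm_app[OF h[OF i]] by (simp add: y_def G_def \<eta>_def)
    have LY: "L\<^sup>2 = qf Y y + (norm (Y \<cdot> y))\<^sup>2"
      unfolding L_def eq unfolding y_def G_def by (rule qf_one_minus_resolvent[OF Yp])
    have Yy: "norm (Y \<cdot> y) \<le> L"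
      by (rule power2_le_imp_le) (use LY pos_qf[OF Yp, of y] L0 in auto)
    have Bn: "norm (B i \<cdot> v) \<le> R * norm v" for v
    proof -
      have "norm (B i \<cdot> v) \<le> norm (r * cs i) * norm (adj (h i) \<cdot> v)" unfolding B_def
        using norm_app[of "r * cs i" "adj (h i) \<cdot> v"] by simp
      also have "\<dots> \<le> R * norm v" using cs(2)[OF i] R unis_adj_norm_app[OF h[OF i]] by (intro mult_mono) auto
      finally show ?thesis .
    qed
    have "(norm (B i \<cdot> y))\<^sup>2 - (real n)\<^sup>2 * (\<kappa> * (norm y)\<^sup>2) \<le> (norm (\<Sum>k<n. B k \<cdot> y))\<^sup>2"
    proof (rule norm_sum_ge[OF i])
      show "0 \<le> \<kappa> * (norm y)\<^sup>2" using \<kappa> by simp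
      fix k j assume kj: "k < n" "j < n" "k \<noteq> j"
      define a where "a = adj (h k) \<cdot> y"
      define a' where "a' = adj (h j) \<cdot> y"
      have "inner (B k \<cdot> y) (B j \<cdot> y) = inner a ((adj (r * cs k) * (r * cs j)) \<cdot> a')"
        by (simp add: B_def a_def a'_def inner_adj_right)
      also have "\<bar>\<dots>\<bar> \<le> norm a * (norm (adj (r * cs k) * (r * cs j)) * norm a')"
        by (rule order_trans[OF Cauchy_Schwarz_ineq2]) (intro mult_left_mono norm_app norm_ge_zero)
      also have "\<dots> \<le> norm a * (\<kappa> * norm a')"
        by (intro mult_left_mono mult_right_mono orth kj norm_ge_zero)
      also have "\<dots> = norm y * (\<kappa> * norm y)"
        unfolding a_def a'_def using unis_adj_norm_app[OF h[OF kj(1)]] unis_adj_norm_app[OF h[OF kj(2)]] by simp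
      finally show "- (\<kappa> * (norm y)\<^sup>2) \<le> inner (B k \<cdot> y) (B j \<cdot> y)"
        by (simp add: power2_eq_square mult.left_commute abs_le_iff)
    qed
    also have "(\<Sum>k<n. B k \<cdot> y) = T \<cdot> y" by (simp add: TB endo_sum_app)
    also have "(norm (T \<cdot> y))\<^sup>2 = qf Y y" unfolding Y_def by (rule qf_adj_mult[symmetric])
    finally have "(norm (B i \<cdot> y))\<^sup>2 \<le> qf Y y + (real n)\<^sup>2 * (\<kappa> * (norm y)\<^sup>2)" by simp
    also have "(real n)\<^sup>2 * (\<kappa> * (norm y)\<^sup>2) \<le> (real n)\<^sup>2 * (\<kappa> * (norm \<xi>)\<^sup>2)"
      using ny \<kappa> by (intro mult_left_mono power_mono) auto
    also have "\<dots> \<le> (c1 / 2)\<^sup>2" by (rule \<kappa>2)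
    also have "qf Y y \<le> L\<^sup>2" using LY by simp
    finally have "(norm (B i \<cdot> y))\<^sup>2 \<le> L\<^sup>2 + (c1 / 2)\<^sup>2" by simp
    also have "\<dots> \<le> (L + c1 / 2)\<^sup>2" using L0 c1 by (simp add: power2_sum)
    finally have By: "norm (B i \<cdot> y) \<le> L + c1 / 2" by (rule power2_le_imp_le) (use L0 c1 in simp)
    \<comment> \<open>Both pieces of \<open>h i \<xi> = y + Y y\<close> are controlled by
      \<open>L\<close>: the first by almost orthogonality, up to \<open>c1 / 2\<close>, the second
      because \<open>norm (Y y) <= L\<close>.\<close>
    have "\<eta> = y + Y \<cdot> y" unfolding y_def G_def by (rule resolvent_split[OF Yp])
    then have "B i \<cdot> \<eta> = B i \<cdot> y + B i \<cdot> Y \<cdot> y" by (metis app_right_simps(1))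
    moreover have "B i \<cdot> \<eta> = (r * cs i) \<cdot> \<xi>" by (simp add: B_def \<eta>_def unis_cancel[OF h[OF i]])
    ultimately have "c1 \<le> norm (B i \<cdot> y + B i \<cdot> Y \<cdot> y)" using cs(3)[OF i] by (simp only:)
    also have "\<dots> \<le> norm (B i \<cdot> y) + norm (B i \<cdot> Y \<cdot> y)" by (rule norm_triangle_ineq)
    also have "\<dots> \<le> (L + c1 / 2) + R * L"
      using By Bn[of "Y \<cdot> y"] mult_left_mono[OF Yy R] by linarith
    finally have "c1 \<le> 2 * (1 + R) * L" by (simp add: algebra_simps)
    then show ?thesis by (simp only: L_def \<eta>_def)
  qed
  ultimately show ?thesis
    by (intro bexI[of _ "C * S"]) (simp_all only: T_def mult.assoc, auto intro: opsA CA SA)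
qed

text \<open>The positive part \<open>p\<close> of \<open>b - t\<close> takes the role of the
  spectral projection: \<open>b >= t\<close> on its range. Failure of \<open>Jp\<close> supplies
  elements \<open>p c\<close> with large value at a fixed \<open>\<xi>\<close> and adjoints small on
  any finite set. Assembled to a contraction \<open>p Z\<close> that is bounded below at all
  \<open>u \<xi>\<close>, \<open>u\<close> in \<open>J\<close>, they contradict the uniform
  smallness of the average.\<close>

theorem bo_diff_mem_Jp:
  assumes c: "0 \<le> c" and K: "minimal R' c (unis A) K" and yz: "y \<in> K" "z \<in> K"
  shows "bo (y - z) \<in> Jp"
proof (rule ccontr)
  define b where "b = bo (y - z)"
  assume "bo (y - z) \<notin> Jp"
  then have nJ: "b \<notin> Jp" by (simp add: b_def)
  have adm: "adm R' c K" using K by (auto simp: minimal_def)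
  have f: "y - z \<in> fin" using yz by (intro fin_diff adm_nonneg[OF c adm])
  have bA: "b \<in> A" and bp: "pos b" unfolding b_def by (rule bo[OF f])+
  obtain \<xi> \<epsilon> where \<epsilon>: "0 < (\<epsilon>::real)" and bad: "\<And>V \<delta>. finite V \<Longrightarrow> 0 < \<delta> \<Longrightarrow>
      \<exists>a\<in>A. norm a \<le> 1 \<and> (\<forall>v\<in>V. norm (a \<cdot> v) \<le> \<delta>) \<and> \<epsilon> < qf b (adj a \<cdot> \<xi>)"
  proof (rule ccontr)
    assume neg: "\<not> thesis"
    have "b \<in> Jp"
    proof (rule JpI[OF bA bp])
      fix \<xi> and \<epsilon> :: real assume "0 < \<epsilon>"
      show "\<exists>V \<delta>. finite V \<and> 0 < \<delta> \<and>
        (\<forall>a\<in>A. norm a \<le> 1 \<longrightarrow> (\<forall>v\<in>V. norm (a \<cdot> v) \<le> \<delta>) \<longrightarrow> qf b (adj a \<cdot> \<xi>) \<le> \<epsilon>)"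
      proof (rule ccontr)
        assume "\<not> ?thesis"
        then have "thesis" using \<open>0 < \<epsilon>\<close> by (intro that[of \<epsilon> \<xi>]) (auto simp: not_le)
        then show False using neg by simp
      qed
    qed
    then show False using nJ by simp
  qed
  \<comment> \<open>Ensures \<open>t |\<xi>|^2 <= \<epsilon> / 2\<close>: the part of
    \<open>b\<close> below \<open>t\<close> accounts for at most half of \<open>\<epsilon>\<close>,
    and the other half must come from \<open>p\<close>. This is also the origin of \<open>c0\<close>
    below.\<close>
  define t where "t = \<epsilon> / (2 * ((norm \<xi>)\<^sup>2 + 1))"
  have n1: "0 < (norm \<xi>)\<^sup>2 + 1" "0 < norm \<xi> + 1" by (simp_all add: add_nonneg_pos)
  have t: "0 < t" using \<epsilon> n1 by (simp add: t_def)
  have t\<xi>: "t * (norm \<xi>)\<^sup>2 \<le> \<epsilon> / 2"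
  proof -
    have "t * (norm \<xi>)\<^sup>2 \<le> t * ((norm \<xi>)\<^sup>2 + 1)" using t by simp
    also have "\<dots> = \<epsilon> / 2"
    proof -
      define X where "X = (norm \<xi>)\<^sup>2 + 1"
      have "X \<noteq> 0" using n1(1) by (simp add: X_def)
      then show ?thesis unfolding t_def X_def[symmetric] by simp
    qed
    finally show ?thesis .
  qed
  define s where "s = b - t *\<^sub>R 1"
  have s: "s \<in> A" "adj s = s" unfolding s_def using bA pos_adj[OF bp] by (auto intro: opsA)
  obtain p n where pn: "pos p" "pos n" "s = p - n" "p * n = 0" "n * p = 0"
    and pc: "\<And>z. z * s = s * z \<Longrightarrow> z * p = p * z"
    using ex_pos_neg_parts[OF s(2)] by blast
  have pA: "p \<in> A" by (rule vna_gen[OF vna s(1) pc])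
  have bs: "b = t *\<^sub>R 1 + p - n" using pn(3) by (simp add: s_def algebra_simps)
  have qb: "qf b v \<le> t * (norm v)\<^sup>2 + qf p v" for v
    unfolding bs qf_simps using pos_qf[OF pn(2), of v] by simp
  have qbp: "t * (norm (p \<cdot> v))\<^sup>2 \<le> qf b (p \<cdot> v)" for v
  proof -
    have "n \<cdot> p \<cdot> v = 0" using arg_cong[OF pn(5), of "\<lambda>T. T \<cdot> v"] by simp
    then have "qf n (p \<cdot> v) = 0" by simp
    then show ?thesis unfolding bs qf_simps using pos_qf[OF pn(1), of "p \<cdot> v"] by simp
  qed
  define c0 where "c0 = \<epsilon> / (2 * (norm \<xi> + 1))"
  have c0: "0 < c0" using \<epsilon> n1 by (simp add: c0_def)
  have hyp: "\<exists>c\<in>A. norm (p * c) \<le> norm p \<and> c0 \<le> norm ((p * c) \<cdot> \<xi>) \<and> (\<forall>v\<in>V. norm (adj (p * c) \<cdot> v) \<le> \<delta>)"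
    if V: "finite V" "0 < \<delta>" for V \<delta>
  proof -
    obtain a where a: "a \<in> A" "norm a \<le> 1" "\<forall>v\<in>(\<lambda>v. p \<cdot> v) ` V. norm (a \<cdot> v) \<le> \<delta>" "\<epsilon> < qf b (adj a \<cdot> \<xi>)"
      using bad[of "(\<lambda>v. p \<cdot> v) ` V" \<delta>] V by auto
    define v where "v = adj a \<cdot> \<xi>"
    have nv: "norm v \<le> norm \<xi>"
      using norm_app[of "adj a" \<xi>] mult_right_mono[OF a(2) norm_ge_zero[of \<xi>]] by (simp add: v_def)
    have "\<epsilon> < t * (norm v)\<^sup>2 + qf p v" using a(4) qb[of v] unfolding v_def by linarith
    also have "t * (norm v)\<^sup>2 \<le> t * (norm \<xi>)\<^sup>2" using nv t by (intro mult_left_mono power_mono) auto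
    also have "t * (norm \<xi>)\<^sup>2 \<le> \<epsilon> / 2" by (rule t\<xi>)
    also have "qf p v \<le> norm v * norm (p \<cdot> v)" by (rule norm_cauchy_schwarz)
    also have "\<dots> \<le> (norm \<xi> + 1) * norm (p \<cdot> v)" using nv by (intro mult_right_mono) auto
    finally have "c0 \<le> norm (p \<cdot> v)" using n1 unfolding c0_def by (simp add: divide_le_eq algebra_simps)
    moreover have "norm (p * adj a) \<le> norm p * 1"
      using a(2) by (intro order_trans[OF norm_mult_ineq] mult_left_mono) auto
    ultimately show ?thesis
      using a(1,3) vna_adj[OF vna a(1)] pos_adj[OF pn(1)] by (intro bexI[of _ "adj a"]) (auto simp: v_def)
  qed
  define R where "R = norm p"
  \<comment> \<open>\<open>d\<close> is fixed before the averaging set \<open>J\<close> is known.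
    This is possible because the bound of \<open>ex_separating_contraction\<close> does not involve
    the number of unitaries; \<open>J\<close> is then chosen for the accuracy
    \<open>t * d^2 / 2\<close>.\<close>
  define d where "d = (c0 / 2) / (2 * (1 + R))"
  have R0: "0 \<le> R" by (simp add: R_def)
  have d: "0 < d" using c0 R0 by (simp add: d_def)
  have td: "0 < t * d\<^sup>2 / 2" using t d by simp
  obtain J \<kappa> where J: "finite J" "J \<subseteq> unis A" "\<forall>u\<in>J. 0 \<le> \<kappa> u" "sum \<kappa> J = (1::real)"
    and le: "\<forall>y\<in>K. \<forall>z\<in>K. \<forall>D\<in>A. norm D \<le> 1 \<longrightarrow> (\<Sum>u\<in>J. \<kappa> u * qf (bo (y - z)) (D \<cdot> u \<cdot> \<xi>)) \<le> t * d\<^sup>2 / 2"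
    using averaged_contraction_ball[OF K c td, of \<xi>] by blast
  obtain h where h: "bij_betw h {0..<card J} J" using ex_bij_betw_nat_finite[OF J(1)] by blast
  then have hJ: "h i \<in> unis A" if "i < card J" for i using that J(2) by (auto simp: bij_betw_def)
  obtain Z where Z: "Z \<in> A" "norm (p * Z) \<le> 1"
    and lower: "\<And>i. i < card J \<Longrightarrow> c0 / 2 \<le> 2 * (1 + R) * norm ((p * Z) \<cdot> h i \<cdot> \<xi>)"
    using ex_separating_contraction[OF pA R0, of c0 \<xi> "c0 / 2" "card J" h] hyp c0 hJ
    unfolding R_def by (auto simp del: app_simps adj_simps)
  have lw: "d \<le> norm ((p * Z) \<cdot> u \<cdot> \<xi>)" if "u \<in> J" for u
  proof -
    have "u \<in> h ` {0..<card J}" using h that by (simp add: bij_betw_def)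
    then obtain i where "u = h i" "i \<in> {0..<card J}" by (rule imageE)
    then show ?thesis using lower[of i] R0 unfolding d_def by (simp add: divide_le_eq algebra_simps)
  qed
  have "t * d\<^sup>2 = (\<Sum>u\<in>J. \<kappa> u * (t * d\<^sup>2))" using J(4) by (simp flip: sum_distrib_right)
  also have "\<dots> \<le> (\<Sum>u\<in>J. \<kappa> u * qf b ((p * Z) \<cdot> u \<cdot> \<xi>))"
  proof (intro sum_mono mult_left_mono)
    fix u assume u: "u \<in> J"
    have "t * d\<^sup>2 \<le> t * (norm (p \<cdot> Z \<cdot> u \<cdot> \<xi>))\<^sup>2" using lw[OF u] t d by (intro mult_left_mono power_mono) auto
    also have "\<dots> \<le> qf b (p \<cdot> Z \<cdot> u \<cdot> \<xi>)" by (rule qbp)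
    finally show "t * d\<^sup>2 \<le> qf b ((p * Z) \<cdot> u \<cdot> \<xi>)" by simp
    show "0 \<le> \<kappa> u" using J(3) u by blast
  qed
  also have "\<dots> \<le> t * d\<^sup>2 / 2" unfolding b_def using le yz Z opsA(7)[OF pA Z(1)] by blast
  finally show False using td by simp
qed


section \<open>Unitaries supported in a corner\<close>

lemma commute_of_skew:
  assumes y: "y * I = I * y" and u: "u - adj u = 2 *\<^sub>R (I * H)" "y * u = u * y" "y * adj u = adj u * y"
  shows "y * H = H * y"
proof -
  have "y * (2 *\<^sub>R (I * H)) = (2 *\<^sub>R (I * H)) * y" unfolding u(1)[symmetric] using u(2,3) by (simp add: algebra_simps)
  then have "y * (I * H) = I * H * y" by simp
  then have "I * (y * H) = I * (H * y)" by (simp only: mult.assoc[symmetric] y)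
  then have "I * I * (y * H) = I * I * (H * y)" by (simp only: mult.assoc)
  then show ?thesis by (simp add: I_sq)
qed

lemma ex_scaling:
  assumes H: "H \<in> A" "adj H = H"
  shows "\<exists>r>0. r *\<^sub>R H \<in> A \<and> adj (r *\<^sub>R H) = r *\<^sub>R H \<and> norm (r *\<^sub>R H) \<le> 1"
proof (intro exI conjI)
  have "norm H + 1 > 0" by (simp add: add_nonneg_pos)
  then show "0 < 1 / (norm H + 1)" "norm ((1 / (norm H + 1)) *\<^sub>R H) \<le> 1" by (simp_all add: divide_le_eq)
qed (use H in \<open>simp_all add: opsA\<close>)

lemma commute_conj_unis: "u \<in> unis A \<Longrightarrow> u * y * adj u = y \<Longrightarrow> y * u = u * y"
proof -
  assume u: "u \<in> unis A" and eq: "u * y * adj u = y"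
  have "y * u = u * y * adj u * u" using eq by simp
  also have "\<dots> = u * y * (adj u * u)" by (simp only: mult.assoc)
  finally show ?thesis using unisD(2)[OF u] by simp
qed

text \<open>
  A vector moved by a strongly null net \<open>b u\<close> with \<open>u - 1\<close> supported on \<open>s\<close>, \<open>s\<^sup>2 \<in> Jp\<close>, has no
  component in the range of \<open>s\<close>: this is where an element of \<open>Jp\<close> forces \<open>bo\<close> to vanish.
\<close>

lemma bo_support:
  assumes c: "0 \<le> c" and G: "grp G" and C: "minimal R c G C" and yz: "y \<in> C" "z \<in> C"
    and n0: "pos n0" "\<And>v. (norm (n0 \<cdot> v))\<^sup>2 \<le> qf n0 v"
    and sJ: "(1 - n0) * (1 - n0) \<in> Jp"
    and Gs: "\<And>u. u \<in> G \<Longrightarrow> (1 - n0) * (u - 1) = u - 1"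
  shows "(1 - n0) * bo (y - z) = 0"
proof (rule endo_eqI)
  fix \<xi>
  define b where "b = bo (y - z)"
  have adm: "adm R c C" using C by (auto simp: minimal_def)
  have f: "y - z \<in> fin" using yz by (intro fin_diff adm_nonneg[OF c adm])
  have bA: "b \<in> A" and bp: "pos b" unfolding b_def by (rule bo[OF f])+
  define \<zeta> where "\<zeta> = b \<cdot> \<xi>"
  define B where "B = norm b + 1"
  have B: "0 < B" "norm b \<le> B" by (simp_all add: B_def add_nonneg_pos)
  have sa: "adj n0 = n0" "adj (1 - n0) = 1 - n0" using pos_adj[OF n0(1)] by simp_all
  have close: "norm \<zeta> \<le> norm (n0 \<cdot> \<zeta>) + \<epsilon>" if \<epsilon>: "0 < \<epsilon>" for \<epsilon>
  proof -
    have e: "0 < (\<epsilon> / B)\<^sup>2" using \<epsilon> B by simp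
    from sJ e obtain V \<delta> where V: "finite V" "0 < \<delta>"
      "\<forall>a\<in>A. norm a \<le> 1 \<longrightarrow> (\<forall>v\<in>V. norm (a \<cdot> v) \<le> \<delta>) \<longrightarrow> qf ((1 - n0) * (1 - n0)) (adj a \<cdot> \<xi>) \<le> (\<epsilon> / B)\<^sup>2"
      by (rule JpE[where \<xi> = \<xi>])
    have "0 < \<delta>\<^sup>2 * B" using V(2) B by simp
    then obtain u where u: "u \<in> G" "(\<Sum>v\<in>V. qf b (u \<cdot> v)) \<le> \<delta>\<^sup>2 * B"
      using ex_contracting_unitary[OF G C c V(1) _ yz] unfolding b_def by blast
    have uA: "u \<in> unis A" using G u(1) by (auto simp: grp_def)
    have u': "adj u \<in> G" using G u(1) by (auto simp: grp_def)
    \<comment> \<open>A contraction that is small on \<open>V\<close> because \<open>b\<close> is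
      small at the vectors \<open>u v\<close>. Its adjoint sends \<open>\<xi>\<close> to a multiple
      of \<open>adj u \<zeta>\<close>, and there the defining property of \<open>Jp\<close> gives
      smallness.\<close>
    define a where "a = (1 / B) *\<^sub>R (b * u)"
    have aA: "a \<in> A" unfolding a_def using bA unisD(1)[OF uA] by (intro opsA)
    have "norm (b * u) \<le> B * 1"
      using B unis_norm[OF uA] by (intro order_trans[OF norm_mult_ineq] mult_mono) auto
    then have a1: "norm a \<le> 1" using B by (simp add: a_def divide_le_eq)
    have "norm (a \<cdot> v) \<le> \<delta>" if v: "v \<in> V" for v
    proof -
      have "(norm (b \<cdot> u \<cdot> v))\<^sup>2 \<le> norm b * qf b (u \<cdot> v)" by (rule pos_norm_app_le'[OF bp])
      also have "\<dots> \<le> B * (\<delta>\<^sup>2 * B)"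
      proof (rule mult_mono)
        have "qf b (u \<cdot> v) \<le> (\<Sum>v\<in>V. qf b (u \<cdot> v))"
          using V(1) v pos_qf[OF bp] by (intro member_le_sum) auto
        then show "qf b (u \<cdot> v) \<le> \<delta>\<^sup>2 * B" using u(2) by linarith
      qed (use B pos_qf[OF bp] in auto)
      also have "\<dots> = (\<delta> * B)\<^sup>2" by (simp add: power2_eq_square)
      finally have "norm (b \<cdot> u \<cdot> v) \<le> \<delta> * B"
        by (rule power2_le_imp_le) (use V(2) B in simp)
      then show ?thesis using B by (simp add: a_def divide_le_eq)
    qed
    then have "qf ((1 - n0) * (1 - n0)) (adj a \<cdot> \<xi>) \<le> (\<epsilon> / B)\<^sup>2" using V(3) aA a1 by blast
    then have "(norm ((1 - n0) \<cdot> adj a \<cdot> \<xi>))\<^sup>2 \<le> (\<epsilon> / B)\<^sup>2" unfolding qf_square[OF sa(2)] .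
    then have le: "norm ((1 - n0) \<cdot> adj a \<cdot> \<xi>) \<le> \<epsilon> / B" by (rule power2_le_imp_le) (use \<epsilon> B in simp)
    have aeq: "adj a \<cdot> \<xi> = (1 / B) *\<^sub>R (adj u \<cdot> \<zeta>)" by (simp add: a_def \<zeta>_def pos_adj[OF bp])
    have "norm ((1 - n0) \<cdot> adj a \<cdot> \<xi>) = norm ((1 - n0) \<cdot> adj u \<cdot> \<zeta>) / B"
      unfolding aeq using B by (simp only: app_right_simps norm_scaleR) simp
    with le have le': "norm ((1 - n0) \<cdot> adj u \<cdot> \<zeta>) \<le> \<epsilon>" using B by (simp add: divide_le_eq)
    \<comment> \<open>Since \<open>1 - n0\<close> fixes \<open>adj u - 1\<close> from the left,
      \<open>adj u\<close> changes nothing that \<open>n0\<close> sees. Thus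
      \<open>norm \<zeta> = norm (adj u \<zeta>)\<close> is carried by \<open>n0 \<zeta>\<close> up
      to \<open>\<epsilon>\<close>.\<close>
    have "n0 * (adj u - 1) = 0" using Gs[OF u'] by (simp add: left_diff_distrib)
    then have "(n0 * (adj u - 1)) \<cdot> \<zeta> = 0" by simp
    then have "n0 \<cdot> adj u \<cdot> \<zeta> = n0 \<cdot> \<zeta>" by simp
    then have "adj u \<cdot> \<zeta> = n0 \<cdot> \<zeta> + (1 - n0) \<cdot> adj u \<cdot> \<zeta>" by simp
    then have "norm (adj u \<cdot> \<zeta>) \<le> norm (n0 \<cdot> \<zeta>) + norm ((1 - n0) \<cdot> adj u \<cdot> \<zeta>)"
      by (metis norm_triangle_ineq)
    then show ?thesis using le' unis_adj_norm_app[OF uA, of \<zeta>] by linarith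
  qed
  have le: "norm \<zeta> \<le> norm (n0 \<cdot> \<zeta>)" by (rule field_le_epsilon) (rule close)
  \<comment> \<open>With \<open>n0^2 <= n0\<close> and \<open>|\<zeta>| <= |n0 \<zeta>|\<close> the
    right hand side is at most \<open>2 |n0 \<zeta>|^2 - 2 |n0 \<zeta>|^2 = 0\<close>.\<close>
  have "(norm ((1 - n0) \<cdot> \<zeta>))\<^sup>2 = (norm \<zeta>)\<^sup>2 - 2 * qf n0 \<zeta> + (norm (n0 \<cdot> \<zeta>))\<^sup>2"
    by (simp add: power2_norm_eq_inner inner_diff_left inner_diff_right inner_commute)
  moreover have "(norm \<zeta>)\<^sup>2 \<le> (norm (n0 \<cdot> \<zeta>))\<^sup>2" using le by (intro power_mono) auto
  ultimately have "(norm ((1 - n0) \<cdot> \<zeta>))\<^sup>2 \<le> 0" using n0(2)[of \<zeta>] by linarith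
  then have "(1 - n0) \<cdot> \<zeta> = 0" by simp
  then show "((1 - n0) * bo (y - z)) \<cdot> \<xi> = 0 \<cdot> \<xi>" by (simp add: \<zeta>_def b_def)
qed

text \<open>\<open>p\<close> is the positive part of \<open>h - \<tau>\<close>. The group
  \<open>G\<close> consists of the unitaries that differ from \<open>1\<close> only under
  \<open>s\<close>, an element of \<open>A\<close> with \<open>s^2\<close> in \<open>Jp\<close> and
  \<open>s p = p\<close>. On a minimal \<open>G\<close>-invariant set \<open>bo_support\<close> and
  faithfulness show that \<open>w = u y adj u - y\<close> is killed by \<open>s\<close>, hence fixed
  by \<open>u\<close>; the orbit of \<open>y\<close> would then run off to infinity unless
  \<open>w = 0\<close>. By \<open>ex_unitary\<close> there are enough elements in \<open>G\<close>
  to reach all of \<open>p A p\<close>.\<close>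

lemma corner_commutes:
  assumes c: "0 \<le> c" and K: "adm R c K" "ginv (unis A) K" and h: "h \<in> Jp" and \<tau>: "0 < \<tau>"
  shows "\<exists>p\<in>A. pos p \<and> (\<forall>v. qf h v \<le> qf p v + \<tau> * (norm v)\<^sup>2) \<and> (\<exists>y\<in>K. \<forall>d\<in>A. y * (p * d * p) = p * d * p * y)"
proof -
  define k where "k = (1 / \<tau>) *\<^sub>R h"
  have kJ: "k \<in> Jp" unfolding k_def using \<tau> by (intro Jp_scale h) simp
  have k: "k \<in> A" "pos k" using Jp_A[OF kJ] Jp_pos[OF kJ] by auto
  have k1: "adj (k - 1) = k - 1" "k - 1 \<in> A" using pos_adj[OF k(2)] k(1) by (simp_all add: opsA)
  obtain p0 n0 where pn: "pos p0" "pos n0" "k - 1 = p0 - n0" "p0 * n0 = 0" "n0 * p0 = 0"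
    and pc: "\<And>z. z * (k - 1) = (k - 1) * z \<Longrightarrow> z * p0 = p0 * z" "\<And>z. z * (k - 1) = (k - 1) * z \<Longrightarrow> z * n0 = n0 * z"
    using ex_pos_neg_parts[OF k1(1)] by blast
  have pA: "p0 \<in> A" by (rule vna_gen[OF vna k1(2) pc(1)])
  have nA: "n0 \<in> A" by (rule vna_gen[OF vna k1(2) pc(2)])
  have keq: "k = 1 + p0 - n0" using pn(3) by (simp add: algebra_simps)
  \<comment> \<open>\<open>n0 k\<close> is a product of commuting positive operators, which yields
    \<open>n0^2 <= n0\<close> for the negative part of \<open>k - 1\<close>.\<close>
  have nk: "n0 * k = n0 - n0 * n0" unfolding keq by (simp add: algebra_simps pn(5))
  have "k * n0 = n0 - n0 * n0" unfolding keq by (simp add: algebra_simps pn(4))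
  then have nkp: "pos (n0 - n0 * n0)" using pos_mult_commute[OF pn(2) k(2)] nk by simp
  have n0sa: "adj n0 = n0" by (rule pos_adj[OF pn(2)])
  have n02: "(norm (n0 \<cdot> v))\<^sup>2 \<le> qf n0 v" for v
    using pos_diffD[OF nkp, of v] unfolding qf_square[OF n0sa] .
  \<comment> \<open>Substitute for the support projection of \<open>p0\<close>: it fixes
    \<open>p0\<close> on both sides, and \<open>k - s^2 = p0 + (n0 - n0^2)\<close> puts
    \<open>s^2\<close> below \<open>k\<close>, hence into \<open>Jp\<close>.\<close>
  define s where "s = 1 - n0"
  have s: "adj s = s" "s \<in> A" "s * p0 = p0" "p0 * s = p0"
    unfolding s_def using n0sa nA pn(4,5) by (auto simp: algebra_simps intro: opsA)
  have ss: "s * s \<in> Jp"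
  proof (rule Jp_hereditary[OF kJ])
    show "s * s \<in> A" "pos (s * s)" using s by (auto intro: opsA pos_square)
    fix v
    have "k - s * s = p0 + (n0 - n0 * n0)" unfolding keq s_def by (simp add: algebra_simps)
    then have "pos (k - s * s)" using pos_add[OF pn(1) nkp] by simp
    then show "qf (s * s) v \<le> qf k v" by (rule pos_diffD)
  qed
  define G where "G = {u \<in> unis A. s * (u - 1) = u - 1 \<and> (u - 1) * s = u - 1}"
  have Gs: "u \<in> G \<Longrightarrow> s * (u - 1) = u - 1" "u \<in> G \<Longrightarrow> (u - 1) * s = u - 1" "u \<in> G \<Longrightarrow> u \<in> unis A" for u
    by (auto simp: G_def)
  have G_adj: "adj u \<in> G" if u: "u \<in> G" for u
  proof -
    have "s * (adj u - 1) = adj u - 1" using arg_cong[OF Gs(2)[OF u], of adj] s(1) by simp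
    moreover have "(adj u - 1) * s = adj u - 1" using arg_cong[OF Gs(1)[OF u], of adj] s(1) by simp
    ultimately show ?thesis using unis_adj[OF vna Gs(3)[OF u]] by (simp add: G_def)
  qed
  have G: "grp G"
    unfolding grp_def
  proof (intro conjI ballI G_adj)
    show "G \<subseteq> unis A" "1 \<in> G" using unis_one[OF vna] by (auto simp: G_def)
    fix u v assume u: "u \<in> G" and v: "v \<in> G"
    have "s * (u * v - 1) = s * (u - 1) * v + s * (v - 1)" by (simp add: algebra_simps)
    then have 1: "s * (u * v - 1) = u * v - 1" unfolding Gs(1)[OF u] Gs(1)[OF v] by (simp add: algebra_simps)
    have "(u * v - 1) * s = u * ((v - 1) * s) + (u - 1) * s" by (simp add: algebra_simps)
    then have "(u * v - 1) * s = u * v - 1" unfolding Gs(2)[OF u] Gs(2)[OF v] by (simp add: algebra_simps)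
    then show "u * v \<in> G" using 1 unis_mult[OF vna Gs(3)[OF u] Gs(3)[OF v]] by (simp add: G_def)
  qed
  have "ginv G K" using K(2) Gs(3) by (auto simp: ginv_def)
  then obtain C where C: "C \<subseteq> K" "minimal R c G C" using ex_minimal[OF K(1)] by blast
  have Cadm: "adm R c C" "ginv G C" using C(2) by (auto simp: minimal_def)
  obtain y where y: "y \<in> C" using Cadm(1) by (auto simp: adm_def)
  have yM: "y \<in> M" "adj y = y" using y Cadm(1) by (auto simp: adm_def)
  have yu: "y * u = u * y" if u: "u \<in> G" for u
  proof -
    define w where "w = u * y * adj u - y"
    have uy: "u * y * adj u \<in> C" using Cadm(2) u y by (auto simp: ginv_def)
    have f: "w \<in> fin" unfolding w_def using uy y by (intro fin_diff adm_nonneg[OF c Cadm(1)])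
    have wsa: "adj w = w" by (rule finD(2)[OF f])
    have "s * bo w = 0"
      unfolding s_def w_def
      by (rule bo_support[OF c G C(2) uy y pn(2) n02]) (use ss Gs(1) in \<open>simp_all add: s_def\<close>)
    then have "adj (s * bo w) = 0" by simp
    then have bs: "bo w * s = 0" using s(1) pos_adj[OF bo(2)[OF f]] by simp
    \<comment> \<open>The weight turns \<open>s w^2 s\<close> into \<open>s * bo w * s = 0\<close>;
      faithfulness then gives \<open>w s = 0\<close>.\<close>
    have "adj s * (w * w) * s = 0"
    proof (rule e_faithful)
      show "adj s * (w * w) * s \<in> M" using s finD(1)[OF f] memA by (auto intro!: opsM)
      show "pos (adj s * (w * w) * s)" by (rule pos_conj[OF finD(4)[OF f]])
      fix \<xi>
      have "qf (bo w) (s \<cdot> \<xi>) = 0" using arg_cong[OF bs, of "\<lambda>T. T \<cdot> \<xi>"] by simp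
      then show "e (adj s * (w * w) * s) \<xi> = 0"
        using e_conj[OF finD(3)[OF f] finD(4)[OF f] s(2), of \<xi>] bo(3)[OF f, of "s \<cdot> \<xi>"] by simp
    qed
    then have "adj (w * s) * (w * s) = 0" by (simp add: wsa mult.assoc)
    then have ws: "w * s = 0" by (rule adj_mult_eq_0)
    then have "adj (w * s) = 0" by simp
    then have sw: "s * w = 0" using wsa s(1) by simp
    have "u - 1 = (u - 1) * s" using Gs(2)[OF u] by simp
    then have "(u - 1) * w = (u - 1) * (s * w)" by (metis mult.assoc)
    then have uw: "u * w = w" by (simp add: sw left_diff_distrib)
    have "w * (adj u - 1) = w * s * (adj u - 1)" using Gs(1)[OF G_adj[OF u]] by (metis mult.assoc)
    then have wu: "w * adj u = w" by (simp add: ws right_diff_distrib)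
    \<comment> \<open>Conjugation by \<open>u\<close> translates by \<open>w\<close> along this
      line, so \<open>C\<close> contains all \<open>y + n w\<close>; the norm bound of
      \<open>C\<close> leaves only \<open>w = 0\<close>.\<close>
    have step: "u * (y + r *\<^sub>R w) * adj u = y + (r + 1) *\<^sub>R w" for r
    proof -
      have "u * (y + r *\<^sub>R w) * adj u = u * y * adj u + r *\<^sub>R (u * w * adj u)" by (simp add: algebra_simps)
      also have "u * w * adj u = w" by (simp add: uw wu)
      also have "u * y * adj u = y + w" by (simp add: w_def)
      finally show ?thesis by (simp add: algebra_simps)
    qed
    have mem: "y + real n *\<^sub>R w \<in> C" for n
    proof (induction n)
      case (Suc n)
      have "u * (y + real n *\<^sub>R w) * adj u \<in> C" using Cadm(2) u Suc by (auto simp: ginv_def)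
      then show ?case unfolding step by (simp add: add.commute)
    qed (simp add: y)
    have bound: "real n * norm w \<le> 2 * R" for n
    proof -
      have "norm (y + real n *\<^sub>R w) \<le> R" "norm y \<le> R" using mem[of n] y Cadm(1) by (auto simp: adm_def)
      moreover have "norm (real n *\<^sub>R w) \<le> norm (y + real n *\<^sub>R w) + norm y"
        using norm_triangle_ineq4[of "y + real n *\<^sub>R w" y] by simp
      ultimately show ?thesis by simp
    qed
    have "norm w = 0"
    proof (rule ccontr)
      assume "norm w \<noteq> 0"
      then obtain n where "2 * R < real n * norm w" using reals_Archimedean3[of "norm w"] by auto
      then show False using bound[of n] by linarith
    qed
    then show ?thesis using commute_conj_unis[OF Gs(3)[OF u], of y] by (simp add: w_def)
  qed
  have yI: "y * I = I * y" by (rule I_M[OF yM(1)])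
  have sa_case: "y * (p0 * d * p0) = p0 * d * p0 * y" if d: "d \<in> A" "adj d = d" for d
  proof -
    define H where "H = p0 * d * p0"
    have H: "H \<in> A" "adj H = H" "s * H = H" "H * s = H"
    proof -
      show "H \<in> A" unfolding H_def by (intro opsA pA d)
      show "adj H = H" by (simp add: H_def d pos_adj[OF pn(1)] mult.assoc)
      show "s * H = H" by (simp only: H_def mult.assoc[symmetric] s)
      show "H * s = H" by (simp only: H_def mult.assoc s)
    qed
    obtain r where r: "0 < r" "r *\<^sub>R H \<in> A" "adj (r *\<^sub>R H) = r *\<^sub>R H" "norm (r *\<^sub>R H) \<le> 1"
      using ex_scaling[OF H(1,2)] by blast
    obtain u where u: "u \<in> unis A" "u - adj u = 2 *\<^sub>R (I * (r *\<^sub>R H))"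
      "\<forall>s. s * I = I * s \<longrightarrow> s * (r *\<^sub>R H) = r *\<^sub>R H \<longrightarrow> s * (u - 1) = u - 1"
      "\<forall>s. r *\<^sub>R H * s = r *\<^sub>R H \<longrightarrow> (u - 1) * s = u - 1"
      using ex_unitary[OF r(2-4)] by blast
    have "u \<in> G" unfolding G_def using u H(3,4) I_comm[OF s(2)] by simp
    then have "y * (r *\<^sub>R H) = r *\<^sub>R H * y" by (intro commute_of_skew[OF yI u(2)] yu G_adj)
    then show ?thesis using r(1) by (simp add: H_def)
  qed
  have "y * (p0 * d * p0) = p0 * d * p0 * y" if d: "d \<in> A" for d
  proof -
    obtain H J where HJ: "H \<in> A" "J \<in> A" "adj H = H" "adj J = J" "d = H + I * J"
      using real_imaginary_parts[OF d] by blast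
    have eq: "p0 * d * p0 = p0 * H * p0 + I * (p0 * J * p0)"
      using I_comm[OF pA] unfolding HJ(5) by (simp add: algebra_simps) (simp add: mult.assoc[symmetric])
    have "y * (I * (p0 * J * p0)) = I * (p0 * J * p0) * y"
      using sa_case[OF HJ(2,4)] yI by (simp only: mult.assoc[symmetric]) (simp only: mult.assoc)
    then show ?thesis unfolding eq using sa_case[OF HJ(1,3)] by (simp add: distrib_left distrib_right)
  qed
  then have "\<forall>d\<in>A. y * ((\<tau> *\<^sub>R p0) * d * (\<tau> *\<^sub>R p0)) = (\<tau> *\<^sub>R p0) * d * (\<tau> *\<^sub>R p0) * y" by simp
  moreover have "qf h v \<le> qf (\<tau> *\<^sub>R p0) v + \<tau> * (norm v)\<^sup>2" for v
  proof -
    have "h = \<tau> *\<^sub>R k" using \<tau> by (simp add: k_def)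
    also have "\<dots> = \<tau> *\<^sub>R (1 + p0 - n0)" by (simp only: keq)
    finally have "qf h v = \<tau> * ((norm v)\<^sup>2 + qf p0 v - qf n0 v)" by (simp only: qf_simps)
    moreover have "0 \<le> \<tau> * qf n0 v" using \<tau> pos_qf[OF pn(2)] by simp
    ultimately show ?thesis unfolding qf_simps by (simp add: algebra_simps)
  qed
  moreover have "\<tau> *\<^sub>R p0 \<in> A" "pos (\<tau> *\<^sub>R p0)" using pA pn(1) \<tau> by (auto intro: opsA pos_scale)
  ultimately show ?thesis using y C(1) by blast
qed


text \<open>\<open>corner_commutes\<close> is applied once, to the sum of the finite family, which
  dominates each member. For \<open>G = (1 + p/\<tau>)^-1\<close> the products \<open>g G\<close>
  are small, so \<open>g d h\<close> differs little from \<open>(1 - G) g d h (1 - G)\<close>, which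
  lies in \<open>p A p\<close> and commutes exactly.\<close>

lemma ex_almost_commuting:
  assumes c: "0 \<le> c" and K: "adm R c K" "ginv (unis A) K" and Hs: "finite Hs" "Hs \<subseteq> Jp" and \<theta>: "0 < (\<theta>::real)"
  shows "\<exists>y\<in>K. \<forall>g\<in>Hs. \<forall>h\<in>Hs. \<forall>d\<in>A. norm d \<le> 1 \<longrightarrow> norm (y * (g * d * h) - g * d * h * y) \<le> \<theta>"
proof -
  obtain y0 where "y0 \<in> K" using K(1) by (auto simp: adm_def)
  then have R: "0 \<le> R" using K(1) norm_ge_zero[of y0] unfolding adm_def by (meson order_trans)
  define m where "m = 1 + (\<Sum>g\<in>Hs. norm g)"
  have m: "0 < m" unfolding m_def by (intro add_pos_nonneg sum_nonneg) auto
  have gm: "norm g \<le> m" if "g \<in> Hs" for g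
    using member_le_sum[of g Hs norm] that Hs(1) by (simp add: m_def)
  define \<mu> where "\<mu> = \<theta> / (4 * (R + 1) * m)"
  have \<mu>: "0 < \<mu>" using \<theta> R m by (simp add: \<mu>_def)
  \<comment> \<open>Each \<open>g\<close> satisfies \<open>G g G <= 2 \<tau>\<close>, hence
    \<open>norm (g G)^2 <= norm g * 2 \<tau> <= m * 2 \<tau> = \<mu>^2\<close>.\<close>
  define \<tau> where "\<tau> = \<mu>\<^sup>2 / (2 * m)"
  have \<tau>: "0 < \<tau>" using \<mu> m by (simp add: \<tau>_def)
  obtain p y where p: "p \<in> A" "pos p" "\<And>v. qf (\<Sum>Hs) v \<le> qf p v + \<tau> * (norm v)\<^sup>2"
    and y: "y \<in> K" "\<And>d. d \<in> A \<Longrightarrow> y * (p * d * p) = p * d * p * y"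
    using corner_commutes[OF c K Jp_sum[OF Hs] \<tau>] by blast
  define Y where "Y = (1 / \<tau>) *\<^sub>R p"
  have Yp: "pos Y" unfolding Y_def using \<tau> p(2) by (intro pos_scale) auto
  have YA: "Y \<in> A" unfolding Y_def by (intro opsA p)
  define G where "G = resolvent Y"
  have GA: "G \<in> A" unfolding G_def by (rule vna_resolvent[OF vna YA Yp])
  have Gsa: "adj G = G" unfolding G_def by (rule resolvent_adj[OF Yp])
  have G1: "norm (G \<cdot> v) \<le> norm v" for v unfolding G_def by (rule norm_resolvent_app[OF Yp])
  have f: "1 - G = (1 / \<tau>) *\<^sub>R (p * G)" "1 - G = (1 / \<tau>) *\<^sub>R (G * p)"
    using one_minus_resolvent[OF Yp] by (simp_all add: G_def Y_def)
  have nf: "norm (1 - G) \<le> 1"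
  proof (rule pos_norm_le)
    show "pos (1 - G)" unfolding G_def by (rule one_minus_resolvent_pos[OF Yp])
    show "qf (1 - G) v \<le> 1 * (norm v)\<^sup>2" for v
      unfolding qf_simps using pos_qf[OF resolvent_pos[OF Yp]] by (simp add: G_def)
  qed simp
  have gG: "norm (g * G) \<le> \<mu>" if g: "g \<in> Hs" for g
  proof (rule norm_endo_le)
    fix v
    have gp: "pos g" using Hs(2) g Jp_pos by blast
    have "qf g (G \<cdot> v) \<le> (\<Sum>g\<in>Hs. qf g (G \<cdot> v))"
      using Hs g Jp_pos by (intro member_le_sum) (auto intro: pos_qf)
    also have "\<dots> = qf (\<Sum>Hs) (G \<cdot> v)" by (rule qf_sum[symmetric])
    also have "\<dots> \<le> qf p (G \<cdot> v) + \<tau> * (norm (G \<cdot> v))\<^sup>2" by (rule p(3))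
    also have "qf p (G \<cdot> v) \<le> \<tau> * (norm v)\<^sup>2"
      using qf_T_resolvent_le[OF Yp, of v] \<tau> by (simp add: Y_def G_def divide_le_eq mult.commute)
    also have "(norm (G \<cdot> v))\<^sup>2 \<le> (norm v)\<^sup>2" using G1 by (intro power_mono) auto
    finally have q: "qf g (G \<cdot> v) \<le> 2 * \<tau> * (norm v)\<^sup>2" using \<tau> by simp
    have "(norm (g \<cdot> G \<cdot> v))\<^sup>2 \<le> norm g * qf g (G \<cdot> v)" by (rule pos_norm_app_le'[OF gp])
    also have "\<dots> \<le> m * (2 * \<tau> * (norm v)\<^sup>2)" using q gm[OF g] m pos_qf[OF gp] by (intro mult_mono) auto
    also have "\<dots> = (\<mu> * norm v)\<^sup>2" using m by (simp add: \<tau>_def power_mult_distrib)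
    finally have "norm (g \<cdot> G \<cdot> v) \<le> \<mu> * norm v" by (rule power2_le_imp_le) (use \<mu> in simp)
    then show "norm ((g * G) \<cdot> v) \<le> \<mu> * norm v" by simp
  qed (use \<mu> in simp)
  have Gg: "norm (G * g) \<le> \<mu>" if g: "g \<in> Hs" for g
  proof -
    have "adj g = g" using Hs(2) g Jp_pos pos_adj by blast
    then show ?thesis using gG[OF g] norm_adj[of "g * G"] by (simp add: Gsa)
  qed
  have "norm (y * (g * d * h) - g * d * h * y) \<le> \<theta>"
    if g: "g \<in> Hs" and h: "h \<in> Hs" and d: "d \<in> A" "norm d \<le> 1" for g h d
  proof -
    define a where "a = g * d * h"
    define X where "X = G * a * G"
    have gA: "g \<in> A" "h \<in> A" using g h Hs(2) Jp_A by auto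
    have "X \<in> A" unfolding X_def a_def by (intro opsA GA gA d)
    then have "y * (p * X * p) = p * X * p * y" by (rule y(2))
    moreover have faf: "(1 - G) * a * (1 - G) = (1 / \<tau> * (1 / \<tau>)) *\<^sub>R (p * X * p)"
    proof -
      have "(1 - G) * a * (1 - G) = ((1 / \<tau>) *\<^sub>R (p * G)) * a * ((1 / \<tau>) *\<^sub>R (G * p))" using f by metis
      then show ?thesis by (simp add: X_def mult.assoc)
    qed
    ultimately have com: "y * ((1 - G) * a * (1 - G)) = (1 - G) * a * (1 - G) * y" by simp
    define D where "D = G * a + (1 - G) * a * G"
    have aD: "a = D + (1 - G) * a * (1 - G)" by (simp add: D_def algebra_simps)
    have n1: "norm (G * a) \<le> \<mu> * m"
    proof -
      have "norm (G * g * (d * h)) \<le> \<mu> * (1 * m)"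
        using Gg[OF g] \<mu> d gm[OF h]
        by (intro order_trans[OF norm_mult_ineq[of "G * g"]] mult_mono order_trans[OF norm_mult_ineq[of d]]) auto
      then show ?thesis by (simp add: a_def mult.assoc)
    qed
    have n2: "norm ((1 - G) * a * G) \<le> m * \<mu>"
    proof -
      have "norm (g * (d * (h * G))) \<le> m * (1 * \<mu>)"
        using gG[OF h] \<mu> d gm[OF g] m
        by (intro order_trans[OF norm_mult_ineq[of g]] mult_mono order_trans[OF norm_mult_ineq[of d]]) auto
      then have "norm ((1 - G) * (g * (d * (h * G)))) \<le> 1 * (m * \<mu>)"
        using nf by (intro order_trans[OF norm_mult_ineq[of "1 - G"]] mult_mono) auto
      then show ?thesis by (simp only: a_def mult.assoc mult_1)
    qed
    have nD: "norm D \<le> 2 * m * \<mu>"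
      using norm_triangle_ineq[of "G * a" "(1 - G) * a * G"] n1 n2 unfolding D_def by (simp add: mult.commute)
    have yR: "norm y \<le> R" using y(1) K(1) by (auto simp: adm_def)
    have "y * a - a * y = y * D - D * y" by (subst (1 2) aD) (simp only: distrib_left distrib_right com, simp)
    then have "norm (y * a - a * y) \<le> norm (y * D) + norm (D * y)" using norm_triangle_ineq4[of "y * D" "D * y"] by simp
    also have "\<dots> \<le> R * (2 * m * \<mu>) + 2 * m * \<mu> * R"
      using yR nD R m \<mu> by (intro add_mono order_trans[OF norm_mult_ineq[of y]] order_trans[OF norm_mult_ineq[of D]] mult_mono) auto
    also have "\<dots> \<le> 4 * (R + 1) * m * \<mu>" using m \<mu> by (simp add: algebra_simps)
    also have "\<dots> = \<theta>"
    proof -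
      have ne: "4 * (R + 1) * m \<noteq> 0" using R m by simp
      show ?thesis unfolding \<mu>_def mult.commute[of "4 * (R + 1) * m"]
        by (rule iffD1[OF nonzero_eq_divide_eq[OF ne] refl])
    qed
    finally show ?thesis unfolding a_def .
  qed
  then show ?thesis using y(1) by blast
qed

section \<open>Commuting with the relative compact operators\<close>

definition compacts :: "'a endo set" where
  "compacts = {g * d * h | g d h. g \<in> Jp \<and> d \<in> A \<and> h \<in> Jp}"

text \<open>Each commutator bound for \<open>(g, d, h, \<theta>)\<close> with
  \<open>norm d <= 1\<close> is a weakly closed condition, and \<open>ex_almost_commuting\<close>
  meets any finite number of them; compactness meets all. Invariance holds because unitaries of
  \<open>A\<close> conjugate \<open>Jp\<close> and \<open>A\<close> into themselves, so
  \<open>J A J\<close> is preserved.\<close>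

lemma ex_commuting_compacts:
  assumes c: "0 \<le> c" and K: "adm R c K" "ginv (unis A) K"
  shows "adm R c (K \<inter> comm compacts)" "ginv (unis A) (K \<inter> comm compacts)"
proof -
  define \<I> where "\<I> = Jp \<times> {d \<in> A. norm d \<le> 1} \<times> Jp \<times> {0::real<..}"
  define C where "C = (\<lambda>(g, d, h, \<theta>). {y :: 'a endo. norm (y * (g * d * h) - g * d * h * y) \<le> \<theta>})"
  have "K \<inter> \<Inter>(C ` \<I>) \<noteq> {}"
  proof (rule adm_Inter[OF K(1)])
    show "closedin wot X" if "X \<in> C ` \<I>" for X
      using that by (auto simp: C_def \<I>_def intro!: closedin_wot_commutator_ball)
    fix \<F> assume "finite \<F>" "\<F> \<subseteq> C ` \<I>"
    then obtain I0 where I0: "finite I0" "I0 \<subseteq> \<I>" "\<F> = C ` I0" using finite_subset_image[of \<F> C \<I>] by blast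
    define Hs where "Hs = fst ` I0 \<union> (\<lambda>(g, d, h, \<theta>). h) ` I0"
    define \<theta> where "\<theta> = Min (insert 1 ((\<lambda>(g, d, h, \<theta>). \<theta>) ` I0))"
    have Hs: "finite Hs" "Hs \<subseteq> Jp" using I0 by (auto simp: Hs_def \<I>_def)
    have "0 < \<theta>" unfolding \<theta>_def using I0 by (subst Min_gr_iff) (auto simp: \<I>_def)
    with ex_almost_commuting[OF c K Hs] obtain y where y: "y \<in> K"
      "\<forall>g\<in>Hs. \<forall>h\<in>Hs. \<forall>d\<in>A. norm d \<le> 1 \<longrightarrow> norm (y * (g * d * h) - g * d * h * y) \<le> \<theta>" by blast
    have "y \<in> C i" if i: "i \<in> I0" for i
    proof -
      obtain g d h \<theta>' where eq: "i = (g, d, h, \<theta>')" by (metis prod.exhaust)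
      have "\<theta> \<le> \<theta>'" unfolding \<theta>_def using I0(1) i eq by (intro Min_le) (auto intro!: image_eqI[of _ _ i])
      moreover have "g \<in> Hs" "h \<in> Hs" using i eq by (auto simp: Hs_def intro!: image_eqI[of _ _ i])
      moreover have "d \<in> A" "norm d \<le> 1" using I0(2) i eq by (auto simp: \<I>_def)
      ultimately have "norm (y * (g * d * h) - g * d * h * y) \<le> \<theta>'" using y(2) order_trans by blast
      then show ?thesis by (simp add: eq C_def)
    qed
    then show "K \<inter> \<Inter>\<F> \<noteq> {}" using y(1) I0(3) by auto
  qed
  then obtain y where y: "y \<in> K" "\<And>i. i \<in> \<I> \<Longrightarrow> y \<in> C i" by blast
  have "y \<in> comm compacts"
  proof (rule commI)
    fix S assume "S \<in> compacts"
    then obtain g d h where S: "S = g * d * h" "g \<in> Jp" "d \<in> A" "h \<in> Jp" by (auto simp: compacts_def)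
    define r where "r = 1 / (norm d + 1)"
    have r: "0 < r" "norm (r *\<^sub>R d) \<le> 1"
    proof -
      have "norm d + 1 > 0" by (simp add: add_nonneg_pos)
      then show "0 < r" "norm (r *\<^sub>R d) \<le> 1" by (simp_all add: r_def divide_le_eq)
    qed
    have "norm (y * (g * (r *\<^sub>R d) * h) - g * (r *\<^sub>R d) * h * y) \<le> 0"
    proof (rule field_le_epsilon)
      fix \<theta> :: real assume "0 < \<theta>"
      then have "(g, r *\<^sub>R d, h, \<theta>) \<in> \<I>" using S r opsA(6)[OF S(3)] by (simp add: \<I>_def)
      from y(2)[OF this] show "norm (y * (g * (r *\<^sub>R d) * h) - g * (r *\<^sub>R d) * h * y) \<le> 0 + \<theta>" by (simp add: C_def)
    qed
    then have "norm (r *\<^sub>R (y * S - S * y)) = 0" by (simp add: S(1) scaleR_diff_right)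
    then show "y * S = S * y" using r(1) by simp
  qed
  then have ne: "K \<inter> comm compacts \<noteq> {}" using y(1) by blast
  have "convex (comm compacts)" by (auto simp: convex_def intro: comm_add comm_scaleR)
  then show "adm R c (K \<inter> comm compacts)"
    using K(1) ne by (intro adm_subset[OF K(1)] closedin_Int closedin_wot_comm convex_Int) (auto simp: adm_def)
  show "ginv (unis A) (K \<inter> comm compacts)"
    unfolding ginv_def
  proof (intro ballI IntI)
    fix u y assume u: "u \<in> unis A" and y: "y \<in> K \<inter> comm compacts"
    show "u * y * adj u \<in> K" using K(2) u y by (auto simp: ginv_def)
    show "u * y * adj u \<in> comm compacts"
    proof (rule commI)
      fix S assume "S \<in> compacts"
      then obtain g d h where S: "S = g * d * h" "g \<in> Jp" "d \<in> A" "h \<in> Jp" by (auto simp: compacts_def)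
      have u': "adj u \<in> unis A" by (rule unis_adj[OF vna u])
      define S' where "S' = adj u * S * u"
      have uu: "u * (adj u * T) = T" "adj u * (u * T) = T" for T
        unfolding mult.assoc[symmetric] using unisD[OF u] by simp_all
      have "S' = (adj u * g * adj (adj u)) * (adj u * d * u) * (adj u * h * adj (adj u))"
        by (simp add: S'_def S(1) mult.assoc uu)
      moreover have "adj u * d * u \<in> A" by (intro opsA S(3) unisD(1)[OF u] unisD(1)[OF u'])
      ultimately have "S' \<in> compacts" unfolding compacts_def using Jp_conj[OF S(2) u'] Jp_conj[OF S(4) u'] by blast
      then have "y * S' = S' * y" using y by (blast intro: commD)
      then have "u * (y * S') * adj u = u * (S' * y) * adj u" by simp
      then show "u * y * adj u * S = S * (u * y * adj u)"
        using unisD[OF u] by (simp add: S'_def mult.assoc uu)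
    qed
  qed
qed

text \<open>For a unitary \<open>v\<close> of \<open>A\<close> commuting with \<open>w\<close>,
  covariance \<open>bo (v w adj v) = v (bo w) (adj v)\<close> is already the claim. The general case
  follows since \<open>a\<close> is a combination of self-adjoint elements \<open>H\<close>, and
  \<open>ex_unitary\<close> gives a unitary that commutes with whatever commutes with
  \<open>H\<close> and has \<open>H\<close> as its skew part.\<close>

lemma bo_commutes:
  assumes w: "w \<in> fin" and a: "a \<in> A" "w * a = a * w" "w * adj a = adj a * w"
  shows "bo w * a = a * bo w"
proof -
  have bA: "bo w \<in> A" by (rule bo[OF w])
  have wI: "w * I = I * w" by (rule I_M[OF finD(1)[OF w]])
  have bI: "bo w * I = I * bo w" by (rule I_comm[OF bA])
  have aI: "a * I = I * a" "adj a * I = I * adj a" by (intro I_comm a vna_adj[OF vna])+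
  have sa: "bo w * H = H * bo w" if H: "H \<in> A" "adj H = H" "w * H = H * w" for H
  proof -
    obtain r where r: "0 < r" "r *\<^sub>R H \<in> A" "adj (r *\<^sub>R H) = r *\<^sub>R H" "norm (r *\<^sub>R H) \<le> 1"
      using ex_scaling[OF H(1,2)] by blast
    obtain u where u: "u \<in> unis A" "u - adj u = 2 *\<^sub>R (I * (r *\<^sub>R H))"
      "\<forall>y. y * (r *\<^sub>R H) = r *\<^sub>R H * y \<longrightarrow> y * I = I * y \<longrightarrow> y * u = u * y"
      using ex_unitary[OF r(2-4)] by blast
    have wu: "w * u = u * w" using u(3) H(3) wI by simp
    have fix_w: "v * w * adj v = w" if v: "v \<in> unis A" "w * v = v * w" for v
      using unisD(3)[OF v(1)] by (simp only: v(2)[symmetric] mult.assoc) simp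
    have bv: "bo w * v = v * bo w" if v: "v \<in> unis A" "w * v = v * w" for v
      using commute_conj_unis[OF v(1), of "bo w"] bo_conj[OF w v(1)] fix_w[OF v] by simp
    have "adj (w * u) = adj (u * w)" using wu by simp
    then have "w * adj u = adj u * w" using finD(2)[OF w] by simp
    then have "bo w * (r *\<^sub>R H) = r *\<^sub>R H * bo w"
      by (intro commute_of_skew[OF bI u(2)] bv u(1) wu unis_adj[OF vna])
    then show ?thesis using r(1) by simp
  qed
  have 1: "bo w * (a + adj a) = (a + adj a) * bo w"
    using a by (intro sa opsA vna_adj[OF vna]) (auto simp: add.commute distrib_left distrib_right)
  have 2: "bo w * (I * (adj a - a)) = I * (adj a - a) * bo w"
  proof (rule sa)
    show "I * (adj a - a) \<in> A" by (intro opsA vna_adj[OF vna] a I_mem)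
    show "adj (I * (adj a - a)) = I * (adj a - a)" by (simp add: I_adj aI left_diff_distrib right_diff_distrib)
    have "w * (I * (adj a - a)) = I * (w * (adj a - a))" by (simp only: mult.assoc[symmetric] wI)
    also have "w * (adj a - a) = (adj a - a) * w" using a(2,3) by (simp add: left_diff_distrib right_diff_distrib)
    finally show "w * (I * (adj a - a)) = I * (adj a - a) * w" by (simp only: mult.assoc)
  qed
  have "I * (bo w * (adj a - a)) = I * ((adj a - a) * bo w)" using 2 by (simp only: mult.assoc[symmetric] bI)
  then have "I * I * (bo w * (adj a - a)) = I * I * ((adj a - a) * bo w)" by (simp only: mult.assoc)
  then have "bo w * (adj a - a) = (adj a - a) * bo w" by (simp add: I_sq)
  then have eq: "bo w * (a + adj a) - bo w * (adj a - a) = (a + adj a) * bo w - (adj a - a) * bo w" using 1 by simp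
  have "2 *\<^sub>R (bo w * a) = bo w * (a + adj a) - bo w * (adj a - a)" by (simp add: right_diff_distrib distrib_left scaleR_2)
  also note eq
  also have "(a + adj a) * bo w - (adj a - a) * bo w = 2 *\<^sub>R (a * bo w)" by (simp add: left_diff_distrib distrib_right scaleR_2)
  finally have "2 *\<^sub>R (bo w * a) = 2 *\<^sub>R (a * bo w)" .
  then show ?thesis by simp
qed

text \<open>\<open>b\<close> lies in the ideal and commutes with \<open>J A J\<close>, which forces
  \<open>b^2\<close> to commute with every unitary of \<open>A\<close>. Then
  \<open>|b \<xi>| = |b u \<xi>|\<close> for all \<open>u\<close>, and some \<open>u\<close> makes
  the right side arbitrarily small.\<close>

lemma bo_eq_0_of_commutes:
  assumes c: "0 \<le> c" and K: "minimal R c (unis A) K" and yz: "y \<in> K" "z \<in> K"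
    and com: "y \<in> comm compacts" "z \<in> comm compacts" and J: "bo (y - z) \<in> Jp"
  shows "bo (y - z) = 0"
proof -
  define b where "b = bo (y - z)"
  have adm: "adm R c K" using K by (auto simp: minimal_def)
  have f: "y - z \<in> fin" using yz by (intro fin_diff adm_nonneg[OF c adm])
  have bA: "b \<in> A" and bp: "pos b" unfolding b_def by (rule bo[OF f])+
  have bsa: "adj b = b" by (rule pos_adj[OF bp])
  have bJ: "b \<in> Jp" using J by (simp add: b_def)
  have bc: "b * S = S * b" if S: "S \<in> compacts" for S
  proof -
    obtain g d h where gdh: "S = g * d * h" "g \<in> Jp" "d \<in> A" "h \<in> Jp" using S by (auto simp: compacts_def)
    have "adj S = h * adj d * g" using gdh pos_adj[OF Jp_pos] by (simp add: mult.assoc)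
    then have S': "adj S \<in> compacts" unfolding compacts_def using gdh vna_adj[OF vna gdh(3)] by blast
    have SA: "S \<in> A" unfolding gdh(1) by (intro opsA Jp_A gdh)
    have "y - z \<in> comm compacts" by (intro comm_diff com)
    then show ?thesis unfolding b_def using SA S S' by (intro bo_commutes[OF f]) (auto intro: commD)
  qed
  have bub: "b * b * adj u = b * adj u * b" if u: "u \<in> unis A" for u
  proof -
    define X where "X = b * adj u - adj u * b"
    have u': "adj u \<in> A" by (rule vna_adj[OF vna unisD(1)[OF u]])
    \<comment> \<open>The product is \<open>b^2 adj u\<close>, displayed as an element of
      \<open>J A J\<close>: its outer factors are \<open>b\<close> and the conjugate
      \<open>u b adj u\<close>, both in \<open>Jp\<close>. Commutation with \<open>b\<close> gives
      \<open>b^2 X = 0\<close> for the commutator \<open>X\<close>, and positivity of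
      \<open>adj (b X) * (b X)\<close> removes one factor \<open>b\<close>.\<close>
    have "b * adj u * (u * b * adj u) \<in> compacts" unfolding compacts_def using bJ u' Jp_conj[OF bJ u] by blast
    then have "b * (b * adj u * (u * b * adj u)) = b * adj u * (u * b * adj u) * b" by (rule bc)
    moreover have "adj u * (u * T) = T" for T unfolding mult.assoc[symmetric] using unisD[OF u] by simp
    ultimately have bbX: "b * (b * X) = 0" by (simp add: X_def right_diff_distrib mult.assoc)
    have "adj (b * X) * (b * X) = adj X * (b * (b * X))" by (simp add: bsa mult.assoc)
    also have "\<dots> = 0" unfolding bbX by simp
    finally have "b * X = 0" by (rule adj_mult_eq_0)
    then show ?thesis by (simp add: X_def right_diff_distrib mult.assoc)
  qed
  have bbu: "b * b * u = u * (b * b)" if u: "u \<in> unis A" for u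
  proof -
    have "b * b * u = b * u * b" using bub[OF unis_adj[OF vna u]] by simp
    also have "\<dots> = adj (b * adj u * b)" by (simp add: bsa mult.assoc)
    also have "\<dots> = adj (b * b * adj u)" by (simp only: bub[OF u])
    finally show ?thesis by (simp add: bsa mult.assoc)
  qed
  have "b \<cdot> \<xi> = 0" for \<xi>
  proof -
    have "(norm (b \<cdot> \<xi>))\<^sup>2 \<le> 0 + \<epsilon>" if \<epsilon>: "0 < \<epsilon>" for \<epsilon>
    proof -
      have B: "0 < norm b + 1" by (simp add: add_nonneg_pos)
      obtain u where u: "u \<in> unis A" "(\<Sum>\<xi>\<in>{\<xi>}. qf (bo (y - z)) (u \<cdot> \<xi>)) \<le> \<epsilon> / (norm b + 1)"
        using ex_contracting_unitary[OF grp_unis K c, of "{\<xi>}" "\<epsilon> / (norm b + 1)"] \<epsilon> B yz by auto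
      have "(norm (b \<cdot> \<xi>))\<^sup>2 = qf (b * b) \<xi>" by (rule qf_square[OF bsa, symmetric])
      also have "\<dots> = inner (u \<cdot> \<xi>) (u \<cdot> (b * b) \<cdot> \<xi>)"
        using inner_adj_right[of "u \<cdot> \<xi>" u "(b * b) \<cdot> \<xi>"] inner_adj_left[of u "u \<cdot> \<xi>" "(b * b) \<cdot> \<xi>"] unis_cancel[OF u(1), of \<xi>] by simp
      also have "\<dots> = qf (b * b) (u \<cdot> \<xi>)" using arg_cong[OF bbu[OF u(1)], of "\<lambda>T. T \<cdot> \<xi>"] by simp
      also have "\<dots> = (norm (b \<cdot> u \<cdot> \<xi>))\<^sup>2" by (rule qf_square[OF bsa])
      also have "\<dots> \<le> norm b * qf b (u \<cdot> \<xi>)" by (rule pos_norm_app_le'[OF bp])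
      also have "\<dots> \<le> (norm b + 1) * (\<epsilon> / (norm b + 1))"
        using u(2) B pos_qf[OF bp] by (intro mult_mono) (auto simp: b_def)
      finally show ?thesis using B by simp
    qed
    then have "(norm (b \<cdot> \<xi>))\<^sup>2 \<le> 0" by (rule field_le_epsilon)
    then show ?thesis by simp
  qed
  then show ?thesis unfolding b_def[symmetric] by (intro endo_eqI) simp
qed

section \<open>A point fixed by the full unitary group\<close>

theorem ex_commutant_point:
  assumes c: "0 \<le> c" and K: "adm R c K" "ginv (unis A) K"
  shows "K \<inter> comm A \<noteq> {}"
proof -
  obtain K' where K': "K' \<subseteq> K \<inter> comm compacts" "minimal R c (unis A) K'"
    using ex_minimal[OF ex_commuting_compacts[OF c K]] by blast
  have adm: "adm R c K'" and inv: "ginv (unis A) K'" using K'(2) by (auto simp: minimal_def)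
  obtain y where y: "y \<in> K'" using adm by (auto simp: adm_def)
  have "y * u = u * y" if u: "u \<in> unis A" for u
  proof (rule commute_conj_unis[OF u])
    have z: "u * y * adj u \<in> K'" using inv u y by (auto simp: ginv_def)
    have f: "u * y * adj u - y \<in> fin" using y z by (intro fin_diff adm_nonneg[OF c adm])
    have "bo (u * y * adj u - y) = 0"
      using K'(1) y z bo_diff_mem_Jp[OF c K'(2) z y] by (intro bo_eq_0_of_commutes[OF c K'(2) z y]) auto
    from bo_eq_0[OF f this] show "u * y * adj u = y" by simp
  qed
  then have "y \<in> comm A" by (rule commute_of_unitaries)
  then show ?thesis using y K'(1) by blast
qed

text \<open>Finiteness of the weight at \<open>x\<close> gives boundedness at the squares:
  \<open>x^2 <= norm x * x\<close>, so \<open>c = norm x * norm b0\<close> bounds the form at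
  \<open>x^2\<close>, and by covariance at the square of every conjugate. The set \<open>S\<close>
  of operators obeying these bounds is convex and weakly closed, hence contains the whole closed
  hull.\<close>

theorem ex_commutant_mean:
  assumes x: "x \<in> M" "pos x" and b0: "pos b0" "\<And>\<xi>. e x \<xi> = ennreal (qf b0 \<xi>)"
  shows "(wot closure_of (convex hull ((\<lambda>u. u * x * adj u) ` unis A))) \<inter> comm A \<noteq> {}"
proof -
  define orb where "orb = (\<lambda>u. u * x * adj u) ` unis A"
  define R c where "R = norm x" and "c = norm x * norm b0"
  have c: "0 \<le> c" by (simp add: c_def)
  define S where "S = (\<Inter>\<xi>. {w \<in> M. adj w = w \<and> norm w \<le> R \<and> e (w * w) \<xi> \<le> ennreal (c * (norm \<xi>)\<^sup>2)})"
  have c\<xi>: "0 \<le> c * (norm \<xi>)\<^sup>2" for \<xi> :: 'a using c by simp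
  have S: "closedin wot S" "convex S" unfolding S_def
    using normal_weight_on.weight_closed_sublevel[OF weight c\<xi>] normal_weight_on.convex_sublevel[OF weight c\<xi>]
    by (auto intro!: convex_INT)
  have "u * x * adj u \<in> S" if u: "u \<in> unis A" for u
  proof -
    let ?w = "u * x * adj u"
    have uA: "u \<in> A" "adj u \<in> A" using unisD(1)[OF u] unisD(1)[OF unis_adj[OF vna u]] by auto
    have "?w \<in> M" by (intro opsM x memA uA)
    moreover have "adj ?w = ?w" by (rule pos_adj[OF pos_conj'[OF x(2)]])
    moreover have "norm ?w \<le> R"
    proof -
      have "norm (u * x) \<le> 1 * R" using unis_norm[OF u] unfolding R_def
        by (intro order_trans[OF norm_mult_ineq] mult_mono) auto
      then have "norm ?w \<le> 1 * R * 1" using unis_norm[OF unis_adj[OF vna u]]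
        by (intro order_trans[OF norm_mult_ineq[of "u * x"]] mult_mono) (auto simp: R_def)
      then show ?thesis by simp
    qed
    moreover have "e (?w * ?w) \<xi> \<le> ennreal (c * (norm \<xi>)\<^sup>2)" for \<xi>
    proof -
      have "adj u * (u * T) = T" for T unfolding mult.assoc[symmetric] using unisD[OF u] by simp
      then have "?w * ?w = adj (adj u) * (x * x) * adj u" by (simp add: mult.assoc)
      moreover have xx: "x * x \<in> M" "pos (x * x)" using x pos_adj by (auto intro: opsM pos_square)
      ultimately have "e (?w * ?w) \<xi> = e (x * x) (adj u \<cdot> \<xi>)" using e_conj[OF xx uA(2)] by simp
      also have "\<dots> \<le> e (norm x *\<^sub>R x) (adj u \<cdot> \<xi>)"
      proof (rule e_mono[OF xx])
        show "norm x *\<^sub>R x \<in> M" "pos (norm x *\<^sub>R x)" using x by (auto intro: opsM pos_scale)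
        show "qf (x * x) v \<le> qf (norm x *\<^sub>R x) v" for v
          unfolding qf_square[OF pos_adj[OF x(2)]] using pos_norm_app_le'[OF x(2)] by simp
      qed
      also have "\<dots> = ennreal (norm x) * e x (adj u \<cdot> \<xi>)"
        using normal_weight_on.scale[OF weight, of "norm x" x] x by simp
      also have "\<dots> = ennreal (norm x * qf b0 (adj u \<cdot> \<xi>))"
        unfolding b0(2) using pos_qf[OF b0(1)] by (simp add: ennreal_mult)
      also have "\<dots> \<le> ennreal (c * (norm \<xi>)\<^sup>2)"
        using qf_le_norm[of "adj u \<cdot> \<xi>" b0] unis_adj_norm_app[OF u, of \<xi>]
        unfolding c_def by (intro ennreal_leI) (simp add: mult.assoc mult_left_mono)
      finally show ?thesis .
    qed
    ultimately show ?thesis by (simp add: S_def)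
  qed
  then have "convex hull orb \<subseteq> S" unfolding orb_def by (intro hull_minimal S) auto
  then have KS: "wot closure_of (convex hull orb) \<subseteq> S" by (rule closure_of_minimal[OF _ S(1)])
  have sub: "convex hull orb \<subseteq> wot closure_of (convex hull orb)" by (rule closure_of_subset) simp
  have "1 * x * adj 1 \<in> orb" unfolding orb_def by (rule imageI[OF unis_one[OF vna]])
  then have "convex hull orb \<noteq> {}" by auto
  then have adm: "adm R c (wot closure_of (convex hull orb))"
    using KS sub convex_wot_closure[OF convex_convex_hull] unfolding adm_def S_def by (auto simp: closedin_closure_of)
  have "ginv (unis A) (wot closure_of (convex hull orb))"
    unfolding ginv_def
  proof (intro ballI)
    fix u y assume u: "u \<in> unis A" and y: "y \<in> wot closure_of (convex hull orb)"
    let ?f = "\<lambda>T. u * T * adj u"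
    have "?f ` orb \<subseteq> orb"
    proof (clarsimp simp: orb_def)
      fix v assume v: "v \<in> unis A"
      show "u * (v * x * adj v) * adj u \<in> (\<lambda>u. u * x * adj u) ` unis A"
        by (rule image_eqI[OF _ unis_mult[OF vna u v]]) (simp add: mult.assoc)
    qed
    moreover have "linear ?f" by (rule linearI) (simp_all add: algebra_simps)
    ultimately have "?f ` (convex hull orb) \<subseteq> convex hull orb"
      by (metis convex_hull_linear_image hull_mono)
    moreover have "?f ` (wot closure_of (convex hull orb)) \<subseteq> wot closure_of (?f ` (convex hull orb))"
      by (rule continuous_map_image_closure_subset[OF continuous_map_wot_conj])
    ultimately show "?f y \<in> wot closure_of (convex hull orb)"
      using y closure_of_mono by blast
  qed
  then show ?thesis using ex_commutant_point[OF c adm] unfolding orb_def by blast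
qed

end

section \<open>Bounded operators on complex Hilbert spaces\<close>

instance chilbert_space \<subseteq> hilbert_space ..

lemmas blin_app = app.rep_eq[symmetric]
lemmas blin_simps = blin_app times_endo.rep_eq[symmetric] plus_endo.rep_eq[symmetric] minus_endo.rep_eq[symmetric]
  scaleR_endo.rep_eq[symmetric] one_endo.rep_eq[symmetric] zero_endo.rep_eq[symmetric] norm_endo.rep_eq[symmetric]
  blin_inject

definition imag :: "'h::chilbert_space endo" where
  "imag = endo (scale_op \<i> id_blinfun)"

lemma blin_imag: "blin imag = scale_op \<i> id_blinfun"
  by (simp add: imag_def endo_inverse)

lemma imag_app: "imag \<cdot> x = \<i> *\<^sub>C x"
  unfolding app.rep_eq blin_imag by (simp add: scale_op.rep_eq)

lemma scaleC_eq: "c *\<^sub>C x = Re c *\<^sub>R x + Im c *\<^sub>R (imag \<cdot> x)"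
proof -
  have "c *\<^sub>C x = (complex_of_real (Re c) + complex_of_real (Im c) * \<i>) *\<^sub>C x"
    by (subst complex_eq[of c]) (simp add: mult.commute)
  then show ?thesis by (simp only: scaleC_add_left scaleC_scaleC[symmetric] scaleC_of_real imag_app)
qed

lemma scale_op_blin: "scale_op c (blin T) = blin (Re c *\<^sub>R T + Im c *\<^sub>R (imag * T))"
  by (rule blinfun_eqI) (simp add: scale_op.rep_eq blin_app scaleC_eq)

lemma Im_cinner: "Im (cinner x y) = inner (imag \<cdot> x) y"
proof -
  have "inner (imag \<cdot> x) y = Re (cnj (\<i> * cinner y x))"
    by (metis Re_cinner cinner_commute cinner_scaleC_right imag_app)
  also have "\<dots> = Im (cinner x y)" by (subst (2) cinner_commute) simp
  finally show ?thesis by simp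
qed

lemma imag_adj: "adj imag = - imag"
proof (rule adj_eqI)
  fix x y :: 'a
  have "inner x (imag \<cdot> y) = Re (\<i> * cinner x y)" by (metis Re_cinner cinner_scaleC_right imag_app)
  then show "inner x (- imag \<cdot> y) = inner (imag \<cdot> x) y" by (simp add: Im_cinner)
qed

lemma imag_sq: "imag * imag = - 1"
proof (rule endo_eqI)
  fix x :: 'a
  have "\<i> *\<^sub>C \<i> *\<^sub>C x = complex_of_real (- 1) *\<^sub>C x" by (simp add: scaleC_scaleC)
  then show "(imag * imag) \<cdot> x = (- 1) \<cdot> x" by (simp only: app_simps imag_app scaleC_of_real) simp
qed

lemma bounded_ops_iff: "blin T \<in> bounded_ops \<longleftrightarrow> T * imag = imag * T"
proof
  assume "blin T \<in> bounded_ops"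
  then show "T * imag = imag * T"
    by (intro endo_eqI) (simp add: bounded_ops_def blin_simps imag_app)
next
  assume eq: "T * imag = imag * T"
  have "T \<cdot> imag \<cdot> x = imag \<cdot> T \<cdot> x" for x using arg_cong[OF eq, of "\<lambda>S. S \<cdot> x"] by simp
  then show "blin T \<in> bounded_ops" by (simp add: bounded_ops_def blin_simps scaleC_eq)
qed

lemma imag_commute: "T * imag = imag * T \<Longrightarrow> T \<cdot> imag \<cdot> x = imag \<cdot> T \<cdot> x"
  by (metis app_simps(6))

lemma imag_commute_adj:
  assumes "T * imag = imag * T" shows "adj T * imag = imag * adj T"
  using arg_cong[OF assms, of adj] by (simp add: imag_adj)

lemma cinner_adj:
  assumes T: "T * imag = imag * T" shows "cinner (adj T \<cdot> x) y = cinner x (T \<cdot> y)"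
proof (rule complex_eqI)
  show "Re (cinner (adj T \<cdot> x) y) = Re (cinner x (T \<cdot> y))" by (simp add: Re_cinner inner_adj_left)
  show "Im (cinner (adj T \<cdot> x) y) = Im (cinner x (T \<cdot> y))"
    using imag_commute[OF imag_commute_adj[OF T], of x] by (simp add: Im_cinner inner_adj_left flip: inner_adj_left)
qed

lemma op_adj_blin:
  assumes T: "T * imag = imag * T" shows "op_adj (blin T) = blin (adj T)"
  unfolding op_adj_def
proof (rule the_equality)
  show "\<forall>x y. cinner (blinfun_apply (blin (adj T)) x) y = cinner x (blinfun_apply (blin T) y)"
    by (simp add: blin_app cinner_adj[OF T])
  fix S :: "'a \<Rightarrow>\<^sub>L 'a" assume S: "\<forall>x y. cinner (blinfun_apply S x) y = cinner x (blinfun_apply (blin T) y)"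
  have "adj T = endo S"
  proof (rule endo_eq_innerI)
    fix x y
    have "cinner (blinfun_apply S y) x = cinner y (T \<cdot> x)" using S unfolding blin_app by blast
    moreover have "blinfun_apply S y = endo S \<cdot> y" by (simp add: app.rep_eq endo_inverse)
    ultimately have "Re (cinner (endo S \<cdot> y) x) = Re (cinner y (T \<cdot> x))" by simp
    then show "inner x (adj T \<cdot> y) = inner x (endo S \<cdot> y)"
      by (simp add: Re_cinner inner_adj_right inner_commute)
  qed
  then show "S = blin (adj T)" by (simp add: endo_inverse)
qed

text \<open>Over the complex numbers a real-valued quadratic form is symmetric: the vanishing of the
  imaginary part \<open><i x, T x>\<close> polarizes to a skew-symmetry, and replacing
  \<open>x\<close> by \<open>i x\<close> turns that into symmetry of \<open>T\<close>.\<close>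

lemma pos_op_iff:
  fixes T :: "'a::chilbert_space endo"
  shows "pos_op (blin T) \<longleftrightarrow> T * imag = imag * T \<and> pos T"
proof
  assume P: "pos_op (blin T)"
  then have T: "T * imag = imag * T" by (simp add: pos_op_def bounded_ops_iff)
  have r: "cinner x (T \<cdot> x) \<in> \<real>\<^sub>\<ge>\<^sub>0" for x using P by (simp add: pos_op_def blin_app)
  have re: "0 \<le> qf T x" for x using r[of x] by (simp add: complex_nonneg_Reals_iff Re_cinner)
  have im: "inner (imag \<cdot> x) (T \<cdot> x) = 0" for x using r[of x] by (simp add: complex_nonneg_Reals_iff Im_cinner)
  have skew: "inner (imag \<cdot> x) (T \<cdot> y) = - inner (imag \<cdot> y) (T \<cdot> x)" for x y
    using im[of "x + y"] im[of x] im[of y] by (simp add: inner_add_left inner_add_right)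
  have "adj T = T"
  proof (rule adj_eqI)
    fix x y :: 'a
    have "imag \<cdot> imag \<cdot> x = - x" using arg_cong[OF imag_sq, of "\<lambda>S. S \<cdot> x"] by simp
    then have "- inner x (T \<cdot> y) = - inner (imag \<cdot> y) (imag \<cdot> T \<cdot> x)"
      using skew[of "imag \<cdot> x" y] imag_commute[OF T, of x] by simp
    also have "inner (imag \<cdot> y) (imag \<cdot> T \<cdot> x) = inner y ((adj imag * imag) \<cdot> T \<cdot> x)" by (simp add: inner_adj_right)
    also have "adj imag * imag = 1" by (simp add: imag_adj imag_sq)
    finally show "inner x (T \<cdot> y) = inner (T \<cdot> x) y" by (simp add: inner_commute)
  qed
  then show "T * imag = imag * T \<and> pos T" using T re by (simp add: pos_def)
next
  assume T: "T * imag = imag * T \<and> pos T"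
  have "cinner x (T \<cdot> x) \<in> \<real>\<^sub>\<ge>\<^sub>0" for x
  proof -
    have "inner (imag \<cdot> x) (T \<cdot> x) = inner (T \<cdot> imag \<cdot> x) x"
      using T adj_inner[OF pos_adj, of T "imag \<cdot> x" x] by simp
    also have "\<dots> = inner (imag \<cdot> T \<cdot> x) x" using T imag_commute by metis
    also have "\<dots> = inner (T \<cdot> x) (adj imag \<cdot> x)" by (rule inner_adj_right[symmetric])
    also have "\<dots> = - inner (imag \<cdot> x) (T \<cdot> x)" by (simp add: imag_adj inner_commute)
    finally have "Im (cinner x (T \<cdot> x)) = 0" by (simp add: Im_cinner)
    moreover have "0 \<le> Re (cinner x (T \<cdot> x))" using T pos_qf[of T x] by (simp add: Re_cinner)
    ultimately show ?thesis by (simp add: complex_nonneg_Reals_iff)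
  qed
  then show "pos_op (blin T)" using T by (simp add: pos_op_def blin_app bounded_ops_iff)
qed

lemma op_le_iff:
  assumes "S * imag = imag * S" "T * imag = imag * T"
  shows "op_le (blin S) (blin T) \<longleftrightarrow> pos (T - S)"
proof -
  have "(T - S) * imag = imag * (T - S)" using assms by (simp add: algebra_simps)
  then show ?thesis by (simp add: op_le_def minus_endo.rep_eq[symmetric] pos_op_iff)
qed

lemma blin_image_vimage: "blin ` (blin -` X) = X"
  by (metis UNIV_I endo_inverse surjI surj_image_vimage_eq)

text \<open>Commuting with multiplication by the imaginary unit is complex-linearity, so once that
  operator belongs to \<open>X\<close> the real commutant consists of elements of
  \<open>bounded_ops\<close> only.\<close>

lemma vimage_commutant:
  assumes "blin imag \<in> X" shows "blin -` commutant X = comm (blin -` X)"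
proof (intro equalityI subsetI)
  fix T assume "T \<in> blin -` commutant X"
  then have "blin T o\<^sub>L S = S o\<^sub>L blin T" if "S \<in> X" for S using that by (auto simp: commutant_def)
  then show "T \<in> comm (blin -` X)" by (intro commI) (simp add: blin_inject[symmetric] times_endo.rep_eq)
next
  fix T assume T: "T \<in> comm (blin -` X)"
  have "blin T o\<^sub>L S = S o\<^sub>L blin T" if "S \<in> X" for S
  proof -
    have "T * endo S = endo S * T" using T that by (intro commD) (auto simp: endo_inverse)
    then have "blin (T * endo S) = blin (endo S * T)" by simp
    then show ?thesis by (simp add: times_endo.rep_eq endo_inverse)
  qed
  moreover have "T * imag = imag * T" using T assms by (intro commD) auto
  ultimately show "T \<in> blin -` commutant X" by (simp add: commutant_def bounded_ops_iff)
qed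

text \<open>Multiplication by the imaginary unit commutes with every complex-linear operator, so it
  lies in every bicommutant.\<close>

lemma von_neumann_imag:
  assumes "von_neumann_algebra X" shows "blin imag \<in> X" "T \<in> blin -` X \<Longrightarrow> T * imag = imag * T"
proof -
  have "imag * T = T * imag" if "blin T \<in> bounded_ops" for T :: "'a endo" using that by (simp add: bounded_ops_iff)
  then have "blin imag o\<^sub>L S = S o\<^sub>L blin imag" if "S \<in> bounded_ops" for S :: "'a \<Rightarrow>\<^sub>L 'a"
    using that by (metis UNIV_I endo_inverse times_endo.rep_eq)
  then have "blin imag \<in> commutant (commutant X)"
    by (simp add: commutant_def bounded_ops_iff)
  then show "blin imag \<in> X" using assms by (simp add: von_neumann_algebra_def)
  show "T * imag = imag * T" if "T \<in> blin -` X"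
    using that assms by (auto simp: von_neumann_algebra_def bounded_ops_iff[symmetric])
qed

lemma von_neumann_vna:
  assumes X: "von_neumann_algebra X" shows "vna (blin -` X)"
  unfolding vna_def
proof (intro conjI ballI)
  fix T assume T: "T \<in> blin -` X"
  then have "op_adj (blin T) \<in> X" using X by (auto simp: von_neumann_algebra_def)
  then show "adj T \<in> blin -` X" using op_adj_blin[OF von_neumann_imag(2)[OF X T]] by simp
next
  have "blin imag \<in> commutant X" using von_neumann_imag(2)[OF X] unfolding commutant_def
    by (auto simp: bounded_ops_iff) (metis UNIV_I endo_inverse times_endo.rep_eq vimageI2)
  from vimage_commutant[OF this] show "comm (comm (blin -` X)) = blin -` X"
    using X vimage_commutant[OF von_neumann_imag(1)[OF X]] by (simp add: von_neumann_algebra_def)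
qed

lemma von_neumann_complex_unit: "von_neumann_algebra X \<Longrightarrow> complex_unit (blin -` X) imag"
  using von_neumann_vna von_neumann_imag by (unfold_locales) (auto simp: imag_adj imag_sq)

lemma unitaries_iff:
  assumes "von_neumann_algebra X" shows "blin u \<in> unitaries X \<longleftrightarrow> u \<in> unis (blin -` X)"
proof (cases "u \<in> blin -` X")
  case True
  then show ?thesis
    using op_adj_blin[OF von_neumann_imag(2)[OF assms True]] by (simp add: unitaries_def unis_def blin_simps)
next
  case False then show ?thesis by (simp add: unitaries_def unis_def)
qed

lemma pos_cone_iff:
  assumes "von_neumann_algebra X" shows "blin T \<in> pos_cone X \<longleftrightarrow> T \<in> blin -` X \<and> pos T"
  using von_neumann_imag(2)[OF assms] by (auto simp: pos_cone_def pos_op_iff)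

section \<open>Vector functionals\<close>

definition l2 :: "(nat \<Rightarrow> 'h::real_normed_vector) \<Rightarrow> bool" where
  "l2 \<xi> \<longleftrightarrow> summable (\<lambda>n. (norm (\<xi> n))\<^sup>2)"

lemma norm_cinner_le: "cmod (cinner x y) \<le> norm x * norm y"
proof -
  obtain c where c: "cmod c = 1" "c * cinner x y = complex_of_real (cmod (cinner x y))"
  proof (cases "cinner x y = 0")
    case True then show ?thesis using that[of 1] by simp
  next
    case False
    define z where "z = cinner x y"
    have "cnj z / complex_of_real (cmod z) * z = complex_of_real ((cmod z)\<^sup>2) / complex_of_real (cmod z)"
      by (simp only: complex_norm_square times_divide_eq_right times_divide_eq_left mult.commute)
    also have "\<dots> = complex_of_real (cmod z)" using False by (simp add: power2_eq_square z_def)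
    finally show ?thesis
      using that[of "cnj z / complex_of_real (cmod z)"] False by (simp add: z_def norm_divide)
  qed
  have "cmod (cinner x y) = Re (cinner x (c *\<^sub>C y))" by (simp add: cinner_scaleC_right c(2))
  also have "\<dots> \<le> norm x * norm (c *\<^sub>C y)" unfolding Re_cinner by (rule norm_cauchy_schwarz)
  finally show ?thesis by (simp add: norm_scaleC c(1))
qed

lemma l2_mult_summable:
  assumes "l2 \<xi>" "l2 \<eta>" shows "summable (\<lambda>n. norm (\<xi> n) * norm (\<eta> n))"
proof (rule summable_comparison_test')
  show "summable (\<lambda>n. (norm (\<xi> n))\<^sup>2 + (norm (\<eta> n))\<^sup>2)" using assms by (simp add: l2_def summable_add)
  fix n
  have "0 \<le> norm (\<xi> n) * norm (\<eta> n)" by simp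
  moreover from this have "norm (norm (\<xi> n) * norm (\<eta> n)) = norm (\<xi> n) * norm (\<eta> n)" by simp
  moreover have "2 * (norm (\<xi> n) * norm (\<eta> n)) \<le> (norm (\<xi> n))\<^sup>2 + (norm (\<eta> n))\<^sup>2"
    using sum_squares_bound[of "norm (\<xi> n)" "norm (\<eta> n)"] by (simp add: mult.assoc)
  ultimately show "norm (norm (\<xi> n) * norm (\<eta> n)) \<le> (norm (\<xi> n))\<^sup>2 + (norm (\<eta> n))\<^sup>2" by linarith
qed

lemma norm_cinner_app_le: "cmod (cinner x (T \<cdot> y)) \<le> norm T * (norm x * norm y)"
proof -
  have "cmod (cinner x (T \<cdot> y)) \<le> norm x * (norm T * norm y)"
    by (rule order_trans[OF norm_cinner_le]) (intro mult_left_mono norm_app norm_ge_zero)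
  then show ?thesis by (simp add: mult_ac)
qed

lemma l2_summable:
  assumes "l2 \<xi>" "l2 \<eta>" shows "summable (\<lambda>n. cinner (\<xi> n) (T \<cdot> \<eta> n))"
  by (rule summable_comparison_test'[OF summable_mult[OF l2_mult_summable[OF assms], of "norm T"]])
    (rule norm_cinner_app_le)

definition vfun :: "('h::chilbert_space \<Rightarrow>\<^sub>L 'h) set \<Rightarrow> (nat \<Rightarrow> 'h) \<Rightarrow> ('h \<Rightarrow>\<^sub>L 'h) \<Rightarrow> complex" where
  "vfun A \<eta> = (\<lambda>T. if T \<in> A then \<Sum>n. cinner (\<eta> n) (blinfun_apply T (\<eta> n)) else 0)"

lemma vfun_pos:
  assumes \<eta>: "l2 \<eta>" and T: "blin T \<in> A" "pos_op (blin T)"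
  shows "vfun A \<eta> (blin T) = complex_of_real (\<Sum>n. qf T (\<eta> n))" "summable (\<lambda>n. qf T (\<eta> n))"
proof -
  have eq: "cinner (\<eta> n) (T \<cdot> \<eta> n) = complex_of_real (qf T (\<eta> n))" for n
    using T(2) unfolding pos_op_def blin_app
    by (intro complex_eqI) (auto simp: complex_nonneg_Reals_iff Re_cinner)
  show s: "summable (\<lambda>n. qf T (\<eta> n))" using l2_summable[OF \<eta> \<eta>, of T] unfolding eq by simp
  show "vfun A \<eta> (blin T) = complex_of_real (\<Sum>n. qf T (\<eta> n))"
    using T(1) s by (simp add: vfun_def blin_app eq suminf_of_real)
qed

lemma topspace_sigma_weak [simp]: "topspace sigma_weak = (bounded_ops :: ('h::chilbert_space \<Rightarrow>\<^sub>L 'h) set)"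
proof
  define z where "z = (\<lambda>n::nat. 0 :: 'h)"
  have "{T \<in> bounded_ops. (\<Sum>n. cinner (z n) (blinfun_apply T (z n))) \<in> UNIV} \<subseteq> topspace sigma_weak"
    unfolding sigma_weak_def topology_generated_by_topspace
  proof (intro Union_upper CollectI exI conjI)
    show "summable (\<lambda>n. (norm (z n))\<^sup>2)" "summable (\<lambda>n. (norm (z n))\<^sup>2)" by (simp_all add: z_def)
  qed (rule refl open_UNIV)+
  then show "bounded_ops \<subseteq> topspace (sigma_weak :: ('h \<Rightarrow>\<^sub>L 'h) topology)" by simp
  show "topspace sigma_weak \<subseteq> (bounded_ops :: ('h \<Rightarrow>\<^sub>L 'h) set)"
    unfolding sigma_weak_def topology_generated_by_topspace by blast
qed

lemma continuous_map_series:
  assumes "l2 \<xi>" "l2 \<eta>"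
  shows "continuous_map sigma_weak euclidean (\<lambda>T. \<Sum>n. cinner (\<xi> n) (blinfun_apply T (\<eta> n)))"
  unfolding continuous_map_def
proof (intro conjI allI impI)
  fix U :: "complex set" assume U: "openin euclidean U"
  show "openin sigma_weak {T \<in> topspace sigma_weak. (\<Sum>n. cinner (\<xi> n) (blinfun_apply T (\<eta> n))) \<in> U}"
    unfolding topspace_sigma_weak unfolding sigma_weak_def
  proof (intro topology_generated_by_Basis CollectI exI conjI)
    show "summable (\<lambda>n. (norm (\<xi> n))\<^sup>2)" "summable (\<lambda>n. (norm (\<eta> n))\<^sup>2)" "open U"
      using assms U by (simp_all add: l2_def)
  qed (rule refl)
qed simp

context
  fixes A :: "('h::chilbert_space \<Rightarrow>\<^sub>L 'h) set"
  assumes A: "von_neumann_algebra A"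
begin

lemma blin_A: "blin T \<in> A \<Longrightarrow> T * imag = imag * T" "blin T \<in> A \<Longrightarrow> pos T \<Longrightarrow> pos_op (blin T)"
  using von_neumann_imag(2)[OF A] by (auto simp: pos_op_iff)

lemma predual_posI:
  assumes "\<And>T. T \<notin> A \<Longrightarrow> \<phi> T = 0"
    and "\<And>S T. blin S \<in> A \<Longrightarrow> blin T \<in> A \<Longrightarrow> \<phi> (blin (S + T)) = \<phi> (blin S) + \<phi> (blin T)"
    and "\<And>c T. blin T \<in> A \<Longrightarrow> \<phi> (scale_op c (blin T)) = c * \<phi> (blin T)"
    and "\<And>T. blin T \<in> A \<Longrightarrow> pos T \<Longrightarrow> \<phi> (blin T) \<in> \<real>\<^sub>\<ge>\<^sub>0"
    and "continuous_map (subtopology sigma_weak A) euclidean \<phi>"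
  shows "\<phi> \<in> predual_pos A"
  unfolding predual_pos_def
proof (intro CollectI conjI allI ballI impI assms(1,5))
  fix S T and c :: complex
  show "S \<in> A \<Longrightarrow> T \<in> A \<Longrightarrow> \<phi> (S + T) = \<phi> S + \<phi> T"
    using assms(2)[of "endo S" "endo T"] by (simp add: endo_inverse plus_endo.rep_eq)
  show "T \<in> A \<Longrightarrow> \<phi> (scale_op c T) = c * \<phi> T" using assms(3)[of "endo T" c] by (simp add: endo_inverse)
  show "T \<in> pos_cone A \<Longrightarrow> \<phi> T \<in> \<real>\<^sub>\<ge>\<^sub>0"
    using assms(4)[of "endo T"] pos_cone_iff[OF A, of "endo T"] by (simp add: endo_inverse)
qed

lemma predual_posD:
  assumes "\<phi> \<in> predual_pos A"
  shows "T \<notin> A \<Longrightarrow> \<phi> T = 0"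
    and "blin S \<in> A \<Longrightarrow> blin R \<in> A \<Longrightarrow> \<phi> (blin (S + R)) = \<phi> (blin S) + \<phi> (blin R)"
    and "blin S \<in> A \<Longrightarrow> \<phi> (scale_op c (blin S)) = c * \<phi> (blin S)"
    and "blin S \<in> A \<Longrightarrow> pos S \<Longrightarrow> \<phi> (blin S) \<in> \<real>\<^sub>\<ge>\<^sub>0"
    and "continuous_map (subtopology sigma_weak A) euclidean \<phi>"
  using assms unfolding predual_pos_def by (simp_all add: plus_endo.rep_eq pos_cone_iff[OF A])

lemma vfun_predual: assumes \<eta>: "l2 \<eta>" shows "vfun A \<eta> \<in> predual_pos A"
proof (rule predual_posI)
  note ops = vna_ops[OF von_neumann_vna[OF A], unfolded vimage_eq]
  fix S T and c :: complex
  assume T: "blin T \<in> A"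
  have iT: "imag * T \<in> blin -` A"
    using T von_neumann_imag(1)[OF A] by (intro vna_ops[OF von_neumann_vna[OF A]]) auto
  have cT: "blin (Re c *\<^sub>R T + Im c *\<^sub>R (imag * T)) \<in> A" using T iT by (intro ops(3) ops(6)) auto
  have "(\<Sum>n. cinner (\<eta> n) (blinfun_apply (scale_op c (blin T)) (\<eta> n))) = (\<Sum>n. c * cinner (\<eta> n) (T \<cdot> \<eta> n))"
    by (simp add: scale_op.rep_eq blin_app cinner_scaleC_right)
  then show "vfun A \<eta> (scale_op c (blin T)) = c * vfun A \<eta> (blin T)"
    using T cT suminf_mult[OF l2_summable[OF \<eta> \<eta>, of T], of c] unfolding vfun_def scale_op_blin by (simp add: blin_app)
  show "pos T \<Longrightarrow> vfun A \<eta> (blin T) \<in> \<real>\<^sub>\<ge>\<^sub>0"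
    using vfun_pos[OF \<eta> T blin_A(2)[OF T]] pos_qf[of T] by (simp add: suminf_nonneg)
  assume S: "blin S \<in> A"
  then show "vfun A \<eta> (blin (S + T)) = vfun A \<eta> (blin S) + vfun A \<eta> (blin T)"
    using T ops(3)[OF S T] suminf_add[OF l2_summable[OF \<eta> \<eta>, of S] l2_summable[OF \<eta> \<eta>, of T]]
    by (simp add: vfun_def blin_app cinner_add_right)
next
  show "continuous_map (subtopology sigma_weak A) euclidean (vfun A \<eta>)"
    by (rule continuous_map_eq[OF continuous_map_from_subtopology[OF continuous_map_series[OF \<eta> \<eta>]]])
      (simp add: vfun_def)
qed (simp add: vfun_def)

lemma predual_add:
  assumes "\<phi> \<in> predual_pos A" "\<psi> \<in> predual_pos A" shows "(\<lambda>T. \<phi> T + \<psi> T) \<in> predual_pos A"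
proof (rule predual_posI)
  note D = predual_posD[OF assms(1)] predual_posD[OF assms(2)]
  show "continuous_map (subtopology sigma_weak A) euclidean (\<lambda>T. \<phi> T + \<psi> T)"
    by (intro continuous_map_add D)
  show "\<phi> T + \<psi> T = 0" if "T \<notin> A" for T using D(1,6)[OF that] by simp
  show "\<phi> (blin (S + T)) + \<psi> (blin (S + T)) = \<phi> (blin S) + \<psi> (blin S) + (\<phi> (blin T) + \<psi> (blin T))"
    if "blin S \<in> A" "blin T \<in> A" for S T using D(2,7)[OF that] by simp
  show "\<phi> (scale_op c (blin T)) + \<psi> (scale_op c (blin T)) = c * (\<phi> (blin T) + \<psi> (blin T))"
    if "blin T \<in> A" for c T using D(3,8)[OF that, of c] by (simp add: distrib_left)
  show "\<phi> (blin T) + \<psi> (blin T) \<in> \<real>\<^sub>\<ge>\<^sub>0" if "blin T \<in> A" "pos T" for T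
    by (intro nonneg_Reals_add_I D that)
qed

lemma predual_scale:
  assumes "\<phi> \<in> predual_pos A" "0 \<le> r" shows "(\<lambda>T. complex_of_real r * \<phi> T) \<in> predual_pos A"
proof (rule predual_posI)
  have "continuous_map (subtopology sigma_weak A) euclidean ((\<lambda>z. complex_of_real r * z) \<circ> \<phi>)"
    using predual_posD(5)[OF assms(1)]
    by (rule continuous_map_compose) (simp add: continuous_on_mult_left)
  then show "continuous_map (subtopology sigma_weak A) euclidean (\<lambda>T. complex_of_real r * \<phi> T)" by (simp add: comp_def)
  note D = predual_posD[OF assms(1)]
  show "complex_of_real r * \<phi> T = 0" if "T \<notin> A" for T using D(1)[OF that] by simp
  show "complex_of_real r * \<phi> (blin (S + T)) = complex_of_real r * \<phi> (blin S) + complex_of_real r * \<phi> (blin T)"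
    if "blin S \<in> A" "blin T \<in> A" for S T using D(2)[OF that] by (simp add: distrib_left)
  show "complex_of_real r * \<phi> (scale_op c (blin T)) = c * (complex_of_real r * \<phi> (blin T))"
    if "blin T \<in> A" for c T using D(3)[OF that, of c] by simp
  show "complex_of_real r * \<phi> (blin T) \<in> \<real>\<^sub>\<ge>\<^sub>0" if "blin T \<in> A" "pos T" for T
    using assms(2) by (intro nonneg_Reals_mult_I D that) simp
qed

lemma predual_diff:
  assumes "\<phi> \<in> predual_pos A" "\<psi> \<in> predual_pos A"
    and "\<And>T. blin T \<in> A \<Longrightarrow> pos T \<Longrightarrow> Re (\<psi> (blin T)) \<le> Re (\<phi> (blin T))"
  shows "(\<lambda>T. \<phi> T - \<psi> T) \<in> predual_pos A"
proof (rule predual_posI)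
  show "continuous_map (subtopology sigma_weak A) euclidean (\<lambda>T. \<phi> T - \<psi> T)"
    by (intro continuous_map_diff predual_posD assms)
  show "\<phi> (blin T) - \<psi> (blin T) \<in> \<real>\<^sub>\<ge>\<^sub>0" if "blin T \<in> A" "pos T" for T
    using predual_posD(4)[OF assms(1) that] predual_posD(4)[OF assms(2) that] assms(3)[OF that]
    by (simp add: complex_nonneg_Reals_iff)
  note D = predual_posD[OF assms(1)] predual_posD[OF assms(2)]
  show "\<phi> T - \<psi> T = 0" if "T \<notin> A" for T using D(1,6)[OF that] by simp
  show "\<phi> (blin (S + T)) - \<psi> (blin (S + T)) = \<phi> (blin S) - \<psi> (blin S) + (\<phi> (blin T) - \<psi> (blin T))"
    if "blin S \<in> A" "blin T \<in> A" for S T using D(2,7)[OF that] by simp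
  show "\<phi> (scale_op c (blin T)) - \<psi> (scale_op c (blin T)) = c * (\<phi> (blin T) - \<psi> (blin T))"
    if "blin T \<in> A" for c T using D(3,8)[OF that, of c] by (simp add: right_diff_distrib)
qed

end

section \<open>The extended positive cone on vector functionals\<close>

lemma l2_qf_summable:
  assumes "l2 \<eta>" shows "summable (\<lambda>n. qf T (\<eta> n))"
proof (rule summable_comparison_test')
  show "summable (\<lambda>n. norm T * (norm (\<eta> n))\<^sup>2)" using assms unfolding l2_def by (rule summable_mult)
  fix n
  have "\<bar>qf T (\<eta> n)\<bar> \<le> norm (\<eta> n) * norm (T \<cdot> \<eta> n)" by (rule Cauchy_Schwarz_ineq2)
  also have "\<dots> \<le> norm (\<eta> n) * (norm T * norm (\<eta> n))" by (intro mult_left_mono norm_app) simp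
  finally show "norm (qf T (\<eta> n)) \<le> norm T * (norm (\<eta> n))\<^sup>2" by (simp add: power2_eq_square mult.left_commute)
qed

text \<open>On positive operators off-diagonal coefficients are controlled by diagonal ones, so
  sigma-weak smallness can be tested on forms \<open><\<eta>, T \<eta>>\<close> alone. Positivity at
  \<open>x + y\<close> and \<open>x - y\<close> bounds the real part; applying this to
  \<open>i x\<close> bounds the imaginary part.\<close>

lemma norm_cinner_le_qf:
  assumes T: "T * imag = imag * T" "pos T"
  shows "cmod (cinner x (T \<cdot> y)) \<le> qf T x + qf T y"
proof -
  have le: "2 * \<bar>inner x (T \<cdot> y)\<bar> \<le> qf T x + qf T y" for x y
  proof -
    have "qf T (x + y) = qf T x + qf T y + 2 * inner x (T \<cdot> y)" "qf T (x - y) = qf T x + qf T y - 2 * inner x (T \<cdot> y)"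
      using adj_inner[OF pos_adj[OF T(2)], of x y]
      by (simp_all add: inner_add_left inner_add_right inner_diff_left inner_diff_right inner_commute)
    then show ?thesis using pos_qf[OF T(2), of "x + y"] pos_qf[OF T(2), of "x - y"] by linarith
  qed
  have "qf T (imag \<cdot> x) = inner (imag \<cdot> x) (imag \<cdot> T \<cdot> x)" by (simp add: imag_commute[OF T(1)])
  also have "\<dots> = inner x ((adj imag * imag) \<cdot> T \<cdot> x)" by (simp add: inner_adj_right)
  also have "adj imag * imag = (1 :: 'a endo)" by (simp add: imag_adj imag_sq)
  finally have "2 * \<bar>Im (cinner x (T \<cdot> y))\<bar> \<le> qf T x + qf T y" using le[of "imag \<cdot> x" y] by (simp add: Im_cinner)
  moreover have "2 * \<bar>Re (cinner x (T \<cdot> y))\<bar> \<le> qf T x + qf T y" using le[of x y] by (simp add: Re_cinner)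
  ultimately show ?thesis using cmod_le[of "cinner x (T \<cdot> y)"] by linarith
qed

text \<open>Induction over the generation of the topology; for a subbasic set both sequences
  \<open>\<xi>\<close> and \<open>\<eta>\<close> go into \<open>F\<close>, by
  \<open>norm_cinner_le_qf\<close>.\<close>

lemma sigma_weak_neighbourhood:
  fixes W :: "('h::chilbert_space \<Rightarrow>\<^sub>L 'h) set"
  assumes "openin sigma_weak W" "0 \<in> W"
  shows "\<exists>F \<delta>. finite F \<and> (\<forall>\<eta>\<in>F. l2 \<eta>) \<and> 0 < (\<delta>::real) \<and>
    (\<forall>T. T * imag = imag * T \<longrightarrow> pos T \<longrightarrow> (\<forall>\<eta>\<in>F. (\<Sum>n. qf T (\<eta> n)) < \<delta>) \<longrightarrow> blin T \<in> W)"
    (is "\<exists>F \<delta>. ?P F \<delta> W")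
proof -
  have "generate_topology_on
     {{T :: 'h \<Rightarrow>\<^sub>L 'h. T \<in> bounded_ops \<and> (\<Sum>n. cinner (\<xi> n) (T (\<eta> n))) \<in> U} | \<xi> \<eta> U.
        summable (\<lambda>n::nat. (norm (\<xi> n))\<^sup>2) \<and> summable (\<lambda>n::nat. (norm (\<eta> n))\<^sup>2) \<and> open U} W"
    using assms(1) unfolding sigma_weak_def by (rule openin_topology_generated_by)
  then show ?thesis using assms(2)
  proof (induction rule: generate_topology_on.induct)
    case Empty then show ?case by simp
  next
    case (Int a b)
    obtain F \<delta> where F: "?P F \<delta> a" using Int.IH(1) Int.prems by blast
    obtain F' \<delta>' where F': "?P F' \<delta>' b" using Int.IH(2) Int.prems by blast
    have "?P (F \<union> F') (min \<delta> \<delta>') (a \<inter> b)" using F F' by auto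
    then show ?case by blast
  next
    case (UN K)
    then obtain k where k: "k \<in> K" "0 \<in> k" by blast
    obtain F \<delta> where F: "?P F \<delta> k" using UN.IH[OF k] by blast
    then have "?P F \<delta> (\<Union>K)" using k by blast
    then show ?case by blast
  next
    case (Basis s)
    then obtain \<xi> \<eta> U where s: "s = {T. T \<in> bounded_ops \<and> (\<Sum>n. cinner (\<xi> n) (blinfun_apply T (\<eta> n))) \<in> U}"
      and l: "l2 \<xi>" "l2 \<eta>" and U: "open U" unfolding l2_def by blast
    have z: "cinner (x :: 'h) 0 = 0" for x using norm_cinner_le[of x 0] by simp
    have "0 \<in> U" using Basis.prems unfolding s by (simp add: z)
    then obtain \<epsilon> where \<epsilon>: "0 < \<epsilon>" "ball 0 \<epsilon> \<subseteq> U" using U open_contains_ball by blast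
    have "blin T \<in> s"
      if T: "T * imag = imag * T" "pos T" and small: "(\<Sum>n. qf T (\<xi> n)) < \<epsilon> / 2" "(\<Sum>n. qf T (\<eta> n)) < \<epsilon> / 2" for T
    proof -
      have "cmod (\<Sum>n. cinner (\<xi> n) (T \<cdot> \<eta> n)) \<le> (\<Sum>n. qf T (\<xi> n) + qf T (\<eta> n))"
        by (intro norm_suminf_le norm_cinner_le_qf T summable_add l2_qf_summable l)
      also have "\<dots> = (\<Sum>n. qf T (\<xi> n)) + (\<Sum>n. qf T (\<eta> n))"
        by (intro suminf_add[symmetric] l2_qf_summable l)
      finally have "cmod (\<Sum>n. cinner (\<xi> n) (T \<cdot> \<eta> n)) < \<epsilon>" using small by linarith
      then have "(\<Sum>n. cinner (\<xi> n) (T \<cdot> \<eta> n)) \<in> U" using \<epsilon>(2) by auto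
      then show ?thesis unfolding s by (simp add: blin_app bounded_ops_iff T)
    qed
    then have "?P {\<xi>, \<eta>} (\<epsilon> / 2) s" using l \<epsilon>(1) by simp
    then show ?case by blast
  qed
qed

definition single :: "'h::real_normed_vector \<Rightarrow> nat \<Rightarrow> 'h" where
  "single \<xi> = (\<lambda>n. if n = 0 then \<xi> else 0)"

lemma cinner_zero_right [simp]: "cinner x 0 = 0"
  using norm_cinner_le[of x 0] by simp

lemma vfun_finite:
  assumes "\<And>n. N \<le> n \<Longrightarrow> \<eta> n = 0"
  shows "l2 \<eta>" "vfun A \<eta> = (\<lambda>T. if T \<in> A then \<Sum>n<N. cinner (\<eta> n) (blinfun_apply T (\<eta> n)) else 0)"
proof -
  show "l2 \<eta>" unfolding l2_def by (rule summable_finite[of "{..<N}"]) (use assms in auto)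
  have eq: "(\<Sum>n. cinner (\<eta> n) (blinfun_apply T (\<eta> n))) = (\<Sum>n<N. cinner (\<eta> n) (blinfun_apply T (\<eta> n)))" for T
    by (rule suminf_finite) (use assms in \<open>auto simp: blinfun.zero_right\<close>)
  show "vfun A \<eta> = (\<lambda>T. if T \<in> A then \<Sum>n<N. cinner (\<eta> n) (blinfun_apply T (\<eta> n)) else 0)"
    unfolding vfun_def eq ..
qed

lemma l2_single: "l2 (single \<xi>)" and vfun_single: "vfun A (single \<xi>) = (\<lambda>T. if T \<in> A then cinner \<xi> (blinfun_apply T \<xi>) else 0)"
  using vfun_finite[of 1 "single \<xi>"] by (auto simp: single_def fun_eq_iff)

context
  fixes A :: "('h::chilbert_space \<Rightarrow>\<^sub>L 'h) set"
  assumes A: "von_neumann_algebra A"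
begin

lemma single_predual: "vfun A (single \<xi>) \<in> predual_pos A"
  by (rule vfun_predual[OF A l2_single])

text \<open>A normal positive functional is in fact a series of vector functionals, but domination
  suffices here and only needs continuity at \<open>0\<close> and homogeneity: a multiple of
  \<open>T\<close> is scaled just inside a neighbourhood on which \<open>\<psi>\<close> is below
  \<open>1\<close>.\<close>

lemma predual_dominated:
  assumes \<psi>: "\<psi> \<in> predual_pos A"
  shows "\<exists>F c. finite F \<and> (\<forall>\<eta>\<in>F. l2 \<eta>) \<and> 0 \<le> c \<and>
    (\<forall>T. blin T \<in> A \<longrightarrow> pos T \<longrightarrow> Re (\<psi> (blin T)) \<le> c * (\<Sum>\<eta>\<in>F. \<Sum>n. qf T (\<eta> n)))"
proof -
  note ops = vna_ops[OF von_neumann_vna[OF A], unfolded vimage_eq]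
  have \<psi>s: "\<psi> (blin (r *\<^sub>R T)) = complex_of_real r * \<psi> (blin T)" if "blin T \<in> A" for r T
    using predual_posD(3)[OF A \<psi> that, of "complex_of_real r"] by (simp add: scale_op_blin)
  define W where "W = {T \<in> topspace (subtopology sigma_weak A). \<psi> T \<in> ball 0 1}"
  have "openin (subtopology sigma_weak A) W"
    unfolding W_def by (rule openin_continuous_map_preimage[OF predual_posD(5)[OF A \<psi>]]) simp
  then obtain O' where O': "openin sigma_weak O'" "W = O' \<inter> A" by (auto simp: openin_subtopology)
  have b: "blin T \<in> bounded_ops" if "blin T \<in> A" for T using blin_A(1)[OF A that] by (simp add: bounded_ops_iff)
  have "\<psi> (blin 0) = 0" using \<psi>s[OF ops(1), of 0] by simp
  then have "blin 0 \<in> W" using ops(1) b[OF ops(1)] by (simp add: W_def)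
  then have "0 \<in> O'" using O'(2) by (simp add: zero_endo.rep_eq)
  from sigma_weak_neighbourhood[OF O'(1) this] obtain F \<delta> where F: "finite F" "\<forall>\<eta>\<in>F. l2 \<eta>" "0 < (\<delta>::real)"
    and small: "\<forall>T. T * imag = imag * T \<longrightarrow> pos T \<longrightarrow> (\<forall>\<eta>\<in>F. (\<Sum>n. qf T (\<eta> n)) < \<delta>) \<longrightarrow> blin T \<in> O'"
    by (elim exE conjE)
  have "Re (\<psi> (blin T)) \<le> (1 / \<delta>) * (\<Sum>\<eta>\<in>F. \<Sum>n. qf T (\<eta> n))" if T: "blin T \<in> A" "pos T" for T
  proof -
    define q where "q = (\<Sum>\<eta>\<in>F. \<Sum>n. qf T (\<eta> n))"
    have q\<eta>: "0 \<le> (\<Sum>n. qf T (\<eta> n))" if "\<eta> \<in> F" for \<eta>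
      using F(2) that pos_qf[OF T(2)] by (intro suminf_nonneg l2_qf_summable) auto
    have q0: "0 \<le> q" unfolding q_def by (intro sum_nonneg q\<eta>)
    have "Re (\<psi> (blin T)) * \<delta> \<le> q + \<kappa>" if \<kappa>: "0 < \<kappa>" for \<kappa>
    proof -
      \<comment> \<open>The scaling that brings the diagonal series of \<open>r T\<close> below
        \<open>\<delta>\<close>; \<open>\<kappa> > 0\<close> covers the case
        \<open>q = 0\<close>.\<close>
      define r where "r = \<delta> / (q + \<kappa>)"
      have r: "0 < r" "r * (q + \<kappa>) = \<delta>" using q0 \<kappa> F(3) by (simp_all add: r_def add_nonneg_pos)
      have rT: "blin (r *\<^sub>R T) \<in> A" "pos (r *\<^sub>R T)" using T r(1) by (auto intro: ops pos_scale)
      have "(\<Sum>n. qf (r *\<^sub>R T) (\<eta> n)) < \<delta>" if \<eta>: "\<eta> \<in> F" for \<eta>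
      proof -
        have "(\<Sum>n. qf (r *\<^sub>R T) (\<eta> n)) = (\<Sum>n. r * qf T (\<eta> n))" by (simp only: qf_simps)
        also have "\<dots> = r * (\<Sum>n. qf T (\<eta> n))" using F(2) \<eta> by (intro suminf_mult l2_qf_summable) auto
        also have "(\<Sum>n. qf T (\<eta> n)) \<le> q" unfolding q_def by (rule member_le_sum) (use F(1) \<eta> q\<eta> in auto)
        finally have "(\<Sum>n. qf (r *\<^sub>R T) (\<eta> n)) \<le> r * q" using r(1) by simp
        also have "\<dots> < r * (q + \<kappa>)" using r(1) \<kappa> by simp
        finally show ?thesis unfolding r(2) .
      qed
      then have "blin (r *\<^sub>R T) \<in> O'" using small blin_A(1)[OF A rT(1)] rT(2) by blast
      then have "blin (r *\<^sub>R T) \<in> W" using O'(2) rT(1) by blast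
      then have "cmod (\<psi> (blin (r *\<^sub>R T))) < 1" by (simp add: W_def)
      then have "\<bar>Re (\<psi> (blin (r *\<^sub>R T)))\<bar> < 1" using abs_Re_le_cmod le_less_trans by blast
      then have "r * Re (\<psi> (blin T)) < 1" by (simp add: \<psi>s[OF T(1)])
      then have "r * Re (\<psi> (blin T)) * (q + \<kappa>) \<le> 1 * (q + \<kappa>)" using q0 \<kappa> by (intro mult_right_mono) auto
      moreover have "r * Re (\<psi> (blin T)) * (q + \<kappa>) = Re (\<psi> (blin T)) * (r * (q + \<kappa>))" by simp
      ultimately show ?thesis unfolding r(2) by simp
    qed
    then have "Re (\<psi> (blin T)) * \<delta> \<le> q" by (rule field_le_epsilon)
    then show ?thesis using F(3) by (simp add: q_def le_divide_eq)
  qed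
  moreover have "0 \<le> 1 / \<delta>" using F(3) by simp
  ultimately show ?thesis using F(1,2) by blast
qed

context
  fixes m assumes m: "m \<in> ext_pos_cone A"
begin

lemma ext_add: "\<phi> \<in> predual_pos A \<Longrightarrow> \<psi> \<in> predual_pos A \<Longrightarrow> m (\<lambda>T. \<phi> T + \<psi> T) = m \<phi> + m \<psi>"
  and ext_scale: "0 \<le> r \<Longrightarrow> \<phi> \<in> predual_pos A \<Longrightarrow> m (\<lambda>T. complex_of_real r * \<phi> T) = ennreal r * m \<phi>"
  and ext_outside: "\<phi> \<notin> predual_pos A \<Longrightarrow> m \<phi> = 0"
  and ext_lsc: "\<phi> \<in> predual_pos A \<Longrightarrow> c < m \<phi> \<Longrightarrow>
    \<exists>\<epsilon>>0. \<forall>\<psi>\<in>predual_pos A. predual_norm A (\<lambda>T. \<psi> T - \<phi> T) < \<epsilon> \<longrightarrow> c < m \<psi>"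
  using m unfolding ext_pos_cone_def by blast+

context
  assumes single0: "\<And>\<xi>. m (vfun A (single \<xi>)) = 0"
begin

text \<open>Truncations of \<open>\<eta>\<close> give finite sums of vector functionals, where
  \<open>m\<close> vanishes by additivity. They converge to \<open>vfun A \<eta>\<close> in the
  predual norm, and lower semicontinuity at level \<open>0\<close> forbids a positive value in the
  limit.\<close>

lemma ext_vfun_0:
  assumes \<eta>: "l2 \<eta>" shows "m (vfun A \<eta>) = 0"
proof (rule ccontr)
  define t where "t N = (\<lambda>n. if n < N then \<eta> n else 0)" for N
  have t: "l2 (t N)" "vfun A (t N) = (\<lambda>T. if T \<in> A then \<Sum>n<N. cinner (\<eta> n) (blinfun_apply T (\<eta> n)) else 0)" for N
    using vfun_finite[of N "t N"] by (auto simp: t_def)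
  have tP: "vfun A (t N) \<in> predual_pos A" for N by (rule vfun_predual[OF A t(1)])
  have t0: "m (vfun A (t N)) = 0" for N
  proof (induction N)
    case 0
    have "vfun A (t 0) = vfun A (single 0)" by (auto simp: t(2) vfun_single fun_eq_iff blinfun.zero_right)
    then show ?case using single0 by simp
  next
    case (Suc N)
    have "vfun A (t (Suc N)) = (\<lambda>T. vfun A (t N) T + vfun A (single (\<eta> N)) T)"
      unfolding t(2) vfun_single by auto
    then show ?case using ext_add[OF tP single_predual] Suc single0 by simp
  qed
  assume "m (vfun A \<eta>) \<noteq> 0"
  then have "0 < m (vfun A \<eta>)" by (simp add: zero_less_iff_neq_zero)
  from ext_lsc[OF vfun_predual[OF A \<eta>] this] obtain \<epsilon> where \<epsilon>: "0 < \<epsilon>"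
    "\<forall>\<psi>\<in>predual_pos A. predual_norm A (\<lambda>T. \<psi> T - vfun A \<eta> T) < \<epsilon> \<longrightarrow> 0 < m \<psi>" by blast
  have s: "summable (\<lambda>n. (norm (\<eta> n))\<^sup>2)" using \<eta> by (simp add: l2_def)
  have "\<exists>N. norm (\<Sum>n. (norm (\<eta> (n + N)))\<^sup>2) < \<epsilon> / 2"
    using suminf_exist_split[OF _ s, of "\<epsilon> / 2"] \<epsilon>(1) by (metis half_gt_zero order_refl)
  then obtain N where "norm (\<Sum>n. (norm (\<eta> (n + N)))\<^sup>2) < \<epsilon> / 2" by blast
  then have N: "(\<Sum>n. (norm (\<eta> (n + N)))\<^sup>2) < \<epsilon> / 2" unfolding real_norm_def by (rule le_less_trans[OF abs_ge_self])
  have "predual_norm A (\<lambda>T. vfun A (t N) T - vfun A \<eta> T) \<le> \<epsilon> / 2"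
    unfolding predual_norm_def
  proof (rule cSUP_least)
    have "blin 0 \<in> A" using vna_ops(1)[OF von_neumann_vna[OF A]] by simp
    then have "(0 :: 'h \<Rightarrow>\<^sub>L 'h) \<in> {T \<in> A. norm T \<le> 1}" by (simp add: zero_endo.rep_eq)
    then show "{T \<in> A. norm T \<le> 1} \<noteq> {}" by blast
    fix T assume "T \<in> {T \<in> A. norm T \<le> 1}"
    then have T: "T \<in> A" "norm T \<le> 1" by auto
    define T' where "T' = endo T"
    have T': "T = blin T'" by (simp add: T'_def endo_inverse)
    have nT: "norm T' \<le> 1" using T(2) unfolding T' norm_endo.rep_eq .
    have "vfun A (t N) T - vfun A \<eta> T = - (\<Sum>n. cinner (\<eta> (n + N)) (T' \<cdot> \<eta> (n + N)))"
      unfolding t(2) unfolding vfun_def T' blin_app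
      using T(1) suminf_split_initial_segment[OF l2_summable[OF \<eta> \<eta>, of T'], of N] by (simp add: T')
    then have "cmod (vfun A (t N) T - vfun A \<eta> T) = cmod (\<Sum>n. cinner (\<eta> (n + N)) (T' \<cdot> \<eta> (n + N)))" by simp
    also have "\<dots> \<le> (\<Sum>n. (norm (\<eta> (n + N)))\<^sup>2)"
    proof (rule norm_suminf_le)
      fix n
      have "cmod (cinner (\<eta> (n + N)) (T' \<cdot> \<eta> (n + N))) \<le> norm T' * (norm (\<eta> (n + N)) * norm (\<eta> (n + N)))"
        by (rule norm_cinner_app_le)
      also have "\<dots> \<le> 1 * (norm (\<eta> (n + N)) * norm (\<eta> (n + N)))" using nT by (intro mult_right_mono) auto
      finally show "cmod (cinner (\<eta> (n + N)) (T' \<cdot> \<eta> (n + N))) \<le> (norm (\<eta> (n + N)))\<^sup>2" by (simp add: power2_eq_square)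
    qed (rule summable_ignore_initial_segment[OF s])
    finally show "cmod (vfun A (t N) T - vfun A \<eta> T) \<le> \<epsilon> / 2" using N by simp
  qed
  also have "\<epsilon> / 2 < \<epsilon>" using \<epsilon>(1) by simp
  finally have "0 < m (vfun A (t N))" using \<epsilon>(2) tP by blast
  then show False using t0 by simp
qed

text \<open>\<open>\<Phi>\<close> dominates \<open>\<psi>\<close>, so \<open>\<Phi> - \<psi>\<close>
  is again positive and normal, and additivity gives \<open>m \<psi> <= m \<Phi> = 0\<close>. This
  permits faithfulness to be tested on vector functionals only.\<close>

lemma ext_eq_0: "m \<psi> = 0"
proof (cases "\<psi> \<in> predual_pos A")
  case True
  from predual_dominated[OF True] obtain F c where F: "finite F" "\<forall>\<eta>\<in>F. l2 \<eta>" "0 \<le> c"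
    and le: "\<forall>T. blin T \<in> A \<longrightarrow> pos T \<longrightarrow> Re (\<psi> (blin T)) \<le> c * (\<Sum>\<eta>\<in>F. \<Sum>n. qf T (\<eta> n))"
    by (elim exE conjE)
  define S where "S F = (\<lambda>T. \<Sum>\<eta>\<in>F. vfun A \<eta> T)" for F
  have S: "S F \<in> predual_pos A \<and> m (S F) = 0" using F(1,2)
  proof (induction F rule: finite_induct)
    case empty
    have "S {} = vfun A (single 0)" by (auto simp: S_def vfun_single fun_eq_iff blinfun.zero_right)
    then show ?case using single_predual[of 0] single0 by simp
  next
    case (insert \<eta> F)
    have eq: "S (insert \<eta> F) = (\<lambda>T. vfun A \<eta> T + S F T)" using insert.hyps by (simp add: S_def)
    have \<eta>: "l2 \<eta>" "vfun A \<eta> \<in> predual_pos A" using insert.prems vfun_predual[OF A] by auto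
    have SF: "S F \<in> predual_pos A" "m (S F) = 0" using insert.IH insert.prems by auto
    show ?case unfolding eq
      using predual_add[OF A \<eta>(2) SF(1)] ext_add[OF \<eta>(2) SF(1)] SF(2) ext_vfun_0[OF \<eta>(1)] by simp
  qed
  define \<Phi> where "\<Phi> = (\<lambda>T. complex_of_real c * S F T)"
  have \<Phi>: "\<Phi> \<in> predual_pos A" "m \<Phi> = 0"
    unfolding \<Phi>_def using predual_scale[OF A conjunct1[OF S] F(3)] ext_scale[OF F(3) conjunct1[OF S]] S by auto
  have D: "(\<lambda>T. \<Phi> T - \<psi> T) \<in> predual_pos A"
  proof (rule predual_diff[OF A \<Phi>(1) True])
    fix T assume T: "blin T \<in> A" "pos T"
    have "S F (blin T) = complex_of_real (\<Sum>\<eta>\<in>F. \<Sum>n. qf T (\<eta> n))"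
      unfolding S_def of_real_sum using F(2) vfun_pos(1)[OF _ T(1) blin_A(2)[OF A T]] by (intro sum.cong) auto
    then show "Re (\<psi> (blin T)) \<le> Re (\<Phi> (blin T))" using le T unfolding \<Phi>_def by (simp flip: of_real_mult of_real_sum)
  qed
  have "m \<Phi> = m \<psi> + m (\<lambda>T. \<Phi> T - \<psi> T)" using ext_add[OF True D] by simp
  then show ?thesis using \<Phi>(2) by simp
qed (rule ext_outside)

end

end

end

section \<open>Reduction to vector functionals\<close>

lemma op_le_blin:
  assumes "von_neumann_algebra M" "blin S \<in> M" "blin T \<in> M"
  shows "op_le (blin S) (blin T) \<longleftrightarrow> pos (T - S)"
  using assms by (intro op_le_iff von_neumann_imag(2)) auto

lemma opval_weight_of_operator_valued_weight:
  assumes M: "von_neumann_algebra M" and A: "von_neumann_algebra A" and AM: "A \<subseteq> M"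
    and E: "operator_valued_weight M A E" and faithful: "faithful_weight M E" and normal: "normal_weight M E"
  shows "opval_weight (blin -` A) imag (blin -` M) (\<lambda>x \<xi>. E (blin x) (vfun A (single \<xi>)))"
proof -
  interpret complex_unit "blin -` A" imag by (rule von_neumann_complex_unit[OF A])
  have pc: "blin x \<in> pos_cone M" if "x \<in> blin -` M" "pos x" for x using that pos_cone_iff[OF M] by simp
  have ext: "E (blin x) \<in> ext_pos_cone A" if "x \<in> blin -` M" "pos x" for x
    using E pc[OF that] by (simp add: operator_valued_weight_def)
  show ?thesis
  proof (intro opval_weight.intro[OF complex_unit_axioms] opval_weight_axioms.intro)
    show "vna (blin -` M)" by (rule von_neumann_vna[OF M])
    show "blin -` A \<subseteq> blin -` M" using AM by blast
    show "T * imag = imag * T" if "T \<in> blin -` M" for T by (rule von_neumann_imag(2)[OF M that])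
  next
    fix \<xi>
    show "normal_weight_on (blin -` M) (\<lambda>x. E (blin x) (vfun A (single \<xi>)))"
    proof
      show "vna (blin -` M)" by (rule von_neumann_vna[OF M])
      fix x y r
      assume x: "x \<in> blin -` M" "pos x"
      show "E (blin (x + y)) (vfun A (single \<xi>)) = E (blin x) (vfun A (single \<xi>)) + E (blin y) (vfun A (single \<xi>))"
        if y: "y \<in> blin -` M" "pos y"
      proof -
        have "E (blin x + blin y) = (\<lambda>\<phi>. E (blin x) \<phi> + E (blin y) \<phi>)"
          using E pc[OF x] pc[OF y] unfolding operator_valued_weight_def by blast
        then show ?thesis by (simp add: plus_endo.rep_eq)
      qed
      show "E (blin (r *\<^sub>R x)) (vfun A (single \<xi>)) = ennreal r * E (blin x) (vfun A (single \<xi>))" if "0 \<le> r"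
      proof -
        have "E (r *\<^sub>R blin x) = (\<lambda>\<phi>. ennreal r * E (blin x) \<phi>)"
          using E pc[OF x] that unfolding operator_valued_weight_def by blast
        then show ?thesis by (simp add: scaleR_endo.rep_eq)
      qed
    next
      fix D x
      assume D: "D \<noteq> {}" "\<And>y. y \<in> D \<Longrightarrow> y \<in> blin -` M \<and> pos y" and x: "x \<in> blin -` M" "pos x"
        and dir: "\<And>y z. y \<in> D \<Longrightarrow> z \<in> D \<Longrightarrow> \<exists>w\<in>D. pos (w - y) \<and> pos (w - z)"
        and ub: "\<And>y. y \<in> D \<Longrightarrow> pos (x - y)"
        and lub: "\<And>z. z \<in> blin -` M \<Longrightarrow> pos z \<Longrightarrow> (\<And>y. y \<in> D \<Longrightarrow> pos (z - y)) \<Longrightarrow> pos (z - x)"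
      have DM: "blin y \<in> M" "pos y" if "y \<in> D" for y using D(2)[OF that] by auto
      have xM: "blin x \<in> M" using x(1) by simp
      have "increases_to M (blin ` D) (blin x)"
        unfolding increases_to_def
      proof (intro conjI ballI impI)
        show "blin ` D \<noteq> {}" using D(1) by simp
        show "blin ` D \<subseteq> pos_cone M" using D(2) pc by blast
        show "blin x \<in> pos_cone M" by (rule pc[OF x])
        fix y' assume "y' \<in> blin ` D"
        then obtain y where y: "y \<in> D" "y' = blin y" by blast
        show "op_le y' (blin x)" unfolding y(2) op_le_blin[OF M DM(1)[OF y(1)] xM] by (rule ub[OF y(1)])
        fix z' assume "z' \<in> blin ` D"
        then obtain z where z: "z \<in> D" "z' = blin z" by blast
        obtain w where w: "w \<in> D" "pos (w - y)" "pos (w - z)" using dir[OF y(1) z(1)] by blast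
        show "\<exists>w\<in>blin ` D. op_le y' w \<and> op_le z' w"
          using w y z op_le_blin[OF M DM(1) DM(1)] by (intro bexI[of _ "blin w"]) auto
      next
        fix z' assume z': "z' \<in> pos_cone M" and le: "\<forall>y\<in>blin ` D. op_le y z'"
        define z where "z = endo z'"
        have zz: "z' = blin z" by (simp add: z_def endo_inverse)
        have z: "blin z \<in> M" "pos z" using z' pos_cone_iff[OF M, of z] unfolding zz by auto
        have "pos (z - x)"
        proof (rule lub)
          show "pos (z - y)" if "y \<in> D" for y using le that op_le_blin[OF M DM(1)[OF that] z(1)] unfolding zz by blast
        qed (use z in auto)
        then show "op_le (blin x) z'" unfolding zz op_le_blin[OF M xM z(1)] .
      qed
      then have "E (blin x) = (\<lambda>\<phi>. SUP y\<in>blin ` D. E y \<phi>)" using normal by (simp add: normal_weight_def)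
      then show "E (blin x) (vfun A (single \<xi>)) = (SUP y\<in>D. E (blin y) (vfun A (single \<xi>)))"
        by (simp add: image_image)
    qed
  next
    fix x a and \<xi> :: 'a assume x: "x \<in> blin -` M" "pos x" and a: "a \<in> blin -` A"
    note aI = von_neumann_imag(2)[OF A a]
    have "E (op_adj (blin a) o\<^sub>L blin x o\<^sub>L blin a) = ext_conj A (blin a) (E (blin x))"
      using E pc[OF x] a unfolding operator_valued_weight_def by blast
    then have "E (blin (adj a * x * a)) (vfun A (single \<xi>))
        = E (blin x) (\<lambda>y. if y \<in> A then vfun A (single \<xi>) (op_adj (blin a) o\<^sub>L y o\<^sub>L blin a) else 0)"
      using single_predual[OF A] by (simp add: op_adj_blin[OF aI] ext_conj_def times_endo.rep_eq)
    \<comment> \<open>The transported functional \<open>a \<phi> (adj a)\<close> of the vector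
      \<open>\<xi>\<close> is the vector functional of \<open>a \<xi>\<close>.\<close>
    also have "(\<lambda>y. if y \<in> A then vfun A (single \<xi>) (op_adj (blin a) o\<^sub>L y o\<^sub>L blin a) else 0) = vfun A (single (a \<cdot> \<xi>))"
    proof
      fix y :: "'a \<Rightarrow>\<^sub>L 'a"
      define T where "T = endo y"
      have T: "y = blin T" by (simp add: T_def endo_inverse)
      have "adj a * T * a \<in> blin -` A" if "blin T \<in> A"
        using that a vna_adj[OF vna a] by (intro vna_ops[OF vna]) auto
      then show "(if y \<in> A then vfun A (single \<xi>) (op_adj (blin a) o\<^sub>L y o\<^sub>L blin a) else 0) = vfun A (single (a \<cdot> \<xi>)) y"
        unfolding T op_adj_blin[OF aI] times_endo.rep_eq[symmetric] vfun_single blin_app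
        using cinner_adj[OF imag_commute_adj[OF aI], of \<xi>] by simp
    qed
    finally show "E (blin (adj a * x * a)) (vfun A (single \<xi>)) = E (blin x) (vfun A (single (a \<cdot> \<xi>)))" .
  next
    fix x and \<xi> \<eta> \<zeta> :: 'a assume x: "x \<in> blin -` M" "pos x"
    let ?m = "E (blin x)" and ?v = "\<lambda>\<xi>. vfun A (single \<xi>)"
    note m = ext[OF x]
    have add3: "?m (?v a) + ?m (?v b) + ?m (?v c) = ?m (\<lambda>T. ?v a T + ?v b T + ?v c T)" for a b c
    proof -
      have "?m (\<lambda>T. ?v a T + ?v b T + ?v c T) = ?m (\<lambda>T. ?v a T + ?v b T) + ?m (?v c)"
        by (rule ext_add[OF A m predual_add[OF A single_predual[OF A] single_predual[OF A]] single_predual[OF A]])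
      then show ?thesis using ext_add[OF A m single_predual[OF A] single_predual[OF A], of a b] by simp
    qed
    \<comment> \<open>The identity already holds between the functionals: both triple sums are the
      same element of the predual, and \<open>m\<close> is additive.\<close>
    show "?m (?v (\<xi> + (\<eta> + \<zeta>))) + ?m (?v (\<xi> - \<eta>)) + ?m (?v (\<xi> - \<zeta>))
        = ?m (?v (\<xi> - (\<eta> + \<zeta>))) + ?m (?v (\<xi> + \<eta>)) + ?m (?v (\<xi> + \<zeta>))"
      unfolding add3 unfolding vfun_single
      by (rule arg_cong[of _ _ ?m], rule HOL.ext, rule complex_eqI)
        (simp_all add: Re_cinner Im_cinner blinfun.add_right blinfun.diff_right
          inner_add_left inner_add_right inner_diff_left inner_diff_right)
    fix r :: real assume r: "0 \<le> r"
    have add2: "?m (?v a) + ennreal r * ?m (?v b) = ?m (\<lambda>T. ?v a T + complex_of_real r * ?v b T)" for a b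
    proof -
      have "?m (\<lambda>T. ?v a T + complex_of_real r * ?v b T) = ?m (?v a) + ?m (\<lambda>T. complex_of_real r * ?v b T)"
        by (rule ext_add[OF A m single_predual[OF A] predual_scale[OF A single_predual[OF A] r]])
      then show ?thesis using ext_scale[OF A m r single_predual[OF A], of b] by simp
    qed
    show "?m (?v (\<xi> + r *\<^sub>R \<eta>)) + ennreal r * ?m (?v (\<xi> - \<eta>)) = ?m (?v (\<xi> - r *\<^sub>R \<eta>)) + ennreal r * ?m (?v (\<xi> + \<eta>))"
      unfolding add2 unfolding vfun_single
      by (rule arg_cong[of _ _ ?m], rule HOL.ext, rule complex_eqI)
        (simp_all add: Re_cinner Im_cinner blinfun.add_right blinfun.diff_right blinfun.scaleR_right
          inner_add_left inner_add_right inner_diff_left inner_diff_right algebra_simps)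
  next
    fix x u and \<xi> :: 'a assume u: "u \<in> unis (comm (blin -` A))"
    have uI: "u * imag = imag * u" using commD[OF unisD(1)[OF u] I_mem] .
    have iso: "cinner (u \<cdot> x) (u \<cdot> y) = cinner x y" for x y
    proof -
      have "adj u \<cdot> u \<cdot> y = y" using unis_cancel[OF u] by blast
      then show ?thesis using cinner_adj[OF imag_commute_adj[OF uI], of x "u \<cdot> y"] by simp
    qed
    \<comment> \<open>A unitary of the commutant does not change the vector functional on
      \<open>A\<close>.\<close>
    have "cinner (u \<cdot> \<xi>) (blinfun_apply T (u \<cdot> \<xi>)) = cinner \<xi> (blinfun_apply T \<xi>)" if "T \<in> A" for T
    proof -
      have "u * endo T = endo T * u" using unisD(1)[OF u] that by (intro commD) (auto simp: endo_inverse)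
      then have "endo T \<cdot> u \<cdot> \<xi> = u \<cdot> endo T \<cdot> \<xi>" by (metis app_simps(6))
      then have "blinfun_apply T (u \<cdot> \<xi>) = u \<cdot> blinfun_apply T \<xi>" by (simp add: app.rep_eq endo_inverse)
      then show ?thesis by (simp add: iso)
    qed
    then have "vfun A (single (u \<cdot> \<xi>)) = vfun A (single \<xi>)" unfolding vfun_single by auto
    then show "E (blin x) (vfun A (single (u \<cdot> \<xi>))) = E (blin x) (vfun A (single \<xi>))" by simp
  next
    fix x assume x: "x \<in> blin -` M" "pos x" and z: "\<And>\<xi>. E (blin x) (vfun A (single \<xi>)) = 0"
    have "E (blin x) = (\<lambda>\<phi>. 0)" by (rule HOL.ext) (rule ext_eq_0[OF A ext[OF x] z])
    then have "blin x = 0" using faithful pc[OF x] by (simp add: faithful_weight_def)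
    then show "x = 0" by (simp add: blin_inject[symmetric] zero_endo.rep_eq)
  qed
qed

text \<open>On a norm-bounded set the tails of the series are uniformly small, so the series is a
  uniform limit of finite sums of matrix coefficients.\<close>

lemma continuous_map_wot_series:
  assumes \<xi>: "l2 \<xi>" and \<eta>: "l2 \<eta>" and Z: "\<And>T. T \<in> Z \<Longrightarrow> norm T \<le> R"
  shows "continuous_map (subtopology wot Z) euclidean (\<lambda>T. \<Sum>n. cinner (\<xi> n) (T \<cdot> \<eta> n))"
proof -
  have s: "summable (\<lambda>n. norm (\<xi> n) * norm (\<eta> n))" by (rule l2_mult_summable[OF \<xi> \<eta>])
  have cont: "continuous_map (subtopology wot Z) euclidean (\<lambda>T. cinner x (T \<cdot> y))" for x y
  proof -
    have eq: "cinner x (T \<cdot> y) = complex_of_real (inner x (T \<cdot> y)) + \<i> * complex_of_real (inner (imag \<cdot> x) (T \<cdot> y))" for T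
      by (rule complex_eqI) (simp_all add: Re_cinner Im_cinner)
    have "continuous_map (subtopology wot Z) euclidean ((\<lambda>r. c * complex_of_real r) \<circ> (\<lambda>T. inner x (T \<cdot> y)))" for c x
      by (rule continuous_map_compose[OF continuous_map_from_subtopology[OF continuous_map_wot]])
        (auto intro!: continuous_intros)
    from continuous_map_add[OF this[of 1 x] this[of \<i> "imag \<cdot> x"]] show ?thesis unfolding eq by (simp add: comp_def)
  qed
  have "continuous_map (subtopology wot Z) Met_TC.mtopology (\<lambda>T. \<Sum>n. cinner (\<xi> n) (T \<cdot> \<eta> n))"
  proof (rule Met_TC.continuous_map_uniform_limit[where F = sequentially and f = "\<lambda>N T. \<Sum>n<N. cinner (\<xi> n) (T \<cdot> \<eta> n)"])
    show "\<forall>\<^sub>F N in sequentially. continuous_map (subtopology wot Z) Met_TC.mtopology (\<lambda>T. \<Sum>n<N. cinner (\<xi> n) (T \<cdot> \<eta> n))"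
      by (intro always_eventually allI) (simp add: continuous_map_sum cont)
    fix \<epsilon> :: real assume \<epsilon>: "0 < \<epsilon>"
    define B where "B = \<bar>R\<bar> + 1"
    have B: "0 < B" by (simp add: B_def)
    obtain N0 where N0: "\<And>N. N \<ge> N0 \<Longrightarrow> norm (\<Sum>n. norm (\<xi> (n + N)) * norm (\<eta> (n + N))) < \<epsilon> / B"
      using suminf_exist_split[OF _ s, of "\<epsilon> / B"] \<epsilon> B by auto
    have "dist (\<Sum>n<N. cinner (\<xi> n) (T \<cdot> \<eta> n)) (\<Sum>n. cinner (\<xi> n) (T \<cdot> \<eta> n)) < \<epsilon>" if N: "N \<ge> N0" and T: "T \<in> Z" for N T
    proof -
      have sN: "summable (\<lambda>n. norm (\<xi> (n + N)) * norm (\<eta> (n + N)))" by (rule summable_ignore_initial_segment[OF s])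
      have "dist (\<Sum>n<N. cinner (\<xi> n) (T \<cdot> \<eta> n)) (\<Sum>n. cinner (\<xi> n) (T \<cdot> \<eta> n)) = cmod (\<Sum>n. cinner (\<xi> (n + N)) (T \<cdot> \<eta> (n + N)))"
        using suminf_split_initial_segment[OF l2_summable[OF \<xi> \<eta>, of T], of N] by (simp add: dist_norm norm_minus_commute)
      also have "\<dots> \<le> (\<Sum>n. B * (norm (\<xi> (n + N)) * norm (\<eta> (n + N))))"
      proof (rule norm_suminf_le)
        fix n
        have "norm T \<le> B" using Z[OF T] by (simp add: B_def)
        then show "cmod (cinner (\<xi> (n + N)) (T \<cdot> \<eta> (n + N))) \<le> B * (norm (\<xi> (n + N)) * norm (\<eta> (n + N)))"
          by (intro order_trans[OF norm_cinner_app_le] mult_right_mono) auto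
      qed (rule summable_mult[OF sN])
      also have "\<dots> = B * (\<Sum>n. norm (\<xi> (n + N)) * norm (\<eta> (n + N)))" by (rule suminf_mult[OF sN])
      also have "\<dots> < B * (\<epsilon> / B)" using N0[OF N] B by (intro mult_strict_left_mono) auto
      finally show ?thesis using B by simp
    qed
    then show "\<forall>\<^sub>F N in sequentially. \<forall>T\<in>topspace (subtopology wot Z). (\<Sum>n. cinner (\<xi> n) (T \<cdot> \<eta> n)) \<in> UNIV \<and>
        dist (\<Sum>n<N. cinner (\<xi> n) (T \<cdot> \<eta> n)) (\<Sum>n. cinner (\<xi> n) (T \<cdot> \<eta> n)) < \<epsilon>"
      unfolding eventually_sequentially by (intro exI[of _ N0]) auto
  qed simp
  then show ?thesis by simp
qed

text \<open>On bounded sets of complex-linear operators the weak operator topology refines the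
  sigma-weak one; it is enough to check the generating sets.\<close>

lemma continuous_map_wot_sigma_weak:
  assumes Z: "\<And>T. T \<in> Z \<Longrightarrow> norm T \<le> R" and b: "\<And>T. T \<in> Z \<Longrightarrow> blin T \<in> bounded_ops"
  shows "continuous_map (subtopology wot Z) sigma_weak blin"
  unfolding sigma_weak_def continuous_on_generated_topo_iff
proof (intro conjI allI impI)
  fix U assume "U \<in> {{T :: 'a \<Rightarrow>\<^sub>L 'a. T \<in> bounded_ops \<and> (\<Sum>n. cinner (\<xi> n) (T (\<eta> n))) \<in> U} | \<xi> \<eta> U.
        summable (\<lambda>n::nat. (norm (\<xi> n))\<^sup>2) \<and> summable (\<lambda>n::nat. (norm (\<eta> n))\<^sup>2) \<and> open U}"
  then obtain \<xi> \<eta> V where U: "U = {T. T \<in> bounded_ops \<and> (\<Sum>n. cinner (\<xi> n) (blinfun_apply T (\<eta> n))) \<in> V}"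
    and l: "l2 \<xi>" "l2 \<eta>" and V: "open V" unfolding l2_def by blast
  have "openin (subtopology wot Z) {T \<in> topspace (subtopology wot Z). (\<Sum>n. cinner (\<xi> n) (T \<cdot> \<eta> n)) \<in> V}"
    using V by (intro openin_continuous_map_preimage[OF continuous_map_wot_series[OF l Z]]) auto
  moreover have "{T \<in> topspace (subtopology wot Z). (\<Sum>n. cinner (\<xi> n) (T \<cdot> \<eta> n)) \<in> V} = blin -` U \<inter> topspace (subtopology wot Z)"
    unfolding U using b by (auto simp: blin_app)
  ultimately show "openin (subtopology wot Z) (blin -` U \<inter> topspace (subtopology wot Z))" by simp
next
  have "blin ` topspace (subtopology wot Z) \<subseteq> topspace sigma_weak" using b by auto
  then show "blin ` topspace (subtopology wot Z)
    \<subseteq> \<Union> {{T :: 'a \<Rightarrow>\<^sub>L 'a. T \<in> bounded_ops \<and> (\<Sum>n. cinner (\<xi> n) (T (\<eta> n))) \<in> U} | \<xi> \<eta> U.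
        summable (\<lambda>n::nat. (norm (\<xi> n))\<^sup>2) \<and> summable (\<lambda>n::nat. (norm (\<eta> n))\<^sup>2) \<and> open U}"
    by (simp only: sigma_weak_def topology_generated_by_topspace)
qed

text \<open>The hull stays in \<open>Z\<close>, the elements of \<open>M\<close> of norm at most
  \<open>norm x\<close>, which is weakly closed and bounded. On \<open>Z\<close> the inclusion is
  continuous into the sigma-weak topology, so weak closure points are sigma-weak closure
  points.\<close>

lemma wot_closure_conj_hull:
  assumes M: "von_neumann_algebra M" and A: "von_neumann_algebra A" and AM: "A \<subseteq> M" and x: "blin x \<in> M"
    and y: "y \<in> wot closure_of (convex hull ((\<lambda>u. u * x * adj u) ` unis (blin -` A)))"
  shows "blin y \<in> conj_hull M (blin x) A"
proof -
  define orb where "orb = (\<lambda>u. u * x * adj u) ` unis (blin -` A)"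
  define Z where "Z = {T \<in> blin -` M. norm T \<le> norm x}"
  note opsM = vna_ops[OF von_neumann_vna[OF M]]
  have "orb \<subseteq> Z"
  proof
    fix w assume "w \<in> orb"
    then obtain u where u: "u \<in> unis (blin -` A)" "w = u * x * adj u" by (auto simp: orb_def)
    have u': "adj u \<in> unis (blin -` A)" by (rule unis_adj[OF von_neumann_vna[OF A] u(1)])
    have "u * x * adj u \<in> blin -` M" using unisD(1)[OF u(1)] unisD(1)[OF u'] x AM by (intro opsM) auto
    moreover have "norm (u * x) \<le> 1 * norm x" using unis_norm[OF u(1)]
      by (intro order_trans[OF norm_mult_ineq] mult_mono) auto
    then have "norm (u * x * adj u) \<le> 1 * norm x * 1" using unis_norm[OF u']
      by (intro order_trans[OF norm_mult_ineq[of "u * x"]] mult_mono) auto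
    ultimately show "w \<in> Z" unfolding Z_def u(2) by simp
  qed
  moreover have "convex Z"
  proof -
    have "convex (blin -` M)" unfolding convex_def using opsM(3,6) by blast
    moreover have "Z = blin -` M \<inter> cball 0 (norm x)" by (auto simp: Z_def)
    ultimately show ?thesis by (simp add: convex_Int)
  qed
  ultimately have hull: "convex hull orb \<subseteq> Z" by (rule hull_minimal)
  have "closedin wot Z"
  proof -
    have "Z = blin -` M \<inter> {T. norm T \<le> norm x}" by (auto simp: Z_def)
    then show ?thesis by (simp add: closedin_Int closedin_wot_vna[OF von_neumann_vna[OF M]] closedin_wot_ball)
  qed
  then have "wot closure_of (convex hull orb) \<subseteq> Z" by (rule closure_of_minimal[OF hull])
  then have "y \<in> subtopology wot Z closure_of (convex hull orb)"
    using y hull unfolding closure_of_subtopology orb_def by (simp add: Int_absorb1 subset_iff)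
  moreover have "continuous_map (subtopology wot Z) (subtopology sigma_weak M) blin"
  proof -
    have "blin T \<in> bounded_ops" if "T \<in> Z" for T
      using that von_neumann_imag(2)[OF M, of T] by (simp add: Z_def bounded_ops_iff)
    then have "continuous_map (subtopology wot Z) sigma_weak blin"
      by (intro continuous_map_wot_sigma_weak[of Z "norm x"]) (auto simp: Z_def)
    then show ?thesis unfolding continuous_map_in_subtopology by (auto simp: Z_def)
  qed
  ultimately have "blin y \<in> subtopology sigma_weak M closure_of (blin ` (convex hull orb))"
    using continuous_map_image_closure_subset by blast
  moreover have "blin ` (convex hull orb) = convex hull ((\<lambda>u. u o\<^sub>L blin x o\<^sub>L op_adj u) ` unitaries A)"
  proof -
    have "linear (blin :: 'a endo \<Rightarrow> _)" by (rule linearI) (simp_all add: plus_endo.rep_eq scaleR_endo.rep_eq)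
    then have "blin ` (convex hull orb) = convex hull (blin ` orb)" by (rule convex_hull_linear_image)
    moreover have "blin ` orb = (\<lambda>u. u o\<^sub>L blin x o\<^sub>L op_adj u) ` (blin ` unis (blin -` A))"
      unfolding orb_def image_image
      using op_adj_blin[OF von_neumann_imag(2)[OF A unisD(1)]] by (intro image_cong) (auto simp: times_endo.rep_eq)
    moreover have "blin ` unis (blin -` A) = unitaries A"
      using unitaries_iff[OF A] by (metis (no_types, lifting) blin_image_vimage set_eqI vimage_eq)
    ultimately show ?thesis by simp
  qed
  ultimately show ?thesis by (simp add: conj_hull_def)
qed

theorem theoremA:
  fixes M A :: "('h::chilbert_space \<Rightarrow>\<^sub>L 'h) set"
    and E :: "'h opval_map"
    and x :: "'h \<Rightarrow>\<^sub>L 'h"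
  assumes "von_neumann_algebra M" and "von_neumann_algebra A" and "A \<subseteq> M"
    and "operator_valued_weight M A E"
    and "faithful_weight M E" and "normal_weight M E" and "semifinite_weight M A E"
    and "x \<in> pos_cone M" and "finite_value A (E x)"
  shows "commutant A \<inter> conj_hull M x A \<noteq> {}"
proof -
  interpret opval_weight "blin -` A" imag "blin -` M" "\<lambda>x \<xi>. E (blin x) (vfun A (single \<xi>))"
    by (rule opval_weight_of_operator_valued_weight) (fact assms)+
  define x' where "x' = endo x"
  have xx: "x = blin x'" by (simp add: x'_def endo_inverse)
  have x': "blin x' \<in> M" "pos x'" using assms(8) pos_cone_iff[OF assms(1), of x'] by (auto simp: xx)
  obtain b where b: "b \<in> pos_cone A" "E x = ext_eval A b" using assms(9) by (auto simp: finite_value_def)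
  define b' where "b' = endo b"
  have bb: "b = blin b'" by (simp add: b'_def endo_inverse)
  have b': "blin b' \<in> A" "pos b'" using b(1) pos_cone_iff[OF assms(2), of b'] by (auto simp: bb)
  have "E (blin x') (vfun A (single \<xi>)) = ennreal (qf b' \<xi>)" for \<xi>
    using b(2) b'(1) single_predual[OF assms(2), of \<xi>]
    by (simp add: xx[symmetric] ext_eval_def vfun_single bb blin_app Re_cinner)
  then obtain y where y: "y \<in> wot closure_of (convex hull ((\<lambda>u. u * x' * adj u) ` unis (blin -` A)))" "y \<in> comm (blin -` A)"
    using ex_commutant_mean[of x' b'] x' b'(2) by auto
  have "blin y \<in> conj_hull M x A"
    unfolding xx by (rule wot_closure_conj_hull[OF assms(1-3) x'(1) y(1)])
  moreover have "blin y \<in> commutant A"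
    using y(2) vimage_commutant[OF von_neumann_imag(1)[OF assms(2)]] by auto
  ultimately show ?thesis by blast
qed

end
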